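(* Let $\mathcal C$ be a $BTC^*$, $\mathcal S\subset\mathcal C$ an even symmetric subcategory, and $G=\mathrm{Aut}_{\mathcal C}(\mathcal C\rtimes\mathcal S)\cong\mathrm{Gal}(\mathcal S)$. Let $\mathcal E$ be a $TC^*$ such that $\mathcal C\subset\mathcal E\subset\mathcal C\rtimes\mathcal S$. Then $\mathcal E=(\mathcal C\rtimes\mathcal S)^H$, where $H=\mathrm{Aut}_{\mathcal E}(\mathcal C\rtimes\mathcal S)$ is a closed subgroup of $G$.
   Context: Tensor categories. All are small and strict; $\rho\sigma$ is the tensor product of objects, $\times$ that of arrows, $\circ$ is composition, $\iota$ the unit. A tensor $*$-category has complex vector spaces as Hom-sets, bilinear $\circ,\times$, and a positive $*$-operation (antilinear, involutive, contravariant, monoidal, and $X^*\circ X=0\Rightarrow X=0$). $\rho$ is irreducible if $\mathrm{Hom}(\rho,\rho)=\mathbb C\,\mathrm{id}_\rho$. Subobjects (for every projection $E=E^*=E^2\in\mathrm{Hom}(\rho,\rho)$ there are an object $\sigma$ and an isometry $V\in\mathrm{Hom}(\sigma,\rho)$ with $VV^*=E$), direct sums (for every $\rho_1,\rho_2$ there are $\tau$ and isometries $V_i\in\mathrm{Hom}(\rho_i,\tau)$ with $V_1V_1^*+V_2V_2^*=\mathrm{id}_\tau$) and conjugates ($R\in\mathrm{Hom}(\iota,\bar\rho\rho)$, $\bar R\in\mathrm{Hom}(\iota,\rho\bar\rho)$ with $(\bar R^*\times\mathrm{id}_\rho)\circ(\mathrm{id}_\rho\times R)=\mathrm{id}_\rho$,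 $(R^*\times\mathrm{id}_{\bar\rho})\circ(\mathrm{id}_{\bar\rho}\times\bar R)=\mathrm{id}_{\bar\rho}$, normalized by $R^*R=\bar R^*\bar R=d(\rho)\mathrm{id}_\iota$ for $\rho$ irreducible) are meant in the $*$-sense. For reducible $\rho$ only standard solutions $R_\rho=\sum_i(\bar W_i\times W_i)\circ R_i$, built from a decomposition into irreducibles, are used. A $TC^*$ is a tensor $*$-category with conjugates, direct sums, subobjects, finite dimensional Hom-spaces and irreducible unit; a $BTC^*$ is a $TC^*$ with unitary braiding $\varepsilon$. The twist is $\kappa(\rho)=(R_\rho^*\times\mathrm{id}_\rho)\circ(\mathrm{id}_{\bar\rho}\times\varepsilon(\rho,\rho))\circ(R_\rho\times\mathrm{id}_\rho)$. $\rho\in\mathcal C$ is degenerate if $\varepsilon(\eta,\rho)\circ\varepsilon(\rho,\eta)=\mathrm{id}_{\rho\eta}$ for all $\eta\in\mathcal C$; $\mathcal D(\mathcal C)$ is the full subcategory of degenerate objects. Even symmetric subcategory $\mathcal S\subset\mathcal C$: a replete full tensor subcategory on which $\varepsilon$ is symmetric, closed under conjugates, direct sums and subobjects, with all twists $\kappa(\rho)=\mathrm{id}_\rho$, $\rho\in\mathcal S$. By Doplicher–Roberts there are a compact group $\mathrm{Gal}(\mathcal S)=G$, unique up to isomorphism, and an isomorphism $F:\mathcal S\to U(G)$ of symmetric tensor $*$-categories onto a category $U(G)$ of finite dimensional continuous unitary representations of $G$ closed under direct sums and subrepresentations and containing members of all classes of irreducibles. Tensor product in $U(G)$ is $\boxtimes$;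 $F(\iota)=\mathbb C$ contains a unit vector $\Omega$ with $\Omega\boxtimes\psi=\psi\boxtimes\Omega=\psi$. Crossed product: let $\hat G$ be the set of isomorphism classes of irreducible objects of $\mathcal S$, $\gamma_k$ ($k\in\hat G$) representatives with $\gamma_0=\iota$, $\mathcal H_k=F(\gamma_k)$ with representation $\pi_k$ of $G$; choose orthonormal bases $\{V_{k,l}^{m,\alpha}\}_{\alpha=1}^{N_{k,l}^m}$ of $\mathrm{Hom}(\gamma_m,\gamma_k\gamma_l)$ ($V^*\circ W=\langle V,W\rangle\mathrm{id}$), and normalized solutions $R_k\in\mathrm{Hom}(\iota,\gamma_{\bar k}\gamma_k)$, $\bar R_k\in\mathrm{Hom}(\iota,\gamma_k\gamma_{\bar k})$ of the conjugate equations with $R_{\bar k}=\bar R_k$, $\bar R_{\bar k}=R_k$ if $\bar k\neq k$ and $\bar R_k=\pm R_k$ if $\bar k=k$. $\mathcal C\rtimes_0\mathcal S$ has the objects and tensor product of objects of $\mathcal C$, and $\mathrm{Hom}_{\mathcal C\rtimes_0\mathcal S}(\rho,\sigma)=\bigoplus_{k\in\hat G}\mathrm{Hom}_{\mathcal C}(\gamma_k\rho,\sigma)\otimes\mathcal H_k$. For $S\in\mathrm{Hom}(\gamma_k\sigma,\delta)$, $T\in\mathrm{Hom}(\gamma_l\rho,\sigma)$, $\psi_k\in\mathcal H_k,\psi_l\in\mathcal H_l$, $$(S\otimes\psi_k)\circ(T\otimes\psi_l)=\bigoplus_{m}\sum_\alpha\big[S\circ(\mathrm{id}_{\gamma_k}\times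 T)\circ(V_{k,l}^{m,\alpha}\times\mathrm{id}_\rho)\big]\otimes F(V_{k,l}^{m,\alpha})^*(\psi_k\boxtimes\psi_l);$$ for $S\in\mathrm{Hom}(\gamma_k\rho_1,\sigma_1)$, $T\in\mathrm{Hom}(\gamma_l\rho_2,\sigma_2)$, $$(S\otimes\psi_k)\times(T\otimes\psi_l)=\bigoplus_{m}\sum_\alpha\big[(S\times T)\circ(\mathrm{id}_{\gamma_k}\times\varepsilon(\gamma_l,\rho_1)\times\mathrm{id}_{\rho_2})\circ(V_{k,l}^{m,\alpha}\times\mathrm{id}_{\rho_1\rho_2})\big]\otimes F(V_{k,l}^{m,\alpha})^*(\psi_k\boxtimes\psi_l);$$ for $S\in\mathrm{Hom}(\gamma_k\rho,\sigma)$, $(S\otimes\psi_k)^*=\big[(R_k^*\times\mathrm{id}_\rho)\circ(\mathrm{id}_{\gamma_{\bar k}}\times S^* )\big]\otimes\bar\psi$, where $\bar\psi\in\mathcal H_{\bar k}$ is defined by $\langle a,\bar\psi\rangle=\langle\psi_k\boxtimes a,F(\bar R_k)\Omega\rangle$ for all $a\in\mathcal H_{\bar k}$ (inner products antilinear in the first variable). $\mathcal C$ is a subcategory of $\mathcal C\rtimes_0\mathcal S$ via $S\mapsto S\otimes\Omega$. $\mathcal C\rtimes\mathcal S$ is the closure of $\mathcal C\rtimes_0\mathcal S$ under subobjects: objects are pairs $(\rho,E)$ with $E=E^2=E^*\in\mathrm{Hom}_{\mathcal C\rtimes_0\mathcal S}(\rho,\rho)$, $\mathrm{Hom}((\rho,E),(\sigma,E'))=E'\circ\mathrm{Hom}_{\mathcal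 C\rtimes_0\mathcal S}(\rho,\sigma)\circ E$, $\mathrm{id}_{(\rho,E)}=E$, $(\rho,E)(\sigma,E')=(\rho\sigma,E\times E')$, with $\circ,\times,*$ of arrows as in $\mathcal C\rtimes_0\mathcal S$; $\rho$ is identified with $(\rho,\mathrm{id}_\rho)$, so that $\mathcal C$ is a subcategory of $\mathcal C\rtimes\mathcal S$. If $\mathcal S\subset\mathcal D(\mathcal C)$, then $\mathcal C\rtimes\mathcal S$ is braided by $\varepsilon((\rho,E),(\sigma,E'))=(E'\times E)\circ(\varepsilon(\rho,\sigma)\otimes\Omega)\circ(E\times E')$. Intermediate categories: $\mathcal C\subset\mathcal E\subset\mathcal C\rtimes\mathcal S$ means that $\mathcal E$ is a (not necessarily full) subcategory of $\mathcal C\rtimes\mathcal S$, with inherited tensor product and $*$-operation, containing all objects and arrows of $\mathcal C$. Automorphisms, action and fixed points: for a subcategory $\mathcal B\subset\mathcal C\rtimes\mathcal S$, $\mathrm{Aut}_{\mathcal B}(\mathcal C\rtimes\mathcal S)$ is the group of automorphisms (invertible tensor $*$-endofunctors, braided when $\mathcal C\rtimes\mathcal S$ is braided) of $\mathcal C\rtimes\mathcal S$ which leave $\mathcal B$ stable, in the sense that they act identically on the objects and arrows of $\mathcal B$. For $g\in G$, put $\alpha_g(S\otimes\psi_k)=S\otimes\pi_k(g)\psi_k$ on arrows and $\alpha_g((\rho,E))=(\rho,\alpha_g(E))$ on objects. Via $g\mapsto\alpha_g$ the compact group $G=\mathrm{Gal}(\mathcal S)$ is identified with $\mathrm{Aut}_{\mathcal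 C}(\mathcal C\rtimes\mathcal S)$, and $\mathrm{Aut}_{\mathcal E}(\mathcal C\rtimes\mathcal S)$ is accordingly regarded as a subgroup of $G$. For a subgroup $H\subset G$, $(\mathcal C\rtimes\mathcal S)^H$ is the subcategory of $\mathcal C\rtimes\mathcal S$ consisting of the $H$-invariant objects and $H$-invariant arrows.
   Formalization: E is assumed to contain, with each object (ρ,p), the arrow p:(ρ,p)→ρ; equality with (C⋊S)^H is proved up to unitary isomorphism of objects, and literally when E contains the subobjects given by its projections. Both conditions are necessary for the literal equality. *)

theory Defs
  imports
    "HOL-Analysis.Analysis"
    "HOL-Algebra.Group"
    "HOL-Library.Function_Algebras"
begin

section \<open>Tensor *-categories\<close>

text \<open>
  The Hom-spaces of a small category are complex subspaces of one ambient complex vector space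
  \<open>'v\<close> (for instance of the direct sum of all of them), with scalar multiplication \<open>scl\<close>.
  The operations on arrows are total functions on \<open>'v\<close>, constrained only on Hom-spaces.  Hom-spaces
  of different pairs of objects may overlap, as they do in a subobject completion, so anything
  that depends on source and target of an arrow takes these as arguments.
\<close>

record ('o, 'v) tcat =
  Ob :: "'o set"
  Hom :: "'o \<Rightarrow> 'o \<Rightarrow> 'v set"
  scl :: "complex \<Rightarrow> 'v \<Rightarrow> 'v"
  idt :: "'o \<Rightarrow> 'v" ("\<ii>\<dd>\<index>")
  cmp :: "'v \<Rightarrow> 'v \<Rightarrow> 'v" (infixl "\<cdot>\<index>" 65)
  str :: "'v \<Rightarrow> 'v" ("_\<^sup>\<star>\<index>" [1000] 1000)
  tun :: "'o" ("\<iota>\<index>")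
  tob :: "'o \<Rightarrow> 'o \<Rightarrow> 'o" (infixr "\<odot>\<index>" 75)
  tar :: "'v \<Rightarrow> 'v \<Rightarrow> 'v" (infixr "\<boxtimes>\<index>" 70)

locale tensor_star_category =
  fixes C :: "('o, 'v::ab_group_add) tcat" (structure)
  assumes scl_vector_space: "vector_space (scl C)"
    and Hom_subspace: "\<lbrakk>a \<in> Ob C; b \<in> Ob C\<rbrakk> \<Longrightarrow> module.subspace (scl C) (Hom C a b)"
    and idt_Hom: "a \<in> Ob C \<Longrightarrow> \<ii>\<dd> a \<in> Hom C a a"
    and cmp_Hom: "\<lbrakk>a \<in> Ob C; b \<in> Ob C; c \<in> Ob C; f \<in> Hom C a b; g \<in> Hom C b c\<rbrakk>
      \<Longrightarrow> g \<cdot> f \<in> Hom C a c"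
    and cmp_assoc: "\<lbrakk>a \<in> Ob C; b \<in> Ob C; c \<in> Ob C; d \<in> Ob C;
        f \<in> Hom C a b; g \<in> Hom C b c; h \<in> Hom C c d\<rbrakk> \<Longrightarrow> (h \<cdot> g) \<cdot> f = h \<cdot> (g \<cdot> f)"
    and cmp_idt: "\<lbrakk>a \<in> Ob C; b \<in> Ob C; f \<in> Hom C a b\<rbrakk> \<Longrightarrow> f \<cdot> \<ii>\<dd> a = f \<and> \<ii>\<dd> b \<cdot> f = f"
    and cmp_add: "\<lbrakk>a \<in> Ob C; b \<in> Ob C; c \<in> Ob C;
        f \<in> Hom C a b; f' \<in> Hom C a b; g \<in> Hom C b c; g' \<in> Hom C b c\<rbrakk>
      \<Longrightarrow> (g + g') \<cdot> f = (g \<cdot> f) + (g' \<cdot> f) \<and> g \<cdot> (f + f') = (g \<cdot> f) + (g \<cdot> f')"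
    and cmp_scl: "\<lbrakk>a \<in> Ob C; b \<in> Ob C; c \<in> Ob C; f \<in> Hom C a b; g \<in> Hom C b c\<rbrakk>
      \<Longrightarrow> scl C z g \<cdot> f = scl C z (g \<cdot> f) \<and> g \<cdot> scl C z f = scl C z (g \<cdot> f)"
    and tun_Ob: "\<iota> \<in> Ob C"
    and tob_Ob: "\<lbrakk>a \<in> Ob C; b \<in> Ob C\<rbrakk> \<Longrightarrow> a \<odot> b \<in> Ob C"
    and tob_assoc: "\<lbrakk>a \<in> Ob C; b \<in> Ob C; c \<in> Ob C\<rbrakk> \<Longrightarrow> (a \<odot> b) \<odot> c = a \<odot> (b \<odot> c)"
    and tob_tun: "a \<in> Ob C \<Longrightarrow> \<iota> \<odot> a = a \<and> a \<odot> \<iota> = a"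
    and tar_Hom: "\<lbrakk>a \<in> Ob C; b \<in> Ob C; c \<in> Ob C; d \<in> Ob C; f \<in> Hom C a b; g \<in> Hom C c d\<rbrakk>
      \<Longrightarrow> f \<boxtimes> g \<in> Hom C (a \<odot> c) (b \<odot> d)"
    and tar_assoc: "\<lbrakk>a \<in> Ob C; b \<in> Ob C; c \<in> Ob C; d \<in> Ob C; a' \<in> Ob C; b' \<in> Ob C;
        f \<in> Hom C a b; g \<in> Hom C c d; h \<in> Hom C a' b'\<rbrakk> \<Longrightarrow> (f \<boxtimes> g) \<boxtimes> h = f \<boxtimes> (g \<boxtimes> h)"
    and tar_tun: "\<lbrakk>a \<in> Ob C; b \<in> Ob C; f \<in> Hom C a b\<rbrakk>
      \<Longrightarrow> \<ii>\<dd> \<iota> \<boxtimes> f = f \<and> f \<boxtimes> \<ii>\<dd> \<iota> = f"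
    and tar_idt: "\<lbrakk>a \<in> Ob C; b \<in> Ob C\<rbrakk> \<Longrightarrow> \<ii>\<dd> a \<boxtimes> \<ii>\<dd> b = \<ii>\<dd> (a \<odot> b)"
    and tar_cmp: "\<lbrakk>a \<in> Ob C; b \<in> Ob C; c \<in> Ob C; a' \<in> Ob C; b' \<in> Ob C; c' \<in> Ob C;
        f \<in> Hom C a b; g \<in> Hom C b c; f' \<in> Hom C a' b'; g' \<in> Hom C b' c'\<rbrakk>
      \<Longrightarrow> (g \<cdot> f) \<boxtimes> (g' \<cdot> f') = (g \<boxtimes> g') \<cdot> (f \<boxtimes> f')"
    and tar_add: "\<lbrakk>a \<in> Ob C; b \<in> Ob C; c \<in> Ob C; d \<in> Ob C;
        f \<in> Hom C a b; f' \<in> Hom C a b; g \<in> Hom C c d; g' \<in> Hom C c d\<rbrakk>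
      \<Longrightarrow> (f + f') \<boxtimes> g = (f \<boxtimes> g) + (f' \<boxtimes> g) \<and> f \<boxtimes> (g + g') = (f \<boxtimes> g) + (f \<boxtimes> g')"
    and tar_scl: "\<lbrakk>a \<in> Ob C; b \<in> Ob C; c \<in> Ob C; d \<in> Ob C; f \<in> Hom C a b; g \<in> Hom C c d\<rbrakk>
      \<Longrightarrow> scl C z f \<boxtimes> g = scl C z (f \<boxtimes> g) \<and> f \<boxtimes> scl C z g = scl C z (f \<boxtimes> g)"
    and str_Hom: "\<lbrakk>a \<in> Ob C; b \<in> Ob C; f \<in> Hom C a b\<rbrakk> \<Longrightarrow> f\<^sup>\<star> \<in> Hom C b a"
    and str_add: "\<lbrakk>a \<in> Ob C; b \<in> Ob C; f \<in> Hom C a b; f' \<in> Hom C a b\<rbrakk>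
      \<Longrightarrow> (f + f')\<^sup>\<star> = f\<^sup>\<star> + f'\<^sup>\<star>"
    and str_scl: "\<lbrakk>a \<in> Ob C; b \<in> Ob C; f \<in> Hom C a b\<rbrakk> \<Longrightarrow> (scl C z f)\<^sup>\<star> = scl C (cnj z) (f\<^sup>\<star>)"
    and str_str: "\<lbrakk>a \<in> Ob C; b \<in> Ob C; f \<in> Hom C a b\<rbrakk> \<Longrightarrow> (f\<^sup>\<star>)\<^sup>\<star> = f"
    and str_cmp: "\<lbrakk>a \<in> Ob C; b \<in> Ob C; c \<in> Ob C; f \<in> Hom C a b; g \<in> Hom C b c\<rbrakk>
      \<Longrightarrow> (g \<cdot> f)\<^sup>\<star> = f\<^sup>\<star> \<cdot> g\<^sup>\<star>"
    and str_tar: "\<lbrakk>a \<in> Ob C; b \<in> Ob C; c \<in> Ob C; d \<in> Ob C; f \<in> Hom C a b; g \<in> Hom C c d\<rbrakk>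
      \<Longrightarrow> (f \<boxtimes> g)\<^sup>\<star> = f\<^sup>\<star> \<boxtimes> g\<^sup>\<star>"
    and str_positive: "\<lbrakk>a \<in> Ob C; b \<in> Ob C; f \<in> Hom C a b; f\<^sup>\<star> \<cdot> f = 0\<rbrakk> \<Longrightarrow> f = 0"

definition isometry :: "('o, 'v) tcat \<Rightarrow> 'o \<Rightarrow> 'o \<Rightarrow> 'v \<Rightarrow> bool" where
  "isometry C a b f \<longleftrightarrow> f \<in> Hom C a b \<and> f\<^sup>\<star>\<^bsub>C\<^esub> \<cdot>\<^bsub>C\<^esub> f = \<ii>\<dd>\<^bsub>C\<^esub> a"

definition unitary_arrow :: "('o, 'v) tcat \<Rightarrow> 'o \<Rightarrow> 'o \<Rightarrow> 'v \<Rightarrow> bool" where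
  "unitary_arrow C a b f \<longleftrightarrow> isometry C a b f \<and> f \<cdot>\<^bsub>C\<^esub> f\<^sup>\<star>\<^bsub>C\<^esub> = \<ii>\<dd>\<^bsub>C\<^esub> b"

definition proj_arrow :: "('o, 'v) tcat \<Rightarrow> 'o \<Rightarrow> 'v \<Rightarrow> bool" where
  "proj_arrow C a p \<longleftrightarrow> p \<in> Hom C a a \<and> p \<cdot>\<^bsub>C\<^esub> p = p \<and> p\<^sup>\<star>\<^bsub>C\<^esub> = p"

definition isomorphic :: "('o, 'v) tcat \<Rightarrow> 'o \<Rightarrow> 'o \<Rightarrow> bool" where
  "isomorphic C a b \<longleftrightarrow> (\<exists>f\<in>Hom C a b. \<exists>g\<in>Hom C b a.
     g \<cdot>\<^bsub>C\<^esub> f = \<ii>\<dd>\<^bsub>C\<^esub> a \<and> f \<cdot>\<^bsub>C\<^esub> g = \<ii>\<dd>\<^bsub>C\<^esub> b)"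

text \<open>
  The condition on the identity excludes zero objects: the projection \<open>0\<close> has a subobject too, and
  a zero object has no other endomorphism than the multiples of its identity.
\<close>

definition irreducible_object :: "('o, 'v::zero) tcat \<Rightarrow> 'o \<Rightarrow> bool" where
  "irreducible_object C a \<longleftrightarrow> \<ii>\<dd>\<^bsub>C\<^esub> a \<noteq> 0 \<and> Hom C a a = range (\<lambda>z. scl C z (\<ii>\<dd>\<^bsub>C\<^esub> a))"

definition has_subobjects :: "('o, 'v) tcat \<Rightarrow> bool" where
  "has_subobjects C \<longleftrightarrow> (\<forall>a\<in>Ob C. \<forall>p. proj_arrow C a p \<longrightarrow>
     (\<exists>b\<in>Ob C. \<exists>v. isometry C b a v \<and> v \<cdot>\<^bsub>C\<^esub> v\<^sup>\<star>\<^bsub>C\<^esub> = p))"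

definition has_direct_sums :: "('o, 'v::plus) tcat \<Rightarrow> bool" where
  "has_direct_sums C \<longleftrightarrow> (\<forall>a\<in>Ob C. \<forall>b\<in>Ob C. \<exists>c\<in>Ob C. \<exists>v w.
     isometry C a c v \<and> isometry C b c w \<and>
     (v \<cdot>\<^bsub>C\<^esub> v\<^sup>\<star>\<^bsub>C\<^esub>) + (w \<cdot>\<^bsub>C\<^esub> w\<^sup>\<star>\<^bsub>C\<^esub>) = \<ii>\<dd>\<^bsub>C\<^esub> c)"

definition conj_equations :: "('o, 'v) tcat \<Rightarrow> 'o \<Rightarrow> 'o \<Rightarrow> 'v \<Rightarrow> 'v \<Rightarrow> bool" where
  "conj_equations C a a' r r' \<longleftrightarrow>
     r \<in> Hom C \<iota>\<^bsub>C\<^esub> (a' \<odot>\<^bsub>C\<^esub> a) \<and> r' \<in> Hom C \<iota>\<^bsub>C\<^esub> (a \<odot>\<^bsub>C\<^esub> a') \<and>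
     (r'\<^sup>\<star>\<^bsub>C\<^esub> \<boxtimes>\<^bsub>C\<^esub> \<ii>\<dd>\<^bsub>C\<^esub> a) \<cdot>\<^bsub>C\<^esub> (\<ii>\<dd>\<^bsub>C\<^esub> a \<boxtimes>\<^bsub>C\<^esub> r) = \<ii>\<dd>\<^bsub>C\<^esub> a \<and>
     (r\<^sup>\<star>\<^bsub>C\<^esub> \<boxtimes>\<^bsub>C\<^esub> \<ii>\<dd>\<^bsub>C\<^esub> a') \<cdot>\<^bsub>C\<^esub> (\<ii>\<dd>\<^bsub>C\<^esub> a' \<boxtimes>\<^bsub>C\<^esub> r') = \<ii>\<dd>\<^bsub>C\<^esub> a'"

definition normalized :: "('o, 'v) tcat \<Rightarrow> 'v \<Rightarrow> 'v \<Rightarrow> bool" where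
  "normalized C r r' \<longleftrightarrow> (\<exists>d. r\<^sup>\<star>\<^bsub>C\<^esub> \<cdot>\<^bsub>C\<^esub> r = scl C d (\<ii>\<dd>\<^bsub>C\<^esub> \<iota>\<^bsub>C\<^esub>) \<and>
     r'\<^sup>\<star>\<^bsub>C\<^esub> \<cdot>\<^bsub>C\<^esub> r' = scl C d (\<ii>\<dd>\<^bsub>C\<^esub> \<iota>\<^bsub>C\<^esub>))"

definition has_conjugates :: "('o, 'v::zero) tcat \<Rightarrow> bool" where
  "has_conjugates C \<longleftrightarrow> (\<forall>a\<in>Ob C. \<exists>a'\<in>Ob C. \<exists>r r'. conj_equations C a a' r r' \<and>
     (irreducible_object C a \<longrightarrow> normalized C r r'))"

text \<open>
  Standard solutions of the conjugate equations, for an orthogonal decomposition of \<open>a\<close> into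
  irreducibles \<open>s i\<close>, \<open>i < n\<close>, with isometries \<open>w i\<close>, and of \<open>a'\<close> into conjugates \<open>s' i\<close>
  with isometries \<open>w' i\<close>.
\<close>

definition standard_solution ::
  "('o, 'v::ab_group_add) tcat \<Rightarrow> 'o \<Rightarrow> 'o \<Rightarrow> 'v \<Rightarrow> 'v \<Rightarrow> bool" where
  "standard_solution C a a' r r' \<longleftrightarrow> (\<exists>(n::nat) s s' w w' q q'.
     (\<forall>i<n. s i \<in> Ob C \<and> s' i \<in> Ob C \<and> irreducible_object C (s i) \<and>
        conj_equations C (s i) (s' i) (q i) (q' i) \<and> normalized C (q i) (q' i) \<and>
        isometry C (s i) a (w i) \<and> isometry C (s' i) a' (w' i)) \<and>
     (\<Sum>i<n. w i \<cdot>\<^bsub>C\<^esub> (w i)\<^sup>\<star>\<^bsub>C\<^esub>) = \<ii>\<dd>\<^bsub>C\<^esub> a \<and>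
     (\<Sum>i<n. w' i \<cdot>\<^bsub>C\<^esub> (w' i)\<^sup>\<star>\<^bsub>C\<^esub>) = \<ii>\<dd>\<^bsub>C\<^esub> a' \<and>
     r = (\<Sum>i<n. (w' i \<boxtimes>\<^bsub>C\<^esub> w i) \<cdot>\<^bsub>C\<^esub> q i) \<and>
     r' = (\<Sum>i<n. (w i \<boxtimes>\<^bsub>C\<^esub> w' i) \<cdot>\<^bsub>C\<^esub> q' i))"

definition TC_star :: "('o, 'v::ab_group_add) tcat \<Rightarrow> bool" where
  "TC_star C \<longleftrightarrow> tensor_star_category C \<and> has_conjugates C \<and> has_direct_sums C \<and>
     has_subobjects C \<and>
     (\<forall>a\<in>Ob C. \<forall>b\<in>Ob C. \<exists>B. finite B \<and> module.span (scl C) B = Hom C a b) \<and>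
     irreducible_object C \<iota>\<^bsub>C\<^esub>"

definition unitary_braiding ::
  "('o, 'v) tcat \<Rightarrow> ('o \<Rightarrow> 'o \<Rightarrow> 'v) \<Rightarrow> bool" where
  "unitary_braiding C \<epsilon> \<longleftrightarrow>
     (\<forall>a\<in>Ob C. \<forall>b\<in>Ob C. unitary_arrow C (a \<odot>\<^bsub>C\<^esub> b) (b \<odot>\<^bsub>C\<^esub> a) (\<epsilon> a b)) \<and>
     (\<forall>a\<in>Ob C. \<forall>a'\<in>Ob C. \<forall>b\<in>Ob C. \<forall>b'\<in>Ob C. \<forall>f\<in>Hom C a a'. \<forall>g\<in>Hom C b b'.
        (g \<boxtimes>\<^bsub>C\<^esub> f) \<cdot>\<^bsub>C\<^esub> \<epsilon> a b = \<epsilon> a' b' \<cdot>\<^bsub>C\<^esub> (f \<boxtimes>\<^bsub>C\<^esub> g)) \<and>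
     (\<forall>a\<in>Ob C. \<forall>b\<in>Ob C. \<forall>c\<in>Ob C.
        \<epsilon> a (b \<odot>\<^bsub>C\<^esub> c) = (\<ii>\<dd>\<^bsub>C\<^esub> b \<boxtimes>\<^bsub>C\<^esub> \<epsilon> a c) \<cdot>\<^bsub>C\<^esub> (\<epsilon> a b \<boxtimes>\<^bsub>C\<^esub> \<ii>\<dd>\<^bsub>C\<^esub> c) \<and>
        \<epsilon> (a \<odot>\<^bsub>C\<^esub> b) c = (\<epsilon> a c \<boxtimes>\<^bsub>C\<^esub> \<ii>\<dd>\<^bsub>C\<^esub> b) \<cdot>\<^bsub>C\<^esub> (\<ii>\<dd>\<^bsub>C\<^esub> a \<boxtimes>\<^bsub>C\<^esub> \<epsilon> b c))"

definition BTC_star ::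
  "('o, 'v::ab_group_add) tcat \<Rightarrow> ('o \<Rightarrow> 'o \<Rightarrow> 'v) \<Rightarrow> bool" where
  "BTC_star C \<epsilon> \<longleftrightarrow> TC_star C \<and> unitary_braiding C \<epsilon>"

text \<open>The twist of \<open>a\<close>, computed from the component \<open>r\<close> of a standard solution.\<close>

definition twist ::
  "('o, 'v) tcat \<Rightarrow> ('o \<Rightarrow> 'o \<Rightarrow> 'v) \<Rightarrow> 'o \<Rightarrow> 'o \<Rightarrow> 'v \<Rightarrow> 'v" where
  "twist C \<epsilon> a a' r =
     (r\<^sup>\<star>\<^bsub>C\<^esub> \<boxtimes>\<^bsub>C\<^esub> \<ii>\<dd>\<^bsub>C\<^esub> a) \<cdot>\<^bsub>C\<^esub> (\<ii>\<dd>\<^bsub>C\<^esub> a' \<boxtimes>\<^bsub>C\<^esub> \<epsilon> a a) \<cdot>\<^bsub>C\<^esub> (r \<boxtimes>\<^bsub>C\<^esub> \<ii>\<dd>\<^bsub>C\<^esub> a)"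

definition degenerate_objects ::
  "('o, 'v) tcat \<Rightarrow> ('o \<Rightarrow> 'o \<Rightarrow> 'v) \<Rightarrow> 'o set" where
  "degenerate_objects C \<epsilon> =
     {a \<in> Ob C. \<forall>b\<in>Ob C. \<epsilon> b a \<cdot>\<^bsub>C\<^esub> \<epsilon> a b = \<ii>\<dd>\<^bsub>C\<^esub> (a \<odot>\<^bsub>C\<^esub> b)}"

text \<open>A full subcategory is given by its set of objects \<open>S\<close>; as a category it is \<open>C\<lparr>Ob := S\<rparr>\<close>.\<close>

definition even_symmetric_subcategory ::
  "('o, 'v::ab_group_add) tcat \<Rightarrow> ('o \<Rightarrow> 'o \<Rightarrow> 'v) \<Rightarrow> 'o set \<Rightarrow> bool" where
  "even_symmetric_subcategory C \<epsilon> S \<longleftrightarrow>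
     S \<subseteq> Ob C \<and>
     (\<forall>a\<in>S. \<forall>b\<in>Ob C. isomorphic C a b \<longrightarrow> b \<in> S) \<and>
     \<iota>\<^bsub>C\<^esub> \<in> S \<and> (\<forall>a\<in>S. \<forall>b\<in>S. a \<odot>\<^bsub>C\<^esub> b \<in> S) \<and>
     (\<forall>a\<in>S. \<forall>b\<in>S. \<epsilon> b a \<cdot>\<^bsub>C\<^esub> \<epsilon> a b = \<ii>\<dd>\<^bsub>C\<^esub> (a \<odot>\<^bsub>C\<^esub> b)) \<and>
     has_conjugates (C\<lparr>Ob := S\<rparr>) \<and> has_direct_sums (C\<lparr>Ob := S\<rparr>) \<and> has_subobjects (C\<lparr>Ob := S\<rparr>) \<and>
     (\<forall>a\<in>S. \<forall>a'\<in>Ob C. \<forall>r r'. standard_solution C a a' r r' \<longrightarrow> twist C \<epsilon> a a' r = \<ii>\<dd>\<^bsub>C\<^esub> a)"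


section \<open>Compact groups and unitary representations\<close>

definition compact_group :: "'g monoid \<Rightarrow> 'g topology \<Rightarrow> bool" where
  "compact_group G T \<longleftrightarrow> group G \<and> topspace T = carrier G \<and>
     compact_space T \<and> Hausdorff_space T \<and>
     continuous_map (prod_topology T T) T (\<lambda>(x, y). x \<otimes>\<^bsub>G\<^esub> y) \<and>
     continuous_map T T (\<lambda>x. inv\<^bsub>G\<^esub> x)"

text \<open>Inner products \<open>ip\<close> are antilinear in the first variable.\<close>

definition fd_hilbert_space ::
  "(complex \<Rightarrow> 'h \<Rightarrow> 'h::ab_group_add) \<Rightarrow> 'h set \<Rightarrow> ('h \<Rightarrow> 'h \<Rightarrow> complex) \<Rightarrow> bool" where
  "fd_hilbert_space sc K ip \<longleftrightarrow>
     module.subspace sc K \<and> (\<exists>B. finite B \<and> module.span sc B = K) \<and>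
     (\<forall>x\<in>K. \<forall>y\<in>K. \<forall>y'\<in>K. ip x (y + y') = ip x y + ip x y') \<and>
     (\<forall>x\<in>K. \<forall>y\<in>K. \<forall>z. ip x (sc z y) = z * ip x y) \<and>
     (\<forall>x\<in>K. \<forall>y\<in>K. ip y x = cnj (ip x y)) \<and>
     (\<forall>x\<in>K. x \<noteq> 0 \<longrightarrow> Re (ip x x) > 0)"

definition linear_between ::
  "(complex \<Rightarrow> 'h \<Rightarrow> 'h::ab_group_add) \<Rightarrow> 'h set \<Rightarrow> 'h set \<Rightarrow> ('h \<Rightarrow> 'h) \<Rightarrow> bool" where
  "linear_between sc K L A \<longleftrightarrow> A ` K \<subseteq> L \<and>
     (\<forall>x\<in>K. \<forall>y\<in>K. A (x + y) = A x + A y) \<and> (\<forall>x\<in>K. \<forall>z. A (sc z x) = sc z (A x))"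

text \<open>Since \<open>K\<close> is finite dimensional, continuity of \<open>\<pi>\<close> is continuity of its matrix elements.\<close>

definition unitary_rep ::
  "'g monoid \<Rightarrow> 'g topology \<Rightarrow> (complex \<Rightarrow> 'h \<Rightarrow> 'h::ab_group_add) \<Rightarrow>
   'h set \<Rightarrow> ('h \<Rightarrow> 'h \<Rightarrow> complex) \<Rightarrow> ('g \<Rightarrow> 'h \<Rightarrow> 'h) \<Rightarrow> bool" where
  "unitary_rep G T sc K ip \<pi> \<longleftrightarrow> fd_hilbert_space sc K ip \<and>
     (\<forall>g\<in>carrier G. linear_between sc K K (\<pi> g)) \<and>
     (\<forall>g\<in>carrier G. \<forall>x\<in>K. \<forall>y\<in>K. ip (\<pi> g x) (\<pi> g y) = ip x y) \<and>
     (\<forall>x\<in>K. \<pi> \<one>\<^bsub>G\<^esub> x = x) \<and>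
     (\<forall>g\<in>carrier G. \<forall>h\<in>carrier G. \<forall>x\<in>K. \<pi> (g \<otimes>\<^bsub>G\<^esub> h) x = \<pi> g (\<pi> h x)) \<and>
     (\<forall>x\<in>K. \<forall>y\<in>K. continuous_map T euclidean (\<lambda>g. ip x (\<pi> g y)))"

definition irreducible_rep ::
  "'g monoid \<Rightarrow> (complex \<Rightarrow> 'h \<Rightarrow> 'h::ab_group_add) \<Rightarrow> 'h set \<Rightarrow> ('g \<Rightarrow> 'h \<Rightarrow> 'h) \<Rightarrow> bool" where
  "irreducible_rep G sc K \<pi> \<longleftrightarrow> K \<noteq> {0} \<and>
     (\<forall>W. module.subspace sc W \<and> W \<subseteq> K \<and> (\<forall>g\<in>carrier G. \<pi> g ` W \<subseteq> W) \<longrightarrow> W = {0} \<or> W = K)"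

definition intertwiner ::
  "'g monoid \<Rightarrow> (complex \<Rightarrow> 'h \<Rightarrow> 'h::ab_group_add) \<Rightarrow> 'h set \<Rightarrow> ('g \<Rightarrow> 'h \<Rightarrow> 'h) \<Rightarrow>
   'h set \<Rightarrow> ('g \<Rightarrow> 'h \<Rightarrow> 'h) \<Rightarrow> ('h \<Rightarrow> 'h) \<Rightarrow> bool" where
  "intertwiner G sc K \<pi> L \<sigma> A \<longleftrightarrow> linear_between sc K L A \<and>
     (\<forall>g\<in>carrier G. \<forall>x\<in>K. A (\<pi> g x) = \<sigma> g (A x))"


section \<open>The Doplicher--Roberts isomorphism\<close>

text \<open>
  The functor \<open>F\<close> from \<open>S\<close> to a category of representations of \<open>G\<close>: the space
  \<open>fsp F a\<close> with inner product \<open>fip F a\<close> and representation \<open>frep F a\<close> is \<open>F(a)\<close>; the map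
  \<open>farr F a b s\<close> is \<open>F(s)\<close> for \<open>s \<in> Hom C a b\<close>; \<open>ften F a b\<close> is the tensor product of vectors
  from \<open>F(a) \<times> F(b)\<close> to \<open>F(a \<odot> b)\<close>; \<open>fvac F\<close> is the unit vector \<open>\<Omega>\<close>.  All spaces lie in
  one ambient complex vector space \<open>'h\<close> with scalar multiplication \<open>fsc F\<close>.
\<close>

record ('o, 'v, 'g, 'h) rep_functor =
  fsc :: "complex \<Rightarrow> 'h \<Rightarrow> 'h"
  fsp :: "'o \<Rightarrow> 'h set"
  fip :: "'o \<Rightarrow> 'h \<Rightarrow> 'h \<Rightarrow> complex"
  frep :: "'o \<Rightarrow> 'g \<Rightarrow> 'h \<Rightarrow> 'h"
  ften :: "'o \<Rightarrow> 'o \<Rightarrow> 'h \<Rightarrow> 'h \<Rightarrow> 'h"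
  farr :: "'o \<Rightarrow> 'o \<Rightarrow> 'v \<Rightarrow> 'h \<Rightarrow> 'h"
  fvac :: "'h"

text \<open>
  The objects of the representation category are named by those of \<open>S\<close>.  It
  consists of all intertwiners between its objects (assumption \<open>full_faithful\<close>), so that closure
  under direct sums and subrepresentations is inherited from \<open>S\<close>.  In
  particular \<open>'h\<close> is infinite dimensional, so assumption \<open>all_irreducibles\<close>, which speaks about
  representations on subspaces of \<open>'h\<close>, reaches all classes of irreducible
  representations.
\<close>

locale DR_isomorphism =
  fixes C :: "('o, 'v::ab_group_add) tcat" (structure)
    and \<epsilon> :: "'o \<Rightarrow> 'o \<Rightarrow> 'v"
    and S :: "'o set"
    and G :: "'g monoid"
    and T :: "'g topology"
    and F :: "('o, 'v, 'g, 'h::ab_group_add) rep_functor"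
  assumes fsc_vector_space: "vector_space (fsc F)"
    and rep: "a \<in> S \<Longrightarrow> unitary_rep G T (fsc F) (fsp F a) (fip F a) (frep F a)"
    and farr_intertwiner: "\<lbrakk>a \<in> S; b \<in> S; s \<in> Hom C a b\<rbrakk>
      \<Longrightarrow> intertwiner G (fsc F) (fsp F a) (frep F a) (fsp F b) (frep F b) (farr F a b s)"
    and full_faithful: "\<lbrakk>a \<in> S; b \<in> S;
        intertwiner G (fsc F) (fsp F a) (frep F a) (fsp F b) (frep F b) A\<rbrakk>
      \<Longrightarrow> \<exists>!s. s \<in> Hom C a b \<and> (\<forall>x\<in>fsp F a. farr F a b s x = A x)"
    and farr_add: "\<lbrakk>a \<in> S; b \<in> S; s \<in> Hom C a b; s' \<in> Hom C a b; x \<in> fsp F a\<rbrakk>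
      \<Longrightarrow> farr F a b (s + s') x = farr F a b s x + farr F a b s' x"
    and farr_scl: "\<lbrakk>a \<in> S; b \<in> S; s \<in> Hom C a b; x \<in> fsp F a\<rbrakk>
      \<Longrightarrow> farr F a b (scl C z s) x = fsc F z (farr F a b s x)"
    and farr_idt: "\<lbrakk>a \<in> S; x \<in> fsp F a\<rbrakk> \<Longrightarrow> farr F a a (\<ii>\<dd> a) x = x"
    and farr_cmp: "\<lbrakk>a \<in> S; b \<in> S; c \<in> S; s \<in> Hom C a b; t \<in> Hom C b c; x \<in> fsp F a\<rbrakk>
      \<Longrightarrow> farr F a c (t \<cdot> s) x = farr F b c t (farr F a b s x)"
    and farr_str: "\<lbrakk>a \<in> S; b \<in> S; s \<in> Hom C a b; x \<in> fsp F a; y \<in> fsp F b\<rbrakk>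
      \<Longrightarrow> fip F a (farr F b a (s\<^sup>\<star>) y) x = fip F b y (farr F a b s x)"
    and ften_add: "\<lbrakk>a \<in> S; b \<in> S; x \<in> fsp F a; x' \<in> fsp F a; y \<in> fsp F b; y' \<in> fsp F b\<rbrakk>
      \<Longrightarrow> ften F a b (x + x') y = ften F a b x y + ften F a b x' y \<and>
          ften F a b x (y + y') = ften F a b x y + ften F a b x y'"
    and ften_scl: "\<lbrakk>a \<in> S; b \<in> S; x \<in> fsp F a; y \<in> fsp F b\<rbrakk>
      \<Longrightarrow> ften F a b (fsc F z x) y = fsc F z (ften F a b x y) \<and>
          ften F a b x (fsc F z y) = fsc F z (ften F a b x y)"
    and ften_span: "\<lbrakk>a \<in> S; b \<in> S\<rbrakk>
      \<Longrightarrow> module.span (fsc F) {ften F a b x y | x y. x \<in> fsp F a \<and> y \<in> fsp F b} = fsp F (a \<odot> b)"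
    and ften_fip: "\<lbrakk>a \<in> S; b \<in> S; x \<in> fsp F a; x' \<in> fsp F a; y \<in> fsp F b; y' \<in> fsp F b\<rbrakk>
      \<Longrightarrow> fip F (a \<odot> b) (ften F a b x y) (ften F a b x' y') = fip F a x x' * fip F b y y'"
    and ften_rep: "\<lbrakk>a \<in> S; b \<in> S; x \<in> fsp F a; y \<in> fsp F b; g \<in> carrier G\<rbrakk>
      \<Longrightarrow> frep F (a \<odot> b) g (ften F a b x y) = ften F a b (frep F a g x) (frep F b g y)"
    and ften_assoc: "\<lbrakk>a \<in> S; b \<in> S; c \<in> S; x \<in> fsp F a; y \<in> fsp F b; w \<in> fsp F c\<rbrakk>
      \<Longrightarrow> ften F (a \<odot> b) c (ften F a b x y) w = ften F a (b \<odot> c) x (ften F b c y w)"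
    and ften_farr: "\<lbrakk>a \<in> S; b \<in> S; a' \<in> S; b' \<in> S; s \<in> Hom C a a'; t \<in> Hom C b b';
        x \<in> fsp F a; y \<in> fsp F b\<rbrakk>
      \<Longrightarrow> farr F (a \<odot> b) (a' \<odot> b') (s \<boxtimes> t) (ften F a b x y) =
          ften F a' b' (farr F a a' s x) (farr F b b' t y)"
    and ften_symmetry: "\<lbrakk>a \<in> S; b \<in> S; x \<in> fsp F a; y \<in> fsp F b\<rbrakk>
      \<Longrightarrow> farr F (a \<odot> b) (b \<odot> a) (\<epsilon> a b) (ften F a b x y) = ften F b a y x"
    and vac_space: "fvac F \<in> fsp F \<iota>" "fsp F \<iota> = module.span (fsc F) {fvac F}"
    and vac_unit: "fip F \<iota> (fvac F) (fvac F) = 1"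
    and ften_vac: "\<lbrakk>a \<in> S; x \<in> fsp F a\<rbrakk>
      \<Longrightarrow> ften F \<iota> a (fvac F) x = x \<and> ften F a \<iota> x (fvac F) = x"
    and all_irreducibles: "\<lbrakk>unitary_rep G T (fsc F) K ip \<pi>; irreducible_rep G (fsc F) K \<pi>\<rbrakk>
      \<Longrightarrow> \<exists>a\<in>S. \<exists>A. intertwiner G (fsc F) K \<pi> (fsp F a) (frep F a) A \<and>
            bij_betw A K (fsp F a) \<and> (\<forall>x\<in>K. \<forall>y\<in>K. fip F a (A x) (A y) = ip x y)"


section \<open>The crossed product\<close>

text \<open>
  The choices entering the crossed product.  The index set of isomorphism classes of irreducible
  objects of \<open>S\<close> is represented by the set \<open>irr\<close> of representatives itself;
  \<open>vbas k l m\<close> is the orthonormal basis of \<open>Hom m (k \<odot> l)\<close>, \<open>cbar k\<close> the representative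
  conjugate to \<open>k\<close>, with \<open>Rs k\<close>, \<open>Rs' k\<close> the solution of the conjugate equations.
  The orthonormal basis \<open>hbas k\<close> of \<open>F(k)\<close> only serves to write elements of
  \<open>Hom (k \<odot> \<rho>) \<sigma> \<otimes> F(k)\<close> as sums of simple tensors.
\<close>

record ('o, 'v, 'h) crossed_data =
  irr :: "'o set"
  hbas :: "'o \<Rightarrow> 'h set"
  vbas :: "'o \<Rightarrow> 'o \<Rightarrow> 'o \<Rightarrow> 'v set"
  cbar :: "'o \<Rightarrow> 'o"
  Rs :: "'o \<Rightarrow> 'v"
  Rs' :: "'o \<Rightarrow> 'v"

locale crossed_product_data =
  fixes C :: "('o, 'v::ab_group_add) tcat" (structure)
    and S :: "'o set"
    and F :: "('o, 'v, 'g, 'h::ab_group_add) rep_functor"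
    and P :: "('o, 'v, 'h) crossed_data"
  assumes irr_S: "k \<in> irr P \<Longrightarrow> k \<in> S \<and> irreducible_object C k"
    and irr_unit: "\<iota> \<in> irr P"
    and irr_representatives: "\<lbrakk>a \<in> S; irreducible_object C a\<rbrakk> \<Longrightarrow> \<exists>!k. k \<in> irr P \<and> isomorphic C k a"
    and hbas_basis: "k \<in> irr P \<Longrightarrow> finite (hbas P k) \<and> module.span (fsc F) (hbas P k) = fsp F k"
    and hbas_orthonormal: "\<lbrakk>k \<in> irr P; x \<in> hbas P k; y \<in> hbas P k\<rbrakk>
      \<Longrightarrow> fip F k x y = (if x = y then 1 else 0)"
    and vbas_basis: "\<lbrakk>k \<in> irr P; l \<in> irr P; m \<in> irr P\<rbrakk>
      \<Longrightarrow> finite (vbas P k l m) \<and> module.span (scl C) (vbas P k l m) = Hom C m (k \<odot> l)"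
    and vbas_orthonormal: "\<lbrakk>k \<in> irr P; l \<in> irr P; m \<in> irr P; v \<in> vbas P k l m; w \<in> vbas P k l m\<rbrakk>
      \<Longrightarrow> v\<^sup>\<star> \<cdot> w = (if v = w then \<ii>\<dd> m else 0)"
    and cbar_irr: "k \<in> irr P \<Longrightarrow> cbar P k \<in> irr P"
    and Rs_solution: "k \<in> irr P \<Longrightarrow>
      conj_equations C k (cbar P k) (Rs P k) (Rs' P k) \<and> normalized C (Rs P k) (Rs' P k)"
    and Rs_cbar: "\<lbrakk>k \<in> irr P; cbar P k \<noteq> k\<rbrakk>
      \<Longrightarrow> Rs P (cbar P k) = Rs' P k \<and> Rs' P (cbar P k) = Rs P k"
    and Rs_selfconjugate: "\<lbrakk>k \<in> irr P; cbar P k = k\<rbrakk> \<Longrightarrow> Rs' P k = Rs P k \<or> Rs' P k = - Rs P k"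

text \<open>
  An arrow of the crossed product is a function on triples: its value at \<open>(\<rho>, \<sigma>, k)\<close> is the
  component in \<open>Hom (k \<odot> \<rho>) \<sigma> \<otimes> F(k)\<close>, where \<open>s \<otimes> \<psi>\<close> is represented by the antilinear map
  \<open>\<phi> \<mapsto> \<langle>\<phi>, \<psi>\<rangle> s\<close> on \<open>F(k)\<close>.  (For finite dimensional \<open>H\<close> this
  identifies \<open>X \<otimes> H\<close> with the antilinear maps from \<open>H\<close> to \<open>X\<close>.)  Source and target are
  recorded because the operations on arrows depend on them.
\<close>

type_synonym ('o, 'v, 'h) xarr = "'o \<times> 'o \<times> 'o \<Rightarrow> 'h \<Rightarrow> 'v"

definition stensor ::
  "('o, 'v::ab_group_add) tcat \<Rightarrow> ('o, 'v, 'g, 'h) rep_functor \<Rightarrow>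
   'o \<Rightarrow> 'o \<Rightarrow> 'o \<Rightarrow> 'v \<Rightarrow> 'h \<Rightarrow> ('o, 'v, 'h) xarr" where
  "stensor C F \<rho> \<sigma> k s \<psi> =
     (\<lambda>t \<phi>. if t = (\<rho>, \<sigma>, k) \<and> \<phi> \<in> fsp F k then scl C (fip F k \<phi> \<psi>) s else 0)"

text \<open>
  \<open>xsum P f x\<close> writes \<open>x\<close> as a sum of simple tensors \<open>s \<otimes> e\<close>, with \<open>e\<close> in the chosen orthonormal
  bases, and adds up the values of \<open>f\<close> on these.  It thus extends operations given on simple tensors
  \<open>s \<otimes> \<psi>\<close> by an expression (anti)linear in both \<open>s\<close> and \<open>\<psi>\<close>.
\<close>

definition xsum ::
  "('o, 'v, 'h) crossed_data \<Rightarrow> ('o \<Rightarrow> 'o \<Rightarrow> 'o \<Rightarrow> 'v::ab_group_add \<Rightarrow> 'h \<Rightarrow> 'b::ab_group_add) \<Rightarrow>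
   ('o, 'v, 'h) xarr \<Rightarrow> 'b" where
  "xsum P f x = (\<Sum>(\<rho>, \<sigma>, k)\<in>{t. x t \<noteq> 0}. \<Sum>e\<in>hbas P k. f \<rho> \<sigma> k (x (\<rho>, \<sigma>, k) e) e)"

definition xscl ::
  "('o, 'v) tcat \<Rightarrow> complex \<Rightarrow> ('o, 'v, 'h) xarr \<Rightarrow> ('o, 'v, 'h) xarr" where
  "xscl C z x = (\<lambda>t \<phi>. scl C z (x t \<phi>))"

definition xHom ::
  "('o, 'v::ab_group_add) tcat \<Rightarrow> ('o, 'v, 'g, 'h) rep_functor \<Rightarrow> ('o, 'v, 'h) crossed_data \<Rightarrow>
   'o \<Rightarrow> 'o \<Rightarrow> ('o, 'v, 'h) xarr set" where
  "xHom C F P \<rho> \<sigma> = module.span (xscl C)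
     {stensor C F \<rho> \<sigma> k s \<psi> | k s \<psi>. k \<in> irr P \<and> s \<in> Hom C (k \<odot>\<^bsub>C\<^esub> \<rho>) \<sigma> \<and> \<psi> \<in> fsp F k}"

text \<open>
  The sum over \<open>m\<close> and the basis arrows \<open>v \<in> vbas P k l m\<close> that occurs both in composition and in
  the tensor product; \<open>F(v)\<^sup>* = F(v\<^sup>*)\<close>.
\<close>

definition xfuse ::
  "('o, 'v::ab_group_add) tcat \<Rightarrow> ('o, 'v, 'g, 'h) rep_functor \<Rightarrow> ('o, 'v, 'h) crossed_data \<Rightarrow>
   'o \<Rightarrow> 'o \<Rightarrow> 'o \<Rightarrow> 'o \<Rightarrow> 'v \<Rightarrow> 'h \<Rightarrow> 'h \<Rightarrow> ('o, 'v, 'h) xarr" where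
  "xfuse C F P \<rho> \<sigma> k l u \<psi> \<psi>' =
     (\<Sum>m\<in>{m \<in> irr P. vbas P k l m \<noteq> {}}. \<Sum>v\<in>vbas P k l m.
        stensor C F \<rho> \<sigma> m (u \<cdot>\<^bsub>C\<^esub> (v \<boxtimes>\<^bsub>C\<^esub> \<ii>\<dd>\<^bsub>C\<^esub> \<rho>))
          (farr F (k \<odot>\<^bsub>C\<^esub> l) m (v\<^sup>\<star>\<^bsub>C\<^esub>) (ften F k l \<psi> \<psi>')))"

definition xcmp ::
  "('o, 'v::ab_group_add) tcat \<Rightarrow> ('o, 'v, 'g, 'h) rep_functor \<Rightarrow> ('o, 'v, 'h) crossed_data \<Rightarrow>
   ('o, 'v, 'h) xarr \<Rightarrow> ('o, 'v, 'h) xarr \<Rightarrow> ('o, 'v, 'h) xarr" where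
  "xcmp C F P x y =
     xsum P (\<lambda>\<sigma> \<delta> k s \<psi>. xsum P (\<lambda>\<rho> \<sigma>' l t \<psi>'.
       if \<sigma>' = \<sigma> then xfuse C F P \<rho> \<delta> k l (s \<cdot>\<^bsub>C\<^esub> (\<ii>\<dd>\<^bsub>C\<^esub> k \<boxtimes>\<^bsub>C\<^esub> t)) \<psi> \<psi>' else 0) y) x"

definition xtar ::
  "('o, 'v::ab_group_add) tcat \<Rightarrow> ('o \<Rightarrow> 'o \<Rightarrow> 'v) \<Rightarrow> ('o, 'v, 'g, 'h) rep_functor \<Rightarrow>
   ('o, 'v, 'h) crossed_data \<Rightarrow>
   ('o, 'v, 'h) xarr \<Rightarrow> ('o, 'v, 'h) xarr \<Rightarrow> ('o, 'v, 'h) xarr" where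
  "xtar C \<epsilon> F P x y =
     xsum P (\<lambda>\<rho>1 \<sigma>1 k s \<psi>. xsum P (\<lambda>\<rho>2 \<sigma>2 l t \<psi>'.
       xfuse C F P (\<rho>1 \<odot>\<^bsub>C\<^esub> \<rho>2) (\<sigma>1 \<odot>\<^bsub>C\<^esub> \<sigma>2) k l
         ((s \<boxtimes>\<^bsub>C\<^esub> t) \<cdot>\<^bsub>C\<^esub> (\<ii>\<dd>\<^bsub>C\<^esub> k \<boxtimes>\<^bsub>C\<^esub> \<epsilon> l \<rho>1 \<boxtimes>\<^bsub>C\<^esub> \<ii>\<dd>\<^bsub>C\<^esub> \<rho>2)) \<psi> \<psi>') y) x"

definition conj_vector ::
  "('o, 'v) tcat \<Rightarrow> ('o, 'v, 'g, 'h) rep_functor \<Rightarrow> ('o, 'v, 'h) crossed_data \<Rightarrow> 'o \<Rightarrow> 'h \<Rightarrow> 'h" where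
  "conj_vector C F P k \<psi> = (THE \<psi>'. \<psi>' \<in> fsp F (cbar P k) \<and>
     (\<forall>x\<in>fsp F (cbar P k). fip F (cbar P k) x \<psi>' =
        fip F (k \<odot>\<^bsub>C\<^esub> cbar P k) (ften F k (cbar P k) \<psi> x)
          (farr F \<iota>\<^bsub>C\<^esub> (k \<odot>\<^bsub>C\<^esub> cbar P k) (Rs' P k) (fvac F))))"

definition xstr ::
  "('o, 'v::ab_group_add) tcat \<Rightarrow> ('o, 'v, 'g, 'h) rep_functor \<Rightarrow> ('o, 'v, 'h) crossed_data \<Rightarrow>
   ('o, 'v, 'h) xarr \<Rightarrow> ('o, 'v, 'h) xarr" where
  "xstr C F P x = xsum P (\<lambda>\<rho> \<sigma> k s \<psi>.
     stensor C F \<sigma> \<rho> (cbar P k)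
       (((Rs P k)\<^sup>\<star>\<^bsub>C\<^esub> \<boxtimes>\<^bsub>C\<^esub> \<ii>\<dd>\<^bsub>C\<^esub> \<rho>) \<cdot>\<^bsub>C\<^esub> (\<ii>\<dd>\<^bsub>C\<^esub> (cbar P k) \<boxtimes>\<^bsub>C\<^esub> s\<^sup>\<star>\<^bsub>C\<^esub>))
       (conj_vector C F P k \<psi>)) x"

text \<open>The image \<open>s \<otimes> \<Omega>\<close> in the crossed product of \<open>s \<in> Hom C \<rho> \<sigma>\<close>.\<close>

definition xemb ::
  "('o, 'v::ab_group_add) tcat \<Rightarrow> ('o, 'v, 'g, 'h) rep_functor \<Rightarrow> 'o \<Rightarrow> 'o \<Rightarrow> 'v \<Rightarrow>
   ('o, 'v, 'h) xarr" where
  "xemb C F \<rho> \<sigma> s = stensor C F \<rho> \<sigma> \<iota>\<^bsub>C\<^esub> s (fvac F)"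

definition crossed_product0 ::
  "('o, 'v::ab_group_add) tcat \<Rightarrow> ('o \<Rightarrow> 'o \<Rightarrow> 'v) \<Rightarrow> ('o, 'v, 'g, 'h) rep_functor \<Rightarrow>
   ('o, 'v, 'h) crossed_data \<Rightarrow> ('o, ('o, 'v, 'h) xarr) tcat" where
  "crossed_product0 C \<epsilon> F P =
     \<lparr> Ob = Ob C, Hom = xHom C F P, scl = xscl C, idt = (\<lambda>\<rho>. xemb C F \<rho> \<rho> (\<ii>\<dd>\<^bsub>C\<^esub> \<rho>)),
       cmp = xcmp C F P, str = xstr C F P, tun = \<iota>\<^bsub>C\<^esub>, tob = tob C, tar = xtar C \<epsilon> F P \<rparr>"

definition subobject_completion ::
  "('o, 'v) tcat \<Rightarrow> ('o \<times> 'v, 'v) tcat" where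
  "subobject_completion A =
     \<lparr> Ob = {(a, p). a \<in> Ob A \<and> proj_arrow A a p},
       Hom = (\<lambda>(a, p) (b, q). {q \<cdot>\<^bsub>A\<^esub> f \<cdot>\<^bsub>A\<^esub> p | f. f \<in> Hom A a b}),
       scl = scl A, idt = snd, cmp = cmp A, str = str A,
       tun = (\<iota>\<^bsub>A\<^esub>, \<ii>\<dd>\<^bsub>A\<^esub> \<iota>\<^bsub>A\<^esub>),
       tob = (\<lambda>(a, p) (b, q). (a \<odot>\<^bsub>A\<^esub> b, p \<boxtimes>\<^bsub>A\<^esub> q)), tar = tar A \<rparr>"

type_synonym ('o, 'v, 'h) xob = "'o \<times> ('o, 'v, 'h) xarr"

definition crossed_product ::
  "('o, 'v::ab_group_add) tcat \<Rightarrow> ('o \<Rightarrow> 'o \<Rightarrow> 'v) \<Rightarrow> ('o, 'v, 'g, 'h) rep_functor \<Rightarrow>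
   ('o, 'v, 'h) crossed_data \<Rightarrow> (('o, 'v, 'h) xob, ('o, 'v, 'h) xarr) tcat" where
  "crossed_product C \<epsilon> F P = subobject_completion (crossed_product0 C \<epsilon> F P)"

text \<open>The object \<open>(\<rho>, id)\<close> of the crossed product, identified with \<open>\<rho>\<close>.\<close>

definition xobj ::
  "('o, 'v::ab_group_add) tcat \<Rightarrow> ('o, 'v, 'g, 'h) rep_functor \<Rightarrow> 'o \<Rightarrow> ('o, 'v, 'h) xob" where
  "xobj C F \<rho> = (\<rho>, xemb C F \<rho> \<rho> (\<ii>\<dd>\<^bsub>C\<^esub> \<rho>))"

definition crossed_braiding ::
  "('o, 'v::ab_group_add) tcat \<Rightarrow> ('o \<Rightarrow> 'o \<Rightarrow> 'v) \<Rightarrow> ('o, 'v, 'g, 'h) rep_functor \<Rightarrow>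
   ('o, 'v, 'h) crossed_data \<Rightarrow> ('o, 'v, 'h) xob \<Rightarrow> ('o, 'v, 'h) xob \<Rightarrow> ('o, 'v, 'h) xarr" where
  "crossed_braiding C \<epsilon> F P = (\<lambda>(\<rho>, p) (\<sigma>, q). xcmp C F P
     (xcmp C F P (xtar C \<epsilon> F P q p) (xemb C F (\<rho> \<odot>\<^bsub>C\<^esub> \<sigma>) (\<sigma> \<odot>\<^bsub>C\<^esub> \<rho>) (\<epsilon> \<rho> \<sigma>)))
     (xtar C \<epsilon> F P p q))"


section \<open>Intermediate categories, automorphisms and fixed points\<close>

definition subcategory :: "('o, 'v) tcat \<Rightarrow> ('o, 'v) tcat \<Rightarrow> bool" where
  "subcategory E D \<longleftrightarrow> Ob E \<subseteq> Ob D \<and> (\<forall>X\<in>Ob E. \<forall>Y\<in>Ob E. Hom E X Y \<subseteq> Hom D X Y) \<and>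
     E = D\<lparr>Ob := Ob E, Hom := Hom E\<rparr>"

definition intermediate_category ::
  "('o, 'v::ab_group_add) tcat \<Rightarrow> ('o \<Rightarrow> 'o \<Rightarrow> 'v) \<Rightarrow> ('o, 'v, 'g, 'h) rep_functor \<Rightarrow>
   ('o, 'v, 'h) crossed_data \<Rightarrow> (('o, 'v, 'h) xob, ('o, 'v, 'h) xarr) tcat \<Rightarrow> bool" where
  "intermediate_category C \<epsilon> F P E \<longleftrightarrow> subcategory E (crossed_product C \<epsilon> F P) \<and>
     (\<forall>\<rho>\<in>Ob C. xobj C F \<rho> \<in> Ob E) \<and>
     (\<forall>\<rho>\<in>Ob C. \<forall>\<sigma>\<in>Ob C. \<forall>s\<in>Hom C \<rho> \<sigma>. xemb C F \<rho> \<sigma> s \<in> Hom E (xobj C F \<rho>) (xobj C F \<sigma>))"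

text \<open>
  An object \<open>(\<rho>, p)\<close> of the crossed product is the subobject of \<open>\<rho>\<close> defined by \<open>p\<close>, with
  \<open>p\<close> itself as isometry from \<open>(\<rho>, p)\<close> to \<open>\<rho>\<close>.  The first definition says that the objects of
  \<open>E\<close> are also in \<open>E\<close> subobjects in this way; the second that \<open>E\<close> contains these subobjects for all
  projections in \<open>E\<close>, not only isomorphic copies.
\<close>

definition inherits_subobjects ::
  "('o, 'v::ab_group_add) tcat \<Rightarrow> ('o, 'v, 'g, 'h) rep_functor \<Rightarrow>
   (('o, 'v, 'h) xob, ('o, 'v, 'h) xarr) tcat \<Rightarrow> bool" where
  "inherits_subobjects C F E \<longleftrightarrow> (\<forall>\<rho> p. (\<rho>, p) \<in> Ob E \<longrightarrow> p \<in> Hom E (\<rho>, p) (xobj C F \<rho>))"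

definition closed_under_subobjects :: "('o \<times> 'v, 'v) tcat \<Rightarrow> bool" where
  "closed_under_subobjects E \<longleftrightarrow>
     (\<forall>a q p. (a, q) \<in> Ob E \<and> proj_arrow E (a, q) p \<longrightarrow> (a, p) \<in> Ob E)"

definition tensor_star_automorphism ::
  "('o, 'v::ab_group_add) tcat \<Rightarrow> ('o \<Rightarrow> 'o) \<Rightarrow> ('o \<Rightarrow> 'o \<Rightarrow> 'v \<Rightarrow> 'v) \<Rightarrow> bool" where
  "tensor_star_automorphism D \<Phi> \<phi> \<longleftrightarrow>
     bij_betw \<Phi> (Ob D) (Ob D) \<and>
     (\<forall>X\<in>Ob D. \<forall>Y\<in>Ob D. bij_betw (\<phi> X Y) (Hom D X Y) (Hom D (\<Phi> X) (\<Phi> Y))) \<and>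
     (\<forall>X\<in>Ob D. \<forall>Y\<in>Ob D. \<forall>f\<in>Hom D X Y. \<forall>g\<in>Hom D X Y. \<phi> X Y (f + g) = \<phi> X Y f + \<phi> X Y g) \<and>
     (\<forall>X\<in>Ob D. \<forall>Y\<in>Ob D. \<forall>f\<in>Hom D X Y. \<forall>z. \<phi> X Y (scl D z f) = scl D z (\<phi> X Y f)) \<and>
     (\<forall>X\<in>Ob D. \<phi> X X (\<ii>\<dd>\<^bsub>D\<^esub> X) = \<ii>\<dd>\<^bsub>D\<^esub> (\<Phi> X)) \<and>
     (\<forall>X\<in>Ob D. \<forall>Y\<in>Ob D. \<forall>Z\<in>Ob D. \<forall>f\<in>Hom D X Y. \<forall>g\<in>Hom D Y Z.
        \<phi> X Z (g \<cdot>\<^bsub>D\<^esub> f) = \<phi> Y Z g \<cdot>\<^bsub>D\<^esub> \<phi> X Y f) \<and>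
     (\<forall>X\<in>Ob D. \<forall>Y\<in>Ob D. \<forall>f\<in>Hom D X Y. \<phi> Y X (f\<^sup>\<star>\<^bsub>D\<^esub>) = (\<phi> X Y f)\<^sup>\<star>\<^bsub>D\<^esub>) \<and>
     \<Phi> \<iota>\<^bsub>D\<^esub> = \<iota>\<^bsub>D\<^esub> \<and>
     (\<forall>X\<in>Ob D. \<forall>Y\<in>Ob D. \<Phi> (X \<odot>\<^bsub>D\<^esub> Y) = \<Phi> X \<odot>\<^bsub>D\<^esub> \<Phi> Y) \<and>
     (\<forall>X\<in>Ob D. \<forall>Y\<in>Ob D. \<forall>Z\<in>Ob D. \<forall>W\<in>Ob D. \<forall>f\<in>Hom D X Y. \<forall>g\<in>Hom D Z W.
        \<phi> (X \<odot>\<^bsub>D\<^esub> Z) (Y \<odot>\<^bsub>D\<^esub> W) (f \<boxtimes>\<^bsub>D\<^esub> g) = \<phi> X Y f \<boxtimes>\<^bsub>D\<^esub> \<phi> Z W g)"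

definition preserves_braiding ::
  "('o, 'v) tcat \<Rightarrow> ('o \<Rightarrow> 'o \<Rightarrow> 'v) \<Rightarrow> ('o \<Rightarrow> 'o) \<Rightarrow> ('o \<Rightarrow> 'o \<Rightarrow> 'v \<Rightarrow> 'v) \<Rightarrow> bool" where
  "preserves_braiding D \<epsilon> \<Phi> \<phi> \<longleftrightarrow>
     (\<forall>X\<in>Ob D. \<forall>Y\<in>Ob D. \<phi> (X \<odot>\<^bsub>D\<^esub> Y) (Y \<odot>\<^bsub>D\<^esub> X) (\<epsilon> X Y) = \<epsilon> (\<Phi> X) (\<Phi> Y))"

text \<open>Automorphisms of the crossed product acting identically on the subcategory \<open>B\<close>.\<close>

definition Aut_over ::
  "('o, 'v::ab_group_add) tcat \<Rightarrow> ('o \<Rightarrow> 'o \<Rightarrow> 'v) \<Rightarrow> 'o set \<Rightarrow> ('o, 'v, 'g, 'h) rep_functor \<Rightarrow>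
   ('o, 'v, 'h) crossed_data \<Rightarrow> (('o, 'v, 'h) xob, ('o, 'v, 'h) xarr) tcat \<Rightarrow>
   ((('o, 'v, 'h) xob \<Rightarrow> ('o, 'v, 'h) xob) \<times>
    (('o, 'v, 'h) xob \<Rightarrow> ('o, 'v, 'h) xob \<Rightarrow> ('o, 'v, 'h) xarr \<Rightarrow> ('o, 'v, 'h) xarr)) set" where
  "Aut_over C \<epsilon> S F P B =
     {(\<Phi>, \<phi>). tensor_star_automorphism (crossed_product C \<epsilon> F P) \<Phi> \<phi> \<and>
        (S \<subseteq> degenerate_objects C \<epsilon> \<longrightarrow>
           preserves_braiding (crossed_product C \<epsilon> F P) (crossed_braiding C \<epsilon> F P) \<Phi> \<phi>) \<and>
        (\<forall>X\<in>Ob B. \<Phi> X = X) \<and>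
        (\<forall>X\<in>Ob B. \<forall>Y\<in>Ob B. \<forall>f\<in>Hom B X Y. \<phi> X Y f = f)}"

text \<open>The action \<open>\<alpha>\<close> of \<open>G\<close> on arrows and on objects.\<close>

definition act_arr ::
  "('o, 'v::ab_group_add) tcat \<Rightarrow> ('o, 'v, 'g, 'h) rep_functor \<Rightarrow> ('o, 'v, 'h) crossed_data \<Rightarrow>
   'g \<Rightarrow> ('o, 'v, 'h) xarr \<Rightarrow> ('o, 'v, 'h) xarr" where
  "act_arr C F P g x = xsum P (\<lambda>\<rho> \<sigma> k s \<psi>. stensor C F \<rho> \<sigma> k s (frep F k g \<psi>)) x"

definition act_ob ::
  "('o, 'v::ab_group_add) tcat \<Rightarrow> ('o, 'v, 'g, 'h) rep_functor \<Rightarrow> ('o, 'v, 'h) crossed_data \<Rightarrow>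
   'g \<Rightarrow> ('o, 'v, 'h) xob \<Rightarrow> ('o, 'v, 'h) xob" where
  "act_ob C F P g = (\<lambda>(\<rho>, p). (\<rho>, act_arr C F P g p))"

text \<open>\<open>Aut_over\<close> as a subset of \<open>G\<close>, by means of \<open>\<alpha>\<close>.\<close>

definition Gal_over ::
  "('o, 'v::ab_group_add) tcat \<Rightarrow> ('o \<Rightarrow> 'o \<Rightarrow> 'v) \<Rightarrow> 'o set \<Rightarrow> 'g monoid \<Rightarrow>
   ('o, 'v, 'g, 'h) rep_functor \<Rightarrow> ('o, 'v, 'h) crossed_data \<Rightarrow>
   (('o, 'v, 'h) xob, ('o, 'v, 'h) xarr) tcat \<Rightarrow> 'g set" where
  "Gal_over C \<epsilon> S G F P B =
     {g \<in> carrier G. (act_ob C F P g, \<lambda>X Y. act_arr C F P g) \<in> Aut_over C \<epsilon> S F P B}"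

definition fixed_category ::
  "('o, 'v::ab_group_add) tcat \<Rightarrow> ('o \<Rightarrow> 'o \<Rightarrow> 'v) \<Rightarrow> ('o, 'v, 'g, 'h) rep_functor \<Rightarrow>
   ('o, 'v, 'h) crossed_data \<Rightarrow> 'g set \<Rightarrow> (('o, 'v, 'h) xob, ('o, 'v, 'h) xarr) tcat" where
  "fixed_category C \<epsilon> F P H = (crossed_product C \<epsilon> F P)
     \<lparr> Ob := {X \<in> Ob (crossed_product C \<epsilon> F P). \<forall>g\<in>H. act_ob C F P g X = X},
       Hom := (\<lambda>X Y. {f \<in> Hom (crossed_product C \<epsilon> F P) X Y. \<forall>g\<in>H. act_arr C F P g f = f}) \<rparr>"

text \<open>
  Equality of subcategories up to isomorphism of objects: \<open>E\<close> is a full subcategory of \<open>B\<close>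
  that meets every unitary equivalence class of objects of \<open>B\<close>.
\<close>

definition equal_up_to_iso :: "('o, 'v) tcat \<Rightarrow> ('o, 'v) tcat \<Rightarrow> bool" where
  "equal_up_to_iso E B \<longleftrightarrow> Ob E \<subseteq> Ob B \<and>
     (\<forall>X\<in>Ob E. \<forall>Y\<in>Ob E. Hom E X Y = Hom B X Y) \<and>
     (\<forall>X\<in>Ob B. \<exists>Y\<in>Ob E. \<exists>u. unitary_arrow B X Y u)"

definition equal_categories :: "('o, 'v) tcat \<Rightarrow> ('o, 'v) tcat \<Rightarrow> bool" where
  "equal_categories E B \<longleftrightarrow> Ob E = Ob B \<and> (\<forall>X\<in>Ob E. \<forall>Y\<in>Ob E. Hom E X Y = Hom B X Y)"

end

theory Submission
  imports Defs "HOL-Computational_Algebra.Fundamental_Theorem_Algebra"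
begin

text \<open>
  The theorem is a Galois correspondence for the action of \<open>G\<close> on the crossed product.  It rests on
  a description of \<open>E\<close> by spaces of vectors and on a form of Tannaka duality for homogeneous spaces
  of the compact group \<open>G\<close>.

  Every arrow of the crossed product is a finite sum of simple tensors \<open>s \<otimes> \<psi>\<close>, and \<open>s \<otimes> \<psi>\<close> is
  composed of arrows of \<open>C\<close> and of the arrow \<open>id \<otimes> \<psi>\<close> from the unit to an object \<open>a\<close> of \<open>S\<close>.
  Let \<open>V a\<close> be the space of the vectors \<open>\<psi>\<close> of \<open>F(a)\<close> for which \<open>id \<otimes> \<psi>\<close> lies in \<open>E\<close>
  (\<open>vectors_in\<close>).  An arrow whose components involve only vectors of \<open>V\<close> therefore lies in \<open>E\<close>.  The
  converse is Frobenius reciprocity: a conjugate \<open>\<rho>'\<close> of \<open>\<rho>\<close> turns an arrow from \<open>\<rho>\<close> to \<open>\<sigma>\<close> into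
  one from the unit to \<open>\<sigma> \<odot> \<rho>'\<close>, and composition with adjoints of arrows \<open>k \<rightarrow> \<sigma> \<odot> \<rho>'\<close> of \<open>C\<close>, for
  \<open>k\<close> irreducible in \<open>S\<close>, isolates arrows of the form \<open>id \<otimes> \<psi>\<close> with \<open>\<psi>\<close> in \<open>F(k)\<close>
  (\<open>probe\<close>, \<open>supported_onI\<close>).  The same reasoning applies to invariant arrows, whose probes have
  invariant vectors.  So \<open>H\<close> is the group of all \<open>g\<close> that fix the vectors of \<open>V\<close>, and what remains
  to be proved is that \<open>V k\<close> contains every vector of \<open>F(k)\<close> fixed by \<open>H\<close> (\<open>stabilizer_fixed\<close>).

  The spaces \<open>V a\<close> are stable under arrows of \<open>S\<close>, tensor products and conjugation of vectors, and
  contain the vacuum, because \<open>E\<close> is closed under the corresponding operations.  Hence the matrix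
  coefficients \<open>\<langle>\<phi>, \<pi>(g) \<psi>\<rangle>\<close> with \<open>\<psi>\<close> in \<open>V a\<close> form a self-adjoint algebra of continuous functions
  on \<open>G\<close>, and two elements of \<open>G\<close> that it does not separate lie in one left coset of \<open>H\<close>.  By the
  Stone--Weierstrass theorem this algebra is uniformly dense in the continuous functions that are
  constant on these cosets.  Suppose that \<open>\<psi>\<close> in \<open>F(k)\<close> is fixed by \<open>H\<close> and orthogonal to \<open>V k\<close>.
  Its coefficients are functions of this kind, but they are orthogonal in the mean to the algebra:
  the complex conjugate of one of them, multiplied by an element of the algebra, is a coefficient
  of a vector that is orthogonal to all invariant vectors (\<open>null_product\<close>).  Approximation of the
  coefficients by the algebra turns the constant sum of their squared absolute values, which is
  the squared norm of \<open>\<psi>\<close>, into such a function of mean zero; therefore \<open>\<psi> = 0\<close>.  Of invariant integration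
  only one consequence enters, and it has an elementary proof: the real part of a function of mean
  zero of this kind has no positive lower bound (\<open>coefficient_not_bounded_below\<close>).

  The operations of the crossed product are defined by means of bases and of irreducible
  representatives.  To calculate with them, simple tensors are extended to arbitrary objects \<open>a\<close> of
  \<open>S\<close> in such a way that \<open>(u \<cdot> (s \<boxtimes> id)) \<otimes> \<psi> = u \<otimes> F(s) \<psi>\<close> (\<open>cten\<close>, \<open>cten_slide\<close>).  The formulas
  for composition and tensor product of these arrows contain neither bases nor sums
  (\<open>bisum_cten\<close>).

  As for objects, a fixed object \<open>(\<rho>, p)\<close> is given by a projection \<open>p\<close> that lies in \<open>E\<close>, and the
  subobject of \<open>\<rho>\<close> that \<open>p\<close> has in \<open>E\<close> is unitarily equivalent to it.  Finally, \<open>H\<close> is closed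
  because it is defined by equations between continuous matrix coefficients.
\<close>


section \<open>Finite dimensional Hilbert spaces inside a vector space\<close>

locale fd_hilbert = vector_space sc for sc :: "complex \<Rightarrow> 'h \<Rightarrow> 'h::ab_group_add" +
  fixes K :: "'h set" and ip :: "'h \<Rightarrow> 'h \<Rightarrow> complex"
  assumes hilbert: "fd_hilbert_space sc K ip"
begin

lemma subspace_K: "subspace K"
  and finite_span: "\<exists>D. finite D \<and> span D = K"
  and hilbert_axioms':
    "\<forall>x\<in>K. \<forall>y\<in>K. \<forall>y'\<in>K. ip x (y + y') = ip x y + ip x y'"
    "\<forall>x\<in>K. \<forall>y\<in>K. \<forall>z. ip x (sc z y) = z * ip x y"
    "\<forall>x\<in>K. \<forall>y\<in>K. ip y x = cnj (ip x y)"
    "\<forall>x\<in>K. x \<noteq> 0 \<longrightarrow> Re (ip x x) > 0"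
  by (rule hilbert[unfolded fd_hilbert_space_def, THEN conjunct1]
      hilbert[unfolded fd_hilbert_space_def, THEN conjunct2, THEN conjunct1]
      hilbert[unfolded fd_hilbert_space_def, THEN conjunct2, THEN conjunct2, THEN conjunct1]
      hilbert[unfolded fd_hilbert_space_def, THEN conjunct2, THEN conjunct2, THEN conjunct2, THEN conjunct1]
      hilbert[unfolded fd_hilbert_space_def, THEN conjunct2, THEN conjunct2, THEN conjunct2, THEN conjunct2, THEN conjunct1]
      hilbert[unfolded fd_hilbert_space_def, THEN conjunct2, THEN conjunct2, THEN conjunct2, THEN conjunct2, THEN conjunct2])+

lemma ip_add_right: "\<lbrakk>x \<in> K; y \<in> K; y' \<in> K\<rbrakk> \<Longrightarrow> ip x (y + y') = ip x y + ip x y'"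
  by (rule hilbert_axioms'(1)[rule_format])

lemma ip_scale_right: "\<lbrakk>x \<in> K; y \<in> K\<rbrakk> \<Longrightarrow> ip x (sc z y) = z * ip x y"
  by (rule hilbert_axioms'(2)[rule_format])

lemma ip_commute: "\<lbrakk>x \<in> K; y \<in> K\<rbrakk> \<Longrightarrow> ip y x = cnj (ip x y)"
  by (rule hilbert_axioms'(3)[rule_format])

lemma ip_pos: "\<lbrakk>x \<in> K; x \<noteq> 0\<rbrakk> \<Longrightarrow> Re (ip x x) > 0"
  by (rule hilbert_axioms'(4)[rule_format])

lemma add_K: "\<lbrakk>x \<in> K; y \<in> K\<rbrakk> \<Longrightarrow> x + y \<in> K"
  and diff_K: "\<lbrakk>x \<in> K; y \<in> K\<rbrakk> \<Longrightarrow> x - y \<in> K"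
  and scale_K: "x \<in> K \<Longrightarrow> sc z x \<in> K"
  and zero_K: "0 \<in> K"
  and sum_K: "(\<And>i. i \<in> I \<Longrightarrow> f i \<in> K) \<Longrightarrow> sum f I \<in> K"
  using subspace_K
  by (auto intro: subspace_add subspace_diff subspace_scale subspace_0 subspace_sum)

lemma ip_zero_right: "x \<in> K \<Longrightarrow> ip x 0 = 0"
  using ip_scale_right[of x 0 0] zero_K by simp

lemma ip_add_left: "\<lbrakk>x \<in> K; x' \<in> K; y \<in> K\<rbrakk> \<Longrightarrow> ip (x + x') y = ip x y + ip x' y"
  using ip_commute[of y "x + x'"] ip_commute[of y x] ip_commute[of y x'] ip_add_right[of y x x'] add_K
  by simp

lemma ip_scale_left: "\<lbrakk>x \<in> K; y \<in> K\<rbrakk> \<Longrightarrow> ip (sc z x) y = cnj z * ip x y"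
  using ip_commute[of y "sc z x"] ip_commute[of y x] ip_scale_right[of y x z] scale_K by simp

lemma ip_zero_left: "x \<in> K \<Longrightarrow> ip 0 x = 0"
  using ip_scale_left[of 0 x 0] zero_K by simp

lemma ip_diff_right: "\<lbrakk>x \<in> K; y \<in> K; y' \<in> K\<rbrakk> \<Longrightarrow> ip x (y - y') = ip x y - ip x y'"
  using ip_add_right[of x "y - y'" y'] diff_K by simp

lemma ip_diff_left: "\<lbrakk>x \<in> K; x' \<in> K; y \<in> K\<rbrakk> \<Longrightarrow> ip (x - x') y = ip x y - ip x' y"
  using ip_add_left[of "x - x'" x' y] diff_K by simp

lemma ip_sum_right: "\<lbrakk>x \<in> K; \<And>i. i \<in> I \<Longrightarrow> f i \<in> K\<rbrakk> \<Longrightarrow> ip x (sum f I) = (\<Sum>i\<in>I. ip x (f i))"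
proof (induction I rule: infinite_finite_induct)
  case (insert i I)
  then show ?case using sum_K[of I f] by (simp add: ip_add_right)
qed (auto simp: ip_zero_right)

lemma ip_sum_left: "\<lbrakk>x \<in> K; \<And>i. i \<in> I \<Longrightarrow> f i \<in> K\<rbrakk> \<Longrightarrow> ip (sum f I) x = (\<Sum>i\<in>I. ip (f i) x)"
proof (induction I rule: infinite_finite_induct)
  case (insert i I)
  then show ?case using sum_K[of I f] by (simp add: ip_add_left)
qed (auto simp: ip_zero_left)

lemma ip_self_eq_0: "x \<in> K \<Longrightarrow> ip x x = 0 \<Longrightarrow> x = 0"
  using ip_pos by fastforce

lemma ip_self_real: "x \<in> K \<Longrightarrow> ip x x = of_real (Re (ip x x))"
  using ip_commute[of x x] by (simp add: complex_eq_iff)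

lemma ip_self_nonneg: "x \<in> K \<Longrightarrow> 0 \<le> Re (ip x x)"
  using ip_pos[of x] ip_zero_right[OF zero_K] by (cases "x = 0") auto

lemma ip_ext:
  assumes "x \<in> K" "y \<in> K" "\<And>z. z \<in> K \<Longrightarrow> ip z x = ip z y"
  shows "x = y"
  using ip_self_eq_0[of "x - y"] assms diff_K by (simp add: ip_diff_right)

definition orthonormal :: "'h set \<Rightarrow> bool" where
  "orthonormal B \<longleftrightarrow> (\<forall>x\<in>B. \<forall>y\<in>B. ip x y = (if x = y then 1 else 0))"

lemma ip_orthonormal_sum:
  assumes "orthonormal B" "finite B" "B \<subseteq> K" "e \<in> B"
  shows "ip e (\<Sum>f\<in>B. sc (a f) f) = a e"
proof -
  have "ip e (\<Sum>f\<in>B. sc (a f) f) = (\<Sum>f\<in>B. a f * ip e f)"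
    using assms by (subst ip_sum_right) (auto simp: scale_K ip_scale_right subset_eq intro!: sum.cong)
  also have "\<dots> = (\<Sum>f\<in>B. if f = e then a e else 0)"
    using assms unfolding orthonormal_def by (intro sum.cong) auto
  finally show ?thesis using assms by simp
qed

lemma independent_orthonormal:
  assumes "orthonormal B" "finite B" "B \<subseteq> K"
  shows "independent B"
proof (rule independent_if_scalars_zero[OF assms(2)])
  fix f x assume "(\<Sum>x\<in>B. sc (f x) x) = 0" "x \<in> B"
  then show "f x = 0"
    using ip_orthonormal_sum[OF assms, of x f] assms(3) ip_zero_right[of x] by auto
qed

lemma orthonormal_expansion:
  assumes "orthonormal B" "finite B" "B \<subseteq> K" "x \<in> span B"
  shows "x = (\<Sum>e\<in>B. sc (ip e x) e)"
proof -
  obtain a where a: "x = (\<Sum>f\<in>B. sc (a f) f)"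
    using assms(2,4) by (auto simp: span_finite)
  show ?thesis
    using ip_orthonormal_sum[OF assms(1-3), of _ a] unfolding a by simp
qed

lemma orthonormal_residual:
  assumes "orthonormal B" "finite B" "B \<subseteq> K" "x \<in> K" "z \<in> span B"
  shows "ip z (x - (\<Sum>e\<in>B. sc (ip e x) e)) = 0"
proof -
  let ?r = "x - (\<Sum>e\<in>B. sc (ip e x) e)"
  have r: "?r \<in> K" using assms by (auto intro!: diff_K sum_K scale_K)
  have zero: "ip e ?r = 0" if "e \<in> B" for e
    using that assms ip_orthonormal_sum[OF assms(1-3) that, of "\<lambda>e. ip e x"]
    by (subst ip_diff_right) (auto intro!: sum_K scale_K)
  obtain a where a: "z = (\<Sum>f\<in>B. sc (a f) f)"
    using assms(2,5) by (auto simp: span_finite)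
  have "ip z ?r = (\<Sum>f\<in>B. ip (sc (a f) f) ?r)"
    unfolding a using assms(3) r by (intro ip_sum_left) (auto intro!: scale_K)
  also have "\<dots> = (\<Sum>f\<in>B. 0)"
    using assms(3) r zero by (intro sum.cong) (auto simp: ip_scale_left)
  finally show ?thesis by simp
qed

lemma finite_span_K: obtains D where "finite D" "span D = K"
  using finite_span by blast

text \<open>
  An orthonormal subset of largest cardinality spans: otherwise the normalized residual of a
  vector outside its span could be added to it.
\<close>

lemma ex_orthonormal_basis:
  assumes "subspace W" "W \<subseteq> K"
  obtains B where "finite B" "B \<subseteq> W" "orthonormal B" "span B = W"
proof -
  obtain D where D: "finite D" "span D = K" by (rule finite_span_K)
  let ?Q = "\<lambda>B. finite B \<and> B \<subseteq> W \<and> orthonormal B"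
  have bound: "card B \<le> card D" if "?Q B" for B
    using independent_span_bound[OF D(1) independent_orthonormal[of B]] that D(2) assms(2) by auto
  have "?Q {}" by (simp add: orthonormal_def)
  moreover have "\<forall>B. ?Q B \<longrightarrow> card B \<le> card D" using bound by blast
  ultimately have "\<exists>B. ?Q B \<and> (\<forall>B'. ?Q B' \<longrightarrow> card B' \<le> card B)"
    using ex_has_greatest_nat[of ?Q "{}" card "Suc (card D)"] le_imp_less_Suc by blast
  then obtain B where B: "?Q B" and max: "\<And>B'. ?Q B' \<Longrightarrow> card B' \<le> card B"
    by blast
  have BK: "B \<subseteq> K" using B assms(2) by auto
  have "span B = W"
  proof (rule ccontr)
    assume "span B \<noteq> W"
    moreover have "span B \<subseteq> W" using B assms(1) span_minimal by blast
    ultimately obtain x where x: "x \<in> W" "x \<notin> span B" by blast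
    define y where "y = x - (\<Sum>e\<in>B. sc (ip e x) e)"
    have yW: "y \<in> W" unfolding y_def
      using B x(1) assms(1) by (auto intro!: subspace_diff subspace_sum subspace_scale)
    have yK: "y \<in> K" using yW assms(2) by auto
    have y0: "y \<noteq> 0"
      using x(2) span_sum[of B "\<lambda>e. sc (ip e x) e" B] by (auto simp: y_def span_scale span_base)
    define n where "n = Re (ip y y)"
    have n: "n > 0" "ip y y = of_real n"
      using ip_pos[OF yK y0] ip_self_real[OF yK] by (simp_all add: n_def)
    define u where "u = sc (of_real (1 / sqrt n)) y"
    have uW: "u \<in> W" unfolding u_def using yW assms(1) subspace_scale by blast
    have uK: "u \<in> K" using uW assms(2) by auto
    have s: "(of_real (sqrt n) * of_real (sqrt n) :: complex) = of_real n"
      using n(1) by (metis abs_of_pos of_real_mult real_sqrt_mult_self)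
    have uu: "ip u u = 1"
      using n yK s by (simp add: u_def ip_scale_left ip_scale_right scale_K field_simps)
    have ey: "ip e u = 0" if "e \<in> B" for e
    proof -
      have "ip e y = 0"
        unfolding y_def using B BK that x(1) assms(2)
        by (intro orthonormal_residual) (auto intro: span_base)
      then show ?thesis using that BK yK by (simp add: u_def ip_scale_right subset_eq)
    qed
    have ye: "ip u e = 0" if "e \<in> B" for e
      using ip_commute[of e u] ey[OF that] that BK uK by auto
    have "u \<notin> B" using ey[of u] uu by auto
    moreover have "?Q (insert u B)"
      using B uW uu ey ye by (auto simp: orthonormal_def)
    ultimately show False using max[of "insert u B"] B by simp
  qed
  then show ?thesis using B that by blast
qed

lemma ex_orthogonal_projection:
  assumes "subspace W" "W \<subseteq> K" "x \<in> K"
  obtains p where "p \<in> W" "\<And>z. z \<in> W \<Longrightarrow> ip z (x - p) = 0"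
proof -
  obtain B where B: "finite B" "B \<subseteq> W" "orthonormal B" "span B = W"
    by (rule ex_orthonormal_basis[OF assms(1,2)])
  show ?thesis
  proof
    show "(\<Sum>e\<in>B. sc (ip e x) e) \<in> W"
      using B assms(1) by (auto intro!: subspace_sum subspace_scale)
    show "ip z (x - (\<Sum>e\<in>B. sc (ip e x) e)) = 0" if "z \<in> W" for z
      using that B assms by (intro orthonormal_residual) auto
  qed
qed

lemma riesz:
  assumes add: "\<And>x y. \<lbrakk>x \<in> K; y \<in> K\<rbrakk> \<Longrightarrow> f (x + y) = f x + f y"
    and scale: "\<And>x z. x \<in> K \<Longrightarrow> f (sc z x) = cnj z * f x"
  obtains y where "y \<in> K" "\<And>x. x \<in> K \<Longrightarrow> ip x y = f x"
proof -
  obtain B where B: "finite B" "B \<subseteq> K" "orthonormal B" "span B = K"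
    by (rule ex_orthonormal_basis[OF subspace_K order_refl])
  have f0: "f 0 = 0" using scale[of 0 0] zero_K by simp
  have fsum: "(\<And>i. i \<in> I \<Longrightarrow> g i \<in> K) \<Longrightarrow> f (sum g I) = (\<Sum>i\<in>I. f (g i))" for I and g :: "'h \<Rightarrow> 'h"
  proof (induction I rule: infinite_finite_induct)
    case (insert i I)
    then show ?case using sum_K[of I g] by (simp add: add)
  qed (auto simp: f0)
  define y where "y = (\<Sum>e\<in>B. sc (f e) e)"
  have BK: "e \<in> K" if "e \<in> B" for e using that B(2) by blast
  have y: "y \<in> K" unfolding y_def by (intro sum_K scale_K BK)
  have "ip x y = f x" if x: "x \<in> K" for x
  proof -
    have "x = (\<Sum>e\<in>B. sc (ip e x) e)" using orthonormal_expansion[of B x] B x by auto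
    then have "f x = f (\<Sum>e\<in>B. sc (ip e x) e)" by simp
    also have "\<dots> = (\<Sum>e\<in>B. cnj (ip e x) * f e)"
      by (subst fsum) (auto simp: scale_K scale BK intro!: sum.cong)
    also have "\<dots> = (\<Sum>e\<in>B. f e * ip x e)"
      using x ip_commute[OF BK x] by (intro sum.cong) auto
    also have "\<dots> = ip x y"
      unfolding y_def using x
      by (subst ip_sum_right) (auto simp: scale_K ip_scale_right BK intro!: sum.cong)
    finally show ?thesis by simp
  qed
  then show ?thesis using that y by blast
qed

lemma parseval:
  assumes "orthonormal B" "finite B" "B \<subseteq> K" "x \<in> span B" "y \<in> K"
  shows "ip x y = (\<Sum>e\<in>B. cnj (ip e x) * ip e y)"
proof -
  have "ip x y = ip (\<Sum>e\<in>B. sc (ip e x) e) y"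
    using orthonormal_expansion[OF assms(1-4)] by simp
  also have "\<dots> = (\<Sum>e\<in>B. cnj (ip e x) * ip e y)"
    using assms(3,5) by (subst ip_sum_left) (auto simp: scale_K ip_scale_left subset_eq intro!: sum.cong)
  finally show ?thesis .
qed

lemma cauchy_schwarz:
  assumes "x \<in> K" "y \<in> K"
  shows "(cmod (ip x y))\<^sup>2 \<le> Re (ip x x) * Re (ip y y)"
proof (cases "x = 0")
  case True
  then show ?thesis using assms by (simp add: ip_zero_left)
next
  case False
  define n where "n = Re (ip x x)"
  have n: "n > 0" "ip x x = of_real n"
    using ip_pos[OF assms(1) False] ip_self_real[OF assms(1)] by (simp_all add: n_def)
  define a where "a = ip x y"
  have yx: "ip y x = cnj a" using ip_commute[OF assms] by (simp add: a_def)
  define r where "r = y - sc (a / of_real n) x"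
  have r: "r \<in> K" unfolding r_def using assms by (intro diff_K scale_K)
  have "ip r r = ip y y - a * cnj a / of_real n"
    using assms n(1) unfolding r_def
    by (simp add: ip_diff_left ip_diff_right ip_scale_left ip_scale_right scale_K diff_K n yx
        a_def[symmetric] field_simps)
  also have "a * cnj a / of_real n = of_real ((cmod a)\<^sup>2 / n)"
    by (simp add: complex_norm_square[symmetric])
  finally have "Re (ip r r) = Re (ip y y) - (cmod a)\<^sup>2 / n"
    by (simp only: minus_complex.sel Re_complex_of_real)
  then show ?thesis
    using mult_nonneg_nonneg[OF less_imp_le[OF n(1)] ip_self_nonneg[OF r]] n(1)
    by (simp add: a_def[symmetric] n_def[symmetric] field_simps)
qed

end


section \<open>Uniform approximation on a compact space\<close>

text \<open>
  A copy of the type of complex valued functions, with the topology of pointwise convergence as a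
  Hausdorff space.  On the function type itself the class of Hausdorff spaces is reserved for
  functions on countable types, since it is implied there by metrizability.
\<close>

typedef 'i pointwise = "UNIV :: ('i \<Rightarrow> complex) set"
  morphisms value_at Pointwise ..

instantiation pointwise :: (type) t2_space
begin

definition open_pointwise :: "'a pointwise set \<Rightarrow> bool" where
  "open_pointwise U \<longleftrightarrow> open (Pointwise -` U)"

instance
proof
  show "open (UNIV :: 'a pointwise set)" by (simp add: open_pointwise_def)
  show "open (U \<inter> V)" if "open U" "open V" for U V :: "'a pointwise set"
    using that by (simp add: open_pointwise_def open_Int)
  show "open (\<Union> \<U>)" if "\<forall>U\<in>\<U>. open U" for \<U> :: "'a pointwise set set"
    using that by (auto simp: open_pointwise_def vimage_Union intro!: open_UN)
  fix x y :: "'a pointwise"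
  assume "x \<noteq> y"
  then have "value_at x \<noteq> value_at y" by (simp add: value_at_inject)
  then obtain i where i: "value_at x i \<noteq> value_at y i" by (meson ext)
  obtain U V where UV: "open U" "open V" "value_at x i \<in> U" "value_at y i \<in> V" "U \<inter> V = {}"
    using hausdorff[OF i] by (elim exE conjE) (rule that)
  let ?U = "{z. value_at z i \<in> U}" and ?V = "{z. value_at z i \<in> V}"
  have "Pointwise -` {z. value_at z i \<in> W} = (\<lambda>f. f i) -` W" for W
    by (auto simp: Pointwise_inverse)
  then have "open ?U" "open ?V"
    using UV(1,2) continuous_on_product_coordinates[of i]
    by (auto simp: open_pointwise_def intro!: open_vimage)
  then show "\<exists>U V. open U \<and> open V \<and> x \<in> U \<and> y \<in> V \<and> U \<inter> V = {}"
    using UV(3-5) by (intro exI[of _ ?U] exI[of _ ?V]) auto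
qed

end

lemma continuous_on_Pointwise: "continuous_on S Pointwise"
  using continuous_on_open_vimage[of UNIV Pointwise]
  by (auto simp: open_pointwise_def intro: continuous_on_subset)

lemma continuous_on_value_at: "continuous_on S (\<lambda>z. value_at z i)"
proof -
  have "Pointwise -` ((\<lambda>z. value_at z i) -` W) = (\<lambda>f. f i) -` W" for W
    by (auto simp: Pointwise_inverse)
  then have "continuous_on UNIV (\<lambda>z. value_at z i)"
    by (auto simp: continuous_on_open_vimage open_pointwise_def
        intro!: open_vimage[OF _ continuous_on_product_coordinates])
  then show ?thesis by (rule continuous_on_subset) simp
qed

text \<open>
  The functions of \<open>A\<close> may identify points of the space \<open>T\<close>.  Evaluation at these functions maps
  \<open>T\<close> onto a compact set \<open>X\<close> in a product of copies of the complex plane, where they separate points.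
  The function \<open>f\<close> factors through this map, and the factor is continuous on \<open>X\<close> by compactness.
\<close>

lemma complex_Stone_Weierstrass:
  fixes A :: "('g \<Rightarrow> complex) set"
  assumes T: "compact_space T"
    and cont: "\<And>a. a \<in> A \<Longrightarrow> continuous_map T euclidean a"
    and A_const: "\<And>c. (\<lambda>_. c) \<in> A"
    and A_add: "\<And>a b. \<lbrakk>a \<in> A; b \<in> A\<rbrakk> \<Longrightarrow> (\<lambda>g. a g + b g) \<in> A"
    and A_mult: "\<And>a b. \<lbrakk>a \<in> A; b \<in> A\<rbrakk> \<Longrightarrow> (\<lambda>g. a g * b g) \<in> A"
    and A_cnj: "\<And>a. a \<in> A \<Longrightarrow> (\<lambda>g. cnj (a g)) \<in> A"
    and f: "continuous_map T euclidean f"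
    and separated: "\<And>g h. \<lbrakk>g \<in> topspace T; h \<in> topspace T; \<And>a. a \<in> A \<Longrightarrow> a g = a h\<rbrakk> \<Longrightarrow> f g = f h"
    and "\<delta> > 0"
  shows "\<exists>a\<in>A. \<forall>g\<in>topspace T. cmod (f g - a g) < \<delta>"
proof -
  \<comment> \<open>The coordinates outside \<open>A\<close> are constant, hence do not separate points of \<open>X\<close>.\<close>
  define Y0 where "Y0 g = (\<lambda>a. if a \<in> A then a g else 0)" for g
  define Y where "Y g = Pointwise (Y0 g)" for g
  have valY: "value_at (Y g) = (\<lambda>a. if a \<in> A then a g else 0)" for g
    by (simp add: Y_def Y0_def Pointwise_inverse)
  define X where "X = Y ` topspace T"
  have "continuous_map T euclidean Y0"
    unfolding euclidean_product_topology[symmetric] continuous_map_componentwise_UNIV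
  proof
    fix a show "continuous_map T euclidean (\<lambda>g. Y0 g a)"
      by (cases "a \<in> A") (simp_all add: Y0_def cont)
  qed
  then have contY: "continuous_map T euclidean Y"
    using continuous_map_compose[of T euclidean Y0 euclidean Pointwise] continuous_on_Pointwise[of UNIV]
    by (simp add: Y_def[abs_def] comp_def)
  have compact_image: "compact (Y ` D)" if "closedin T D" for D
    using image_compactin[OF closedin_compact_space[OF T that] contY] by simp
  have compactX: "compact X" unfolding X_def by (rule compact_image) simp
  define R where "R = {r. continuous_on X r \<and> (\<exists>a\<in>A. \<forall>g\<in>topspace T. a g = complex_of_real (r (Y g)))}"
  have coord: "(\<lambda>z. Re (c * value_at z a)) \<in> R" if a: "a \<in> A" for a c
  proof -
    have "(\<lambda>g. (1/2) * ((c * a g) + cnj (c * a g))) \<in> A"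
      by (intro A_mult A_add A_cnj A_const a)
    moreover have "(1/2) * ((c * a g) + cnj (c * a g)) = of_real (Re (c * value_at (Y g) a))" for g
      using a by (simp add: valY complex_eq_iff)
    moreover have "continuous_on X (\<lambda>z. Re (c * value_at z a))"
      by (intro continuous_intros continuous_on_value_at)
    ultimately show ?thesis unfolding R_def by (intro CollectI conjI bexI ballI)
  qed
  interpret function_ring_on R X
  proof
    show "continuous_on X r" if "r \<in> R" for r using that by (simp add: R_def)
    show "(\<lambda>x. r x + s x) \<in> R" if rs: "r \<in> R" "s \<in> R" for r s
    proof -
      obtain a b where "a \<in> A" "\<forall>g\<in>topspace T. a g = of_real (r (Y g))"
        "b \<in> A" "\<forall>g\<in>topspace T. b g = of_real (s (Y g))"
        using rs by (auto simp: R_def)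
      then show ?thesis using rs A_add[of a b]
        by (auto simp: R_def intro!: continuous_on_add bexI[of _ "\<lambda>g. a g + b g"])
    qed
    show "(\<lambda>x. r x * s x) \<in> R" if rs: "r \<in> R" "s \<in> R" for r s
    proof -
      obtain a b where "a \<in> A" "\<forall>g\<in>topspace T. a g = of_real (r (Y g))"
        "b \<in> A" "\<forall>g\<in>topspace T. b g = of_real (s (Y g))"
        using rs by (auto simp: R_def)
      then show ?thesis using rs A_mult[of a b]
        by (auto simp: R_def intro!: continuous_on_mult bexI[of _ "\<lambda>g. a g * b g"])
    qed
    show "(\<lambda>_. c) \<in> R" for c
      using A_const[of "of_real c"] by (auto simp: R_def intro!: bexI[of _ "\<lambda>_. of_real c"])
    show "\<exists>r\<in>R. r x \<noteq> r y" if xy: "x \<in> X" "y \<in> X" "x \<noteq> y" for x y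
    proof -
      obtain a where a: "value_at x a \<noteq> value_at y a"
        using xy(3) by (metis value_at_inject ext)
      have aA: "a \<in> A" using a xy(1,2) by (auto simp: X_def valY split: if_splits)
      show ?thesis
      proof (cases "Re (value_at x a) = Re (value_at y a)")
        case True
        then have "Re (- \<i> * value_at x a) \<noteq> Re (- \<i> * value_at y a)" using a by (simp add: complex_eq_iff)
        then show ?thesis by (intro bexI[OF _ coord[OF aA, of "- \<i>"]])
      next
        case False
        then show ?thesis by (intro bexI[OF _ coord[OF aA, of 1]]) simp
      qed
    qed
  qed (rule compactX)
  have approx: "\<exists>a\<in>A. \<forall>g\<in>topspace T. cmod (of_real (p (f g)) - a g) < \<delta> / 2"
    if p: "continuous_on UNIV p" for p :: "complex \<Rightarrow> real"
  proof -
    define q where "q x = p (f (SOME g. g \<in> topspace T \<and> Y g = x))" for x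
    have q: "q (Y g) = p (f g)" if g: "g \<in> topspace T" for g
    proof -
      let ?g' = "SOME g'. g' \<in> topspace T \<and> Y g' = Y g"
      have g': "?g' \<in> topspace T \<and> Y ?g' = Y g" by (rule someI[of _ g]) (simp add: g)
      have "f ?g' = f g"
      proof (rule separated)
        fix a assume "a \<in> A"
        then show "a ?g' = a g"
          using fun_cong[OF arg_cong[of _ _ value_at, OF conjunct2[OF g']], of a] by (simp add: valY)
      qed (use g g' in auto)
      then show ?thesis by (simp add: q_def)
    qed
    \<comment> \<open>A closed map: the preimage of a closed set under \<open>q\<close> is the image of a compact set.\<close>
    have "continuous_on X q"
      unfolding continuous_on_closed_vimage[OF compact_imp_closed[OF compactX]]
    proof (intro allI impI)
      fix B :: "real set" assume B: "closed B"
      have "closedin T {g \<in> topspace T. f g \<in> p -` B}"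
        using closedin_continuous_map_preimage[OF f, of "p -` B"] closed_vimage[OF B p] by simp
      then have "closed (Y ` {g \<in> topspace T. f g \<in> p -` B})"
        by (intro compact_imp_closed compact_image)
      also have "Y ` {g \<in> topspace T. f g \<in> p -` B} = q -` B \<inter> X"
        by (auto simp: X_def q)
      finally show "closed (q -` B \<inter> X)" .
    qed
    then obtain r where r: "r \<in> R" "\<forall>x\<in>X. \<bar>q x - r x\<bar> < \<delta> / 2"
      using Stone_Weierstrass_basic[of q "\<delta>/2"] \<open>\<delta> > 0\<close> by auto
    obtain a where a: "a \<in> A" "\<forall>g\<in>topspace T. a g = of_real (r (Y g))"
      using r(1) by (auto simp: R_def)
    have "cmod (of_real (p (f g)) - a g) < \<delta> / 2" if g: "g \<in> topspace T" for g
    proof -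
      have "of_real (p (f g)) - a g = complex_of_real (q (Y g) - r (Y g))"
        using a(2) g q[OF g] by simp
      then have "cmod (of_real (p (f g)) - a g) = \<bar>q (Y g) - r (Y g)\<bar>"
        by (simp only: norm_of_real)
      then show ?thesis using r(2) g by (simp add: X_def)
    qed
    then show ?thesis using a(1) by blast
  qed
  obtain a where a: "a \<in> A" "\<forall>g\<in>topspace T. cmod (of_real (Re (f g)) - a g) < \<delta> / 2"
    using approx[of Re] continuous_on_Re[OF continuous_on_id] by auto
  obtain b where b: "b \<in> A" "\<forall>g\<in>topspace T. cmod (of_real (Im (f g)) - b g) < \<delta> / 2"
    using approx[of Im] continuous_on_Im[OF continuous_on_id] by auto
  have mem: "(\<lambda>g. a g + \<i> * b g) \<in> A" by (rule A_add[OF a(1) A_mult[OF A_const b(1)]])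
  have close: "cmod (f g - (a g + \<i> * b g)) < \<delta>" if g: "g \<in> topspace T" for g
  proof -
    have "f g - (a g + \<i> * b g) = (of_real (Re (f g)) - a g) + \<i> * (of_real (Im (f g)) - b g)"
      by (simp add: complex_eq_iff)
    moreover have "cmod ((of_real (Re (f g)) - a g) + \<i> * (of_real (Im (f g)) - b g)) \<le>
        cmod (of_real (Re (f g)) - a g) + cmod (of_real (Im (f g)) - b g)"
      using norm_triangle_ineq[of "of_real (Re (f g)) - a g" "\<i> * (of_real (Im (f g)) - b g)"]
      by (simp add: norm_mult)
    ultimately have "cmod (f g - (a g + \<i> * b g)) \<le>
        cmod (of_real (Re (f g)) - a g) + cmod (of_real (Im (f g)) - b g)"
      by (simp only:)
    moreover have "cmod (of_real (Re (f g)) - a g) < \<delta> / 2" "cmod (of_real (Im (f g)) - b g) < \<delta> / 2"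
      using a(2) b(2) g by auto
    ultimately show ?thesis by linarith
  qed
  show ?thesis by (rule bexI[OF _ mem]) (use close in simp)
qed


section \<open>Averaging over a group of unitaries\<close>

context fd_hilbert
begin

definition nsq :: "'h \<Rightarrow> real" where "nsq x = Re (ip x x)"

lemma nsq_nonneg: "x \<in> K \<Longrightarrow> 0 \<le> nsq x"
  by (simp add: nsq_def ip_self_nonneg)

text \<open>The parallelogram law, with the midpoint in place of the sum.\<close>

lemma nsq_diff:
  assumes "x \<in> K" "y \<in> K"
  shows "nsq (x - y) = 2 * nsq x + 2 * nsq y - 4 * nsq (sc (1/2) (x + y))"
  using assms
  by (simp add: nsq_def ip_diff_left ip_diff_right ip_add_left ip_add_right ip_scale_left
      ip_scale_right scale_K add_K diff_K algebra_simps)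

lemma cmod_ip_le: "\<lbrakk>x \<in> K; y \<in> K\<rbrakk> \<Longrightarrow> cmod (ip x y) \<le> sqrt (nsq x * nsq y)"
  using cauchy_schwarz[of x y] by (simp add: nsq_def real_le_rsqrt)

text \<open>
  The coordinates of the sequence with respect to an orthonormal basis are Cauchy sequences.
\<close>

lemma weak_limit:
  assumes v: "\<And>n. v n \<in> K" and N: "\<And>i j. nsq (v i - v j) \<le> d i + d j" and d: "d \<longlonglongrightarrow> 0"
  obtains w where "w \<in> K" "\<And>y. y \<in> K \<Longrightarrow> (\<lambda>n. ip y (v n)) \<longlonglongrightarrow> ip y w"
proof -
  obtain B where B: "finite B" "B \<subseteq> K" "orthonormal B" "span B = K"
    by (rule ex_orthonormal_basis[OF subspace_K order_refl])
  have BK: "e \<in> K" if "e \<in> B" for e using that B(2) by blast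
  have conv: "convergent (\<lambda>n. ip e (v n))" if e: "e \<in> B" for e
  proof (rule Cauchy_convergent, rule CauchyI)
    fix r :: real assume r: "r > 0"
    have "0 < r\<^sup>2 / 2" using r by simp
    then have "\<forall>\<^sub>F n in sequentially. d n < r\<^sup>2 / 2"
      by (rule order_tendstoD(2)[OF d])
    then obtain M where M: "\<And>n. n \<ge> M \<Longrightarrow> d n < r\<^sup>2 / 2"
      by (auto simp: eventually_sequentially)
    have one: "nsq e = 1" using B(3) e by (simp add: nsq_def orthonormal_def)
    have "cmod (ip e (v i) - ip e (v j)) < r" if "i \<ge> M" "j \<ge> M" for i j
    proof -
      have "nsq (v i - v j) < r\<^sup>2" using N[of i j] M[OF that(1)] M[OF that(2)] by linarith
      then have "sqrt (nsq (v i - v j)) < r" using r real_less_lsqrt nsq_nonneg[OF diff_K[OF v v]] by auto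
      moreover have "cmod (ip e (v i - v j)) \<le> sqrt (nsq (v i - v j))"
        using cmod_ip_le[OF BK[OF e] diff_K[OF v v]] one by simp
      ultimately show ?thesis using v BK[OF e] by (simp add: ip_diff_right)
    qed
    then show "\<exists>M. \<forall>m\<ge>M. \<forall>n\<ge>M. norm (ip e (v m) - ip e (v n)) < r" by blast
  qed
  define L where "L e = lim (\<lambda>n. ip e (v n))" for e
  have L: "(\<lambda>n. ip e (v n)) \<longlonglongrightarrow> L e" if "e \<in> B" for e
    using conv[OF that] by (simp add: L_def convergent_LIMSEQ_iff)
  define w where "w = (\<Sum>e\<in>B. sc (L e) e)"
  have w: "w \<in> K" unfolding w_def by (intro sum_K scale_K BK)
  have "(\<lambda>n. ip y (v n)) \<longlonglongrightarrow> ip y w" if y: "y \<in> K" for y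
  proof -
    have expand: "ip y z = (\<Sum>e\<in>B. cnj (ip e y) * ip e z)" if "z \<in> K" for z
      using parseval[OF B(3,1,2), of y z] y B(4) that by blast
    have "(\<lambda>n. \<Sum>e\<in>B. cnj (ip e y) * ip e (v n)) \<longlonglongrightarrow> (\<Sum>e\<in>B. cnj (ip e y) * L e)"
      by (intro tendsto_sum tendsto_mult tendsto_const L)
    moreover have "(\<Sum>e\<in>B. cnj (ip e y) * L e) = ip y w"
      unfolding expand[OF w] using ip_orthonormal_sum[OF B(3,1,2)] by (simp add: w_def)
    ultimately show ?thesis using expand[OF v] by simp
  qed
  then show ?thesis using that w by blast
qed

text \<open>
  A matrix coefficient of a vector orthogonal to the invariants has mean zero, so its real part
  cannot stay above a positive constant.  In place of an invariant measure the proof uses that a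
  minimizing sequence for the norm in a nonempty, convex and invariant set converges to an
  invariant vector.
\<close>

lemma coefficient_not_bounded_below:
  assumes G: "group G" and rep: "unitary_rep G T sc K ip \<pi>"
    and \<psi>: "\<psi> \<in> K" "\<And>z. \<lbrakk>z \<in> K; \<And>g. g \<in> carrier G \<Longrightarrow> \<pi> g z = z\<rbrakk> \<Longrightarrow> ip z \<psi> = 0"
    and \<phi>: "\<phi> \<in> K" and c: "\<And>g. g \<in> carrier G \<Longrightarrow> c \<le> Re (ip \<phi> (\<pi> g \<psi>))"
  shows "c \<le> 0"
proof -
  interpret G: group G by fact
  have rK: "\<pi> g x \<in> K" if "g \<in> carrier G" "x \<in> K" for g x
    using rep that unfolding unitary_rep_def linear_between_def by blast
  have radd: "\<pi> g (x + y) = \<pi> g x + \<pi> g y" if "g \<in> carrier G" "x \<in> K" "y \<in> K" for g x y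
    using rep that unfolding unitary_rep_def linear_between_def by blast
  have rscale: "\<pi> g (sc z x) = sc z (\<pi> g x)" if "g \<in> carrier G" "x \<in> K" for g x z
    using rep that unfolding unitary_rep_def linear_between_def by blast
  have unit: "ip (\<pi> g x) (\<pi> g y) = ip x y" if "g \<in> carrier G" "x \<in> K" "y \<in> K" for g x y
    using rep that unfolding unitary_rep_def by blast
  have rone: "\<pi> \<one>\<^bsub>G\<^esub> x = x" if "x \<in> K" for x
    using rep that unfolding unitary_rep_def by blast
  have rmult: "\<pi> (g \<otimes>\<^bsub>G\<^esub> h) x = \<pi> g (\<pi> h x)" if "g \<in> carrier G" "h \<in> carrier G" "x \<in> K" for g h x
    using rep that unfolding unitary_rep_def by blast
  have adj: "ip x (\<pi> g y) = ip (\<pi> (inv\<^bsub>G\<^esub> g) x) y" if "g \<in> carrier G" "x \<in> K" "y \<in> K" for g x y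
    using unit[of g "\<pi> (inv\<^bsub>G\<^esub> g) x" y] rmult[of g "inv\<^bsub>G\<^esub> g" x] rone[of x] rK[of "inv\<^bsub>G\<^esub> g" x] that
    by simp
  define I where "I = {z \<in> K. \<forall>g\<in>carrier G. \<pi> g z = z}"
  \<comment> \<open>A convex invariant set, orthogonal to the invariant vectors, on which the lower bound persists.\<close>
  define M where "M = {v \<in> K. (\<forall>z\<in>I. ip z v = 0) \<and> (\<forall>h\<in>carrier G. c \<le> Re (ip \<phi> (\<pi> h v)))}"
  have MK: "v \<in> K" if "v \<in> M" for v using that by (simp add: M_def)
  have \<psi>M: "\<psi> \<in> M" using \<psi> c by (simp add: M_def I_def)
  have mid: "sc (1/2) (x + y) \<in> M" if "x \<in> M" "y \<in> M" for x y
  proof -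
    have "x \<in> K" "y \<in> K" using that MK by auto
    moreover have "c \<le> Re (ip \<phi> (\<pi> h (sc (1/2) (x + y))))" if "h \<in> carrier G" for h
    proof -
      have "c \<le> Re (ip \<phi> (\<pi> h x))" "c \<le> Re (ip \<phi> (\<pi> h y))"
        using \<open>x \<in> M\<close> \<open>y \<in> M\<close> that by (auto simp: M_def)
      moreover have "ip \<phi> (\<pi> h (sc (1/2) (x + y))) = 1/2 * (ip \<phi> (\<pi> h x) + ip \<phi> (\<pi> h y))"
        using \<open>x \<in> K\<close> \<open>y \<in> K\<close> that \<phi>
        by (simp add: radd rscale rK add_K scale_K ip_add_right ip_scale_right)
      then have "Re (ip \<phi> (\<pi> h (sc (1/2) (x + y)))) = 1/2 * (Re (ip \<phi> (\<pi> h x)) + Re (ip \<phi> (\<pi> h y)))"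
        by (simp only:) simp
      ultimately show ?thesis by (simp add: field_simps)
    qed
    ultimately show ?thesis using that
      by (auto simp: M_def I_def add_K scale_K ip_add_right ip_scale_right)
  qed
  have move: "\<pi> g x \<in> M" if "g \<in> carrier G" "x \<in> M" for g x
  proof -
    have x: "x \<in> K" using that MK by auto
    have "ip z (\<pi> g x) = 0" if "z \<in> I" for z
      using adj[of g z x] that \<open>g \<in> carrier G\<close> x \<open>x \<in> M\<close> by (simp add: I_def M_def)
    moreover have "c \<le> Re (ip \<phi> (\<pi> h (\<pi> g x)))" if "h \<in> carrier G" for h
    proof -
      have "c \<le> Re (ip \<phi> (\<pi> (h \<otimes>\<^bsub>G\<^esub> g) x))"
        using \<open>x \<in> M\<close> G.m_closed[OF that \<open>g \<in> carrier G\<close>] by (simp add: M_def)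
      then show ?thesis using rmult[OF that \<open>g \<in> carrier G\<close> x] by simp
    qed
    ultimately show ?thesis using rK[OF that(1) x] by (simp add: M_def)
  qed
  define m where "m = Inf (nsq ` M)"
  have bdd: "bdd_below (nsq ` M)" using MK nsq_nonneg by (intro bdd_belowI[of _ 0]) auto
  have m_le: "m \<le> nsq x" if "x \<in> M" for x
    unfolding m_def using that bdd by (intro cInf_lower) auto
  have "\<exists>x\<in>M. nsq x < m + 1 / real (Suc n)" for n
  proof -
    have "Inf (nsq ` M) < m + 1 / real (Suc n)" by (simp add: m_def)
    then show ?thesis using cInf_lessD[of "nsq ` M"] \<psi>M by blast
  qed
  then obtain v where v: "\<And>n. v n \<in> M" "\<And>n. nsq (v n) < m + 1 / real (Suc n)" by metis
  define d where "d n = 2 * (1 / real (Suc n))" for n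
  have d: "d \<longlonglongrightarrow> 0" unfolding d_def
    using tendsto_mult_left[OF LIMSEQ_inverse_real_of_nat, of 2] by (simp add: inverse_eq_divide)
  \<comment> \<open>The midpoint lies in \<open>M\<close>, so its squared norm in the parallelogram law is at least \<open>m\<close>.\<close>
  have close: "nsq (x - y) \<le> 2 * (nsq x - m) + 2 * (nsq y - m)" if "x \<in> M" "y \<in> M" for x y
    using nsq_diff[OF MK MK, OF that] m_le[OF mid[OF that]] by (simp add: algebra_simps)
  have vK: "v n \<in> K" for n using v(1) MK by blast
  have N: "nsq (v i - v j) \<le> d i + d j" for i j
    using close[OF v(1) v(1), of i j] v(2)[of i] v(2)[of j] by (simp add: d_def)
  obtain w where w: "w \<in> K" "\<And>y. y \<in> K \<Longrightarrow> (\<lambda>n. ip y (v n)) \<longlonglongrightarrow> ip y w"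
    by (rule weak_limit[OF vK N d], rule that)
  have "w \<in> I"
  proof -
    have "\<pi> g w = w" if g: "g \<in> carrier G" for g
    proof (rule ip_ext)
      fix y assume y: "y \<in> K"
      have "(\<lambda>n. ip y (\<pi> g (v n))) \<longlonglongrightarrow> ip y (\<pi> g w)"
        using w(2)[of "\<pi> (inv\<^bsub>G\<^esub> g) y"] rK[of "inv\<^bsub>G\<^esub> g" y] y g vK w(1) by (simp add: adj)
      then have "(\<lambda>n. ip y (\<pi> g (v n)) - ip y (v n)) \<longlonglongrightarrow> ip y (\<pi> g w) - ip y w"
        by (intro tendsto_diff w(2) y)
      moreover have "(\<lambda>n. ip y (\<pi> g (v n)) - ip y (v n)) \<longlonglongrightarrow> 0"
      proof (rule Lim_null_comparison)
        have "cmod (ip y (\<pi> g (v n)) - ip y (v n)) \<le> sqrt (nsq y * (2 * d n))" for n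
        proof -
          have gv: "\<pi> g (v n) \<in> M" "nsq (\<pi> g (v n)) = nsq (v n)"
            using move[OF g v(1)] unit[OF g vK vK] by (auto simp: nsq_def)
          have "nsq (\<pi> g (v n) - v n) \<le> 2 * d n"
            using close[OF gv(1) v(1)[of n]] gv(2) v(2)[of n] by (simp add: d_def)
          moreover have "cmod (ip y (\<pi> g (v n) - v n)) \<le> sqrt (nsq y * nsq (\<pi> g (v n) - v n))"
            using y rK[OF g vK] vK by (intro cmod_ip_le diff_K)
          ultimately have "cmod (ip y (\<pi> g (v n) - v n)) \<le> sqrt (nsq y * (2 * d n))"
            using nsq_nonneg[OF y] by (meson mult_left_mono order_trans real_sqrt_le_iff)
          then show ?thesis using y rK[OF g vK] vK by (simp add: ip_diff_right)
        qed
        then show "\<forall>\<^sub>F n in sequentially. norm (ip y (\<pi> g (v n)) - ip y (v n)) \<le> sqrt (nsq y * (2 * d n))"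
          by simp
        have "(\<lambda>n. sqrt (nsq y * (2 * d n))) \<longlonglongrightarrow> sqrt (nsq y * (2 * 0))"
          by (intro tendsto_intros d)
        then show "(\<lambda>n. sqrt (nsq y * (2 * d n))) \<longlonglongrightarrow> 0" by simp
      qed
      ultimately have "ip y (\<pi> g w) - ip y w = 0" by (rule LIMSEQ_unique)
      then show "ip y (\<pi> g w) = ip y w" by simp
    qed (use w rK g in auto)
    then show ?thesis using w(1) by (simp add: I_def)
  qed
  then have "ip w (v n) = 0" for n using v(1)[of n] by (simp add: M_def)
  then have "ip w w = 0" using w(2)[OF w(1)] LIMSEQ_unique[OF tendsto_const] by fastforce
  then have "w = 0" using w(1) by (rule ip_self_eq_0[rotated])
  then have "(\<lambda>n. ip \<phi> (v n)) \<longlonglongrightarrow> 0" using w(2)[OF \<phi>] ip_zero_right[OF \<phi>] by simp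
  then have "(\<lambda>n. Re (ip \<phi> (v n))) \<longlonglongrightarrow> 0" using tendsto_Re by fastforce
  moreover have "c \<le> Re (ip \<phi> (v n))" for n
  proof -
    have "c \<le> Re (ip \<phi> (\<pi> \<one>\<^bsub>G\<^esub> (v n)))" using v(1)[of n] by (simp add: M_def)
    then show ?thesis using rone[OF vK] by simp
  qed
  ultimately show ?thesis by (intro LIMSEQ_le_const[where X = "\<lambda>n. Re (ip \<phi> (v n))"]) auto
qed

end


section \<open>Eigenvectors\<close>

context fd_hilbert
begin

text \<open>The vector \<open>q(A) y\<close>, evaluated by Horner's rule.\<close>

definition poly_at :: "('h \<Rightarrow> 'h) \<Rightarrow> 'h \<Rightarrow> complex poly \<Rightarrow> 'h" where
  "poly_at A y q = fold_coeffs (\<lambda>a z. sc a y + A z) q 0"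

text \<open>
  By finiteness of the dimension the vectors \<open>y\<close>, \<open>A y\<close>, \<open>A (A y)\<close> and so on are dependent, so a nonzero
  polynomial in \<open>A\<close> annihilates \<open>y\<close>.  Linear factors are split off by the fundamental theorem of
  algebra until a factor annihilates a nonzero vector.
\<close>

lemma exists_eigenvector:
  assumes A: "linear_between sc K K A" and K: "K \<noteq> {0}"
  obtains c z where "z \<in> K" "z \<noteq> 0" "A z = sc c z"
proof -
  have AK: "A x \<in> K" if "x \<in> K" for x using A that unfolding linear_between_def by auto
  have Aadd: "A (x + y) = A x + A y" if "x \<in> K" "y \<in> K" for x y
    using A that unfolding linear_between_def by simp
  have Asc: "A (sc c x) = sc c (A x)" if "x \<in> K" for c x
    using A that unfolding linear_between_def by simp
  have A0: "A 0 = 0" using Asc[OF zero_K, of 0] by simp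
  obtain y where y: "y \<in> K" "y \<noteq> 0" using K zero_K by blast
  let ?ev = "poly_at A y"
  have ev0: "?ev 0 = 0" by (simp add: poly_at_def)
  have evp: "?ev (pCons a q) = sc a y + A (?ev q)" for a q
    by (cases "q = 0 \<and> a = 0") (auto simp: poly_at_def A0)
  have evK: "?ev q \<in> K" for q
    by (induction q) (simp_all add: ev0 evp zero_K add_K scale_K AK y)
  have eva: "?ev (p + q) = ?ev p + ?ev q" for p q
  proof (induction p q rule: poly_induct2)
    case (pCons a p b q)
    then show ?case by (simp add: evp evK Aadd scale_left_distrib)
  qed (simp add: ev0)
  have evs: "?ev (smult c q) = sc c (?ev q)" for c q
    by (induction q) (simp_all add: ev0 evp evK Asc scale_right_distrib)
  have evsum: "?ev (sum f I) = (\<Sum>i\<in>I. ?ev (f i))" for f and I :: "nat set"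
    by (induction I rule: infinite_finite_induct) (simp_all add: ev0 eva)
  define v where "v i = ?ev (monom 1 i)" for i :: nat
  obtain D where D: "finite D" "span D = K" by (rule finite_span_K)
  have "\<exists>q. q \<noteq> 0 \<and> ?ev q = 0"
  proof (cases "inj_on v {..card D}")
    case False
    then obtain i j where ij: "i \<noteq> j" "v i = v j" unfolding inj_on_def by auto
    let ?q = "monom 1 i + smult (-1) (monom 1 j) :: complex poly"
    have "coeff ?q i = 1" using ij(1) by simp
    then have "?q \<noteq> 0" by (metis coeff_0 zero_neq_one)
    moreover have "?ev ?q = 0" unfolding eva evs using ij(2) by (simp add: v_def)
    ultimately show ?thesis by blast
  next
    case True
    let ?V = "v ` {..card D}"
    have card: "card ?V = Suc (card D)" using True by (simp add: card_image)
    have VK: "?V \<subseteq> span D" unfolding D(2) v_def using evK by auto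
    have "dependent ?V"
    proof (rule ccontr)
      assume "\<not> dependent ?V"
      then have "card ?V \<le> card D" using independent_span_bound[OF D(1) _ VK] by simp
      then show False using card by simp
    qed
    then obtain u w where u: "w \<in> ?V" "u w \<noteq> 0" "(\<Sum>x\<in>?V. sc (u x) x) = 0"
      unfolding dependent_finite[of ?V, simplified] by auto
    then obtain i where i: "i \<le> card D" "u (v i) \<noteq> 0" by auto
    let ?q = "\<Sum>j\<le>card D. smult (u (v j)) (monom 1 j)"
    have "coeff ?q i = u (v i)" using i(1) by (simp add: coeff_sum if_distrib cong: if_cong)
    then have "?q \<noteq> 0" using i(2) by auto
    moreover have "?ev ?q = (\<Sum>j\<le>card D. sc (u (v j)) (v j))"
      unfolding evsum evs v_def ..
    moreover have "\<dots> = (\<Sum>x\<in>?V. sc (u x) x)" using True by (simp add: sum.reindex)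
    ultimately show ?thesis using u(3) by (intro exI[of _ ?q]) simp
  qed
  then obtain q where q: "q \<noteq> 0" "?ev q = 0" by blast
  have "\<exists>c z. z \<in> K \<and> z \<noteq> 0 \<and> A z = sc c z" if "q \<noteq> 0" "?ev q = 0" for q
    using that
  proof (induction "degree q" arbitrary: q)
    case 0
    then obtain a where a: "q = [:a:]" by (metis degree_eq_zeroE)
    then have "sc a y = 0" using 0(3) evp[of a 0] ev0 A0 by simp
    then show ?case using a 0(2) y(2) by simp
  next
    case (Suc n)
    then have "\<not> constant (poly q)" by (simp add: constant_degree)
    then obtain c where c: "poly q c = 0" using fundamental_theorem_of_algebra by blast
    then obtain r where r: "q = [:-c, 1:] * r" unfolding poly_eq_0_iff_dvd by (auto elim: dvdE)
    have r0: "r \<noteq> 0" using Suc(3) r by auto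
    have "degree q = Suc (degree r)" unfolding r using r0 by (subst degree_mult_eq) auto
    then have deg: "n = degree r" using Suc(2) by simp
    have "q = smult (- c) r + pCons 0 r" using r by simp
    then have "?ev q = sc (- c) (?ev r) + (sc 0 y + A (?ev r))" by (simp only: eva evs evp)
    then have ev: "A (?ev r) = sc c (?ev r)" using Suc(4) by simp
    show ?case
    proof (cases "?ev r = 0")
      case True
      show ?thesis by (rule Suc(1)[OF deg r0 True])
    next
      case False
      then show ?thesis using ev evK by blast
    qed
  qed
  then show ?thesis using q that by blast
qed

lemma dim_psubset:
  assumes W: "subspace W" "W \<subseteq> V" "W \<noteq> V" and V: "subspace V" "V \<subseteq> K"
  shows "dim W < dim V"
proof -
  obtain D where D: "finite D" "span D = K" by (rule finite_span_K)
  obtain B where B: "B \<subseteq> W" "independent B" "W \<subseteq> span B" "card B = dim W"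
    by (rule basis_exists)
  obtain B' where B': "B \<subseteq> B'" "B' \<subseteq> V" "independent B'" "V \<subseteq> span B'"
    using maximal_independent_subset_extend[of B V] B(1,2) W(2) by auto
  have fin: "finite B'"
    using independent_span_bound[OF D(1) B'(3)] B'(2) V(2) D(2) by auto
  have "span B \<subseteq> W" using B(1) W(1) by (rule span_minimal)
  then have "B' \<noteq> B" using B'(4) W(2,3) by auto
  then have "card B < card B'" using B'(1) fin by (simp add: psubset_card_mono psubset_eq)
  moreover have "card B' = dim V" by (rule basis_card_eq_dim[OF B'(2,4,3)])
  ultimately show ?thesis using B(4) by simp
qed

definition is_projection :: "'h set \<Rightarrow> 'h \<Rightarrow> 'h \<Rightarrow> bool" where
  "is_projection W x y \<longleftrightarrow> y \<in> W \<and> (\<forall>z\<in>W. ip z (x - y) = 0)"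

context
  fixes W assumes W: "subspace W" "W \<subseteq> K"
begin

lemma projection_exists: "x \<in> K \<Longrightarrow> \<exists>y. is_projection W x y"
  using ex_orthogonal_projection[OF W, of x] unfolding is_projection_def by metis

lemma projection_unique:
  assumes "x \<in> K" "is_projection W x y" "is_projection W x y'"
  shows "y = y'"
proof -
  have yy: "y \<in> W" "y' \<in> W" using assms by (simp_all add: is_projection_def)
  then have K: "y \<in> K" "y' \<in> K" "y - y' \<in> W" "y - y' \<in> K"
    using W subspace_diff by auto
  have "ip (y - y') ((x - y') - (x - y)) = 0"
    using assms K by (subst ip_diff_right) (auto simp: is_projection_def diff_K)
  then have "y - y' = 0" using ip_self_eq_0[OF K(4)] by simp
  then show ?thesis by simp
qed

lemma projection_add:
  assumes "x \<in> K" "x' \<in> K" "is_projection W x y" "is_projection W x' y'"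
  shows "is_projection W (x + x') (y + y')"
proof -
  have yy: "y \<in> W" "y' \<in> W" using assms by (simp_all add: is_projection_def)
  then have K: "y \<in> K" "y' \<in> K" using W by auto
  have "ip z ((x + x') - (y + y')) = 0" if "z \<in> W" for z
  proof -
    have "(x + x') - (y + y') = (x - y) + (x' - y')" by simp
    moreover have "ip z ((x - y) + (x' - y')) = 0"
      using that W(2) K assms by (subst ip_add_right) (auto simp: is_projection_def diff_K)
    ultimately show ?thesis by (simp only:)
  qed
  then show ?thesis using yy W(1) by (simp add: is_projection_def subspace_add)
qed

lemma projection_scale:
  assumes "x \<in> K" "is_projection W x y"
  shows "is_projection W (sc c x) (sc c y)"
proof -
  have y: "y \<in> W" "y \<in> K" using assms W by (auto simp: is_projection_def)
  have "ip z (sc c x - sc c y) = 0" if "z \<in> W" for z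
  proof -
    have "sc c x - sc c y = sc c (x - y)" by (simp add: scale_right_diff_distrib)
    moreover have "ip z (sc c (x - y)) = 0"
      using that W(2) y assms by (subst ip_scale_right) (auto simp: is_projection_def diff_K)
    ultimately show ?thesis by simp
  qed
  then show ?thesis using y W(1) by (simp add: is_projection_def subspace_scale)
qed

lemma projection_of_member: "x \<in> W \<Longrightarrow> is_projection W x x"
  using W by (auto simp: is_projection_def ip_zero_right)

end

end


section \<open>Arrows of a tensor *-category\<close>

context tensor_star_category
begin

sublocale arrows: vector_space "scl C" by (rule scl_vector_space)

lemma Hom_add: "\<lbrakk>a \<in> Ob C; b \<in> Ob C; f \<in> Hom C a b; g \<in> Hom C a b\<rbrakk> \<Longrightarrow> f + g \<in> Hom C a b"
  and Hom_scl: "\<lbrakk>a \<in> Ob C; b \<in> Ob C; f \<in> Hom C a b\<rbrakk> \<Longrightarrow> scl C z f \<in> Hom C a b"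
  and Hom_zero: "\<lbrakk>a \<in> Ob C; b \<in> Ob C\<rbrakk> \<Longrightarrow> 0 \<in> Hom C a b"
  and Hom_sum: "\<lbrakk>a \<in> Ob C; b \<in> Ob C; \<And>i. i \<in> I \<Longrightarrow> h i \<in> Hom C a b\<rbrakk> \<Longrightarrow> sum h I \<in> Hom C a b"
  by (auto dest: Hom_subspace
      intro: arrows.subspace_add arrows.subspace_scale arrows.subspace_0
        arrows.subspace_sum)

lemma cmp_zero_left:
  assumes "a \<in> Ob C" "b \<in> Ob C" "f \<in> Hom C a b"
  shows "0 \<cdot> f = 0"
  using cmp_scl[OF assms(1,2,2) assms(3) Hom_zero[OF assms(2,2)], of 0] by simp

lemma cmp_zero_right:
  assumes "a \<in> Ob C" "b \<in> Ob C" "f \<in> Hom C a b"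
  shows "f \<cdot> 0 = 0"
  using cmp_scl[OF assms(1,1,2) Hom_zero[OF assms(1,1)] assms(3), of 0] by simp

lemma cmp_sum_left:
  assumes "a \<in> Ob C" "b \<in> Ob C" "c \<in> Ob C" "f \<in> Hom C a b" "\<And>i. i \<in> I \<Longrightarrow> h i \<in> Hom C b c"
  shows "sum h I \<cdot> f = (\<Sum>i\<in>I. h i \<cdot> f)"
  using assms(5)
proof (induction I rule: infinite_finite_induct)
  case (insert i I)
  then have "h i \<in> Hom C b c" "sum h I \<in> Hom C b c" using assms(2,3) by (auto intro: Hom_sum)
  then show ?case using insert cmp_add[OF assms(1-4,4)] by simp
qed (use assms cmp_zero_left in auto)

lemma cmp_sum_right:
  assumes "a \<in> Ob C" "b \<in> Ob C" "c \<in> Ob C" "g \<in> Hom C b c" "\<And>i. i \<in> I \<Longrightarrow> h i \<in> Hom C a b"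
  shows "g \<cdot> sum h I = (\<Sum>i\<in>I. g \<cdot> h i)"
  using assms(5)
proof (induction I rule: infinite_finite_induct)
  case (insert i I)
  then have "h i \<in> Hom C a b" "sum h I \<in> Hom C a b" using assms(1,2) by (auto intro: Hom_sum)
  then show ?case using insert cmp_add[OF assms(1-3) _ _ assms(4,4)] by simp
qed (use assms cmp_zero_right in auto)

lemma str_zero: "a \<in> Ob C \<Longrightarrow> 0\<^sup>\<star> = 0"
  using str_scl[of a a 0 0] Hom_zero[of a a] by simp

lemma str_idt: "a \<in> Ob C \<Longrightarrow> (\<ii>\<dd> a)\<^sup>\<star> = \<ii>\<dd> a"
  using str_cmp[of a a a "\<ii>\<dd> a" "(\<ii>\<dd> a)\<^sup>\<star>"] str_str[of a a "\<ii>\<dd> a"] idt_Hom[of a]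
    str_Hom[of a a "\<ii>\<dd> a"] cmp_idt[of a a "(\<ii>\<dd> a)\<^sup>\<star>"]
  by simp

lemma tar_zero_left:
  assumes "a \<in> Ob C" "b \<in> Ob C" "c \<in> Ob C" "f \<in> Hom C a b"
  shows "0 \<boxtimes> f = 0"
  using tar_scl[OF assms(3,3) assms(1,2) Hom_zero[OF assms(3,3)] assms(4), of 0] by simp

lemma tar_sum_left:
  assumes "a \<in> Ob C" "b \<in> Ob C" "c \<in> Ob C" "d \<in> Ob C" "f \<in> Hom C c d" "\<And>i. i \<in> I \<Longrightarrow> h i \<in> Hom C a b"
  shows "sum h I \<boxtimes> f = (\<Sum>i\<in>I. h i \<boxtimes> f)"
  using assms(6)
proof (induction I rule: infinite_finite_induct)
  case (insert i I)
  then have "h i \<in> Hom C a b" "sum h I \<in> Hom C a b" using assms(1,2) by (auto intro: Hom_sum)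
  then show ?case using insert tar_add[OF assms(1-4) _ _ assms(5,5)] by simp
qed (use assms tar_zero_left in auto)

end


section \<open>The representation category and the crossed product data\<close>

locale crossed_setting =
  tensor_star_category C + DR_isomorphism C \<epsilon> S G T F + crossed_product_data C S F P
  for C :: "('o, 'v::ab_group_add) tcat" (structure)
    and \<epsilon> :: "'o \<Rightarrow> 'o \<Rightarrow> 'v"
    and S :: "'o set"
    and G :: "'g monoid"
    and T :: "'g topology"
    and F :: "('o, 'v, 'g, 'h::ab_group_add) rep_functor"
    and P :: "('o, 'v, 'h) crossed_data" +
  assumes braiding: "unitary_braiding C \<epsilon>"
    and conjugates: "has_conjugates C"
    and even: "even_symmetric_subcategory C \<epsilon> S"
    and compact: "compact_group G T"
begin

sublocale vecs: vector_space "fsc F" by (rule fsc_vector_space)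

sublocale G: group G using compact by (simp add: compact_group_def)

lemma S_Ob: "a \<in> S \<Longrightarrow> a \<in> Ob C"
  and S_tun: "\<iota> \<in> S"
  and S_tob: "\<lbrakk>a \<in> S; b \<in> S\<rbrakk> \<Longrightarrow> a \<odot> b \<in> S"
  using even by (auto simp: even_symmetric_subcategory_def)

lemma S_subobject:
  assumes "a \<in> S" "p \<in> Hom C a a" "p \<cdot> p = p" "p\<^sup>\<star> = p"
  obtains b w where "b \<in> S" "w \<in> Hom C b a" "w\<^sup>\<star> \<cdot> w = \<ii>\<dd> b" "w \<cdot> w\<^sup>\<star> = p"
proof -
  have "has_subobjects (C\<lparr>Ob := S\<rparr>)"
    using even by (simp add: even_symmetric_subcategory_def)
  then show ?thesis
    using assms that unfolding has_subobjects_def proj_arrow_def isometry_def by auto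
qed

lemma S_direct_sum:
  assumes "a \<in> S" "b \<in> S"
  obtains c v w where "c \<in> S" "v \<in> Hom C a c" "v\<^sup>\<star> \<cdot> v = \<ii>\<dd> a" "w \<in> Hom C b c" "w\<^sup>\<star> \<cdot> w = \<ii>\<dd> b"
    "(v \<cdot> v\<^sup>\<star>) + (w \<cdot> w\<^sup>\<star>) = \<ii>\<dd> c"
proof -
  have "has_direct_sums (C\<lparr>Ob := S\<rparr>)"
    using even by (simp add: even_symmetric_subcategory_def)
  then show ?thesis
    using assms that unfolding has_direct_sums_def isometry_def by auto blast
qed

lemma fsp_hilbert: "a \<in> S \<Longrightarrow> fd_hilbert (fsc F) (fsp F a) (fip F a)"
  using rep[of a] fsc_vector_space
  by (simp add: fd_hilbert_def fd_hilbert_axioms_def unitary_rep_def)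

lemmas fsp_subspace = fd_hilbert.subspace_K[OF fsp_hilbert]
  and fsp_add = fd_hilbert.add_K[OF fsp_hilbert]
  and fsp_diff = fd_hilbert.diff_K[OF fsp_hilbert]
  and fsp_scale = fd_hilbert.scale_K[OF fsp_hilbert]
  and fsp_zero = fd_hilbert.zero_K[OF fsp_hilbert]
  and fsp_sum = fd_hilbert.sum_K[OF fsp_hilbert]
  and fip_add_right = fd_hilbert.ip_add_right[OF fsp_hilbert]
  and fip_add_left = fd_hilbert.ip_add_left[OF fsp_hilbert]
  and fip_scale_right = fd_hilbert.ip_scale_right[OF fsp_hilbert]
  and fip_scale_left = fd_hilbert.ip_scale_left[OF fsp_hilbert]
  and fip_zero_right = fd_hilbert.ip_zero_right[OF fsp_hilbert]
  and fip_zero_left = fd_hilbert.ip_zero_left[OF fsp_hilbert]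
  and fip_sum_right = fd_hilbert.ip_sum_right[OF fsp_hilbert]
  and fip_sum_left = fd_hilbert.ip_sum_left[OF fsp_hilbert]
  and fip_commute = fd_hilbert.ip_commute[OF fsp_hilbert]
  and fip_self_real = fd_hilbert.ip_self_real[OF fsp_hilbert]
  and fip_self_nonneg = fd_hilbert.ip_self_nonneg[OF fsp_hilbert]
  and fip_ext = fd_hilbert.ip_ext[OF fsp_hilbert]

context
  fixes a g assumes ag: "a \<in> S" "g \<in> carrier G"
begin

lemma frep_linear: "linear_between (fsc F) (fsp F a) (fsp F a) (frep F a g)"
  using rep[OF ag(1)] ag(2) by (simp add: unitary_rep_def)

lemma frep_fsp: "x \<in> fsp F a \<Longrightarrow> frep F a g x \<in> fsp F a"
  and frep_add: "\<lbrakk>x \<in> fsp F a; y \<in> fsp F a\<rbrakk> \<Longrightarrow> frep F a g (x + y) = frep F a g x + frep F a g y"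
  and frep_scale: "x \<in> fsp F a \<Longrightarrow> frep F a g (fsc F z x) = fsc F z (frep F a g x)"
  using frep_linear unfolding linear_between_def by auto

lemma frep_fip: "\<lbrakk>x \<in> fsp F a; y \<in> fsp F a\<rbrakk> \<Longrightarrow> fip F a (frep F a g x) (frep F a g y) = fip F a x y"
  using rep[OF ag(1)] ag(2) by (simp add: unitary_rep_def)

end

lemma frep_one: "\<lbrakk>a \<in> S; x \<in> fsp F a\<rbrakk> \<Longrightarrow> frep F a \<one>\<^bsub>G\<^esub> x = x"
  using rep[of a] by (simp add: unitary_rep_def)

lemma frep_mult: "\<lbrakk>a \<in> S; g \<in> carrier G; h \<in> carrier G; x \<in> fsp F a\<rbrakk>
    \<Longrightarrow> frep F a (g \<otimes>\<^bsub>G\<^esub> h) x = frep F a g (frep F a h x)"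
  using rep[of a] by (simp add: unitary_rep_def)

lemma frep_inv: "\<lbrakk>a \<in> S; g \<in> carrier G; x \<in> fsp F a\<rbrakk>
    \<Longrightarrow> frep F a g (frep F a (inv\<^bsub>G\<^esub> g) x) = x \<and> frep F a (inv\<^bsub>G\<^esub> g) (frep F a g x) = x"
  using frep_mult[of a g "inv\<^bsub>G\<^esub> g" x] frep_mult[of a "inv\<^bsub>G\<^esub> g" g x] frep_one[of a x] by simp

lemma frep_adjoint: "\<lbrakk>a \<in> S; g \<in> carrier G; x \<in> fsp F a; y \<in> fsp F a\<rbrakk>
    \<Longrightarrow> fip F a x (frep F a g y) = fip F a (frep F a (inv\<^bsub>G\<^esub> g) x) y"
  using frep_fip[of a g "frep F a (inv\<^bsub>G\<^esub> g) x" y] frep_inv[of a g x] frep_fsp[of a "inv\<^bsub>G\<^esub> g" x]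
  by simp

lemma frep_continuous: "\<lbrakk>a \<in> S; x \<in> fsp F a; y \<in> fsp F a\<rbrakk>
    \<Longrightarrow> continuous_map T euclidean (\<lambda>g. fip F a x (frep F a g y))"
  using rep[of a] by (simp add: unitary_rep_def)

context
  fixes a b s assumes abs: "a \<in> S" "b \<in> S" "s \<in> Hom C a b"
begin

lemma farr_linear: "linear_between (fsc F) (fsp F a) (fsp F b) (farr F a b s)"
  using farr_intertwiner[OF abs] by (simp add: intertwiner_def)

lemma farr_fsp: "x \<in> fsp F a \<Longrightarrow> farr F a b s x \<in> fsp F b"
  and farr_plus: "\<lbrakk>x \<in> fsp F a; y \<in> fsp F a\<rbrakk> \<Longrightarrow> farr F a b s (x + y) = farr F a b s x + farr F a b s y"
  and farr_fsc: "x \<in> fsp F a \<Longrightarrow> farr F a b s (fsc F z x) = fsc F z (farr F a b s x)"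
  using farr_linear unfolding linear_between_def by auto

lemma farr_frep: "\<lbrakk>g \<in> carrier G; x \<in> fsp F a\<rbrakk> \<Longrightarrow> farr F a b s (frep F a g x) = frep F b g (farr F a b s x)"
  using farr_intertwiner[OF abs] by (simp add: intertwiner_def)

lemma farr_zero: "farr F a b s 0 = 0"
  using farr_fsc[of 0 0] fsp_zero[OF abs(1)] by simp

lemma farr_sum:
  "(\<And>i. i \<in> I \<Longrightarrow> h i \<in> fsp F a) \<Longrightarrow> farr F a b s (sum h I) = (\<Sum>i\<in>I. farr F a b s (h i))"
proof (induction I rule: infinite_finite_induct)
  case (insert i I)
  then show ?case using fsp_sum[OF abs(1), of I h] by (simp add: farr_plus)
qed (auto simp: farr_zero)

lemma farr_adjoint:
  "\<lbrakk>x \<in> fsp F a; y \<in> fsp F b\<rbrakk> \<Longrightarrow> fip F b (farr F a b s x) y = fip F a x (farr F b a (s\<^sup>\<star>) y)"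
  using farr_str[OF abs(2,1) str_Hom[OF S_Ob[OF abs(1)] S_Ob[OF abs(2)] abs(3)], of y x]
    str_str[OF S_Ob[OF abs(1)] S_Ob[OF abs(2)] abs(3)] by simp

lemma faithful:
  assumes "s' \<in> Hom C a b" "\<And>x. x \<in> fsp F a \<Longrightarrow> farr F a b s x = farr F a b s' x"
  shows "s = s'"
  using full_faithful[OF abs(1,2) farr_intertwiner[OF abs]] abs(3) assms by metis

end

lemma farr_zero_arrow: "\<lbrakk>a \<in> S; b \<in> S; x \<in> fsp F a\<rbrakk> \<Longrightarrow> farr F a b 0 x = 0"
  using farr_scl[of a b 0 x 0] Hom_zero[of a b] S_Ob by simp

lemma farr_sum_arrow:
  assumes "a \<in> S" "b \<in> S" "x \<in> fsp F a" "\<And>i. i \<in> I \<Longrightarrow> h i \<in> Hom C a b"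
  shows "farr F a b (sum h I) x = (\<Sum>i\<in>I. farr F a b (h i) x)"
  using assms(4)
proof (induction I rule: infinite_finite_induct)
  case (insert i I)
  then have "sum h I \<in> Hom C a b" using assms(1,2) S_Ob by (auto intro: Hom_sum)
  then show ?case using insert assms by (simp add: farr_add)
qed (use assms farr_zero_arrow in auto)

lemma full:
  assumes "a \<in> S" "b \<in> S" "intertwiner G (fsc F) (fsp F a) (frep F a) (fsp F b) (frep F b) A"
  obtains s where "s \<in> Hom C a b" "\<And>x. x \<in> fsp F a \<Longrightarrow> farr F a b s x = A x"
  using full_faithful[OF assms] that by blast

lemma zero_object: "a \<in> S \<Longrightarrow> fsp F a = {0} \<Longrightarrow> \<ii>\<dd> a = 0"
  using faithful[of a a "\<ii>\<dd> a" 0] idt_Hom[of a] Hom_zero[of a a] S_Ob[of a]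
    farr_idt[of a 0] farr_zero_arrow[of a a 0] by auto


section \<open>Decomposition into irreducible objects\<close>

lemma irr_in_S: "m \<in> irr P \<Longrightarrow> m \<in> S"
  and irr_Ob: "m \<in> irr P \<Longrightarrow> m \<in> Ob C"
  and irr_idt_nonzero: "m \<in> irr P \<Longrightarrow> \<ii>\<dd> m \<noteq> 0"
  using irr_S[of m] S_Ob by (auto simp: irreducible_object_def)

lemma irr_endomorphism:
  assumes "m \<in> irr P" "t \<in> Hom C m m" obtains c where "t = scl C c (\<ii>\<dd> m)"
  using irr_S[OF assms(1)] assms(2) that by (auto simp: irreducible_object_def)

text \<open>
  Schur's lemma: \<open>t\<^sup>\<star> \<cdot> t\<close> and \<open>t \<cdot> t\<^sup>\<star>\<close> are the same multiple of identities, so a nonzero \<open>t\<close> would be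
  invertible.
\<close>

lemma irr_distinct_Hom:
  assumes m: "m \<in> irr P" "m' \<in> irr P" "m \<noteq> m'" and t: "t \<in> Hom C m m'"
  shows "t = 0"
proof (rule ccontr)
  assume "t \<noteq> 0"
  note O = irr_Ob[OF m(1)] irr_Ob[OF m(2)]
  have ts: "t\<^sup>\<star> \<in> Hom C m' m" using O t by (intro str_Hom)
  obtain c where c: "t\<^sup>\<star> \<cdot> t = scl C c (\<ii>\<dd> m)"
    by (rule irr_endomorphism[OF m(1) cmp_Hom[OF O(1,2,1) t ts]])
  obtain c' where c': "t \<cdot> t\<^sup>\<star> = scl C c' (\<ii>\<dd> m')"
    by (rule irr_endomorphism[OF m(2) cmp_Hom[OF O(2,1,2) ts t]])
  have c0: "c \<noteq> 0" using c \<open>t \<noteq> 0\<close> str_positive[OF O t] by auto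
  have "scl C c t = t \<cdot> (t\<^sup>\<star> \<cdot> t)"
    using cmp_scl[OF O(1,1,2) idt_Hom[OF O(1)] t] cmp_idt[OF O t] by (simp add: c)
  also have "\<dots> = (t \<cdot> t\<^sup>\<star>) \<cdot> t" using cmp_assoc[OF O(1,2,1,2) t ts t] by simp
  also have "\<dots> = scl C c' t"
    using cmp_scl[OF O(1,2,2) t idt_Hom[OF O(2)]] cmp_idt[OF O t] by (simp add: c')
  finally have cc: "c = c'" using \<open>t \<noteq> 0\<close> by simp
  let ?r = "scl C (1 / c) (t\<^sup>\<star>)"
  have r: "?r \<in> Hom C m' m" using O ts by (intro Hom_scl)
  have "?r \<cdot> t = \<ii>\<dd> m" using cmp_scl[OF O(1,2,1) t ts] c c0 by simp
  moreover have "t \<cdot> ?r = \<ii>\<dd> m'" using cmp_scl[OF O(2,1,2) ts t] c' c0 cc by simp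
  ultimately have "isomorphic C m m'" using t r unfolding isomorphic_def by blast
  moreover have "isomorphic C m' m'"
    using idt_Hom[OF O(2)] cmp_idt[OF O(2,2) idt_Hom[OF O(2)]] unfolding isomorphic_def by blast
  ultimately show False using irr_representatives[of m'] irr_S[OF m(2)] m by blast
qed

definition projects_onto :: "'o \<Rightarrow> 'v \<Rightarrow> 'h set \<Rightarrow> bool" where
  "projects_onto a p W \<longleftrightarrow>
     p \<in> Hom C a a \<and> (\<forall>x\<in>fsp F a. fd_hilbert.is_projection (fip F a) W x (farr F a a p x))"

definition invariant_subspace :: "'o \<Rightarrow> 'h set \<Rightarrow> bool" where
  "invariant_subspace a W \<longleftrightarrow> vecs.subspace W \<and> W \<subseteq> fsp F a \<and>
     (\<forall>g\<in>carrier G. \<forall>x\<in>W. frep F a g x \<in> W)"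

text \<open>
  The orthogonal projection onto an invariant subspace is an intertwiner, and \<open>F\<close> is full.
\<close>

lemma invariant_projection:
  assumes a: "a \<in> S" and W: "invariant_subspace a W"
  obtains p where "projects_onto a p W"
proof -
  interpret K: fd_hilbert "fsc F" "fsp F a" "fip F a" by (rule fsp_hilbert[OF a])
  have sub: "vecs.subspace W" "W \<subseteq> fsp F a" using W by (simp_all add: invariant_subspace_def)
  note uniq = K.projection_unique[OF sub]
  define A where "A x = (SOME y. K.is_projection W x y)" for x
  have A: "K.is_projection W x (A x)" if "x \<in> fsp F a" for x
    unfolding A_def using K.projection_exists[OF sub that] by (rule someI_ex)
  have AW: "A x \<in> W" if "x \<in> fsp F a" for x using A[OF that] by (simp add: K.is_projection_def)
  have AK: "A x \<in> fsp F a" if "x \<in> fsp F a" for x using AW[OF that] sub(2) by blast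
  have "intertwiner G (fsc F) (fsp F a) (frep F a) (fsp F a) (frep F a) A"
    unfolding intertwiner_def linear_between_def
  proof (intro conjI ballI allI)
    show "A ` fsp F a \<subseteq> fsp F a" using AK by auto
    fix x assume x: "x \<in> fsp F a"
    show "A (x + y) = A x + A y" if y: "y \<in> fsp F a" for y
      by (rule uniq[OF K.add_K[OF x y] A[OF K.add_K[OF x y]] K.projection_add[OF sub x y A[OF x] A[OF y]]])
    show "A (fsc F z x) = fsc F z (A x)" for z
      by (rule uniq[OF K.scale_K[OF x] A[OF K.scale_K[OF x]] K.projection_scale[OF sub x A[OF x]]])
    show "A (frep F a g x) = frep F a g (A x)" if g: "g \<in> carrier G" for g
    proof (rule uniq[OF frep_fsp[OF a g x] A[OF frep_fsp[OF a g x]]])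
      have mem: "frep F a g (A x) \<in> W" using AW[OF x] W g by (simp add: invariant_subspace_def)
      have "fip F a z (frep F a g x - frep F a g (A x)) = 0" if z: "z \<in> W" for z
      proof -
        have zK: "z \<in> fsp F a" using z sub by blast
        have z': "frep F a (inv\<^bsub>G\<^esub> g) z \<in> W" using W g z by (simp add: invariant_subspace_def)
        have "frep F a g x - frep F a g (A x) = frep F a g (x - A x)"
          using frep_add[OF a g K.diff_K[OF x AK[OF x]] AK[OF x]] by simp
        moreover have "fip F a z (frep F a g (x - A x)) = 0"
          using frep_adjoint[OF a g zK K.diff_K[OF x AK[OF x]]] A[OF x] z'
          by (simp add: K.is_projection_def)
        ultimately show ?thesis by simp
      qed
      then show "K.is_projection W (frep F a g x) (frep F a g (A x))"
        using mem by (simp add: K.is_projection_def)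
    qed
  qed
  then obtain p where p: "p \<in> Hom C a a" "\<And>x. x \<in> fsp F a \<Longrightarrow> farr F a a p x = A x"
    by (rule full[OF a a]) (rule that)
  then have "projects_onto a p W" using A by (simp add: projects_onto_def)
  then show ?thesis by (rule that)
qed

lemma projects_onto_props:
  assumes a: "a \<in> S" and W: "invariant_subspace a W" and p: "projects_onto a p W"
  shows "p \<in> Hom C a a" "p \<cdot> p = p" "p\<^sup>\<star> = p"
    "\<And>x. x \<in> fsp F a \<Longrightarrow> farr F a a p x \<in> W" "\<And>x. x \<in> W \<Longrightarrow> farr F a a p x = x"
proof -
  interpret K: fd_hilbert "fsc F" "fsp F a" "fip F a" by (rule fsp_hilbert[OF a])
  have sub: "vecs.subspace W" "W \<subseteq> fsp F a" using W by (simp_all add: invariant_subspace_def)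
  show pH: "p \<in> Hom C a a" using p by (simp add: projects_onto_def)
  have proj: "K.is_projection W x (farr F a a p x)" if "x \<in> fsp F a" for x
    using p that by (simp add: projects_onto_def)
  show mem: "farr F a a p x \<in> W" if "x \<in> fsp F a" for x
    using proj[OF that] by (simp add: K.is_projection_def)
  show fixed: "farr F a a p x = x" if "x \<in> W" for x
    using K.projection_unique[OF sub _ proj K.projection_of_member[OF sub that]] that sub by blast
  have O: "a \<in> Ob C" using a by (rule S_Ob)
  have ps: "p\<^sup>\<star> \<in> Hom C a a" using O pH by (intro str_Hom)
  show "p \<cdot> p = p"
    by (rule faithful[OF a a cmp_Hom[OF O O O pH pH] pH]) (simp add: farr_cmp[OF a a a pH pH] fixed mem)
  have orth: "fip F a z x = fip F a z (farr F a a p x)" if "z \<in> W" "x \<in> fsp F a" for z x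
  proof -
    have "fip F a z (x - farr F a a p x) = 0"
      using proj[OF that(2)] that(1) by (simp add: K.is_projection_def)
    then show ?thesis
      using that sub K.ip_diff_right[of z x "farr F a a p x"] mem[OF that(2)] by auto
  qed
  show "p\<^sup>\<star> = p"
  proof (rule faithful[OF a a ps pH])
    fix y assume y: "y \<in> fsp F a"
    show "farr F a a (p\<^sup>\<star>) y = farr F a a p y"
    proof (rule K.ip_ext)
      fix x assume x: "x \<in> fsp F a"
      have px: "farr F a a p x \<in> fsp F a" and py: "farr F a a p y \<in> fsp F a"
        using mem[OF x] mem[OF y] sub by auto
      have "fip F a x (farr F a a (p\<^sup>\<star>) y) = fip F a (farr F a a p x) y"
        by (rule farr_adjoint[OF a a pH x y, symmetric])
      also have "\<dots> = fip F a (farr F a a p x) (farr F a a p y)"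
        by (rule orth[OF mem[OF x] y])
      also have "\<dots> = cnj (fip F a (farr F a a p y) (farr F a a p x))"
        by (rule K.ip_commute[OF py px])
      also have "\<dots> = cnj (fip F a (farr F a a p y) x)"
        using orth[OF mem[OF y] x] by simp
      also have "\<dots> = fip F a x (farr F a a p y)"
        by (rule K.ip_commute[OF py x, symmetric])
      finally show "fip F a x (farr F a a (p\<^sup>\<star>) y) = fip F a x (farr F a a p y)" .
    qed (use farr_fsp[OF a a] ps pH y in auto)
  qed
qed

end

context crossed_setting
begin

text \<open>
  A decomposition of \<open>p\<close> into arrows from irreducible representatives.  For \<open>p = \<ii>\<dd> a\<close> it is a
  decomposition of \<open>a\<close> into irreducibles.
\<close>

definition resolves :: "('o \<times> 'v) set \<Rightarrow> 'o \<Rightarrow> 'v \<Rightarrow> bool" where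
  "resolves I a p \<longleftrightarrow> finite I \<and> (\<forall>(m, v)\<in>I. m \<in> irr P \<and> v \<in> Hom C m a) \<and>
     (\<Sum>(m, v)\<in>I. v \<cdot> v\<^sup>\<star>) = p"

lemma resolvesD:
  assumes "resolves I a p"
  shows "finite I" "\<And>i. i \<in> I \<Longrightarrow> fst i \<in> irr P" "\<And>i. i \<in> I \<Longrightarrow> snd i \<in> Hom C (fst i) a"
    "(\<Sum>i\<in>I. snd i \<cdot> (snd i)\<^sup>\<star>) = p"
  using assms unfolding resolves_def by (auto simp: case_prod_unfold)

text \<open>
  The isometry \<open>w\<close> with range projection \<open>p\<close> identifies \<open>F(b)\<close> with \<open>W\<close>.
\<close>

lemma isometry_transport:
  assumes a: "a \<in> S" "b \<in> S" and w: "w \<in> Hom C b a" "w\<^sup>\<star> \<cdot> w = \<ii>\<dd> b" "w \<cdot> w\<^sup>\<star> = p"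
    and W: "invariant_subspace a W" "projects_onto a p W"
  shows "y \<in> W \<Longrightarrow> farr F b a w (farr F a b (w\<^sup>\<star>) y) = y"
    and "z \<in> fsp F b \<Longrightarrow> farr F b a w z \<in> W"
    and "z \<in> fsp F b \<Longrightarrow> farr F a b (w\<^sup>\<star>) (farr F b a w z) = z"
proof -
  note O = S_Ob[OF a(1)] S_Ob[OF a(2)]
  have ws: "w\<^sup>\<star> \<in> Hom C a b" using O w(1) by (intro str_Hom)
  note props = projects_onto_props[OF a(1) W]
  have sub: "W \<subseteq> fsp F a" using W(1) by (simp add: invariant_subspace_def)
  show "farr F b a w (farr F a b (w\<^sup>\<star>) y) = y" if "y \<in> W" for y
    using farr_cmp[OF a(1,2,1) ws w(1), of y] props(5)[OF that] that sub w(3) by auto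
  show ret: "farr F a b (w\<^sup>\<star>) (farr F b a w z) = z" if "z \<in> fsp F b" for z
    using farr_cmp[OF a(2,1,2) w(1) ws that] farr_idt[OF a(2) that] w(2) by simp
  show "farr F b a w z \<in> W" if z: "z \<in> fsp F b" for z
  proof -
    have "p \<cdot> w = w \<cdot> (w\<^sup>\<star> \<cdot> w)" using cmp_assoc[OF O(2,1,2,1) w(1) ws w(1)] w(3) by simp
    then have "p \<cdot> w = w" using w(2) cmp_idt[OF O(2,1) w(1)] by simp
    then have "farr F b a w z = farr F a a p (farr F b a w z)"
      using farr_cmp[OF a(2,1,1) w(1) props(1) z] by simp
    then show ?thesis using props(4)[OF farr_fsp[OF a(2,1) w(1) z]] by simp
  qed
qed

text \<open>
  If the subobject is not irreducible, an eigenspace of a nonscalar endomorphism splits off a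
  proper invariant subspace.
\<close>

lemma split_invariant_subspace:
  assumes a: "a \<in> S" "b \<in> S" and w: "w \<in> Hom C b a" "w\<^sup>\<star> \<cdot> w = \<ii>\<dd> b" "w \<cdot> w\<^sup>\<star> = p"
    and W: "invariant_subspace a W" "projects_onto a p W" "W \<noteq> {0}"
    and b: "\<not> irreducible_object C b"
  obtains W1 where "invariant_subspace a W1" "W1 \<subseteq> W" "W1 \<noteq> {0}" "W1 \<noteq> W"
proof -
  note O = S_Ob[OF a(1)] S_Ob[OF a(2)]
  have ws: "w\<^sup>\<star> \<in> Hom C a b" using O w(1) by (intro str_Hom)
  have sub: "W \<subseteq> fsp F a" "vecs.subspace W" using W(1) by (simp_all add: invariant_subspace_def)
  note move = isometry_transport[OF a w W(1,2)]
  interpret B: fd_hilbert "fsc F" "fsp F b" "fip F b" by (rule fsp_hilbert[OF a(2)])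
  obtain y where y: "y \<in> W" "y \<noteq> 0" using W(3) vecs.subspace_0[OF sub(2)] by auto
  have wy: "farr F a b (w\<^sup>\<star>) y \<in> fsp F b" using farr_fsp[OF a ws] y(1) sub(1) by auto
  have wy0: "farr F a b (w\<^sup>\<star>) y \<noteq> 0"
  proof
    assume "farr F a b (w\<^sup>\<star>) y = 0"
    then show False using move(1)[OF y(1)] y(2) farr_zero[OF a(2,1) w(1)] by simp
  qed
  have nonzero: "fsp F b \<noteq> {0}"
  proof
    assume "fsp F b = {0}"
    then show False using wy wy0 by simp
  qed
  have "\<ii>\<dd> b \<noteq> 0"
  proof
    assume "\<ii>\<dd> b = 0"
    then have "farr F a b (w\<^sup>\<star>) y = 0"
      using farr_idt[OF a(2) wy] farr_zero_arrow[OF a(2,2) wy] by simp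
    then show False using wy0 by simp
  qed
  then have "Hom C b b \<noteq> range (\<lambda>c. scl C c (\<ii>\<dd> b))" using b by (simp add: irreducible_object_def)
  moreover have scalar: "scl C c (\<ii>\<dd> b) \<in> Hom C b b" for c
    using O(2) idt_Hom by (intro Hom_scl)
  then have "range (\<lambda>c. scl C c (\<ii>\<dd> b)) \<subseteq> Hom C b b" by auto
  ultimately obtain x where x: "x \<in> Hom C b b" "x \<notin> range (\<lambda>c. scl C c (\<ii>\<dd> b))" by blast
  obtain c z where z: "z \<in> fsp F b" "z \<noteq> 0" "farr F b b x z = fsc F c z"
    by (rule B.exists_eigenvector[OF farr_linear[OF a(2,2) x(1)] nonzero])
  define U where "U = {u \<in> fsp F b. farr F b b x u = fsc F c u}"
  define W1 where "W1 = {u \<in> W. farr F a b (w\<^sup>\<star>) u \<in> U}"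
  have U: "u + u' \<in> U" "fsc F d u \<in> U" "0 \<in> U" if "u \<in> U" "u' \<in> U" for u u' d
    using that B.add_K B.scale_K B.zero_K farr_plus[OF a(2,2) x(1)] farr_fsc[OF a(2,2) x(1)]
      farr_zero[OF a(2,2) x(1)]
    by (auto simp: U_def vecs.scale_right_distrib mult.commute)
  have zU: "z \<in> U" using z by (simp add: U_def)
  have inv: "invariant_subspace a W1"
    unfolding invariant_subspace_def
  proof (intro conjI ballI)
    show "W1 \<subseteq> fsp F a" using sub(1) by (auto simp: W1_def)
    show "vecs.subspace W1"
    proof (rule vecs.subspaceI)
      show "0 \<in> W1" using U(3)[OF zU zU] vecs.subspace_0[OF sub(2)] farr_zero[OF a ws]
        by (simp add: W1_def)
      show "u + u' \<in> W1" if "u \<in> W1" "u' \<in> W1" for u u'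
        using that vecs.subspace_add[OF sub(2)] U(1) sub(1)
        by (auto simp: W1_def farr_plus[OF a ws] subset_eq)
      show "fsc F d u \<in> W1" if "u \<in> W1" for d u
        using that vecs.subspace_scale[OF sub(2)] U(2) sub(1)
        by (auto simp: W1_def farr_fsc[OF a ws] subset_eq)
    qed
    fix g u assume g: "g \<in> carrier G" and u: "u \<in> W1"
    have uK: "u \<in> fsp F a" "u \<in> W" "farr F a b (w\<^sup>\<star>) u \<in> U" using u sub(1) by (auto simp: W1_def)
    let ?u = "farr F a b (w\<^sup>\<star>) u"
    have "frep F b g ?u \<in> U"
      using uK(3) farr_frep[OF a(2,2) x(1) g, of ?u] frep_fsp[OF a(2) g, of ?u]
        frep_scale[OF a(2) g, of ?u c] by (simp add: U_def)
    then show "frep F a g u \<in> W1"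
      using farr_frep[OF a ws g uK(1)] uK(2) W(1) g by (simp add: W1_def invariant_subspace_def)
  qed
  have "farr F b a w z \<in> W1" using move(2,3)[OF z(1)] zU by (simp add: W1_def)
  moreover have "farr F b a w z \<noteq> 0" using move(3)[OF z(1)] z(2) farr_zero[OF a ws] by auto
  ultimately have "W1 \<noteq> {0}" by blast
  moreover have "W1 \<noteq> W"
  proof
    assume eq: "W1 = W"
    have "x = scl C c (\<ii>\<dd> b)"
    proof (rule faithful[OF a(2,2) x(1)])
      show "scl C c (\<ii>\<dd> b) \<in> Hom C b b" by (rule scalar)
      fix u assume u: "u \<in> fsp F b"
      have "farr F b a w u \<in> W1" using move(2)[OF u] eq by simp
      then have "u \<in> U" using move(3)[OF u] by (simp add: W1_def)
      then show "farr F b b x u = farr F b b (scl C c (\<ii>\<dd> b)) u"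
        using farr_scl[OF a(2,2) idt_Hom[OF O(2)] u] farr_idt[OF a(2) u] by (simp add: U_def)
    qed
    then show False using x(2) by blast
  qed
  ultimately show ?thesis using that inv by (auto simp: W1_def)
qed

text \<open>
  An irreducible subobject is isomorphic to a representative; its inverse is the
  adjoint up to a scalar, which rescaling removes.
\<close>

lemma irreducible_subobject:
  assumes a: "a \<in> S" "b \<in> S" and w: "w \<in> Hom C b a" "w\<^sup>\<star> \<cdot> w = \<ii>\<dd> b" "w \<cdot> w\<^sup>\<star> = p"
    and b: "irreducible_object C b"
  obtains k v where "k \<in> irr P" "v \<in> Hom C k a" "v \<cdot> v\<^sup>\<star> = p"
proof -
  note O = S_Ob[OF a(1)] S_Ob[OF a(2)]
  have ws: "w\<^sup>\<star> \<in> Hom C a b" using O w(1) by (intro str_Hom)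
  obtain k where k: "k \<in> irr P" "isomorphic C k b" using irr_representatives[OF a(2) b] by blast
  note Ok = irr_Ob[OF k(1)]
  obtain f g where f: "f \<in> Hom C k b" and g: "g \<in> Hom C b k" and fg: "f \<cdot> g = \<ii>\<dd> b" "g \<cdot> f = \<ii>\<dd> k"
    using k(2) unfolding isomorphic_def by blast
  have fs: "f\<^sup>\<star> \<in> Hom C b k" using O Ok f by (intro str_Hom)
  obtain c where c: "f \<cdot> f\<^sup>\<star> = scl C c (\<ii>\<dd> b)"
    using b cmp_Hom[OF O(2) Ok O(2) fs f] unfolding irreducible_object_def by auto
  interpret B: fd_hilbert "fsc F" "fsp F b" "fip F b" by (rule fsp_hilbert[OF a(2)])
  have b0: "\<ii>\<dd> b \<noteq> 0" using b by (simp add: irreducible_object_def)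
  then have "fsp F b \<noteq> {0}" using zero_object[OF a(2)] by auto
  then obtain x where x: "x \<in> fsp F b" "x \<noteq> 0" using B.zero_K by auto
  have c0: "c \<noteq> 0"
  proof
    assume "c = 0"
    then have "(f\<^sup>\<star>)\<^sup>\<star> \<cdot> f\<^sup>\<star> = 0" using c str_str[OF Ok O(2) f] by simp
    then have "f\<^sup>\<star> = 0" by (rule str_positive[OF O(2) Ok fs])
    then have "f = 0" using str_str[OF Ok O(2) f] str_zero[OF O(2)] by simp
    then show False using fg(1) cmp_zero_left[OF O(2) Ok g] b0 by simp
  qed
  define d where "d = Re c"
  have d: "c = of_real d" "d > 0"
  proof -
    note kS = irr_in_S[OF k(1)]
    define y where "y = farr F b k (f\<^sup>\<star>) x"
    have yK: "y \<in> fsp F k" unfolding y_def by (rule farr_fsp[OF a(2) kS fs x(1)])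
    define n where "n = Re (fip F b x x)"
    define m where "m = Re (fip F k y y)"
    have n: "n > 0" "fip F b x x = of_real n"
      using B.ip_pos[OF x] B.ip_self_real[OF x(1)] by (simp_all add: n_def)
    have m: "0 \<le> m" "fip F k y y = of_real m"
      using fip_self_nonneg[OF kS yK] fip_self_real[OF kS yK] by (simp_all add: m_def)
    have "farr F b b (scl C c (\<ii>\<dd> b)) x = fsc F c x"
      using farr_scl[OF a(2,2) idt_Hom[OF O(2)] x(1)] farr_idt[OF a(2) x(1)] by simp
    then have "farr F k b f y = fsc F c x"
      unfolding y_def using farr_cmp[OF a(2) kS a(2) fs f x(1)] c by simp
    moreover have "fip F k y y = fip F b x (farr F k b f y)"
      using farr_str[OF kS a(2) f yK x(1)] by (simp add: y_def)
    ultimately have "of_real m = c * of_real n" using B.ip_scale_right[OF x(1,1)] n(2) m(2) by simp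
    then have "c = of_real (m / n)" using n(1) by (simp add: field_simps)
    then show cd: "c = of_real d" by (simp add: d_def)
    then have "d = m / n" using \<open>c = of_real (m / n)\<close> by (simp only: of_real_eq_iff)
    then have "d \<ge> 0" using m(1) n(1) by simp
    moreover have "d \<noteq> 0" using c0 cd by auto
    ultimately show "d > 0" by simp
  qed
  define v where "v = scl C (1 / of_real (sqrt d)) (w \<cdot> f)"
  have wf: "w \<cdot> f \<in> Hom C k a" by (rule cmp_Hom[OF Ok O(2,1) f w(1)])
  have wfs: "(w \<cdot> f)\<^sup>\<star> \<in> Hom C a k" using Ok O wf by (intro str_Hom)
  have v: "v \<in> Hom C k a" unfolding v_def using Ok O wf by (intro Hom_scl)
  have "(w \<cdot> f) \<cdot> (w \<cdot> f)\<^sup>\<star> = (w \<cdot> f) \<cdot> (f\<^sup>\<star> \<cdot> w\<^sup>\<star>)" using str_cmp[OF Ok O(2,1) f w(1)] by simp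
  also have "\<dots> = w \<cdot> (f \<cdot> (f\<^sup>\<star> \<cdot> w\<^sup>\<star>))"
    by (rule cmp_assoc[OF O(1) Ok O(2,1) cmp_Hom[OF O(1,2) Ok ws fs] f w(1)])
  also have "f \<cdot> (f\<^sup>\<star> \<cdot> w\<^sup>\<star>) = (f \<cdot> f\<^sup>\<star>) \<cdot> w\<^sup>\<star>"
    using cmp_assoc[OF O(1,2) Ok O(2) ws fs f] by simp
  also have "\<dots> = scl C c (w\<^sup>\<star>)"
    using c cmp_scl[OF O(1,2,2) ws idt_Hom[OF O(2)]] cmp_idt[OF O(1,2) ws] by simp
  also have "w \<cdot> scl C c (w\<^sup>\<star>) = scl C c p" using cmp_scl[OF O(1,2,1) ws w(1)] w(3) by simp
  finally have wfp: "(w \<cdot> f) \<cdot> (w \<cdot> f)\<^sup>\<star> = scl C c p" .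
  have "v\<^sup>\<star> = scl C (1 / of_real (sqrt d)) ((w \<cdot> f)\<^sup>\<star>)"
    unfolding v_def using str_scl[OF Ok O(1) wf] by simp
  then have "v \<cdot> v\<^sup>\<star> = scl C (1 / of_real (sqrt d)) (scl C (1 / of_real (sqrt d)) ((w \<cdot> f) \<cdot> (w \<cdot> f)\<^sup>\<star>))"
    using cmp_scl[OF O(1) Ok O(1) wfs wf] cmp_scl[OF O(1) Ok O(1) wfs v] unfolding v_def by simp
  also have "\<dots> = scl C (1 / of_real (sqrt d) * (1 / of_real (sqrt d)) * c) p"
    using wfp by simp
  also have "1 / of_real (sqrt d) * (1 / of_real (sqrt d)) * c = (1 :: complex)"
    using d by (simp add: of_real_mult[symmetric] del: of_real_mult)
  finally have "v \<cdot> v\<^sup>\<star> = p" by simp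
  then show ?thesis using that k(1) v by blast
qed

text \<open>
  Induction on the dimension of \<open>W\<close>: a subspace that does not belong to an irreducible subobject
  contains a proper invariant subspace, and together with its orthogonal complement in \<open>W\<close> this
  gives two subspaces of smaller dimension.  That the arrows are nonzero and have their range in
  \<open>p\<close> makes the two resulting families disjoint.
\<close>

lemma resolve_projection:
  assumes a: "a \<in> S"
  shows "invariant_subspace a W \<Longrightarrow> projects_onto a p W
    \<Longrightarrow> \<exists>I. resolves I a p \<and> (\<forall>(m, v)\<in>I. v \<noteq> 0 \<and> p \<cdot> v = v)"
proof (induction "vecs.dim W" arbitrary: W p rule: less_induct)
  case less
  note W = less.prems
  interpret K: fd_hilbert "fsc F" "fsp F a" "fip F a" by (rule fsp_hilbert[OF a])
  have O: "a \<in> Ob C" using a by (rule S_Ob)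
  note props = projects_onto_props[OF a W]
  have sub: "vecs.subspace W" "W \<subseteq> fsp F a" using W(1) by (simp_all add: invariant_subspace_def)
  show ?case
  proof (cases "W = {0}")
    case True
    have "p = 0"
      by (rule faithful[OF a a props(1) Hom_zero[OF O O]])
        (use props(4) True farr_zero_arrow[OF a a] in auto)
    then show ?thesis by (intro exI[of _ "{}"]) (simp add: resolves_def)
  next
    case False
    obtain b w where b: "b \<in> S" and w: "w \<in> Hom C b a" "w\<^sup>\<star> \<cdot> w = \<ii>\<dd> b" "w \<cdot> w\<^sup>\<star> = p"
      by (rule S_subobject[OF a props(1-3)])
    show ?thesis
    proof (cases "irreducible_object C b")
      case True
      obtain k v where k: "k \<in> irr P" and v: "v \<in> Hom C k a" "v \<cdot> v\<^sup>\<star> = p"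
        by (rule irreducible_subobject[OF a b w True])
      note Ok = irr_Ob[OF k]
      have vs: "v\<^sup>\<star> \<in> Hom C a k" using O Ok v by (intro str_Hom)
      have "v \<noteq> 0"
      proof
        assume "v = 0"
        then have "p = 0" using v(2) cmp_zero_left[OF O Ok vs] by simp
        moreover obtain y where "y \<in> W" "y \<noteq> 0" using False vecs.subspace_0[OF sub(1)] by blast
        ultimately show False using props(5)[of y] farr_zero_arrow[OF a a, of y] sub(2) by auto
      qed
      obtain c where c: "v\<^sup>\<star> \<cdot> v = scl C c (\<ii>\<dd> k)"
        by (rule irr_endomorphism[OF k cmp_Hom[OF Ok O Ok v(1) vs]])
      have pv: "p \<cdot> v = scl C c v"
        using cmp_assoc[OF Ok O Ok O v(1) vs v(1)] v(2) c cmp_scl[OF Ok Ok O idt_Hom[OF Ok] v(1)]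
          cmp_idt[OF Ok O v(1)] by simp
      have "c \<noteq> 0" using c str_positive[OF Ok O v(1)] \<open>v \<noteq> 0\<close> by auto
      have "scl C c (scl C c v) = p \<cdot> (p \<cdot> v)"
        using pv cmp_scl[OF Ok O O v(1) props(1)] by simp
      also have "\<dots> = scl C c v" using cmp_assoc[OF Ok O O O v(1) props(1,1)] props(2) pv by simp
      finally have "scl C c v = v" using \<open>c \<noteq> 0\<close> by auto
      then show ?thesis using pv k v \<open>v \<noteq> 0\<close>
        by (intro exI[of _ "{(k, v)}"]) (simp add: resolves_def)
    next
      case nonirr: False
      obtain W1 where W1: "invariant_subspace a W1" "W1 \<subseteq> W" "W1 \<noteq> {0}" "W1 \<noteq> W"
        by (rule split_invariant_subspace[OF a b w W False nonirr])
      have sub1: "vecs.subspace W1" "W1 \<subseteq> fsp F a" using W1(1) by (simp_all add: invariant_subspace_def)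
      define W2 where "W2 = {y \<in> W. \<forall>z\<in>W1. fip F a z y = 0}"
      have W2: "invariant_subspace a W2"
        unfolding invariant_subspace_def
      proof (intro conjI ballI)
        show "vecs.subspace W2"
          using sub sub1(2) by (intro vecs.subspaceI)
            (auto simp: W2_def subset_eq vecs.subspace_0 vecs.subspace_add vecs.subspace_scale
              K.ip_zero_right K.ip_add_right K.ip_scale_right)
        show "W2 \<subseteq> fsp F a" using sub(2) by (auto simp: W2_def)
        fix g y assume g: "g \<in> carrier G" and y: "y \<in> W2"
        have "fip F a z (frep F a g y) = 0" if z: "z \<in> W1" for z
        proof -
          have "frep F a (inv\<^bsub>G\<^esub> g) z \<in> W1" using W1(1) g z by (simp add: invariant_subspace_def)
          then show ?thesis
            using frep_adjoint[OF a g, of z y] y z sub(2) sub1(2) by (auto simp: W2_def subset_eq)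
        qed
        then show "frep F a g y \<in> W2"
          using y W(1) g by (simp add: W2_def invariant_subspace_def)
      qed
      have sub2: "vecs.subspace W2" "W2 \<subseteq> fsp F a" "W2 \<subseteq> W"
        using W2 by (simp_all add: invariant_subspace_def W2_def)
      have "W2 \<noteq> W"
      proof
        assume eq: "W2 = W"
        obtain z where z: "z \<in> W1" "z \<noteq> 0" using W1(3) vecs.subspace_0[OF sub1(1)] by blast
        then have "fip F a z z = 0" using eq W1(2) by (auto simp: W2_def)
        then show False using z sub1(2) K.ip_self_eq_0[of z] by auto
      qed
      obtain p1 where p1: "projects_onto a p1 W1" by (rule invariant_projection[OF a W1(1)])
      obtain p2 where p2: "projects_onto a p2 W2" by (rule invariant_projection[OF a W2])
      note props1 = projects_onto_props[OF a W1(1) p1]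
      note props2 = projects_onto_props[OF a W2 p2]
      have H: "p1 \<in> Hom C a a" "p2 \<in> Hom C a a" by (rule props1 props2)+
      obtain I1 where I1: "resolves I1 a p1" "\<And>m v. (m, v) \<in> I1 \<Longrightarrow> v \<noteq> 0 \<and> p1 \<cdot> v = v"
        using less.hyps[OF K.dim_psubset[OF sub1(1) W1(2,4) sub] W1(1) p1] by blast
      obtain I2 where I2: "resolves I2 a p2" "\<And>m v. (m, v) \<in> I2 \<Longrightarrow> v \<noteq> 0 \<and> p2 \<cdot> v = v"
        using less.hyps[OF K.dim_psubset[OF sub2(1,3) \<open>W2 \<noteq> W\<close> sub] W2 p2] by blast
      have p: "p = p1 + p2"
      proof (rule faithful[OF a a props(1) Hom_add[OF O O H]])
        fix x assume x: "x \<in> fsp F a"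
        let ?p = "farr F a a p x" and ?p1 = "farr F a a p1 x" and ?p2 = "farr F a a p2 x"
        have mem: "?p \<in> W" "?p1 \<in> W1" "?p2 \<in> W2" using props(4) props1(4) props2(4) x by auto
        then have memK: "?p \<in> fsp F a" "?p1 \<in> fsp F a" "?p2 \<in> fsp F a" using sub(2) sub1(2) sub2(2) by auto
        have orth: "fip F a z (x - ?p) = 0" if "z \<in> W" for z
          using W(2) x that by (simp add: projects_onto_def K.is_projection_def)
        have orth1: "fip F a z (x - ?p1) = 0" if "z \<in> W1" for z
          using p1 x that by (simp add: projects_onto_def K.is_projection_def)
        have dW: "?p - ?p1 \<in> W" using mem W1(2) vecs.subspace_diff[OF sub(1)] by blast
        have "fip F a z (?p - ?p1) = 0" if z: "z \<in> W1" for z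
        proof -
          have zK: "z \<in> fsp F a" "z \<in> W" using z sub1(2) W1(2) by auto
          show ?thesis using orth1[OF z] orth[OF zK(2)] zK(1) x memK
            by (simp add: K.ip_diff_right)
        qed
        then have "?p - ?p1 \<in> W2" using dW by (simp add: W2_def)
        moreover have "fip F a z (x - (?p - ?p1)) = 0" if z: "z \<in> W2" for z
        proof -
          have zK: "z \<in> fsp F a" "z \<in> W" using z sub2(2,3) by auto
          have "fip F a ?p1 z = 0" using z mem(2) by (simp add: W2_def)
          then have "fip F a z ?p1 = 0" using K.ip_commute[OF memK(2) zK(1)] by simp
          then show ?thesis using orth[OF zK(2)] zK(1) x memK
            by (simp add: K.ip_diff_right K.diff_K)
        qed
        ultimately have "K.is_projection W2 x (?p - ?p1)" by (simp add: K.is_projection_def)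
        moreover have "K.is_projection W2 x ?p2" using p2 x by (simp add: projects_onto_def)
        ultimately have "?p - ?p1 = ?p2" by (rule K.projection_unique[OF sub2(1,2) x])
        then show "?p = farr F a a (p1 + p2) x" using farr_add[OF a a H x] by (simp add: algebra_simps)
      qed
      have zero21: "p2 \<cdot> p1 = 0" and zero12: "p1 \<cdot> p2 = 0"
      proof -
        have z2: "farr F a a p2 y = 0" if y: "y \<in> W1" for y
        proof -
          have yK: "y \<in> fsp F a" "y \<in> W" using y sub1(2) W1(2) by auto
          have "y = farr F a a p1 y + farr F a a p2 y"
            using props(5)[OF yK(2)] farr_add[OF a a H yK(1)] p by simp
          then show ?thesis using props1(5)[OF y] by simp
        qed
        have z1: "farr F a a p1 y = 0" if y: "y \<in> W2" for y
        proof -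
          have yK: "y \<in> fsp F a" "y \<in> W" using y sub2(2,3) by auto
          have "y = farr F a a p1 y + farr F a a p2 y"
            using props(5)[OF yK(2)] farr_add[OF a a H yK(1)] p by simp
          then show ?thesis using props2(5)[OF y] by simp
        qed
        show "p2 \<cdot> p1 = 0"
          by (rule faithful[OF a a cmp_Hom[OF O O O H] Hom_zero[OF O O]])
            (use farr_cmp[OF a a a H] z2 props1(4) farr_zero_arrow[OF a a] in simp)
        show "p1 \<cdot> p2 = 0"
          by (rule faithful[OF a a cmp_Hom[OF O O O H(2,1)] Hom_zero[OF O O]])
            (use farr_cmp[OF a a a H(2,1)] z1 props2(4) farr_zero_arrow[OF a a] in simp)
      qed
      have vO: "m \<in> Ob C" "v \<in> Hom C m a" if "(m, v) \<in> I1 \<union> I2" for m v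
        using that resolvesD(2,3)[OF I1(1), of "(m, v)"] resolvesD(2,3)[OF I2(1), of "(m, v)"] irr_Ob by auto
      have kill: "p2 \<cdot> v = 0" if mv: "(m, v) \<in> I1" for m v
      proof -
        have v: "m \<in> Ob C" "v \<in> Hom C m a" using vO[of m v] mv by auto
        have "p2 \<cdot> v = p2 \<cdot> (p1 \<cdot> v)" using I1(2)[OF mv] by simp
        also have "\<dots> = (p2 \<cdot> p1) \<cdot> v" using cmp_assoc[OF v(1) O O O v(2) H] by simp
        finally show ?thesis using zero21 cmp_zero_left[OF v(1) O v(2)] by simp
      qed
      have kill': "p1 \<cdot> v = 0" if mv: "(m, v) \<in> I2" for m v
      proof -
        have v: "m \<in> Ob C" "v \<in> Hom C m a" using vO[of m v] mv by auto
        have "p1 \<cdot> v = p1 \<cdot> (p2 \<cdot> v)" using I2(2)[OF mv] by simp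
        also have "\<dots> = (p1 \<cdot> p2) \<cdot> v" using cmp_assoc[OF v(1) O O O v(2) H(2,1)] by simp
        finally show ?thesis using zero12 cmp_zero_left[OF v(1) O v(2)] by simp
      qed
      have disj: "I1 \<inter> I2 = {}" using I1(2) I2(2) kill by force
      have res: "resolves (I1 \<union> I2) a p"
        using I1(1) I2(1) disj unfolding resolves_def p by (auto simp: sum.union_disjoint)
      have "v \<noteq> 0 \<and> p \<cdot> v = v" if mv: "(m, v) \<in> I1 \<union> I2" for m v
      proof -
        have "p \<cdot> v = (p1 \<cdot> v) + (p2 \<cdot> v)"
          unfolding p using cmp_add[OF vO(1)[OF mv] O O vO(2)[OF mv] vO(2)[OF mv] H] by simp
        then show ?thesis using mv I1(2)[of m v] I2(2)[of m v] kill[of m v] kill'[of m v] by auto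
      qed
      then show ?thesis using res by blast
    qed
  qed
qed

lemma exists_resolution:
  assumes a: "a \<in> S"
  obtains I where "resolves I a (\<ii>\<dd> a)"
proof -
  interpret K: fd_hilbert "fsc F" "fsp F a" "fip F a" by (rule fsp_hilbert[OF a])
  have "invariant_subspace a (fsp F a)"
    using K.subspace_K frep_fsp[OF a] by (simp add: invariant_subspace_def)
  moreover have "projects_onto a (\<ii>\<dd> a) (fsp F a)"
    using idt_Hom[OF S_Ob[OF a]] farr_idt[OF a] K.projection_of_member[OF K.subspace_K order_refl]
    by (simp add: projects_onto_def)
  ultimately show ?thesis using resolve_projection[OF a] that by blast
qed

lemma resolution_arrow:
  assumes I: "resolves I a (\<ii>\<dd> a)" and O: "a \<in> Ob C" "c \<in> Ob C" and f: "f \<in> Hom C c a"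
  shows "(\<Sum>i\<in>I. snd i \<cdot> ((snd i)\<^sup>\<star> \<cdot> f)) = f"
proof -
  note R = resolvesD[OF I]
  have v: "fst i \<in> Ob C" "snd i \<in> Hom C (fst i) a" "(snd i)\<^sup>\<star> \<in> Hom C a (fst i)" if "i \<in> I" for i
    using R(2,3)[OF that] irr_Ob O str_Hom by auto
  have "(\<Sum>i\<in>I. snd i \<cdot> ((snd i)\<^sup>\<star> \<cdot> f)) = (\<Sum>i\<in>I. (snd i \<cdot> (snd i)\<^sup>\<star>) \<cdot> f)"
    by (intro sum.cong refl) (metis cmp_assoc[OF O(2,1) v(1) O(1) f v(3,2)])
  also have "\<dots> = (\<Sum>i\<in>I. snd i \<cdot> (snd i)\<^sup>\<star>) \<cdot> f"
    by (intro cmp_sum_left[OF O(2,1,1) f, symmetric] cmp_Hom[OF O(1) v(1) O(1) v(3,2)])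
  also have "\<dots> = f" using R(4) cmp_idt[OF O(2,1) f] by simp
  finally show ?thesis .
qed

lemma resolution_vector:
  assumes I: "resolves I a (\<ii>\<dd> a)" and a: "a \<in> S" and x: "x \<in> fsp F a"
  shows "(\<Sum>i\<in>I. farr F (fst i) a (snd i) (farr F a (fst i) ((snd i)\<^sup>\<star>) x)) = x"
proof -
  note R = resolvesD[OF I] and O = S_Ob[OF a]
  have v: "fst i \<in> S" "snd i \<in> Hom C (fst i) a" "(snd i)\<^sup>\<star> \<in> Hom C a (fst i)" if "i \<in> I" for i
    using R(2,3)[OF that] irr_in_S irr_Ob O str_Hom by auto
  have "(\<Sum>i\<in>I. farr F (fst i) a (snd i) (farr F a (fst i) ((snd i)\<^sup>\<star>) x)) =
      (\<Sum>i\<in>I. farr F a a (snd i \<cdot> (snd i)\<^sup>\<star>) x)"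
    by (intro sum.cong refl) (metis farr_cmp[OF a v(1) a v(3,2) x])
  also have "\<dots> = farr F a a (\<Sum>i\<in>I. snd i \<cdot> (snd i)\<^sup>\<star>) x"
    by (intro farr_sum_arrow[OF a a x, symmetric] cmp_Hom[OF O S_Ob[OF v(1)] O v(3,2)])
  also have "\<dots> = x" using R(4) farr_idt[OF a x] by simp
  finally show ?thesis .
qed

text \<open>The bases entering the definition of the fusion of simple tensors resolve the identity.\<close>

lemma vbas_expansion:
  assumes k: "k \<in> irr P" "l \<in> irr P" "m \<in> irr P" and v: "v \<in> Hom C m (k \<odot> l)"
  shows "(\<Sum>u\<in>vbas P k l m. u \<cdot> (u\<^sup>\<star> \<cdot> v)) = v"
proof -
  let ?B = "vbas P k l m"
  note B = vbas_basis[OF k] and Om = irr_Ob[OF k(3)] and O = tob_Ob[OF irr_Ob[OF k(1)] irr_Ob[OF k(2)]]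
  have fin: "finite ?B" and uH: "u \<in> Hom C m (k \<odot> l)" if "u \<in> ?B" for u
    using B arrows.span_base[OF that] by auto
  have us: "u\<^sup>\<star> \<in> Hom C (k \<odot> l) m" if "u \<in> ?B" for u using uH[OF that] Om O by (intro str_Hom)
  have "v \<in> arrows.span ?B" using B v by simp
  then obtain c where c: "v = (\<Sum>w\<in>?B. scl C (c w) w)"
    unfolding arrows.span_finite[OF conjunct1[OF B]] by blast
  have "u\<^sup>\<star> \<cdot> v = scl C (c u) (\<ii>\<dd> m)" if u: "u \<in> ?B" for u
  proof -
    have "u\<^sup>\<star> \<cdot> v = (\<Sum>w\<in>?B. u\<^sup>\<star> \<cdot> scl C (c w) w)"
      unfolding c using uH by (intro cmp_sum_right[OF Om O Om us[OF u]] Hom_scl[OF Om O])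
    also have "\<dots> = (\<Sum>w\<in>?B. if w = u then scl C (c u) (\<ii>\<dd> m) else 0)"
    proof (intro sum.cong refl)
      fix w assume w: "w \<in> ?B"
      have "u\<^sup>\<star> \<cdot> scl C (c w) w = scl C (c w) (u\<^sup>\<star> \<cdot> w)"
        using cmp_scl[OF Om O Om uH[OF w] us[OF u]] by simp
      then show "u\<^sup>\<star> \<cdot> scl C (c w) w = (if w = u then scl C (c u) (\<ii>\<dd> m) else 0)"
        using vbas_orthonormal[OF k u w] by simp
    qed
    finally show ?thesis using u B by simp
  qed
  then have "(\<Sum>u\<in>?B. u \<cdot> (u\<^sup>\<star> \<cdot> v)) = (\<Sum>u\<in>?B. scl C (c u) u)"
    using cmp_scl[OF Om Om O idt_Hom[OF Om]] cmp_idt[OF Om O] uH by (intro sum.cong) auto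
  then show ?thesis using c by simp
qed

lemma
  assumes k: "k \<in> irr P" "l \<in> irr P"
  shows finite_fusion: "finite {m \<in> irr P. vbas P k l m \<noteq> {}}"
    and resolves_vbas: "resolves (Sigma {m \<in> irr P. vbas P k l m \<noteq> {}} (vbas P k l)) (k \<odot> l) (\<ii>\<dd> (k \<odot> l))"
proof -
  let ?a = "k \<odot> l" and ?M = "{m \<in> irr P. vbas P k l m \<noteq> {}}"
  have aS: "?a \<in> S" using k irr_in_S S_tob by auto
  note O = S_Ob[OF aS]
  obtain I where I: "resolves I ?a (\<ii>\<dd> ?a)" by (rule exists_resolution[OF aS])
  note R = resolvesD[OF I]
  have v: "fst i \<in> Ob C" "snd i \<in> Hom C (fst i) ?a" "(snd i)\<^sup>\<star> \<in> Hom C ?a (fst i)" if "i \<in> I" for i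
    using R(2,3)[OF that] irr_Ob O str_Hom by auto
  have uH: "u \<in> Hom C m ?a" and us: "u\<^sup>\<star> \<in> Hom C ?a m" if "m \<in> irr P" "u \<in> vbas P k l m" for m u
    using vbas_basis[OF k that(1)] arrows.span_base[OF that(2)] irr_Ob[OF that(1)] O str_Hom by auto
  have "?M \<subseteq> fst ` I"
  proof
    fix m assume "m \<in> ?M"
    then obtain u where m: "m \<in> irr P" and u: "u \<in> vbas P k l m" by auto
    note Om = irr_Ob[OF m]
    show "m \<in> fst ` I"
    proof (rule ccontr)
      assume no: "m \<notin> fst ` I"
      have "snd i \<cdot> ((snd i)\<^sup>\<star> \<cdot> u) = 0" if i: "i \<in> I" for i
      proof -
        have "(snd i)\<^sup>\<star> \<cdot> u = 0"
          using irr_distinct_Hom[OF m R(2)[OF i]] no i cmp_Hom[OF Om O v(1)[OF i] uH[OF m u] v(3)[OF i]]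
          by force
        then show ?thesis using cmp_zero_right[OF v(1)[OF i] O v(2)[OF i]] by simp
      qed
      then have "u = 0" using resolution_arrow[OF I O Om uH[OF m u]] by simp
      then have "\<ii>\<dd> m = 0" using vbas_orthonormal[OF k m u u] cmp_zero_right[OF O Om us[OF m u]] by simp
      then show False using irr_idt_nonzero[OF m] by simp
    qed
  qed
  then show fin: "finite ?M" using R(1) finite_subset by blast
  let ?J = "Sigma ?M (vbas P k l)"
  have finB: "finite (vbas P k l m)" if "m \<in> irr P" for m using vbas_basis[OF k that] by simp
  then have finJ: "finite ?J" using fin by auto
  have JO: "fst j \<in> Ob C" "snd j \<in> Hom C (fst j) ?a" "(snd j)\<^sup>\<star> \<in> Hom C ?a (fst j)" if "j \<in> ?J" for j
    using that uH us irr_Ob by auto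
  define p where "p = (\<Sum>j\<in>?J. snd j \<cdot> (snd j)\<^sup>\<star>)"
  have p: "p \<in> Hom C ?a ?a" unfolding p_def
    by (intro Hom_sum[OF O O] cmp_Hom[OF O JO(1) O JO(3,2)])
  have pv: "p \<cdot> w = w" if m: "m \<in> irr P" and w: "w \<in> Hom C m ?a" for m w
  proof -
    note Om = irr_Ob[OF m]
    have zero: "u \<cdot> (u\<^sup>\<star> \<cdot> w) = 0" if "m' \<in> irr P" "m' \<noteq> m" "u \<in> vbas P k l m'" for m' u
    proof -
      have "u\<^sup>\<star> \<cdot> w \<in> Hom C m m'"
        using cmp_Hom[OF Om O irr_Ob[OF that(1)] w us[OF that(1,3)]] .
      then have "u\<^sup>\<star> \<cdot> w = 0" using irr_distinct_Hom[OF m that(1)] that(2) by auto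
      then show ?thesis using cmp_zero_right[OF irr_Ob[OF that(1)] O uH[OF that(1,3)]] by simp
    qed
    have "p \<cdot> w = (\<Sum>j\<in>?J. (snd j \<cdot> (snd j)\<^sup>\<star>) \<cdot> w)"
      unfolding p_def by (intro cmp_sum_left[OF Om O O w] cmp_Hom[OF O JO(1) O JO(3,2)])
    also have "\<dots> = (\<Sum>j\<in>?J. snd j \<cdot> ((snd j)\<^sup>\<star> \<cdot> w))"
      by (intro sum.cong refl) (rule cmp_assoc[OF Om O JO(1) O w JO(3,2)])
    also have "\<dots> = (\<Sum>m'\<in>?M. \<Sum>u\<in>vbas P k l m'. u \<cdot> (u\<^sup>\<star> \<cdot> w))"
      using fin finB by (subst sum.Sigma) (auto simp: case_prod_unfold)
    also have "\<dots> = (\<Sum>m'\<in>?M. if m' = m then w else 0)"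
      using zero vbas_expansion[OF k m w] by (intro sum.cong refl) (auto intro: sum.neutral)
    also have "\<dots> = (if m \<in> ?M then w else 0)" using fin by simp
    also have "\<dots> = w" using vbas_expansion[OF k m w] m by auto
    finally show ?thesis .
  qed
  have "p = p \<cdot> \<ii>\<dd> ?a" using cmp_idt[OF O O p] by simp
  also have "\<dots> = (\<Sum>i\<in>I. p \<cdot> (snd i \<cdot> (snd i)\<^sup>\<star>))"
    unfolding R(4)[symmetric] by (intro cmp_sum_right[OF O O O p] cmp_Hom[OF O v(1) O v(3,2)])
  also have "\<dots> = (\<Sum>i\<in>I. snd i \<cdot> (snd i)\<^sup>\<star>)"
    by (intro sum.cong refl) (metis cmp_assoc[OF O v(1) O O v(3,2) p] pv[OF R(2,3)])
  also have "\<dots> = \<ii>\<dd> ?a" by (rule R(4))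
  finally show "resolves ?J ?a (\<ii>\<dd> ?a)"
    using finJ uH by (auto simp: resolves_def p_def case_prod_unfold)
qed


section \<open>Arrows of the crossed product\<close>

sublocale xarrs: vector_space "xscl C"
  by unfold_locales
    (auto simp: xscl_def fun_eq_iff arrows.scale_right_distrib arrows.scale_left_distrib)

lemma stensor_add_arrow: "stensor C F \<rho> \<sigma> k (s + s') \<psi> = stensor C F \<rho> \<sigma> k s \<psi> + stensor C F \<rho> \<sigma> k s' \<psi>"
  by (auto simp: stensor_def fun_eq_iff arrows.scale_right_distrib)

lemma stensor_scl_arrow: "stensor C F \<rho> \<sigma> k (scl C z s) \<psi> = xscl C z (stensor C F \<rho> \<sigma> k s \<psi>)"
  by (auto simp: stensor_def xscl_def fun_eq_iff mult.commute)

lemma stensor_zero_arrow: "stensor C F \<rho> \<sigma> k 0 \<psi> = 0"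
  by (auto simp: stensor_def fun_eq_iff)

lemma stensor_sum_arrow:
  "stensor C F \<rho> \<sigma> k (sum h I) \<psi> = (\<Sum>i\<in>I. stensor C F \<rho> \<sigma> k (h i) \<psi>)"
  by (induction I rule: infinite_finite_induct) (auto simp: stensor_zero_arrow stensor_add_arrow)

lemma stensor_add_vec: "\<lbrakk>k \<in> S; \<psi> \<in> fsp F k; \<psi>' \<in> fsp F k\<rbrakk>
    \<Longrightarrow> stensor C F \<rho> \<sigma> k s (\<psi> + \<psi>') = stensor C F \<rho> \<sigma> k s \<psi> + stensor C F \<rho> \<sigma> k s \<psi>'"
  by (auto simp: stensor_def fun_eq_iff fip_add_right arrows.scale_left_distrib)

lemma stensor_scl_vec: "\<lbrakk>k \<in> S; \<psi> \<in> fsp F k\<rbrakk>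
    \<Longrightarrow> stensor C F \<rho> \<sigma> k s (fsc F z \<psi>) = stensor C F \<rho> \<sigma> k (scl C z s) \<psi>"
  by (auto simp: stensor_def fun_eq_iff fip_scale_right mult.commute)

lemma stensor_zero_vec: "k \<in> S \<Longrightarrow> stensor C F \<rho> \<sigma> k s 0 = 0"
  by (auto simp: stensor_def fun_eq_iff fip_zero_right)

lemma stensor_sum_vec: "k \<in> S \<Longrightarrow> (\<And>i. i \<in> I \<Longrightarrow> h i \<in> fsp F k)
    \<Longrightarrow> stensor C F \<rho> \<sigma> k s (sum h I) = (\<Sum>i\<in>I. stensor C F \<rho> \<sigma> k s (h i))"
proof (induction I rule: infinite_finite_induct)
  case (insert i I)
  then show ?case using fsp_sum[OF insert.prems(1), of I h] by (simp add: stensor_add_vec)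
qed (auto simp: stensor_zero_vec)

text \<open>By Schur's lemma \<open>t\<close> is zero or a scalar multiple of an identity.\<close>

lemma stensor_slide:
  assumes m: "m \<in> irr P" "m' \<in> irr P" and t: "t \<in> Hom C m m'" and O: "\<rho> \<in> Ob C" "\<sigma> \<in> Ob C"
    and u: "u \<in> Hom C (m' \<odot> \<rho>) \<sigma>" and \<psi>: "\<psi> \<in> fsp F m"
  shows "stensor C F \<rho> \<sigma> m (u \<cdot> (t \<boxtimes> \<ii>\<dd> \<rho>)) \<psi> = stensor C F \<rho> \<sigma> m' u (farr F m m' t \<psi>)"
proof -
  note Om = irr_Ob[OF m(1)] irr_Ob[OF m(2)]
  note OO = tob_Ob[OF Om(1) O(1)] tob_Ob[OF Om(2) O(1)]
  show ?thesis
  proof (cases "m = m'")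
    case False
    then have t0: "t = 0" using irr_distinct_Hom[OF m _ t] by simp
    then have "u \<cdot> (t \<boxtimes> \<ii>\<dd> \<rho>) = 0"
      using tar_zero_left[OF O(1,1) Om(1) idt_Hom[OF O(1)]] cmp_zero_right[OF OO(2) O(2) u] by simp
    then show ?thesis
      using t0 farr_zero_arrow[OF irr_in_S[OF m(1)] irr_in_S[OF m(2)] \<psi>]
      by (simp add: stensor_zero_arrow stensor_zero_vec[OF irr_in_S[OF m(2)]])
  next
    case True
    obtain c where c: "t = scl C c (\<ii>\<dd> m)" using irr_endomorphism[OF m(1)] t True by auto
    note mS = irr_in_S[OF m(1)]
    have "t \<boxtimes> \<ii>\<dd> \<rho> = scl C c (\<ii>\<dd> (m \<odot> \<rho>))"
      unfolding c using tar_scl[OF Om(1,1) O(1,1) idt_Hom[OF Om(1)] idt_Hom[OF O(1)]] tar_idt[OF Om(1) O(1)]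
      by simp
    then have "u \<cdot> (t \<boxtimes> \<ii>\<dd> \<rho>) = scl C c u"
      using cmp_scl[OF OO(1,1) O(2) idt_Hom[OF OO(1)]] cmp_idt[OF OO(1) O(2)] u True by simp
    moreover have "farr F m m' t \<psi> = fsc F c \<psi>"
      using farr_scl[OF mS mS idt_Hom[OF Om(1)] \<psi>] farr_idt[OF mS \<psi>] c True by simp
    ultimately show ?thesis using stensor_scl_vec[OF mS \<psi>] True by simp
  qed
qed

text \<open>
  The arrow \<open>u \<otimes> \<psi>\<close> for an arbitrary object \<open>a\<close> of \<open>S\<close>: with these arrows the crossed product
  becomes the coend over \<open>S\<close> of \<open>Hom (a \<odot> \<rho>) \<sigma> \<otimes> F(a)\<close>, in which \<open>u \<cdot> (s \<boxtimes> \<ii>\<dd>)\<close> tensor \<open>\<psi>\<close> is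
  identified with \<open>u\<close> tensor \<open>F(s) \<psi>\<close>, and its operations no longer refer to bases.
\<close>

definition cten_on :: "('o \<times> 'v) set \<Rightarrow> 'o \<Rightarrow> 'o \<Rightarrow> 'o \<Rightarrow> 'v \<Rightarrow> 'h \<Rightarrow> ('o, 'v, 'h) xarr" where
  "cten_on I \<rho> \<sigma> a u \<psi> =
     (\<Sum>i\<in>I. stensor C F \<rho> \<sigma> (fst i) (u \<cdot> (snd i \<boxtimes> \<ii>\<dd> \<rho>)) (farr F a (fst i) ((snd i)\<^sup>\<star>) \<psi>))"

text \<open>
  Between the two resolutions \<open>s\<close> becomes a matrix of arrows between irreducible objects, which
  move across the tensor sign by Schur's lemma.  For an identity \<open>s\<close> this says that \<open>cten_on\<close> does
  not depend on the resolution.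
\<close>

lemma cten_on_slide:
  assumes ab: "a \<in> S" "b \<in> S" and s: "s \<in> Hom C a b" and O: "\<rho> \<in> Ob C" "\<sigma> \<in> Ob C"
    and u: "u \<in> Hom C (b \<odot> \<rho>) \<sigma>" and \<psi>: "\<psi> \<in> fsp F a"
    and I: "resolves I a (\<ii>\<dd> a)" and J: "resolves J b (\<ii>\<dd> b)"
  shows "cten_on I \<rho> \<sigma> a (u \<cdot> (s \<boxtimes> \<ii>\<dd> \<rho>)) \<psi> = cten_on J \<rho> \<sigma> b u (farr F a b s \<psi>)"
proof -
  note RI = resolvesD[OF I] and RJ = resolvesD[OF J] and Oab = S_Ob[OF ab(1)] S_Ob[OF ab(2)]
  note OO = tob_Ob[OF Oab(2) O(1)]
  have v: "fst i \<in> Ob C" "fst i \<in> S" "snd i \<in> Hom C (fst i) a" "(snd i)\<^sup>\<star> \<in> Hom C a (fst i)" if "i \<in> I" for i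
    using RI(2,3)[OF that] irr_Ob irr_in_S Oab str_Hom by auto
  have w: "fst j \<in> Ob C" "fst j \<in> S" "snd j \<in> Hom C (fst j) b" "(snd j)\<^sup>\<star> \<in> Hom C b (fst j)" if "j \<in> J" for j
    using RJ(2,3)[OF that] irr_Ob irr_in_S Oab str_Hom by auto
  define x where "x i = farr F a (fst i) ((snd i)\<^sup>\<star>) \<psi>" for i
  have x: "x i \<in> fsp F (fst i)" if "i \<in> I" for i
    unfolding x_def using farr_fsp[OF ab(1) v(2)[OF that] v(4)[OF that] \<psi>] .
  have sv: "s \<cdot> snd i \<in> Hom C (fst i) b" if "i \<in> I" for i
    using cmp_Hom[OF v(1)[OF that] Oab v(3)[OF that] s] .
  have step: "stensor C F \<rho> \<sigma> (fst i) ((u \<cdot> (s \<boxtimes> \<ii>\<dd> \<rho>)) \<cdot> (snd i \<boxtimes> \<ii>\<dd> \<rho>)) (x i) =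
      (\<Sum>j\<in>J. stensor C F \<rho> \<sigma> (fst j) (u \<cdot> (snd j \<boxtimes> \<ii>\<dd> \<rho>))
        (farr F b (fst j) ((snd j)\<^sup>\<star>) (farr F a b s (farr F (fst i) a (snd i) (x i)))))"
    if i: "i \<in> I" for i
  proof -
    note vi = v[OF i] and Oi = tob_Ob[OF v(1)[OF i] O(1)]
    have t: "(snd j)\<^sup>\<star> \<cdot> (s \<cdot> snd i) \<in> Hom C (fst i) (fst j)" if "j \<in> J" for j
      using cmp_Hom[OF vi(1) Oab(2) w(1)[OF that] sv[OF i] w(4)[OF that]] .
    have wt: "snd j \<cdot> ((snd j)\<^sup>\<star> \<cdot> (s \<cdot> snd i)) \<in> Hom C (fst i) b" if "j \<in> J" for j
      using cmp_Hom[OF vi(1) w(1)[OF that] Oab(2) t[OF that] w(3)[OF that]] .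
    have "(u \<cdot> (s \<boxtimes> \<ii>\<dd> \<rho>)) \<cdot> (snd i \<boxtimes> \<ii>\<dd> \<rho>) = u \<cdot> ((s \<boxtimes> \<ii>\<dd> \<rho>) \<cdot> (snd i \<boxtimes> \<ii>\<dd> \<rho>))"
      by (rule cmp_assoc[OF Oi tob_Ob[OF Oab(1) O(1)] OO O(2) tar_Hom[OF vi(1) Oab(1) O(1,1) vi(3) idt_Hom[OF O(1)]]
            tar_Hom[OF Oab O(1,1) s idt_Hom[OF O(1)]] u])
    also have "(s \<boxtimes> \<ii>\<dd> \<rho>) \<cdot> (snd i \<boxtimes> \<ii>\<dd> \<rho>) = (s \<cdot> snd i) \<boxtimes> \<ii>\<dd> \<rho>"
      using tar_cmp[OF vi(1) Oab O(1,1,1) vi(3) s idt_Hom[OF O(1)] idt_Hom[OF O(1)]]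
        cmp_idt[OF O(1,1) idt_Hom[OF O(1)]] by simp
    also have "s \<cdot> snd i = (\<Sum>j\<in>J. snd j \<cdot> ((snd j)\<^sup>\<star> \<cdot> (s \<cdot> snd i)))"
      by (rule resolution_arrow[OF J Oab(2) vi(1) sv[OF i], symmetric])
    also have "\<dots> \<boxtimes> \<ii>\<dd> \<rho> = (\<Sum>j\<in>J. (snd j \<cdot> ((snd j)\<^sup>\<star> \<cdot> (s \<cdot> snd i))) \<boxtimes> \<ii>\<dd> \<rho>)"
      by (rule tar_sum_left[OF vi(1) Oab(2) O(1,1) idt_Hom[OF O(1)] wt])
    also have "u \<cdot> \<dots> = (\<Sum>j\<in>J. u \<cdot> ((snd j \<cdot> ((snd j)\<^sup>\<star> \<cdot> (s \<cdot> snd i))) \<boxtimes> \<ii>\<dd> \<rho>))"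
      by (rule cmp_sum_right[OF Oi OO O(2) u]) (rule tar_Hom[OF vi(1) Oab(2) O(1,1) wt idt_Hom[OF O(1)]])
    also have "\<dots> = (\<Sum>j\<in>J. (u \<cdot> (snd j \<boxtimes> \<ii>\<dd> \<rho>)) \<cdot> (((snd j)\<^sup>\<star> \<cdot> (s \<cdot> snd i)) \<boxtimes> \<ii>\<dd> \<rho>))"
    proof (intro sum.cong refl)
      fix j assume j: "j \<in> J"
      note wj = w[OF j]
      have "(snd j \<cdot> ((snd j)\<^sup>\<star> \<cdot> (s \<cdot> snd i))) \<boxtimes> \<ii>\<dd> \<rho> = (snd j \<boxtimes> \<ii>\<dd> \<rho>) \<cdot> (((snd j)\<^sup>\<star> \<cdot> (s \<cdot> snd i)) \<boxtimes> \<ii>\<dd> \<rho>)"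
        using tar_cmp[OF vi(1) wj(1) Oab(2) O(1,1,1) t[OF j] wj(3) idt_Hom[OF O(1)] idt_Hom[OF O(1)]]
          cmp_idt[OF O(1,1) idt_Hom[OF O(1)]] by simp
      then show "u \<cdot> ((snd j \<cdot> ((snd j)\<^sup>\<star> \<cdot> (s \<cdot> snd i))) \<boxtimes> \<ii>\<dd> \<rho>) =
          (u \<cdot> (snd j \<boxtimes> \<ii>\<dd> \<rho>)) \<cdot> (((snd j)\<^sup>\<star> \<cdot> (s \<cdot> snd i)) \<boxtimes> \<ii>\<dd> \<rho>)"
        using cmp_assoc[OF Oi tob_Ob[OF wj(1) O(1)] OO O(2) tar_Hom[OF vi(1) wj(1) O(1,1) t[OF j] idt_Hom[OF O(1)]]
            tar_Hom[OF wj(1) Oab(2) O(1,1) wj(3) idt_Hom[OF O(1)]] u] by simp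
    qed
    finally have "stensor C F \<rho> \<sigma> (fst i) ((u \<cdot> (s \<boxtimes> \<ii>\<dd> \<rho>)) \<cdot> (snd i \<boxtimes> \<ii>\<dd> \<rho>)) (x i) =
        (\<Sum>j\<in>J. stensor C F \<rho> \<sigma> (fst i) ((u \<cdot> (snd j \<boxtimes> \<ii>\<dd> \<rho>)) \<cdot> (((snd j)\<^sup>\<star> \<cdot> (s \<cdot> snd i)) \<boxtimes> \<ii>\<dd> \<rho>)) (x i))"
      by (simp add: stensor_sum_arrow)
    also have "\<dots> = (\<Sum>j\<in>J. stensor C F \<rho> \<sigma> (fst j) (u \<cdot> (snd j \<boxtimes> \<ii>\<dd> \<rho>))
        (farr F b (fst j) ((snd j)\<^sup>\<star>) (farr F a b s (farr F (fst i) a (snd i) (x i)))))"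
    proof (intro sum.cong refl)
      fix j assume j: "j \<in> J"
      note wj = w[OF j]
      have "farr F (fst i) (fst j) ((snd j)\<^sup>\<star> \<cdot> (s \<cdot> snd i)) (x i) =
          farr F b (fst j) ((snd j)\<^sup>\<star>) (farr F a b s (farr F (fst i) a (snd i) (x i)))"
        using farr_cmp[OF vi(2) ab(2) wj(2) sv[OF i] wj(4) x[OF i]] farr_cmp[OF vi(2) ab vi(3) s x[OF i]]
        by simp
      moreover have "u \<cdot> (snd j \<boxtimes> \<ii>\<dd> \<rho>) \<in> Hom C (fst j \<odot> \<rho>) \<sigma>"
        by (rule cmp_Hom[OF tob_Ob[OF wj(1) O(1)] OO O(2) tar_Hom[OF wj(1) Oab(2) O(1,1) wj(3) idt_Hom[OF O(1)]] u])
      ultimately show "stensor C F \<rho> \<sigma> (fst i) ((u \<cdot> (snd j \<boxtimes> \<ii>\<dd> \<rho>)) \<cdot> (((snd j)\<^sup>\<star> \<cdot> (s \<cdot> snd i)) \<boxtimes> \<ii>\<dd> \<rho>)) (x i) =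
          stensor C F \<rho> \<sigma> (fst j) (u \<cdot> (snd j \<boxtimes> \<ii>\<dd> \<rho>))
            (farr F b (fst j) ((snd j)\<^sup>\<star>) (farr F a b s (farr F (fst i) a (snd i) (x i))))"
        using stensor_slide[OF RI(2)[OF i] RJ(2)[OF j] t[OF j] O _ x[OF i]] by simp
    qed
    finally show ?thesis .
  qed
  have vx: "farr F (fst i) a (snd i) (x i) \<in> fsp F a" if "i \<in> I" for i
    using farr_fsp[OF v(2)[OF that] ab(1) v(3)[OF that] x[OF that]] .
  have svx: "farr F a b s (farr F (fst i) a (snd i) (x i)) \<in> fsp F b" if "i \<in> I" for i
    using farr_fsp[OF ab s vx[OF that]] .
  have "cten_on I \<rho> \<sigma> a (u \<cdot> (s \<boxtimes> \<ii>\<dd> \<rho>)) \<psi> =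
      (\<Sum>j\<in>J. \<Sum>i\<in>I. stensor C F \<rho> \<sigma> (fst j) (u \<cdot> (snd j \<boxtimes> \<ii>\<dd> \<rho>))
        (farr F b (fst j) ((snd j)\<^sup>\<star>) (farr F a b s (farr F (fst i) a (snd i) (x i)))))"
    unfolding cten_on_def x_def[symmetric] by (subst sum.swap) (intro sum.cong refl step)
  also have "\<dots> = cten_on J \<rho> \<sigma> b u (farr F a b s \<psi>)"
    unfolding cten_on_def
  proof (intro sum.cong refl)
    fix j assume j: "j \<in> J"
    note wj = w[OF j]
    have "(\<Sum>i\<in>I. farr F b (fst j) ((snd j)\<^sup>\<star>) (farr F a b s (farr F (fst i) a (snd i) (x i)))) =
        farr F b (fst j) ((snd j)\<^sup>\<star>) (farr F a b s (\<Sum>i\<in>I. farr F (fst i) a (snd i) (x i)))"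
      using vx svx by (simp add: farr_sum[OF ab s] farr_sum[OF ab(2) wj(2,4)])
    also have "(\<Sum>i\<in>I. farr F (fst i) a (snd i) (x i)) = \<psi>"
      unfolding x_def by (rule resolution_vector[OF I ab(1) \<psi>])
    finally show "(\<Sum>i\<in>I. stensor C F \<rho> \<sigma> (fst j) (u \<cdot> (snd j \<boxtimes> \<ii>\<dd> \<rho>))
        (farr F b (fst j) ((snd j)\<^sup>\<star>) (farr F a b s (farr F (fst i) a (snd i) (x i))))) =
        stensor C F \<rho> \<sigma> (fst j) (u \<cdot> (snd j \<boxtimes> \<ii>\<dd> \<rho>)) (farr F b (fst j) ((snd j)\<^sup>\<star>) (farr F a b s \<psi>))"
      using stensor_sum_vec[OF wj(2), of I "\<lambda>i. farr F b (fst j) ((snd j)\<^sup>\<star>) (farr F a b s (farr F (fst i) a (snd i) (x i)))"]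
        farr_fsp[OF ab(2) wj(2,4) svx] by simp
  qed
  finally show ?thesis .
qed

definition resolution :: "'o \<Rightarrow> ('o \<times> 'v) set" where
  "resolution a = (SOME I. resolves I a (\<ii>\<dd> a))"

lemma resolves_resolution: "a \<in> S \<Longrightarrow> resolves (resolution a) a (\<ii>\<dd> a)"
  unfolding resolution_def using exists_resolution[of a] by (metis someI_ex)

definition cten :: "'o \<Rightarrow> 'o \<Rightarrow> 'o \<Rightarrow> 'v \<Rightarrow> 'h \<Rightarrow> ('o, 'v, 'h) xarr" where
  "cten \<rho> \<sigma> a u \<psi> = cten_on (resolution a) \<rho> \<sigma> a u \<psi>"

lemma cten_slide:
  assumes "a \<in> S" "b \<in> S" "s \<in> Hom C a b" "\<rho> \<in> Ob C" "\<sigma> \<in> Ob C" "u \<in> Hom C (b \<odot> \<rho>) \<sigma>" "\<psi> \<in> fsp F a"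
  shows "cten \<rho> \<sigma> a (u \<cdot> (s \<boxtimes> \<ii>\<dd> \<rho>)) \<psi> = cten \<rho> \<sigma> b u (farr F a b s \<psi>)"
  unfolding cten_def using assms by (intro cten_on_slide resolves_resolution)

lemma cten_eq:
  assumes a: "a \<in> S" and I: "resolves I a (\<ii>\<dd> a)" and O: "\<rho> \<in> Ob C" "\<sigma> \<in> Ob C"
    and u: "u \<in> Hom C (a \<odot> \<rho>) \<sigma>" and \<psi>: "\<psi> \<in> fsp F a"
  shows "cten \<rho> \<sigma> a u \<psi> = cten_on I \<rho> \<sigma> a u \<psi>"
proof -
  note Oa = S_Ob[OF a]
  have "u \<cdot> (\<ii>\<dd> a \<boxtimes> \<ii>\<dd> \<rho>) = u" using tar_idt[OF Oa O(1)] cmp_idt[OF tob_Ob[OF Oa O(1)] O(2) u] by simp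
  then show ?thesis
    using cten_on_slide[OF a a idt_Hom[OF Oa] O u \<psi> resolves_resolution[OF a] I] farr_idt[OF a \<psi>]
    by (simp add: cten_def)
qed

lemma resolves_irr: "k \<in> irr P \<Longrightarrow> resolves {(k, \<ii>\<dd> k)} k (\<ii>\<dd> k)"
  using idt_Hom[OF irr_Ob[of k]] str_idt[OF irr_Ob[of k]] cmp_idt[OF irr_Ob[of k] irr_Ob[of k]]
  by (simp add: resolves_def)

lemma cten_irr:
  assumes k: "k \<in> irr P" and O: "\<rho> \<in> Ob C" "\<sigma> \<in> Ob C"
    and u: "u \<in> Hom C (k \<odot> \<rho>) \<sigma>" and \<psi>: "\<psi> \<in> fsp F k"
  shows "cten \<rho> \<sigma> k u \<psi> = stensor C F \<rho> \<sigma> k u \<psi>"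
  using cten_eq[OF irr_in_S[OF k] resolves_irr[OF k] O u \<psi>] tar_idt[OF irr_Ob[OF k] O(1)]
    cmp_idt[OF tob_Ob[OF irr_Ob[OF k] O(1)] O(2) u] str_idt[OF irr_Ob[OF k]] farr_idt[OF irr_in_S[OF k] \<psi>]
  by (simp add: cten_on_def)

lemma xfuse_cten:
  assumes k: "k \<in> irr P" "l \<in> irr P" and O: "\<rho> \<in> Ob C" "\<sigma> \<in> Ob C"
    and u: "u \<in> Hom C ((k \<odot> l) \<odot> \<rho>) \<sigma>" and \<psi>: "\<psi> \<in> fsp F k" "\<psi>' \<in> fsp F l"
  shows "xfuse C F P \<rho> \<sigma> k l u \<psi> \<psi>' = cten \<rho> \<sigma> (k \<odot> l) u (ften F k l \<psi> \<psi>')"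
proof -
  note kS = irr_in_S[OF k(1)] irr_in_S[OF k(2)]
  have mem: "ften F k l \<psi> \<psi>' \<in> fsp F (k \<odot> l)"
    unfolding ften_span[OF kS, symmetric] using \<psi> by (intro vecs.span_base) auto
  show ?thesis
    unfolding cten_eq[OF S_tob[OF kS] resolves_vbas[OF k] O u mem] xfuse_def cten_on_def
    using finite_fusion[OF k] vbas_basis[OF k] by (subst sum.Sigma) (auto simp: case_prod_unfold)
qed

lemma ften_fsp: "\<lbrakk>a \<in> S; b \<in> S; x \<in> fsp F a; y \<in> fsp F b\<rbrakk> \<Longrightarrow> ften F a b x y \<in> fsp F (a \<odot> b)"
  unfolding ften_span[symmetric] by (intro vecs.span_base) auto

lemma ften_sum_left:
  assumes "a \<in> S" "b \<in> S" "y \<in> fsp F b" "\<And>i. i \<in> I \<Longrightarrow> h i \<in> fsp F a"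
  shows "ften F a b (sum h I) y = (\<Sum>i\<in>I. ften F a b (h i) y)"
  using assms(4)
proof (induction I rule: infinite_finite_induct)
  case (insert i I)
  then show ?case
    using ften_add[OF assms(1,2) _ _ assms(3,3), of "h i" "sum h I"] fsp_sum[OF assms(1), of I h] by simp
qed (use ften_scl[OF assms(1,2) fsp_zero[OF assms(1)] assms(3), of 0] in auto)

lemma ften_sum_right:
  assumes "a \<in> S" "b \<in> S" "x \<in> fsp F a" "\<And>i. i \<in> I \<Longrightarrow> h i \<in> fsp F b"
  shows "ften F a b x (sum h I) = (\<Sum>i\<in>I. ften F a b x (h i))"
  using assms(4)
proof (induction I rule: infinite_finite_induct)
  case (insert i I)
  then show ?case
    using ften_add[OF assms(1,2) assms(3,3), of "h i" "sum h I"] fsp_sum[OF assms(2), of I h] by simp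
qed (use ften_scl[OF assms(1,2,3) fsp_zero[OF assms(2)], of 0] in auto)

context
  fixes a \<rho> \<sigma> assumes a: "a \<in> S" and O: "\<rho> \<in> Ob C" "\<sigma> \<in> Ob C"
begin

lemma resolution_member:
  assumes "i \<in> resolution a"
  shows "fst i \<in> irr P" "fst i \<in> S" "fst i \<in> Ob C" "snd i \<in> Hom C (fst i) a" "(snd i)\<^sup>\<star> \<in> Hom C a (fst i)"
    "\<psi> \<in> fsp F a \<Longrightarrow> farr F a (fst i) ((snd i)\<^sup>\<star>) \<psi> \<in> fsp F (fst i)"
    "u \<in> Hom C (a \<odot> \<rho>) \<sigma> \<Longrightarrow> u \<cdot> (snd i \<boxtimes> \<ii>\<dd> \<rho>) \<in> Hom C (fst i \<odot> \<rho>) \<sigma>"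
    "snd i \<boxtimes> \<ii>\<dd> \<rho> \<in> Hom C (fst i \<odot> \<rho>) (a \<odot> \<rho>)"
proof -
  note R = resolvesD[OF resolves_resolution[OF a]]
  show "fst i \<in> irr P" by (rule R(2)[OF assms])
  then show m: "fst i \<in> S" "fst i \<in> Ob C" using irr_in_S irr_Ob by auto
  show v: "snd i \<in> Hom C (fst i) a" by (rule R(3)[OF assms])
  then show vs: "(snd i)\<^sup>\<star> \<in> Hom C a (fst i)" using m S_Ob[OF a] by (intro str_Hom)
  show "\<psi> \<in> fsp F a \<Longrightarrow> farr F a (fst i) ((snd i)\<^sup>\<star>) \<psi> \<in> fsp F (fst i)" by (rule farr_fsp[OF a m(1) vs])
  show vr: "snd i \<boxtimes> \<ii>\<dd> \<rho> \<in> Hom C (fst i \<odot> \<rho>) (a \<odot> \<rho>)"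
    by (rule tar_Hom[OF m(2) S_Ob[OF a] O(1,1) v idt_Hom[OF O(1)]])
  show "u \<in> Hom C (a \<odot> \<rho>) \<sigma> \<Longrightarrow> u \<cdot> (snd i \<boxtimes> \<ii>\<dd> \<rho>) \<in> Hom C (fst i \<odot> \<rho>) \<sigma>"
    by (rule cmp_Hom[OF tob_Ob[OF m(2) O(1)] tob_Ob[OF S_Ob[OF a] O(1)] O(2) vr])
qed

lemma cten_add_arrow:
  assumes "u \<in> Hom C (a \<odot> \<rho>) \<sigma>" "u' \<in> Hom C (a \<odot> \<rho>) \<sigma>"
  shows "cten \<rho> \<sigma> a (u + u') \<psi> = cten \<rho> \<sigma> a u \<psi> + cten \<rho> \<sigma> a u' \<psi>"
proof -
  have "(u + u') \<cdot> (snd i \<boxtimes> \<ii>\<dd> \<rho>) = (u \<cdot> (snd i \<boxtimes> \<ii>\<dd> \<rho>)) + (u' \<cdot> (snd i \<boxtimes> \<ii>\<dd> \<rho>))" if "i \<in> resolution a" for i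
    using cmp_add[OF tob_Ob[OF resolution_member(3)[OF that] O(1)] tob_Ob[OF S_Ob[OF a] O(1)] O(2)
        resolution_member(8,8)[OF that] assms] by simp
  then show ?thesis by (simp add: cten_def cten_on_def stensor_add_arrow sum.distrib)
qed

lemma cten_scl_arrow:
  assumes "u \<in> Hom C (a \<odot> \<rho>) \<sigma>"
  shows "cten \<rho> \<sigma> a (scl C z u) \<psi> = xscl C z (cten \<rho> \<sigma> a u \<psi>)"
proof -
  have "(scl C z u) \<cdot> (snd i \<boxtimes> \<ii>\<dd> \<rho>) = scl C z (u \<cdot> (snd i \<boxtimes> \<ii>\<dd> \<rho>))" if "i \<in> resolution a" for i
    using cmp_scl[OF tob_Ob[OF resolution_member(3)[OF that] O(1)] tob_Ob[OF S_Ob[OF a] O(1)] O(2)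
        resolution_member(8)[OF that] assms] by simp
  then show ?thesis by (simp add: cten_def cten_on_def stensor_scl_arrow xarrs.scale_sum_right)
qed

lemma cten_add_vec: "\<lbrakk>\<psi> \<in> fsp F a; \<psi>' \<in> fsp F a\<rbrakk>
    \<Longrightarrow> cten \<rho> \<sigma> a u (\<psi> + \<psi>') = cten \<rho> \<sigma> a u \<psi> + cten \<rho> \<sigma> a u \<psi>'"
  using resolution_member
  by (simp add: cten_def cten_on_def farr_plus[OF a] stensor_add_vec sum.distrib)

lemma cten_scl_vec:
  assumes "u \<in> Hom C (a \<odot> \<rho>) \<sigma>" "\<psi> \<in> fsp F a"
  shows "cten \<rho> \<sigma> a u (fsc F z \<psi>) = xscl C z (cten \<rho> \<sigma> a u \<psi>)"
  using resolution_member assms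
  by (simp add: cten_def cten_on_def farr_fsc[OF a] stensor_scl_vec stensor_scl_arrow xarrs.scale_sum_right)

lemma cten_zero_vec: "cten \<rho> \<sigma> a u 0 = 0"
  using resolution_member by (simp add: cten_def cten_on_def farr_zero[OF a] stensor_zero_vec)

lemma cten_sum_vec: "(\<And>i. i \<in> I \<Longrightarrow> h i \<in> fsp F a) \<Longrightarrow> cten \<rho> \<sigma> a u (sum h I) = (\<Sum>i\<in>I. cten \<rho> \<sigma> a u (h i))"
proof (induction I rule: infinite_finite_induct)
  case (insert i I)
  then show ?case using fsp_sum[OF a, of I h] by (simp add: cten_add_vec)
qed (auto simp: cten_zero_vec)

lemma cten_expand:
  assumes "u \<in> Hom C (a \<odot> \<rho>) \<sigma>" "\<psi> \<in> fsp F a"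
  shows "cten \<rho> \<sigma> a u \<psi> = (\<Sum>i\<in>resolution a.
    stensor C F \<rho> \<sigma> (fst i) (u \<cdot> (snd i \<boxtimes> \<ii>\<dd> \<rho>)) (farr F a (fst i) ((snd i)\<^sup>\<star>) \<psi>))"
  by (simp add: cten_def cten_on_def)

end

context
  fixes \<rho> \<sigma> assumes O: "\<rho> \<in> Ob C" "\<sigma> \<in> Ob C"
begin

lemma xHom_add: "\<lbrakk>x \<in> xHom C F P \<rho> \<sigma>; y \<in> xHom C F P \<rho> \<sigma>\<rbrakk> \<Longrightarrow> x + y \<in> xHom C F P \<rho> \<sigma>"
  and xHom_zero: "0 \<in> xHom C F P \<rho> \<sigma>"
  and xHom_sum: "(\<And>i. i \<in> I \<Longrightarrow> f i \<in> xHom C F P \<rho> \<sigma>) \<Longrightarrow> sum f I \<in> xHom C F P \<rho> \<sigma>"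
  by (auto simp: xHom_def intro: xarrs.span_add xarrs.span_zero xarrs.span_sum)

lemma stensor_xHom: "\<lbrakk>k \<in> irr P; s \<in> Hom C (k \<odot> \<rho>) \<sigma>; \<psi> \<in> fsp F k\<rbrakk> \<Longrightarrow> stensor C F \<rho> \<sigma> k s \<psi> \<in> xHom C F P \<rho> \<sigma>"
  unfolding xHom_def by (intro xarrs.span_base) auto

lemma xHom_induct [consumes 1, case_names zero add]:
  assumes x: "x \<in> xHom C F P \<rho> \<sigma>"
    and zero: "Q 0"
    and add: "\<And>k s \<psi> y. \<lbrakk>k \<in> irr P; s \<in> Hom C (k \<odot> \<rho>) \<sigma>; \<psi> \<in> fsp F k; y \<in> xHom C F P \<rho> \<sigma>; Q y\<rbrakk>
      \<Longrightarrow> Q (stensor C F \<rho> \<sigma> k s \<psi> + y)"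
  shows "Q x"
proof -
  let ?G = "{stensor C F \<rho> \<sigma> k s \<psi> | k s \<psi>. k \<in> irr P \<and> s \<in> Hom C (k \<odot> \<rho>) \<sigma> \<and> \<psi> \<in> fsp F k}"
  have "x \<in> xarrs.span ?G" using x by (simp add: xHom_def)
  then have "x \<in> xHom C F P \<rho> \<sigma> \<and> Q x"
  proof (induction rule: xarrs.span_induct_alt)
    case base
    show ?case by (intro conjI xHom_zero zero)
  next
    case (step c x y)
    then obtain k s \<psi> where k: "k \<in> irr P" "s \<in> Hom C (k \<odot> \<rho>) \<sigma>" "\<psi> \<in> fsp F k"
      and x: "x = stensor C F \<rho> \<sigma> k s \<psi>" by auto
    have s: "scl C c s \<in> Hom C (k \<odot> \<rho>) \<sigma>" using irr_Ob[OF k(1)] O k(2) by (intro Hom_scl tob_Ob)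
    have eq: "xscl C c x = stensor C F \<rho> \<sigma> k (scl C c s) \<psi>" by (simp add: x stensor_scl_arrow)
    have y: "y \<in> xHom C F P \<rho> \<sigma>" "Q y" using step(2) by blast+
    show ?case unfolding eq
      by (intro conjI xHom_add stensor_xHom add k(1) s k(3) y)
  qed
  then show ?thesis by simp
qed

lemma cten_xHom: "\<lbrakk>a \<in> S; u \<in> Hom C (a \<odot> \<rho>) \<sigma>; \<psi> \<in> fsp F a\<rbrakk> \<Longrightarrow> cten \<rho> \<sigma> a u \<psi> \<in> xHom C F P \<rho> \<sigma>"
  using cten_expand[OF _ O] resolution_member[OF _ O] by (auto intro!: xHom_sum stensor_xHom)

lemma xHom_component:
  assumes "x \<in> xHom C F P \<rho> \<sigma>"
  shows "x t \<noteq> 0 \<Longrightarrow> \<exists>k\<in>irr P. t = (\<rho>, \<sigma>, k)"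
    and "finite {k. x (\<rho>, \<sigma>, k) \<noteq> 0}"
    and "k \<in> irr P \<Longrightarrow> x (\<rho>, \<sigma>, k) \<phi> \<in> Hom C (k \<odot> \<rho>) \<sigma>"
proof -
  have "(\<forall>t. x t \<noteq> 0 \<longrightarrow> (\<exists>k\<in>irr P. t = (\<rho>, \<sigma>, k))) \<and> finite {k. x (\<rho>, \<sigma>, k) \<noteq> 0} \<and>
      (\<forall>k\<in>irr P. \<forall>\<phi>. x (\<rho>, \<sigma>, k) \<phi> \<in> Hom C (k \<odot> \<rho>) \<sigma>)"
    using assms
  proof (induction rule: xHom_induct)
    case zero
    show ?case using O irr_Ob by (auto intro: Hom_zero tob_Ob)
  next
    case (add k s \<psi> y)
    let ?s = "stensor C F \<rho> \<sigma> k s \<psi>"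
    have st: "?s t = 0" if "t \<noteq> (\<rho>, \<sigma>, k)" for t using that by (auto simp: stensor_def fun_eq_iff)
    have sv: "?s (\<rho>, \<sigma>, l) \<phi> \<in> Hom C (l \<odot> \<rho>) \<sigma>" if "l \<in> irr P" for l \<phi>
    proof (cases "l = k \<and> \<phi> \<in> fsp F k")
      case True
      then show ?thesis using add(2) tob_Ob[OF irr_Ob[OF add(1)] O(1)] O(2)
        by (auto simp: stensor_def intro: Hom_scl)
    next
      case False
      then have "?s (\<rho>, \<sigma>, l) \<phi> = 0" by (auto simp: stensor_def)
      then show ?thesis using Hom_zero[OF tob_Ob[OF irr_Ob[OF that] O(1)] O(2)] by simp
    qed
    have "{l. (?s + y) (\<rho>, \<sigma>, l) \<noteq> 0} \<subseteq> insert k {l. y (\<rho>, \<sigma>, l) \<noteq> 0}"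
    proof
      fix l assume "l \<in> {l. (?s + y) (\<rho>, \<sigma>, l) \<noteq> 0}"
      then have "?s (\<rho>, \<sigma>, l) + y (\<rho>, \<sigma>, l) \<noteq> 0" by simp
      then show "l \<in> insert k {l. y (\<rho>, \<sigma>, l) \<noteq> 0}" using st[of "(\<rho>, \<sigma>, l)"] by auto
    qed
    then have "finite {l. (?s + y) (\<rho>, \<sigma>, l) \<noteq> 0}" using add(5) finite_subset by blast
    moreover have "\<exists>k\<in>irr P. t = (\<rho>, \<sigma>, k)" if "(?s + y) t \<noteq> 0" for t
    proof (cases "t = (\<rho>, \<sigma>, k)")
      case False
      then have "y t \<noteq> 0" using that st by auto
      then show ?thesis using add(5) by blast
    qed (use add(1) in auto)
    moreover have "(?s + y) (\<rho>, \<sigma>, l) \<phi> \<in> Hom C (l \<odot> \<rho>) \<sigma>" if "l \<in> irr P" for l \<phi>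
      using sv[OF that] add(5) that O irr_Ob[OF that] by (auto intro!: Hom_add tob_Ob)
    ultimately show ?case by blast
  qed
  then show "x t \<noteq> 0 \<Longrightarrow> \<exists>k\<in>irr P. t = (\<rho>, \<sigma>, k)" "finite {k. x (\<rho>, \<sigma>, k) \<noteq> 0}"
    "k \<in> irr P \<Longrightarrow> x (\<rho>, \<sigma>, k) \<phi> \<in> Hom C (k \<odot> \<rho>) \<sigma>"
    by blast+
qed

lemma xHom_support:
  assumes "x \<in> xHom C F P \<rho> \<sigma>"
  shows "finite {k. x (\<rho>, \<sigma>, k) \<noteq> 0}" "{k. x (\<rho>, \<sigma>, k) \<noteq> 0} \<subseteq> irr P"
proof -
  show "finite {k. x (\<rho>, \<sigma>, k) \<noteq> 0}" by (rule xHom_component(2)[OF assms])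
  show "{k. x (\<rho>, \<sigma>, k) \<noteq> 0} \<subseteq> irr P"
  proof
    fix k assume "k \<in> {k. x (\<rho>, \<sigma>, k) \<noteq> 0}"
    then show "k \<in> irr P" using xHom_component(1)[OF assms, of "(\<rho>, \<sigma>, k)"] by auto
  qed
qed

text \<open>
  The condition for \<open>f\<close> to be defined on the tensor products \<open>Hom (k \<odot> \<rho>) \<sigma> \<otimes> F(k)\<close> over the complex
  numbers, as an additive map.
\<close>

definition balanced :: "('o \<Rightarrow> 'o \<Rightarrow> 'o \<Rightarrow> 'v \<Rightarrow> 'h \<Rightarrow> 'b::ab_group_add) \<Rightarrow> bool" where
  "balanced f \<longleftrightarrow> (\<forall>k\<in>irr P. \<forall>s\<in>Hom C (k \<odot> \<rho>) \<sigma>. \<forall>\<psi>\<in>fsp F k.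
     (\<forall>s'\<in>Hom C (k \<odot> \<rho>) \<sigma>. f \<rho> \<sigma> k (s + s') \<psi> = f \<rho> \<sigma> k s \<psi> + f \<rho> \<sigma> k s' \<psi>) \<and>
     (\<forall>\<psi>'\<in>fsp F k. f \<rho> \<sigma> k s (\<psi> + \<psi>') = f \<rho> \<sigma> k s \<psi> + f \<rho> \<sigma> k s \<psi>') \<and>
     (\<forall>z. f \<rho> \<sigma> k (scl C z s) \<psi> = f \<rho> \<sigma> k s (fsc F z \<psi>)))"

lemma balancedI:
  assumes "\<And>k s s' \<psi>. \<lbrakk>k \<in> irr P; s \<in> Hom C (k \<odot> \<rho>) \<sigma>; s' \<in> Hom C (k \<odot> \<rho>) \<sigma>; \<psi> \<in> fsp F k\<rbrakk>
      \<Longrightarrow> f \<rho> \<sigma> k (s + s') \<psi> = f \<rho> \<sigma> k s \<psi> + f \<rho> \<sigma> k s' \<psi>"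
    and "\<And>k s \<psi> \<psi>'. \<lbrakk>k \<in> irr P; s \<in> Hom C (k \<odot> \<rho>) \<sigma>; \<psi> \<in> fsp F k; \<psi>' \<in> fsp F k\<rbrakk>
      \<Longrightarrow> f \<rho> \<sigma> k s (\<psi> + \<psi>') = f \<rho> \<sigma> k s \<psi> + f \<rho> \<sigma> k s \<psi>'"
    and "\<And>k s \<psi> z. \<lbrakk>k \<in> irr P; s \<in> Hom C (k \<odot> \<rho>) \<sigma>; \<psi> \<in> fsp F k\<rbrakk>
      \<Longrightarrow> f \<rho> \<sigma> k (scl C z s) \<psi> = f \<rho> \<sigma> k s (fsc F z \<psi>)"
  shows "balanced f"
  unfolding balanced_def using assms by blast

context
  fixes f :: "'o \<Rightarrow> 'o \<Rightarrow> 'o \<Rightarrow> 'v \<Rightarrow> 'h \<Rightarrow> 'b::ab_group_add"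
  assumes f: "balanced f"
begin

lemma balanced_add: "\<lbrakk>k \<in> irr P; s \<in> Hom C (k \<odot> \<rho>) \<sigma>; s' \<in> Hom C (k \<odot> \<rho>) \<sigma>; \<psi> \<in> fsp F k\<rbrakk>
    \<Longrightarrow> f \<rho> \<sigma> k (s + s') \<psi> = f \<rho> \<sigma> k s \<psi> + f \<rho> \<sigma> k s' \<psi>"
  and balanced_add_vec: "\<lbrakk>k \<in> irr P; s \<in> Hom C (k \<odot> \<rho>) \<sigma>; \<psi> \<in> fsp F k; \<psi>' \<in> fsp F k\<rbrakk>
    \<Longrightarrow> f \<rho> \<sigma> k s (\<psi> + \<psi>') = f \<rho> \<sigma> k s \<psi> + f \<rho> \<sigma> k s \<psi>'"
  and balanced_scl: "\<lbrakk>k \<in> irr P; s \<in> Hom C (k \<odot> \<rho>) \<sigma>; \<psi> \<in> fsp F k\<rbrakk>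
    \<Longrightarrow> f \<rho> \<sigma> k (scl C z s) \<psi> = f \<rho> \<sigma> k s (fsc F z \<psi>)"
  using f unfolding balanced_def by blast+

lemma balanced_zero: "k \<in> irr P \<Longrightarrow> \<psi> \<in> fsp F k \<Longrightarrow> f \<rho> \<sigma> k 0 \<psi> = 0"
  using balanced_add[of k 0 0 \<psi>] Hom_zero[OF tob_Ob[OF irr_Ob O(1)] O(2), of k] by simp

lemma balanced_sum_vec:
  assumes "k \<in> irr P" "s \<in> Hom C (k \<odot> \<rho>) \<sigma>" "\<And>i. i \<in> I \<Longrightarrow> h i \<in> fsp F k"
  shows "f \<rho> \<sigma> k s (sum h I) = (\<Sum>i\<in>I. f \<rho> \<sigma> k s (h i))"
proof -
  note kS = irr_in_S[OF assms(1)]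
  have z: "f \<rho> \<sigma> k s 0 = 0" using balanced_add_vec[OF assms(1,2) fsp_zero[OF kS] fsp_zero[OF kS]] by simp
  show ?thesis using assms(3)
  proof (induction I rule: infinite_finite_induct)
    case (insert i I)
    then show ?case using fsp_sum[OF kS, of I h] balanced_add_vec[OF assms(1,2)] by simp
  qed (auto simp: z)
qed

lemma hbas_fsp: "k \<in> irr P \<Longrightarrow> e \<in> hbas P k \<Longrightarrow> e \<in> fsp F k"
  using hbas_basis[of k] vecs.span_base[of e "hbas P k"] by simp

lemma xsum_eq:
  assumes x: "x \<in> xHom C F P \<rho> \<sigma>" and J: "finite J" "J \<subseteq> irr P" "{k. x (\<rho>, \<sigma>, k) \<noteq> 0} \<subseteq> J"
  shows "xsum P f x = (\<Sum>k\<in>J. \<Sum>e\<in>hbas P k. f \<rho> \<sigma> k (x (\<rho>, \<sigma>, k) e) e)"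
proof -
  let ?g = "\<lambda>(\<rho>, \<sigma>, k). \<Sum>e\<in>hbas P k. f \<rho> \<sigma> k (x (\<rho>, \<sigma>, k) e) e"
  have "xsum P f x = sum ?g ((\<lambda>k. (\<rho>, \<sigma>, k)) ` J)"
    unfolding xsum_def
  proof (rule sum.mono_neutral_left)
    show "{t. x t \<noteq> 0} \<subseteq> (\<lambda>k. (\<rho>, \<sigma>, k)) ` J"
      using xHom_component(1)[OF x] J(3) by fastforce
    show "\<forall>t\<in>(\<lambda>k. (\<rho>, \<sigma>, k)) ` J - {t. x t \<noteq> 0}. ?g t = 0"
      using J(2) balanced_zero hbas_fsp by (auto intro!: sum.neutral)
  qed (use J in simp)
  then show ?thesis by (simp add: sum.reindex inj_on_def)
qed

text \<open>
  Expansion of \<open>\<psi>\<close> in the orthonormal basis that enters \<open>xsum\<close>.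
\<close>

lemma xsum_stensor:
  assumes k: "k \<in> irr P" and s: "s \<in> Hom C (k \<odot> \<rho>) \<sigma>" and \<psi>: "\<psi> \<in> fsp F k"
  shows "xsum P f (stensor C F \<rho> \<sigma> k s \<psi>) = f \<rho> \<sigma> k s \<psi>"
proof -
  note kS = irr_in_S[OF k]
  interpret K: fd_hilbert "fsc F" "fsp F k" "fip F k" by (rule fsp_hilbert[OF kS])
  note B = hbas_basis[OF k]
  have on: "K.orthonormal (hbas P k)" using hbas_orthonormal[OF k] by (simp add: K.orthonormal_def)
  have sub: "hbas P k \<subseteq> fsp F k" using hbas_fsp[OF k] by blast
  have "xsum P f (stensor C F \<rho> \<sigma> k s \<psi>) =
      (\<Sum>l\<in>{k}. \<Sum>e\<in>hbas P l. f \<rho> \<sigma> l (stensor C F \<rho> \<sigma> k s \<psi> (\<rho>, \<sigma>, l) e) e)"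
    using k by (intro xsum_eq[OF stensor_xHom[OF k s \<psi>]]) (auto simp: stensor_def fun_eq_iff)
  also have "\<dots> = (\<Sum>e\<in>hbas P k. f \<rho> \<sigma> k s (fsc F (fip F k e \<psi>) e))"
    using hbas_fsp[OF k] balanced_scl[OF k s] by (simp add: stensor_def)
  also have "\<dots> = f \<rho> \<sigma> k s (\<Sum>e\<in>hbas P k. fsc F (fip F k e \<psi>) e)"
    using hbas_fsp[OF k] K.scale_K by (intro balanced_sum_vec[OF k s, symmetric]) auto
  also have "(\<Sum>e\<in>hbas P k. fsc F (fip F k e \<psi>) e) = \<psi>"
    using K.orthonormal_expansion[OF on _ sub, of \<psi>] B \<psi> by simp
  finally show ?thesis .
qed

lemma xsum_add:
  assumes x: "x \<in> xHom C F P \<rho> \<sigma>" and y: "y \<in> xHom C F P \<rho> \<sigma>"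
  shows "xsum P f (x + y) = xsum P f x + xsum P f y"
proof -
  let ?J = "{k. x (\<rho>, \<sigma>, k) \<noteq> 0} \<union> {k. y (\<rho>, \<sigma>, k) \<noteq> 0}"
  have J: "finite ?J" "?J \<subseteq> irr P" using xHom_support[OF x] xHom_support[OF y] by simp_all
  have "xsum P f (x + y) = (\<Sum>k\<in>?J. \<Sum>e\<in>hbas P k. f \<rho> \<sigma> k ((x + y) (\<rho>, \<sigma>, k) e) e)"
    by (rule xsum_eq[OF xHom_add[OF x y] J]) auto
  also have "\<dots> = (\<Sum>k\<in>?J. \<Sum>e\<in>hbas P k. f \<rho> \<sigma> k (x (\<rho>, \<sigma>, k) e) e + f \<rho> \<sigma> k (y (\<rho>, \<sigma>, k) e) e)"
    using J(2) balanced_add xHom_component(3)[OF x] xHom_component(3)[OF y] hbas_fsp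
    by (intro sum.cong refl) (simp add: subset_eq)
  also have "\<dots> = xsum P f x + xsum P f y"
    by (simp add: sum.distrib xsum_eq[OF x J] xsum_eq[OF y J])
  finally show ?thesis .
qed

end

end


section \<open>The group action on arrows\<close>

context
  fixes g assumes g: "g \<in> carrier G"
begin

lemma act_balanced:
  assumes O: "\<rho> \<in> Ob C" "\<sigma> \<in> Ob C"
  shows "balanced \<rho> \<sigma> (\<lambda>\<rho> \<sigma> k s \<psi>. stensor C F \<rho> \<sigma> k s (frep F k g \<psi>))"
  by (rule balancedI[OF O])
    (simp_all add: stensor_add_arrow frep_add[OF irr_in_S g] stensor_add_vec[OF irr_in_S]
      frep_fsp[OF irr_in_S g] frep_scale[OF irr_in_S g] stensor_scl_vec[OF irr_in_S])

lemma act_stensor: "\<lbrakk>\<rho> \<in> Ob C; \<sigma> \<in> Ob C; k \<in> irr P; s \<in> Hom C (k \<odot> \<rho>) \<sigma>; \<psi> \<in> fsp F k\<rbrakk>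
    \<Longrightarrow> act_arr C F P g (stensor C F \<rho> \<sigma> k s \<psi>) = stensor C F \<rho> \<sigma> k s (frep F k g \<psi>)"
  unfolding act_arr_def by (rule xsum_stensor[OF _ _ act_balanced])

lemma act_add: "\<lbrakk>\<rho> \<in> Ob C; \<sigma> \<in> Ob C; x \<in> xHom C F P \<rho> \<sigma>; y \<in> xHom C F P \<rho> \<sigma>\<rbrakk>
    \<Longrightarrow> act_arr C F P g (x + y) = act_arr C F P g x + act_arr C F P g y"
  unfolding act_arr_def by (rule xsum_add[OF _ _ act_balanced])

lemma act_zero: "act_arr C F P g 0 = 0"
  by (simp add: act_arr_def xsum_def)

lemma act_sum:
  assumes O: "\<rho> \<in> Ob C" "\<sigma> \<in> Ob C" and h: "\<And>i. i \<in> I \<Longrightarrow> h i \<in> xHom C F P \<rho> \<sigma>"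
  shows "act_arr C F P g (sum h I) = (\<Sum>i\<in>I. act_arr C F P g (h i))"
  using h
proof (induction I rule: infinite_finite_induct)
  case (insert i I)
  then show ?case using act_add[OF O, of "h i" "sum h I"] xHom_sum[OF O, of I h]
    by (simp del: plus_fun_apply)
qed (simp_all add: act_zero del: zero_fun_apply)

lemma act_cten:
  assumes O: "\<rho> \<in> Ob C" "\<sigma> \<in> Ob C" and a: "a \<in> S" "u \<in> Hom C (a \<odot> \<rho>) \<sigma>" "\<psi> \<in> fsp F a"
  shows "act_arr C F P g (cten \<rho> \<sigma> a u \<psi>) = cten \<rho> \<sigma> a u (frep F a g \<psi>)"
proof -
  note m = resolution_member[OF a(1) O]
  have "act_arr C F P g (cten \<rho> \<sigma> a u \<psi>) = (\<Sum>i\<in>resolution a. act_arr C F P g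
      (stensor C F \<rho> \<sigma> (fst i) (u \<cdot> (snd i \<boxtimes> \<ii>\<dd> \<rho>)) (farr F a (fst i) ((snd i)\<^sup>\<star>) \<psi>)))"
    unfolding cten_expand[OF a(1) O a(2,3)] using m a by (intro act_sum[OF O] stensor_xHom[OF O])
  also have "\<dots> = (\<Sum>i\<in>resolution a.
      stensor C F \<rho> \<sigma> (fst i) (u \<cdot> (snd i \<boxtimes> \<ii>\<dd> \<rho>)) (farr F a (fst i) ((snd i)\<^sup>\<star>) (frep F a g \<psi>)))"
  proof (intro sum.cong refl)
    fix i assume i: "i \<in> resolution a"
    note mi = m[OF i]
    show "act_arr C F P g (stensor C F \<rho> \<sigma> (fst i) (u \<cdot> (snd i \<boxtimes> \<ii>\<dd> \<rho>)) (farr F a (fst i) ((snd i)\<^sup>\<star>) \<psi>)) =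
      stensor C F \<rho> \<sigma> (fst i) (u \<cdot> (snd i \<boxtimes> \<ii>\<dd> \<rho>)) (farr F a (fst i) ((snd i)\<^sup>\<star>) (frep F a g \<psi>))"
      using act_stensor[OF O mi(1) mi(7)[OF a(2)] mi(6)[OF a(3)]] farr_frep[OF a(1) mi(2) mi(5) g a(3)]
      by simp
  qed
  also have "\<dots> = cten \<rho> \<sigma> a u (frep F a g \<psi>)"
    unfolding cten_expand[OF a(1) O a(2) frep_fsp[OF a(1) g a(3)]] ..
  finally show ?thesis .
qed

lemma act_xHom:
  assumes O: "\<rho> \<in> Ob C" "\<sigma> \<in> Ob C" and x: "x \<in> xHom C F P \<rho> \<sigma>"
  shows "act_arr C F P g x \<in> xHom C F P \<rho> \<sigma>"
  using x
proof (induction rule: xHom_induct[OF O, consumes 1, case_names zero add])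
  case (add k s \<psi> y)
  show ?case
    unfolding act_add[OF O stensor_xHom[OF O add(1-3)] add(4)] act_stensor[OF O add(1-3)]
    by (intro xHom_add[OF O] stensor_xHom[OF O] add frep_fsp[OF irr_in_S g])
next
  case zero
  show ?case unfolding act_zero by (rule xHom_zero[OF O])
qed

lemma act_component:
  assumes O: "\<rho> \<in> Ob C" "\<sigma> \<in> Ob C" and x: "x \<in> xHom C F P \<rho> \<sigma>" and k: "k \<in> irr P" "\<phi> \<in> fsp F k"
  shows "act_arr C F P g x (\<rho>, \<sigma>, k) \<phi> = x (\<rho>, \<sigma>, k) (frep F k (inv\<^bsub>G\<^esub> g) \<phi>)"
  using x
proof (induction rule: xHom_induct[OF O, consumes 1, case_names zero add])
  case (add l s \<psi> y)
  note kS = irr_in_S[OF k(1)]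
  show ?case
    unfolding act_add[OF O stensor_xHom[OF O add(1-3)] add(4)] act_stensor[OF O add(1-3)]
    using add(5) k frep_adjoint[OF kS g k(2)] frep_fsp[OF kS G.inv_closed[OF g] k(2)] add(3)
    by (auto simp: stensor_def)
next
  case zero
  show ?case unfolding act_zero by simp
qed

end


section \<open>Biadditive extension from simple tensors\<close>

text \<open>The common shape of composition and tensor product.\<close>

definition bisum where
  "bisum N x y = xsum P (\<lambda>\<sigma> \<delta> k s \<psi>. xsum P (N \<sigma> \<delta> k s \<psi>) y) x"

text \<open>
  The operation on simple tensors is given by \<open>B\<close> for arbitrary objects \<open>a\<close> and \<open>b\<close> of \<open>S\<close>, and by
  \<open>N\<close> for irreducible ones, as a sum over bases.  The last condition but one is naturality of \<open>B\<close> in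
  \<open>a\<close> and \<open>b\<close>; it makes \<open>B\<close> compatible with moving arrows of \<open>S\<close> across the tensor sign.
\<close>

definition fusion_rule where
  "fusion_rule \<sigma> \<delta> \<rho> \<sigma>' \<rho>'' \<sigma>'' B N \<longleftrightarrow>
     (\<sigma> \<in> Ob C \<and> \<delta> \<in> Ob C \<and> \<rho> \<in> Ob C \<and> \<sigma>' \<in> Ob C \<and> \<rho>'' \<in> Ob C \<and> \<sigma>'' \<in> Ob C) \<and>
     (\<forall>a b u t. a \<in> S \<longrightarrow> b \<in> S \<longrightarrow> u \<in> Hom C (a \<odot> \<sigma>) \<delta> \<longrightarrow> t \<in> Hom C (b \<odot> \<rho>) \<sigma>' \<longrightarrow>
        B a b u t \<in> Hom C ((a \<odot> b) \<odot> \<rho>'') \<sigma>'') \<and>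
     (\<forall>a b u u' t t'. a \<in> S \<longrightarrow> b \<in> S \<longrightarrow> u \<in> Hom C (a \<odot> \<sigma>) \<delta> \<longrightarrow> u' \<in> Hom C (a \<odot> \<sigma>) \<delta> \<longrightarrow>
        t \<in> Hom C (b \<odot> \<rho>) \<sigma>' \<longrightarrow> t' \<in> Hom C (b \<odot> \<rho>) \<sigma>' \<longrightarrow>
        B a b (u + u') t = B a b u t + B a b u' t \<and> B a b u (t + t') = B a b u t + B a b u t') \<and>
     (\<forall>a b u t z. a \<in> S \<longrightarrow> b \<in> S \<longrightarrow> u \<in> Hom C (a \<odot> \<sigma>) \<delta> \<longrightarrow> t \<in> Hom C (b \<odot> \<rho>) \<sigma>' \<longrightarrow>
        B a b (scl C z u) t = scl C z (B a b u t) \<and> B a b u (scl C z t) = scl C z (B a b u t)) \<and>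
     (\<forall>a b k l u t v w. a \<in> S \<longrightarrow> b \<in> S \<longrightarrow> k \<in> S \<longrightarrow> l \<in> S \<longrightarrow>
        u \<in> Hom C (a \<odot> \<sigma>) \<delta> \<longrightarrow> t \<in> Hom C (b \<odot> \<rho>) \<sigma>' \<longrightarrow> v \<in> Hom C k a \<longrightarrow> w \<in> Hom C l b \<longrightarrow>
        B k l (u \<cdot> (v \<boxtimes> \<ii>\<dd> \<sigma>)) (t \<cdot> (w \<boxtimes> \<ii>\<dd> \<rho>)) = B a b u t \<cdot> ((v \<boxtimes> w) \<boxtimes> \<ii>\<dd> \<rho>'')) \<and>
     (\<forall>k l s t \<psi> \<psi>'. N \<sigma> \<delta> k s \<psi> \<rho> \<sigma>' l t \<psi>' = xfuse C F P \<rho>'' \<sigma>'' k l (B k l s t) \<psi> \<psi>')"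

context
  fixes \<sigma> \<delta> \<rho> \<sigma>' \<rho>'' \<sigma>'' B N
  assumes fr: "fusion_rule \<sigma> \<delta> \<rho> \<sigma>' \<rho>'' \<sigma>'' B N"
begin

lemma fusion_Ob: "\<sigma> \<in> Ob C" "\<delta> \<in> Ob C" "\<rho> \<in> Ob C" "\<sigma>' \<in> Ob C" "\<rho>'' \<in> Ob C" "\<sigma>'' \<in> Ob C"
  using fr[unfolded fusion_rule_def, THEN conjunct1] by simp_all

lemmas B_Hom = fr[unfolded fusion_rule_def, THEN conjunct2, THEN conjunct1, rule_format]
  and B_add = fr[unfolded fusion_rule_def, THEN conjunct2, THEN conjunct2, THEN conjunct1, rule_format]
  and B_scl = fr[unfolded fusion_rule_def, THEN conjunct2, THEN conjunct2, THEN conjunct2, THEN conjunct1,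
    rule_format]
  and B_natural = fr[unfolded fusion_rule_def, THEN conjunct2, THEN conjunct2, THEN conjunct2, THEN conjunct2,
    THEN conjunct1, rule_format]
  and N_xfuse = fr[unfolded fusion_rule_def, THEN conjunct2, THEN conjunct2, THEN conjunct2, THEN conjunct2,
    THEN conjunct2, rule_format]

lemma N_cten:
  assumes "k \<in> irr P" "l \<in> irr P" "s \<in> Hom C (k \<odot> \<sigma>) \<delta>" "t \<in> Hom C (l \<odot> \<rho>) \<sigma>'"
    "\<psi> \<in> fsp F k" "\<psi>' \<in> fsp F l"
  shows "N \<sigma> \<delta> k s \<psi> \<rho> \<sigma>' l t \<psi>' = cten \<rho>'' \<sigma>'' (k \<odot> l) (B k l s t) (ften F k l \<psi> \<psi>')"
  unfolding N_xfuse using assms irr_in_S by (intro xfuse_cten fusion_Ob B_Hom)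

lemma N_balanced:
  assumes k: "k \<in> irr P" "s \<in> Hom C (k \<odot> \<sigma>) \<delta>" "\<psi> \<in> fsp F k"
  shows "balanced \<rho> \<sigma>' (N \<sigma> \<delta> k s \<psi>)"
proof (rule balancedI[OF fusion_Ob(3,4)])
  note kS = irr_in_S[OF k(1)]
  fix l t \<psi>' assume l: "l \<in> irr P" "t \<in> Hom C (l \<odot> \<rho>) \<sigma>'" "\<psi>' \<in> fsp F l"
  note lS = irr_in_S[OF l(1)]
  note klS = S_tob[OF kS lS] and Ol = tob_Ob[OF irr_Ob[OF l(1)] fusion_Ob(3)]
  note mem = ften_fsp[OF kS lS k(3) l(3)] and Bmem = B_Hom[OF kS lS k(2) l(2)]
  show "N \<sigma> \<delta> k s \<psi> \<rho> \<sigma>' l (t + t') \<psi>' = N \<sigma> \<delta> k s \<psi> \<rho> \<sigma>' l t \<psi>' + N \<sigma> \<delta> k s \<psi> \<rho> \<sigma>' l t' \<psi>'"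
    if t': "t' \<in> Hom C (l \<odot> \<rho>) \<sigma>'" for t'
    using k l t' Hom_add[OF Ol fusion_Ob(4) l(2) t'] B_add[OF kS lS k(2,2) l(2) t']
      cten_add_arrow[OF klS fusion_Ob(5,6) Bmem B_Hom[OF kS lS k(2) t']]
    by (simp add: N_cten)
  show "N \<sigma> \<delta> k s \<psi> \<rho> \<sigma>' l t (\<psi>' + \<psi>'') = N \<sigma> \<delta> k s \<psi> \<rho> \<sigma>' l t \<psi>' + N \<sigma> \<delta> k s \<psi> \<rho> \<sigma>' l t \<psi>''"
    if p: "\<psi>'' \<in> fsp F l" for \<psi>''
    using k l p fsp_add[OF lS l(3) p] ften_add[OF kS lS k(3,3) l(3) p]
      cten_add_vec[OF klS fusion_Ob(5,6) mem ften_fsp[OF kS lS k(3) p]]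
    by (simp add: N_cten)
  show "N \<sigma> \<delta> k s \<psi> \<rho> \<sigma>' l (scl C z t) \<psi>' = N \<sigma> \<delta> k s \<psi> \<rho> \<sigma>' l t (fsc F z \<psi>')" for z
    using k l Hom_scl[OF Ol fusion_Ob(4) l(2)] fsp_scale[OF lS l(3)] B_scl[OF kS lS k(2) l(2)]
      ften_scl[OF kS lS k(3) l(3)] cten_scl_vec[OF klS fusion_Ob(5,6) Bmem mem] cten_scl_arrow[OF klS fusion_Ob(5,6) Bmem]
    by (simp add: N_cten)
qed

lemma N_balanced_outer:
  assumes y: "y \<in> xHom C F P \<rho> \<sigma>'"
  shows "balanced \<sigma> \<delta> (\<lambda>\<sigma> \<delta> k s \<psi>. xsum P (N \<sigma> \<delta> k s \<psi>) y)"
proof -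
  let ?J = "{l. y (\<rho>, \<sigma>', l) \<noteq> 0}"
  have J: "finite ?J" "?J \<subseteq> irr P" using xHom_support[OF fusion_Ob(3,4) y] by simp_all
  have eq: "xsum P (N \<sigma> \<delta> k s \<psi>) y = (\<Sum>l\<in>?J. \<Sum>e\<in>hbas P l. N \<sigma> \<delta> k s \<psi> \<rho> \<sigma>' l (y (\<rho>, \<sigma>', l) e) e)"
    if "k \<in> irr P" "s \<in> Hom C (k \<odot> \<sigma>) \<delta>" "\<psi> \<in> fsp F k" for k s \<psi>
    by (rule xsum_eq[OF fusion_Ob(3,4) N_balanced[OF that] y J order_refl])
  show ?thesis
  proof (rule balancedI[OF fusion_Ob(1,2)])
    fix k s \<psi> assume k: "k \<in> irr P" "s \<in> Hom C (k \<odot> \<sigma>) \<delta>" "\<psi> \<in> fsp F k"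
    note kS = irr_in_S[OF k(1)]
    note Ok = tob_Ob[OF irr_Ob[OF k(1)] fusion_Ob(1)]
    have yl: "l \<in> irr P" "l \<in> S" "e \<in> fsp F l" "y (\<rho>, \<sigma>', l) e \<in> Hom C (l \<odot> \<rho>) \<sigma>'"
      if "l \<in> ?J" "e \<in> hbas P l" for l e
      using that J(2) hbas_fsp[OF fusion_Ob(3,4) N_balanced[OF k]] irr_in_S xHom_component(3)[OF fusion_Ob(3,4) y] by auto
    show "xsum P (N \<sigma> \<delta> k (s + s') \<psi>) y = xsum P (N \<sigma> \<delta> k s \<psi>) y + xsum P (N \<sigma> \<delta> k s' \<psi>) y"
      if s': "s' \<in> Hom C (k \<odot> \<sigma>) \<delta>" for s'
    proof -
      have "N \<sigma> \<delta> k (s + s') \<psi> \<rho> \<sigma>' l t \<psi>' = N \<sigma> \<delta> k s \<psi> \<rho> \<sigma>' l t \<psi>' + N \<sigma> \<delta> k s' \<psi> \<rho> \<sigma>' l t \<psi>'"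
        if l: "l \<in> irr P" "l \<in> S" "\<psi>' \<in> fsp F l" "t \<in> Hom C (l \<odot> \<rho>) \<sigma>'" for l t \<psi>'
        using k l s' Hom_add[OF Ok fusion_Ob(2) k(2) s'] B_add[OF kS l(2) k(2) s' l(4,4)]
          cten_add_arrow[OF S_tob[OF kS l(2)] fusion_Ob(5,6) B_Hom[OF kS l(2) k(2) l(4)] B_Hom[OF kS l(2) s' l(4)]]
        by (simp add: N_cten)
      then show ?thesis
        using yl unfolding eq[OF k] eq[OF k(1) s' k(3)] eq[OF k(1) Hom_add[OF Ok fusion_Ob(2) k(2) s'] k(3)]
        by (simp add: sum.distrib)
    qed
    show "xsum P (N \<sigma> \<delta> k s (\<psi> + \<psi>'')) y = xsum P (N \<sigma> \<delta> k s \<psi>) y + xsum P (N \<sigma> \<delta> k s \<psi>'') y"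
      if p: "\<psi>'' \<in> fsp F k" for \<psi>''
    proof -
      have "N \<sigma> \<delta> k s (\<psi> + \<psi>'') \<rho> \<sigma>' l t \<psi>' = N \<sigma> \<delta> k s \<psi> \<rho> \<sigma>' l t \<psi>' + N \<sigma> \<delta> k s \<psi>'' \<rho> \<sigma>' l t \<psi>'"
        if l: "l \<in> irr P" "l \<in> S" "\<psi>' \<in> fsp F l" "t \<in> Hom C (l \<odot> \<rho>) \<sigma>'" for l t \<psi>'
        using k l p fsp_add[OF kS k(3) p] ften_add[OF kS l(2) k(3) p l(3,3)]
          cten_add_vec[OF S_tob[OF kS l(2)] fusion_Ob(5,6) ften_fsp[OF kS l(2) k(3) l(3)] ften_fsp[OF kS l(2) p l(3)]]
        by (simp add: N_cten)
      then show ?thesis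
        using yl unfolding eq[OF k] eq[OF k(1,2) p] eq[OF k(1,2) fsp_add[OF kS k(3) p]]
        by (simp add: sum.distrib)
    qed
    show "xsum P (N \<sigma> \<delta> k (scl C z s) \<psi>) y = xsum P (N \<sigma> \<delta> k s (fsc F z \<psi>)) y" for z
    proof -
      have "N \<sigma> \<delta> k (scl C z s) \<psi> \<rho> \<sigma>' l t \<psi>' = N \<sigma> \<delta> k s (fsc F z \<psi>) \<rho> \<sigma>' l t \<psi>'"
        if l: "l \<in> irr P" "l \<in> S" "\<psi>' \<in> fsp F l" "t \<in> Hom C (l \<odot> \<rho>) \<sigma>'" for l t \<psi>'
        using k l Hom_scl[OF Ok fusion_Ob(2) k(2)] fsp_scale[OF kS k(3)] B_scl[OF kS l(2) k(2) l(4)]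
          ften_scl[OF kS l(2) k(3) l(3)] cten_scl_arrow[OF S_tob[OF kS l(2)] fusion_Ob(5,6) B_Hom[OF kS l(2) k(2) l(4)]]
          cten_scl_vec[OF S_tob[OF kS l(2)] fusion_Ob(5,6) B_Hom[OF kS l(2) k(2) l(4)] ften_fsp[OF kS l(2) k(3) l(3)]]
        by (simp add: N_cten)
      then show ?thesis
        using yl unfolding eq[OF k(1) Hom_scl[OF Ok fusion_Ob(2) k(2)] k(3)] eq[OF k(1,2) fsp_scale[OF kS k(3)]]
        by simp
    qed
  qed
qed

lemma bisum_stensor:
  assumes k: "k \<in> irr P" "l \<in> irr P" "s \<in> Hom C (k \<odot> \<sigma>) \<delta>" "t \<in> Hom C (l \<odot> \<rho>) \<sigma>'"
    "\<psi> \<in> fsp F k" "\<psi>' \<in> fsp F l"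
  shows "bisum N (stensor C F \<sigma> \<delta> k s \<psi>) (stensor C F \<rho> \<sigma>' l t \<psi>') =
    cten \<rho>'' \<sigma>'' (k \<odot> l) (B k l s t) (ften F k l \<psi> \<psi>')"
  unfolding bisum_def
    xsum_stensor[OF fusion_Ob(1,2) N_balanced_outer[OF stensor_xHom[OF fusion_Ob(3,4) k(2,4,6)]] k(1,3,5)]
    xsum_stensor[OF fusion_Ob(3,4) N_balanced[OF k(1,3,5)] k(2,4,6)]
  by (rule N_cten[OF k])

lemma bisum_add_left:
  "\<lbrakk>x \<in> xHom C F P \<sigma> \<delta>; x' \<in> xHom C F P \<sigma> \<delta>; y \<in> xHom C F P \<rho> \<sigma>'\<rbrakk>
    \<Longrightarrow> bisum N (x + x') y = bisum N x y + bisum N x' y"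
  unfolding bisum_def by (rule xsum_add[OF fusion_Ob(1,2) N_balanced_outer])

lemma bisum_add_right:
  assumes x: "x \<in> xHom C F P \<sigma> \<delta>" and y: "y \<in> xHom C F P \<rho> \<sigma>'" "y' \<in> xHom C F P \<rho> \<sigma>'"
  shows "bisum N x (y + y') = bisum N x y + bisum N x y'"
proof -
  let ?J = "{k. x (\<sigma>, \<delta>, k) \<noteq> 0}"
  have J: "finite ?J" "?J \<subseteq> irr P" using xHom_support[OF fusion_Ob(1,2) x] by simp_all
  have eq: "bisum N x z = (\<Sum>k\<in>?J. \<Sum>e\<in>hbas P k. xsum P (N \<sigma> \<delta> k (x (\<sigma>, \<delta>, k) e) e) z)"
    if "z \<in> xHom C F P \<rho> \<sigma>'" for z
    unfolding bisum_def by (rule xsum_eq[OF fusion_Ob(1,2) N_balanced_outer[OF that] x J order_refl])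
  have "xsum P (N \<sigma> \<delta> k (x (\<sigma>, \<delta>, k) e) e) (y + y') =
      xsum P (N \<sigma> \<delta> k (x (\<sigma>, \<delta>, k) e) e) y + xsum P (N \<sigma> \<delta> k (x (\<sigma>, \<delta>, k) e) e) y'"
    if "k \<in> ?J" "e \<in> hbas P k" for k e
    using that J(2) hbas_fsp[OF fusion_Ob(1,2) N_balanced_outer[OF y(1)]] xHom_component(3)[OF fusion_Ob(1,2) x]
    by (intro xsum_add[OF fusion_Ob(3,4) N_balanced y]) auto
  then show ?thesis
    unfolding eq[OF y(1)] eq[OF y(2)] eq[OF xHom_add[OF fusion_Ob(3,4) y]] by (simp add: sum.distrib)
qed

lemma bisum_zero: "bisum N 0 y = 0" "bisum N x 0 = 0"
  by (simp_all add: bisum_def xsum_def)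

lemma bisum_induct [consumes 2, case_names stensor add_left add_right zero]:
  assumes x: "x \<in> xHom C F P \<sigma> \<delta>" and y: "y \<in> xHom C F P \<rho> \<sigma>'"
    and stensor: "\<And>k l s t \<psi> \<psi>'. \<lbrakk>k \<in> irr P; l \<in> irr P; s \<in> Hom C (k \<odot> \<sigma>) \<delta>; t \<in> Hom C (l \<odot> \<rho>) \<sigma>';
        \<psi> \<in> fsp F k; \<psi>' \<in> fsp F l\<rbrakk> \<Longrightarrow> Q (stensor C F \<sigma> \<delta> k s \<psi>) (stensor C F \<rho> \<sigma>' l t \<psi>')"
    and left: "\<And>x x' y. \<lbrakk>x \<in> xHom C F P \<sigma> \<delta>; x' \<in> xHom C F P \<sigma> \<delta>; y \<in> xHom C F P \<rho> \<sigma>'; Q x y; Q x' y\<rbrakk>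
        \<Longrightarrow> Q (x + x') y"
    and right: "\<And>x y y'. \<lbrakk>x \<in> xHom C F P \<sigma> \<delta>; y \<in> xHom C F P \<rho> \<sigma>'; y' \<in> xHom C F P \<rho> \<sigma>'; Q x y; Q x y'\<rbrakk>
        \<Longrightarrow> Q x (y + y')"
    and zero: "\<And>x. Q x 0" "\<And>y. Q 0 y"
  shows "Q x y"
  using x
proof (induction rule: xHom_induct[OF fusion_Ob(1,2), consumes 1, case_names zero add])
  case (add k s \<psi> x)
  note outer = add
  have "Q (stensor C F \<sigma> \<delta> k s \<psi>) y"
    using y
  proof (induction rule: xHom_induct[OF fusion_Ob(3,4), consumes 1, case_names zero add])
    case (add l t \<psi>' y)
    show ?case
      by (intro right stensor stensor_xHom fusion_Ob outer(1-3) add)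
  qed (rule zero)
  then show ?case by (intro left stensor_xHom fusion_Ob outer y)
qed (rule zero)

lemma bisum_xHom:
  assumes "x \<in> xHom C F P \<sigma> \<delta>" "y \<in> xHom C F P \<rho> \<sigma>'"
  shows "bisum N x y \<in> xHom C F P \<rho>'' \<sigma>''"
  using assms
proof (induction rule: bisum_induct)
  case (stensor k l s t \<psi> \<psi>')
  then show ?case unfolding bisum_stensor[OF stensor]
    using irr_in_S by (intro cten_xHom[OF fusion_Ob(5,6)] S_tob B_Hom ften_fsp)
qed (use xHom_add[OF fusion_Ob(5,6)] xHom_zero[OF fusion_Ob(5,6)] in
    \<open>simp_all add: bisum_add_left bisum_add_right bisum_zero del: plus_fun_apply zero_fun_apply\<close>)

lemma act_bisum:
  assumes g: "g \<in> carrier G" and "x \<in> xHom C F P \<sigma> \<delta>" "y \<in> xHom C F P \<rho> \<sigma>'"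
  shows "act_arr C F P g (bisum N x y) = bisum N (act_arr C F P g x) (act_arr C F P g y)"
  using assms(2,3)
proof (induction rule: bisum_induct)
  case (stensor k l s t \<psi> \<psi>')
  note kS = irr_in_S[OF stensor(1)] and lS = irr_in_S[OF stensor(2)]
  show ?case
    unfolding bisum_stensor[OF stensor] act_stensor[OF g fusion_Ob(1,2) stensor(1,3,5)]
      act_stensor[OF g fusion_Ob(3,4) stensor(2,4,6)]
      bisum_stensor[OF stensor(1-4) frep_fsp[OF kS g stensor(5)] frep_fsp[OF lS g stensor(6)]]
      act_cten[OF g fusion_Ob(5,6) S_tob[OF kS lS] B_Hom[OF kS lS stensor(3,4)] ften_fsp[OF kS lS stensor(5,6)]]
      ften_rep[OF kS lS stensor(5,6) g] ..
next
  case (add_left x x' y)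
  note A = act_xHom[OF g fusion_Ob(1,2)] act_xHom[OF g fusion_Ob(3,4)]
  show ?case
    unfolding bisum_add_left[OF add_left(1-3)] act_add[OF g fusion_Ob(1,2) add_left(1,2)]
      bisum_add_left[OF A(1)[OF add_left(1)] A(1)[OF add_left(2)] A(2)[OF add_left(3)]] add_left(4,5)[symmetric]
    by (rule act_add[OF g fusion_Ob(5,6) bisum_xHom[OF add_left(1,3)] bisum_xHom[OF add_left(2,3)]])
next
  case (add_right x y y')
  note A = act_xHom[OF g fusion_Ob(1,2)] act_xHom[OF g fusion_Ob(3,4)]
  show ?case
    unfolding bisum_add_right[OF add_right(1-3)] act_add[OF g fusion_Ob(3,4) add_right(2,3)]
      bisum_add_right[OF A(1)[OF add_right(1)] A(2)[OF add_right(2)] A(2)[OF add_right(3)]] add_right(4,5)[symmetric]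
    by (rule act_add[OF g fusion_Ob(5,6) bisum_xHom[OF add_right(1,2)] bisum_xHom[OF add_right(1,3)]])
qed (simp_all only: bisum_zero act_zero[OF g])

lemma bisum_sum:
  assumes "\<And>i. i \<in> I \<Longrightarrow> x i \<in> xHom C F P \<sigma> \<delta>" "\<And>j. j \<in> J \<Longrightarrow> y j \<in> xHom C F P \<rho> \<sigma>'"
  shows "bisum N (sum x I) (sum y J) = (\<Sum>i\<in>I. \<Sum>j\<in>J. bisum N (x i) (y j))"
proof -
  have right: "bisum N z (sum y J) = (\<Sum>j\<in>J. bisum N z (y j))" if z: "z \<in> xHom C F P \<sigma> \<delta>" for z
    using assms(2)
  proof (induction J rule: infinite_finite_induct)
    case (insert j J)
    then show ?case using bisum_add_right[OF z, of "y j" "sum y J"] xHom_sum[OF fusion_Ob(3,4), of J y]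
      by (simp del: plus_fun_apply)
  qed (simp_all add: bisum_zero del: zero_fun_apply)
  show ?thesis
    using assms(1)
  proof (induction I rule: infinite_finite_induct)
    case (insert i I)
    then show ?case
      using bisum_add_left[of "x i" "sum x I" "sum y J"] xHom_sum[OF fusion_Ob(1,2), of I x]
        xHom_sum[OF fusion_Ob(3,4), of J y] assms(2) right[of "x i"]
      by (simp del: plus_fun_apply)
  qed (simp_all add: bisum_zero del: zero_fun_apply)
qed

text \<open>
  Both factors are decomposed into irreducible parts, for which the rule is the definition, and
  the parts are collected again by naturality of \<open>B\<close> and of the tensor product of vectors.
\<close>

lemma bisum_cten:
  assumes ab: "a \<in> S" "b \<in> S" and u: "u \<in> Hom C (a \<odot> \<sigma>) \<delta>" and t: "t \<in> Hom C (b \<odot> \<rho>) \<sigma>'"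
    and x: "x \<in> fsp F a" and y: "y \<in> fsp F b"
  shows "bisum N (cten \<sigma> \<delta> a u x) (cten \<rho> \<sigma>' b t y) = cten \<rho>'' \<sigma>'' (a \<odot> b) (B a b u t) (ften F a b x y)"
proof -
  let ?I = "resolution a" and ?J = "resolution b"
  note mI = resolution_member[OF ab(1) fusion_Ob(1,2)] and mJ = resolution_member[OF ab(2) fusion_Ob(3,4)]
  define p where "p i = farr F a (fst i) ((snd i)\<^sup>\<star>) x" for i
  define q where "q j = farr F b (fst j) ((snd j)\<^sup>\<star>) y" for j
  have p: "p i \<in> fsp F (fst i)" "farr F (fst i) a (snd i) (p i) \<in> fsp F a" if "i \<in> ?I" for i
    using mI[OF that] x farr_fsp[OF mI(2)[OF that] ab(1) mI(4)[OF that]] by (simp_all add: p_def)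
  have q: "q j \<in> fsp F (fst j)" "farr F (fst j) b (snd j) (q j) \<in> fsp F b" if "j \<in> ?J" for j
    using mJ[OF that] y farr_fsp[OF mJ(2)[OF that] ab(2) mJ(4)[OF that]] by (simp_all add: q_def)
  have sum_p: "(\<Sum>i\<in>?I. farr F (fst i) a (snd i) (p i)) = x"
    unfolding p_def by (rule resolution_vector[OF resolves_resolution[OF ab(1)] ab(1) x])
  have sum_q: "(\<Sum>j\<in>?J. farr F (fst j) b (snd j) (q j)) = y"
    unfolding q_def by (rule resolution_vector[OF resolves_resolution[OF ab(2)] ab(2) y])
  have "bisum N (cten \<sigma> \<delta> a u x) (cten \<rho> \<sigma>' b t y) =
      (\<Sum>i\<in>?I. \<Sum>j\<in>?J. bisum N (stensor C F \<sigma> \<delta> (fst i) (u \<cdot> (snd i \<boxtimes> \<ii>\<dd> \<sigma>)) (p i))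
        (stensor C F \<rho> \<sigma>' (fst j) (t \<cdot> (snd j \<boxtimes> \<ii>\<dd> \<rho>)) (q j)))"
    unfolding cten_expand[OF ab(1) fusion_Ob(1,2) u x] cten_expand[OF ab(2) fusion_Ob(3,4) t y]
      p_def[symmetric] q_def[symmetric]
    using mI mJ u t p q by (intro bisum_sum stensor_xHom fusion_Ob)
  also have "\<dots> = (\<Sum>i\<in>?I. \<Sum>j\<in>?J. cten \<rho>'' \<sigma>'' (a \<odot> b) (B a b u t)
      (ften F a b (farr F (fst i) a (snd i) (p i)) (farr F (fst j) b (snd j) (q j))))"
  proof (intro sum.cong refl)
    fix i j assume i: "i \<in> ?I" and j: "j \<in> ?J"
    note mi = mI[OF i] and mj = mJ[OF j]
    note klS = S_tob[OF mi(2) mj(2)]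
    have vw: "snd i \<boxtimes> snd j \<in> Hom C (fst i \<odot> fst j) (a \<odot> b)"
      by (rule tar_Hom[OF mi(3) S_Ob[OF ab(1)] mj(3) S_Ob[OF ab(2)] mi(4) mj(4)])
    have "bisum N (stensor C F \<sigma> \<delta> (fst i) (u \<cdot> (snd i \<boxtimes> \<ii>\<dd> \<sigma>)) (p i))
        (stensor C F \<rho> \<sigma>' (fst j) (t \<cdot> (snd j \<boxtimes> \<ii>\<dd> \<rho>)) (q j)) =
      cten \<rho>'' \<sigma>'' (fst i \<odot> fst j) (B a b u t \<cdot> ((snd i \<boxtimes> snd j) \<boxtimes> \<ii>\<dd> \<rho>'')) (ften F (fst i) (fst j) (p i) (q j))"
      using bisum_stensor[OF mi(1) mj(1) mi(7)[OF u] mj(7)[OF t] p(1)[OF i] q(1)[OF j]]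
        B_natural[OF ab mi(2) mj(2) u t mi(4) mj(4)] by simp
    also have "\<dots> = cten \<rho>'' \<sigma>'' (a \<odot> b) (B a b u t)
        (farr F (fst i \<odot> fst j) (a \<odot> b) (snd i \<boxtimes> snd j) (ften F (fst i) (fst j) (p i) (q j)))"
      by (rule cten_slide[OF klS S_tob[OF ab] vw fusion_Ob(5,6) B_Hom[OF ab u t] ften_fsp[OF mi(2) mj(2) p(1)[OF i] q(1)[OF j]]])
    also have "farr F (fst i \<odot> fst j) (a \<odot> b) (snd i \<boxtimes> snd j) (ften F (fst i) (fst j) (p i) (q j)) =
        ften F a b (farr F (fst i) a (snd i) (p i)) (farr F (fst j) b (snd j) (q j))"
      by (rule ften_farr[OF mi(2) mj(2) ab mi(4) mj(4) p(1)[OF i] q(1)[OF j]])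
    finally show "bisum N (stensor C F \<sigma> \<delta> (fst i) (u \<cdot> (snd i \<boxtimes> \<ii>\<dd> \<sigma>)) (p i))
        (stensor C F \<rho> \<sigma>' (fst j) (t \<cdot> (snd j \<boxtimes> \<ii>\<dd> \<rho>)) (q j)) = cten \<rho>'' \<sigma>'' (a \<odot> b) (B a b u t)
        (ften F a b (farr F (fst i) a (snd i) (p i)) (farr F (fst j) b (snd j) (q j)))" .
  qed
  also have "\<dots> = (\<Sum>i\<in>?I. cten \<rho>'' \<sigma>'' (a \<odot> b) (B a b u t) (ften F a b (farr F (fst i) a (snd i) (p i)) y))"
  proof (intro sum.cong refl)
    fix i assume i: "i \<in> ?I"
    show "(\<Sum>j\<in>?J. cten \<rho>'' \<sigma>'' (a \<odot> b) (B a b u t)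
        (ften F a b (farr F (fst i) a (snd i) (p i)) (farr F (fst j) b (snd j) (q j)))) =
      cten \<rho>'' \<sigma>'' (a \<odot> b) (B a b u t) (ften F a b (farr F (fst i) a (snd i) (p i)) y)"
      using ften_sum_right[OF ab p(2)[OF i], of ?J "\<lambda>j. farr F (fst j) b (snd j) (q j)"] q(2) sum_q
        cten_sum_vec[OF S_tob[OF ab] fusion_Ob(5,6), of ?J
          "\<lambda>j. ften F a b (farr F (fst i) a (snd i) (p i)) (farr F (fst j) b (snd j) (q j))"]
        ften_fsp[OF ab p(2)[OF i] q(2)] by simp
  qed
  also have "\<dots> = cten \<rho>'' \<sigma>'' (a \<odot> b) (B a b u t) (ften F a b x y)"
    using ften_sum_left[OF ab y, of ?I "\<lambda>i. farr F (fst i) a (snd i) (p i)"] p(2) sum_p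
      cten_sum_vec[OF S_tob[OF ab] fusion_Ob(5,6), of ?I "\<lambda>i. ften F a b (farr F (fst i) a (snd i) (p i)) y"]
      ften_fsp[OF ab p(2) y] by simp
  finally show ?thesis .
qed

end

lemma fusion_ruleI:
  assumes "\<sigma> \<in> Ob C" "\<delta> \<in> Ob C" "\<rho> \<in> Ob C" "\<sigma>' \<in> Ob C" "\<rho>'' \<in> Ob C" "\<sigma>'' \<in> Ob C"
    and 1: "\<And>a b u t. \<lbrakk>a \<in> S; b \<in> S; u \<in> Hom C (a \<odot> \<sigma>) \<delta>; t \<in> Hom C (b \<odot> \<rho>) \<sigma>'\<rbrakk>
      \<Longrightarrow> B a b u t \<in> Hom C ((a \<odot> b) \<odot> \<rho>'') \<sigma>''"
    and 2: "\<And>a b u u' t t'. \<lbrakk>a \<in> S; b \<in> S; u \<in> Hom C (a \<odot> \<sigma>) \<delta>; u' \<in> Hom C (a \<odot> \<sigma>) \<delta>;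
        t \<in> Hom C (b \<odot> \<rho>) \<sigma>'; t' \<in> Hom C (b \<odot> \<rho>) \<sigma>'\<rbrakk>
      \<Longrightarrow> B a b (u + u') t = B a b u t + B a b u' t \<and> B a b u (t + t') = B a b u t + B a b u t'"
    and 3: "\<And>a b u t z. \<lbrakk>a \<in> S; b \<in> S; u \<in> Hom C (a \<odot> \<sigma>) \<delta>; t \<in> Hom C (b \<odot> \<rho>) \<sigma>'\<rbrakk>
      \<Longrightarrow> B a b (scl C z u) t = scl C z (B a b u t) \<and> B a b u (scl C z t) = scl C z (B a b u t)"
    and 4: "\<And>a b k l u t v w. \<lbrakk>a \<in> S; b \<in> S; k \<in> S; l \<in> S;
        u \<in> Hom C (a \<odot> \<sigma>) \<delta>; t \<in> Hom C (b \<odot> \<rho>) \<sigma>'; v \<in> Hom C k a; w \<in> Hom C l b\<rbrakk>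
      \<Longrightarrow> B k l (u \<cdot> (v \<boxtimes> \<ii>\<dd> \<sigma>)) (t \<cdot> (w \<boxtimes> \<ii>\<dd> \<rho>)) = B a b u t \<cdot> ((v \<boxtimes> w) \<boxtimes> \<ii>\<dd> \<rho>'')"
    and 5: "\<And>k l s t \<psi> \<psi>'. N \<sigma> \<delta> k s \<psi> \<rho> \<sigma>' l t \<psi>' = xfuse C F P \<rho>'' \<sigma>'' k l (B k l s t) \<psi> \<psi>'"
  shows "fusion_rule \<sigma> \<delta> \<rho> \<sigma>' \<rho>'' \<sigma>'' B N"
  unfolding fusion_rule_def
proof (intro conjI)
  show "\<forall>a b u t. a \<in> S \<longrightarrow> b \<in> S \<longrightarrow> u \<in> Hom C (a \<odot> \<sigma>) \<delta> \<longrightarrow> t \<in> Hom C (b \<odot> \<rho>) \<sigma>' \<longrightarrow>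
        B a b u t \<in> Hom C ((a \<odot> b) \<odot> \<rho>'') \<sigma>''"
    by (intro allI impI 1)
  show "\<forall>a b u u' t t'. a \<in> S \<longrightarrow> b \<in> S \<longrightarrow> u \<in> Hom C (a \<odot> \<sigma>) \<delta> \<longrightarrow> u' \<in> Hom C (a \<odot> \<sigma>) \<delta> \<longrightarrow>
        t \<in> Hom C (b \<odot> \<rho>) \<sigma>' \<longrightarrow> t' \<in> Hom C (b \<odot> \<rho>) \<sigma>' \<longrightarrow>
        B a b (u + u') t = B a b u t + B a b u' t \<and> B a b u (t + t') = B a b u t + B a b u t'"
    by (intro allI impI 2)
  show "\<forall>a b u t z. a \<in> S \<longrightarrow> b \<in> S \<longrightarrow> u \<in> Hom C (a \<odot> \<sigma>) \<delta> \<longrightarrow> t \<in> Hom C (b \<odot> \<rho>) \<sigma>' \<longrightarrow>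
        B a b (scl C z u) t = scl C z (B a b u t) \<and> B a b u (scl C z t) = scl C z (B a b u t)"
    by (intro allI impI 3)
  show "\<forall>a b k l u t v w. a \<in> S \<longrightarrow> b \<in> S \<longrightarrow> k \<in> S \<longrightarrow> l \<in> S \<longrightarrow>
        u \<in> Hom C (a \<odot> \<sigma>) \<delta> \<longrightarrow> t \<in> Hom C (b \<odot> \<rho>) \<sigma>' \<longrightarrow> v \<in> Hom C k a \<longrightarrow> w \<in> Hom C l b \<longrightarrow>
        B k l (u \<cdot> (v \<boxtimes> \<ii>\<dd> \<sigma>)) (t \<cdot> (w \<boxtimes> \<ii>\<dd> \<rho>)) = B a b u t \<cdot> ((v \<boxtimes> w) \<boxtimes> \<ii>\<dd> \<rho>'')"
    by (intro allI impI 4)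
  show "\<forall>k l s t \<psi> \<psi>'. N \<sigma> \<delta> k s \<psi> \<rho> \<sigma>' l t \<psi>' = xfuse C F P \<rho>'' \<sigma>'' k l (B k l s t) \<psi> \<psi>'"
    by (intro allI 5)
qed (use assms(1-6) in simp_all)


section \<open>Composition\<close>

definition cmp_summand where
  "cmp_summand \<sigma> \<delta> k s \<psi> = (\<lambda>\<rho> \<sigma>' l t \<psi>'.
     if \<sigma>' = \<sigma> then xfuse C F P \<rho> \<delta> k l (s \<cdot> (\<ii>\<dd> k \<boxtimes> t)) \<psi> \<psi>' else 0)"

lemma xcmp_bisum: "xcmp C F P = bisum cmp_summand"
  unfolding xcmp_def bisum_def cmp_summand_def by (rule refl)

context
  fixes \<rho> \<sigma> \<delta> assumes O: "\<rho> \<in> Ob C" "\<sigma> \<in> Ob C" "\<delta> \<in> Ob C"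
begin

lemma cmp_fusion: "fusion_rule \<sigma> \<delta> \<rho> \<sigma> \<rho> \<delta> (\<lambda>a b u t. u \<cdot> (\<ii>\<dd> a \<boxtimes> t)) cmp_summand"
proof (rule fusion_ruleI)
  fix a b u t assume ab: "a \<in> S" "b \<in> S" and u: "u \<in> Hom C (a \<odot> \<sigma>) \<delta>" and t: "t \<in> Hom C (b \<odot> \<rho>) \<sigma>"
  note Oa = S_Ob[OF ab(1)] and Ob = S_Ob[OF ab(2)]
  note Obr = tob_Ob[OF Ob O(1)] and Oas = tob_Ob[OF Oa O(2)]
  note Oabr = tob_Ob[OF Oa Obr]
  note ia = idt_Hom[OF Oa]
  have it: "\<ii>\<dd> a \<boxtimes> t \<in> Hom C (a \<odot> (b \<odot> \<rho>)) (a \<odot> \<sigma>)"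
    by (rule tar_Hom[OF Oa Oa Obr O(2) ia t])
  then show "u \<cdot> (\<ii>\<dd> a \<boxtimes> t) \<in> Hom C ((a \<odot> b) \<odot> \<rho>) \<delta>"
    using cmp_Hom[OF Oabr Oas O(3) it u] tob_assoc[OF Oa Ob O(1)] by simp
  show "scl C z u \<cdot> (\<ii>\<dd> a \<boxtimes> t) = scl C z (u \<cdot> (\<ii>\<dd> a \<boxtimes> t)) \<and>
      u \<cdot> (\<ii>\<dd> a \<boxtimes> scl C z t) = scl C z (u \<cdot> (\<ii>\<dd> a \<boxtimes> t))" for z
    using cmp_scl[OF Oabr Oas O(3) it u] tar_scl[OF Oa Oa Obr O(2) ia t] by simp
  show "(u + u') \<cdot> (\<ii>\<dd> a \<boxtimes> t) = (u \<cdot> (\<ii>\<dd> a \<boxtimes> t)) + (u' \<cdot> (\<ii>\<dd> a \<boxtimes> t)) \<and>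
      u \<cdot> (\<ii>\<dd> a \<boxtimes> (t + t')) = (u \<cdot> (\<ii>\<dd> a \<boxtimes> t)) + (u \<cdot> (\<ii>\<dd> a \<boxtimes> t'))"
    if u': "u' \<in> Hom C (a \<odot> \<sigma>) \<delta>" and t': "t' \<in> Hom C (b \<odot> \<rho>) \<sigma>" for u' t'
    using cmp_add[OF Oabr Oas O(3) it tar_Hom[OF Oa Oa Obr O(2) ia t'] u u']
      tar_add[OF Oa Oa Obr O(2) ia ia t t'] by simp
  fix k l v w assume kl: "k \<in> S" "l \<in> S" and v: "v \<in> Hom C k a" and w: "w \<in> Hom C l b"
  note Ok = S_Ob[OF kl(1)] and Ol = S_Ob[OF kl(2)]
  note Olr = tob_Ob[OF Ol O(1)] and Oks = tob_Ob[OF Ok O(2)]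
  have wr: "w \<boxtimes> \<ii>\<dd> \<rho> \<in> Hom C (l \<odot> \<rho>) (b \<odot> \<rho>)" by (rule tar_Hom[OF Ol Ob O(1,1) w idt_Hom[OF O(1)]])
  have tw: "t \<cdot> (w \<boxtimes> \<ii>\<dd> \<rho>) \<in> Hom C (l \<odot> \<rho>) \<sigma>" by (rule cmp_Hom[OF Olr Obr O(2) wr t])
  have vs: "v \<boxtimes> \<ii>\<dd> \<sigma> \<in> Hom C (k \<odot> \<sigma>) (a \<odot> \<sigma>)" by (rule tar_Hom[OF Ok Oa O(2,2) v idt_Hom[OF O(2)]])
  have itw: "\<ii>\<dd> k \<boxtimes> (t \<cdot> (w \<boxtimes> \<ii>\<dd> \<rho>)) \<in> Hom C (k \<odot> (l \<odot> \<rho>)) (k \<odot> \<sigma>)"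
    by (rule tar_Hom[OF Ok Ok Olr O(2) idt_Hom[OF Ok] tw])
  have vw: "v \<boxtimes> (w \<boxtimes> \<ii>\<dd> \<rho>) \<in> Hom C (k \<odot> (l \<odot> \<rho>)) (a \<odot> (b \<odot> \<rho>))"
    by (rule tar_Hom[OF Ok Oa Olr Obr v wr])
  have "(u \<cdot> (v \<boxtimes> \<ii>\<dd> \<sigma>)) \<cdot> (\<ii>\<dd> k \<boxtimes> (t \<cdot> (w \<boxtimes> \<ii>\<dd> \<rho>))) =
      u \<cdot> ((v \<boxtimes> \<ii>\<dd> \<sigma>) \<cdot> (\<ii>\<dd> k \<boxtimes> (t \<cdot> (w \<boxtimes> \<ii>\<dd> \<rho>))))"
    by (rule cmp_assoc[OF tob_Ob[OF Ok Olr] Oks Oas O(3) itw vs u])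
  also have "(v \<boxtimes> \<ii>\<dd> \<sigma>) \<cdot> (\<ii>\<dd> k \<boxtimes> (t \<cdot> (w \<boxtimes> \<ii>\<dd> \<rho>))) = v \<boxtimes> (t \<cdot> (w \<boxtimes> \<ii>\<dd> \<rho>))"
    using tar_cmp[OF Ok Ok Oa Olr O(2,2) idt_Hom[OF Ok] v tw idt_Hom[OF O(2)]] cmp_idt[OF Ok Oa v]
      cmp_idt[OF Olr O(2) tw] by simp
  also have "\<dots> = (\<ii>\<dd> a \<boxtimes> t) \<cdot> (v \<boxtimes> (w \<boxtimes> \<ii>\<dd> \<rho>))"
    using tar_cmp[OF Ok Oa Oa Olr Obr O(2) v ia wr t] cmp_idt[OF Ok Oa v] by simp
  also have "u \<cdot> \<dots> = (u \<cdot> (\<ii>\<dd> a \<boxtimes> t)) \<cdot> (v \<boxtimes> (w \<boxtimes> \<ii>\<dd> \<rho>))"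
    by (rule cmp_assoc[OF tob_Ob[OF Ok Olr] Oabr Oas O(3) vw it u, symmetric])
  also have "v \<boxtimes> (w \<boxtimes> \<ii>\<dd> \<rho>) = (v \<boxtimes> w) \<boxtimes> \<ii>\<dd> \<rho>"
    by (rule tar_assoc[OF Ok Oa Ol Ob O(1,1) v w idt_Hom[OF O(1)], symmetric])
  finally show "(u \<cdot> (v \<boxtimes> \<ii>\<dd> \<sigma>)) \<cdot> (\<ii>\<dd> k \<boxtimes> (t \<cdot> (w \<boxtimes> \<ii>\<dd> \<rho>))) =
      (u \<cdot> (\<ii>\<dd> a \<boxtimes> t)) \<cdot> ((v \<boxtimes> w) \<boxtimes> \<ii>\<dd> \<rho>)" .
next
  show "cmp_summand \<sigma> \<delta> k s \<psi> \<rho> \<sigma> l t \<psi>' = xfuse C F P \<rho> \<delta> k l (s \<cdot> (\<ii>\<dd> k \<boxtimes> t)) \<psi> \<psi>'" for k l s t \<psi> \<psi>'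
    by (simp add: cmp_summand_def)
qed (rule O)+

lemmas xcmp_stensor = bisum_stensor[OF cmp_fusion, folded xcmp_bisum]
  and xcmp_add_left = bisum_add_left[OF cmp_fusion, folded xcmp_bisum]
  and xcmp_add_right = bisum_add_right[OF cmp_fusion, folded xcmp_bisum]
  and xcmp_zero = bisum_zero[OF cmp_fusion, folded xcmp_bisum]
  and xcmp_xHom = bisum_xHom[OF cmp_fusion, folded xcmp_bisum]
  and xcmp_cten = bisum_cten[OF cmp_fusion, folded xcmp_bisum]
  and act_xcmp = act_bisum[OF cmp_fusion, folded xcmp_bisum]

end

text \<open>
  On simple tensors both sides are the arrow given by a composite in \<open>C\<close> and a tensor product of
  three vectors, and both of these are associative.
\<close>

lemma xcmp_assoc:
  assumes O: "a \<in> Ob C" "b \<in> Ob C" "c \<in> Ob C" "d \<in> Ob C"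
    and x: "x \<in> xHom C F P a b" and y: "y \<in> xHom C F P b c" and z: "z \<in> xHom C F P c d"
  shows "xcmp C F P (xcmp C F P z y) x = xcmp C F P z (xcmp C F P y x)"
  using z
proof (induction rule: xHom_induct[OF O(3,4), consumes 1, case_names zero add])
  case zero
  show ?case by (simp only: xcmp_zero[OF O(1,2,3)] xcmp_zero[OF O(2,3,4)] xcmp_zero[OF O(1,3,4)] xcmp_zero[OF O(1,2,4)])
next
  case outer: (add k s \<psi> z)
  note zs = stensor_xHom[OF O(3,4) outer(1-3)]
  have "xcmp C F P (xcmp C F P (stensor C F c d k s \<psi>) y) x = xcmp C F P (stensor C F c d k s \<psi>) (xcmp C F P y x)"
    using y
  proof (induction rule: xHom_induct[OF O(2,3), consumes 1, case_names zero add])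
    case zero
    show ?case by (simp only: xcmp_zero[OF O(1,2,3)] xcmp_zero[OF O(2,3,4)] xcmp_zero[OF O(1,3,4)] xcmp_zero[OF O(1,2,4)])
  next
    case middle: (add l t \<phi> y)
    note ys = stensor_xHom[OF O(2,3) middle(1-3)]
    have "xcmp C F P (xcmp C F P (stensor C F c d k s \<psi>) (stensor C F b c l t \<phi>)) x =
        xcmp C F P (stensor C F c d k s \<psi>) (xcmp C F P (stensor C F b c l t \<phi>) x)"
      using x
    proof (induction rule: xHom_induct[OF O(1,2), consumes 1, case_names zero add])
      case zero
      show ?case by (simp only: xcmp_zero[OF O(1,2,3)] xcmp_zero[OF O(2,3,4)] xcmp_zero[OF O(1,3,4)] xcmp_zero[OF O(1,2,4)])
    next
      case inner: (add j r \<xi> x)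
      note xs = stensor_xHom[OF O(1,2) inner(1-3)]
      note kS = irr_in_S[OF outer(1)] and lS = irr_in_S[OF middle(1)] and jS = irr_in_S[OF inner(1)]
      note Ok = S_Ob[OF kS] and Ol = S_Ob[OF lS] and Oj = S_Ob[OF jS]
      note s = outer(2) and t = middle(2) and r = inner(2)
      note Oja = tob_Ob[OF Oj O(1)] and Olb = tob_Ob[OF Ol O(2)] and Okc = tob_Ob[OF Ok O(3)]
      note Olja = tob_Ob[OF Ol Oja] and Oklb = tob_Ob[OF Ok Olb]
      have lr: "\<ii>\<dd> l \<boxtimes> r \<in> Hom C (l \<odot> (j \<odot> a)) (l \<odot> b)" by (rule tar_Hom[OF Ol Ol Oja O(2) idt_Hom[OF Ol] r])
      have kt: "\<ii>\<dd> k \<boxtimes> t \<in> Hom C (k \<odot> (l \<odot> b)) (k \<odot> c)" by (rule tar_Hom[OF Ok Ok Olb O(3) idt_Hom[OF Ok] t])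
      have tlr: "t \<cdot> (\<ii>\<dd> l \<boxtimes> r) \<in> Hom C ((l \<odot> j) \<odot> a) c"
        using cmp_Hom[OF Olja Olb O(3) lr t] tob_assoc[OF Ol Oj O(1)] by simp
      have skt: "s \<cdot> (\<ii>\<dd> k \<boxtimes> t) \<in> Hom C ((k \<odot> l) \<odot> b) d"
        using cmp_Hom[OF Oklb Okc O(4) kt s] tob_assoc[OF Ok Ol O(2)] by simp
      have klr: "\<ii>\<dd> k \<boxtimes> (\<ii>\<dd> l \<boxtimes> r) \<in> Hom C (k \<odot> (l \<odot> (j \<odot> a))) (k \<odot> (l \<odot> b))"
        by (rule tar_Hom[OF Ok Ok Olja Olb idt_Hom[OF Ok] lr])
      have arrow: "(s \<cdot> (\<ii>\<dd> k \<boxtimes> t)) \<cdot> (\<ii>\<dd> (k \<odot> l) \<boxtimes> r) = s \<cdot> (\<ii>\<dd> k \<boxtimes> (t \<cdot> (\<ii>\<dd> l \<boxtimes> r)))"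
      proof -
        have "\<ii>\<dd> (k \<odot> l) \<boxtimes> r = \<ii>\<dd> k \<boxtimes> (\<ii>\<dd> l \<boxtimes> r)"
          using tar_assoc[OF Ok Ok Ol Ol Oja O(2) idt_Hom[OF Ok] idt_Hom[OF Ol] r] tar_idt[OF Ok Ol] by simp
        moreover have "(\<ii>\<dd> k \<boxtimes> t) \<cdot> (\<ii>\<dd> k \<boxtimes> (\<ii>\<dd> l \<boxtimes> r)) = \<ii>\<dd> k \<boxtimes> (t \<cdot> (\<ii>\<dd> l \<boxtimes> r))"
          using tar_cmp[OF Ok Ok Ok Olja Olb O(3) idt_Hom[OF Ok] idt_Hom[OF Ok] lr t]
            cmp_idt[OF Ok Ok idt_Hom[OF Ok]] by simp
        ultimately show ?thesis
          using cmp_assoc[OF tob_Ob[OF Ok Olja] Oklb Okc O(4) klr kt s] by simp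
      qed
      have m: "ften F k l \<psi> \<phi> \<in> fsp F (k \<odot> l)" "ften F l j \<phi> \<xi> \<in> fsp F (l \<odot> j)"
        by (rule ften_fsp[OF kS lS outer(3) middle(3)], rule ften_fsp[OF lS jS middle(3) inner(3)])
      have "xcmp C F P (xcmp C F P (stensor C F c d k s \<psi>) (stensor C F b c l t \<phi>)) (stensor C F a b j r \<xi>) =
          cten a d ((k \<odot> l) \<odot> j) ((s \<cdot> (\<ii>\<dd> k \<boxtimes> t)) \<cdot> (\<ii>\<dd> (k \<odot> l) \<boxtimes> r)) (ften F (k \<odot> l) j (ften F k l \<psi> \<phi>) \<xi>)"
        unfolding xcmp_stensor[OF O(2,3,4) outer(1) middle(1) s t outer(3) middle(3)]
          cten_irr[OF inner(1) O(1,2) r inner(3), symmetric]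
        by (rule xcmp_cten[OF O(1,2,4) S_tob[OF kS lS] jS skt r m(1) inner(3)])
      moreover have "xcmp C F P (stensor C F c d k s \<psi>) (xcmp C F P (stensor C F b c l t \<phi>) (stensor C F a b j r \<xi>)) =
          cten a d (k \<odot> (l \<odot> j)) (s \<cdot> (\<ii>\<dd> k \<boxtimes> (t \<cdot> (\<ii>\<dd> l \<boxtimes> r)))) (ften F k (l \<odot> j) \<psi> (ften F l j \<phi> \<xi>))"
        unfolding xcmp_stensor[OF O(1,2,3) middle(1) inner(1) t r middle(3) inner(3)]
          cten_irr[OF outer(1) O(3,4) s outer(3), symmetric]
        by (rule xcmp_cten[OF O(1,3,4) kS S_tob[OF lS jS] s tlr outer(3) m(2)])
      ultimately have simple: "xcmp C F P (xcmp C F P (stensor C F c d k s \<psi>) (stensor C F b c l t \<phi>)) (stensor C F a b j r \<xi>) =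
          xcmp C F P (stensor C F c d k s \<psi>) (xcmp C F P (stensor C F b c l t \<phi>) (stensor C F a b j r \<xi>))"
        using arrow tob_assoc[OF Ok Ol Oj] ften_assoc[OF kS lS jS outer(3) middle(3) inner(3)] by simp
      show ?case
        unfolding xcmp_add_right[OF O(1,2,4) xcmp_xHom[OF O(2,3,4) zs ys] xs inner(4)]
          xcmp_add_right[OF O(1,2,3) ys xs inner(4)]
          xcmp_add_right[OF O(1,3,4) zs xcmp_xHom[OF O(1,2,3) ys xs] xcmp_xHom[OF O(1,2,3) ys inner(4)]]
          simple inner(5) ..
    qed
    then show ?case
      unfolding xcmp_add_right[OF O(2,3,4) zs ys middle(4)] xcmp_add_left[OF O(1,2,3) ys middle(4) x]
        xcmp_add_left[OF O(1,2,4) xcmp_xHom[OF O(2,3,4) zs ys] xcmp_xHom[OF O(2,3,4) zs middle(4)] x]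
        xcmp_add_right[OF O(1,3,4) zs xcmp_xHom[OF O(1,2,3) ys x] xcmp_xHom[OF O(1,2,3) middle(4) x]]
        middle(5) by (rule arg_cong2[where f = "(+)", OF _ refl])
  qed
  then show ?case
    unfolding xcmp_add_left[OF O(2,3,4) zs outer(4) y]
      xcmp_add_left[OF O(1,2,4) xcmp_xHom[OF O(2,3,4) zs y] xcmp_xHom[OF O(2,3,4) outer(4) y] x]
      xcmp_add_left[OF O(1,3,4) zs outer(4) xcmp_xHom[OF O(1,2,3) y x]]
      outer(5) by (rule arg_cong2[where f = "(+)", OF _ refl])
qed


section \<open>Tensor product\<close>

lemma eps_Hom: "\<lbrakk>a \<in> Ob C; b \<in> Ob C\<rbrakk> \<Longrightarrow> \<epsilon> a b \<in> Hom C (a \<odot> b) (b \<odot> a)"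
  and eps_unitary: "\<lbrakk>a \<in> Ob C; b \<in> Ob C\<rbrakk> \<Longrightarrow> (\<epsilon> a b)\<^sup>\<star> \<cdot> \<epsilon> a b = \<ii>\<dd> (a \<odot> b)"
  and eps_natural: "\<lbrakk>a \<in> Ob C; a' \<in> Ob C; b \<in> Ob C; b' \<in> Ob C; f \<in> Hom C a a'; g \<in> Hom C b b'\<rbrakk>
    \<Longrightarrow> (g \<boxtimes> f) \<cdot> \<epsilon> a b = \<epsilon> a' b' \<cdot> (f \<boxtimes> g)"
  and eps_tensor: "\<lbrakk>a \<in> Ob C; b \<in> Ob C; c \<in> Ob C\<rbrakk>
    \<Longrightarrow> \<epsilon> a (b \<odot> c) = (\<ii>\<dd> b \<boxtimes> \<epsilon> a c) \<cdot> (\<epsilon> a b \<boxtimes> \<ii>\<dd> c) \<and>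
        \<epsilon> (a \<odot> b) c = (\<epsilon> a c \<boxtimes> \<ii>\<dd> b) \<cdot> (\<ii>\<dd> a \<boxtimes> \<epsilon> b c)"
  using braiding unfolding unitary_braiding_def unitary_arrow_def isometry_def by auto

text \<open>
  With units for objects, the hexagon equations say that the braiding is idempotent, and a unitary
  idempotent is an identity.
\<close>

lemma eps_unit: assumes a: "a \<in> Ob C" shows "\<epsilon> a \<iota> = \<ii>\<dd> a" "\<epsilon> \<iota> a = \<ii>\<dd> a"
proof -
  note i = tun_Ob and u = tob_tun[OF a] tob_tun[OF tun_Ob]
  have idem: "e = \<ii>\<dd> a" if e: "e \<in> Hom C a a" "e\<^sup>\<star> \<cdot> e = \<ii>\<dd> a" "e = e \<cdot> e" for e
  proof -
    have es: "e\<^sup>\<star> \<in> Hom C a a" using a e(1) by (intro str_Hom)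
    have "\<ii>\<dd> a = e\<^sup>\<star> \<cdot> (e \<cdot> e)" using e(2,3) by simp
    also have "\<dots> = (e\<^sup>\<star> \<cdot> e) \<cdot> e" by (rule cmp_assoc[OF a a a a e(1) e(1) es, symmetric])
    also have "\<dots> = e" using e(2) cmp_idt[OF a a e(1)] by simp
    finally show ?thesis by simp
  qed
  have H: "\<epsilon> a \<iota> \<in> Hom C a a" "\<epsilon> \<iota> a \<in> Hom C a a" using eps_Hom[OF a i] eps_Hom[OF i a] u by simp_all
  show "\<epsilon> a \<iota> = \<ii>\<dd> a"
    by (rule idem[OF H(1)])
      (use eps_unitary[OF a i] eps_tensor[OF a i i] u tar_tun[OF a a H(1)] in simp_all)
  show "\<epsilon> \<iota> a = \<ii>\<dd> a"
    by (rule idem[OF H(2)])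
      (use eps_unitary[OF i a] eps_tensor[OF i i a] u tar_tun[OF a a H(2)] in simp_all)
qed

definition tar_summand where
  "tar_summand \<rho>1 \<sigma>1 k s \<psi> = (\<lambda>\<rho>2 \<sigma>2 l t \<psi>'.
     xfuse C F P (\<rho>1 \<odot> \<rho>2) (\<sigma>1 \<odot> \<sigma>2) k l ((s \<boxtimes> t) \<cdot> (\<ii>\<dd> k \<boxtimes> \<epsilon> l \<rho>1 \<boxtimes> \<ii>\<dd> \<rho>2)) \<psi> \<psi>')"

lemma xtar_bisum: "xtar C \<epsilon> F P = bisum tar_summand"
  unfolding xtar_def bisum_def tar_summand_def by (rule refl)

context
  fixes \<rho>1 \<sigma>1 \<rho>2 \<sigma>2 assumes O: "\<rho>1 \<in> Ob C" "\<sigma>1 \<in> Ob C" "\<rho>2 \<in> Ob C" "\<sigma>2 \<in> Ob C"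
begin

lemma tar_fusion: "fusion_rule \<rho>1 \<sigma>1 \<rho>2 \<sigma>2 (\<rho>1 \<odot> \<rho>2) (\<sigma>1 \<odot> \<sigma>2)
    (\<lambda>a b u t. (u \<boxtimes> t) \<cdot> (\<ii>\<dd> a \<boxtimes> \<epsilon> b \<rho>1 \<boxtimes> \<ii>\<dd> \<rho>2)) tar_summand"
proof (rule fusion_ruleI)
  have exch: "\<ii>\<dd> a \<boxtimes> \<epsilon> b \<rho>1 \<boxtimes> \<ii>\<dd> \<rho>2 \<in> Hom C ((a \<odot> b) \<odot> (\<rho>1 \<odot> \<rho>2)) ((a \<odot> \<rho>1) \<odot> (b \<odot> \<rho>2))"
    if ab: "a \<in> S" "b \<in> S" for a b
  proof -
    note Oa = S_Ob[OF ab(1)] and Ob = S_Ob[OF ab(2)]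
    have "\<ii>\<dd> a \<boxtimes> (\<epsilon> b \<rho>1 \<boxtimes> \<ii>\<dd> \<rho>2) \<in> Hom C (a \<odot> ((b \<odot> \<rho>1) \<odot> \<rho>2)) (a \<odot> ((\<rho>1 \<odot> b) \<odot> \<rho>2))"
      by (intro tar_Hom tob_Ob idt_Hom eps_Hom Oa Ob O)
    then show ?thesis using Oa Ob O by (simp add: tob_assoc tob_Ob)
  qed
  fix a b u t assume ab: "a \<in> S" "b \<in> S" and u: "u \<in> Hom C (a \<odot> \<rho>1) \<sigma>1" and t: "t \<in> Hom C (b \<odot> \<rho>2) \<sigma>2"
  note Oa = S_Ob[OF ab(1)] and Ob = S_Ob[OF ab(2)]
  note Oar = tob_Ob[OF Oa O(1)] and Obr = tob_Ob[OF Ob O(3)]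
  note X = exch[OF ab]
  note OX = tob_Ob[OF tob_Ob[OF Oa Ob] tob_Ob[OF O(1,3)]] tob_Ob[OF Oar Obr] tob_Ob[OF O(2,4)]
  have ut: "u \<boxtimes> t \<in> Hom C ((a \<odot> \<rho>1) \<odot> (b \<odot> \<rho>2)) (\<sigma>1 \<odot> \<sigma>2)" by (rule tar_Hom[OF Oar O(2) Obr O(4) u t])
  show "(u \<boxtimes> t) \<cdot> (\<ii>\<dd> a \<boxtimes> \<epsilon> b \<rho>1 \<boxtimes> \<ii>\<dd> \<rho>2) \<in> Hom C ((a \<odot> b) \<odot> (\<rho>1 \<odot> \<rho>2)) (\<sigma>1 \<odot> \<sigma>2)"
    by (rule cmp_Hom[OF OX X ut])
  show "(scl C z u \<boxtimes> t) \<cdot> (\<ii>\<dd> a \<boxtimes> \<epsilon> b \<rho>1 \<boxtimes> \<ii>\<dd> \<rho>2) = scl C z ((u \<boxtimes> t) \<cdot> (\<ii>\<dd> a \<boxtimes> \<epsilon> b \<rho>1 \<boxtimes> \<ii>\<dd> \<rho>2)) \<and>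
      (u \<boxtimes> scl C z t) \<cdot> (\<ii>\<dd> a \<boxtimes> \<epsilon> b \<rho>1 \<boxtimes> \<ii>\<dd> \<rho>2) = scl C z ((u \<boxtimes> t) \<cdot> (\<ii>\<dd> a \<boxtimes> \<epsilon> b \<rho>1 \<boxtimes> \<ii>\<dd> \<rho>2))" for z
    using tar_scl[OF Oar O(2) Obr O(4) u t] cmp_scl[OF OX X ut] by simp
  show "((u + u') \<boxtimes> t) \<cdot> (\<ii>\<dd> a \<boxtimes> \<epsilon> b \<rho>1 \<boxtimes> \<ii>\<dd> \<rho>2) =
        ((u \<boxtimes> t) \<cdot> (\<ii>\<dd> a \<boxtimes> \<epsilon> b \<rho>1 \<boxtimes> \<ii>\<dd> \<rho>2)) + ((u' \<boxtimes> t) \<cdot> (\<ii>\<dd> a \<boxtimes> \<epsilon> b \<rho>1 \<boxtimes> \<ii>\<dd> \<rho>2)) \<and>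
      (u \<boxtimes> (t + t')) \<cdot> (\<ii>\<dd> a \<boxtimes> \<epsilon> b \<rho>1 \<boxtimes> \<ii>\<dd> \<rho>2) =
        ((u \<boxtimes> t) \<cdot> (\<ii>\<dd> a \<boxtimes> \<epsilon> b \<rho>1 \<boxtimes> \<ii>\<dd> \<rho>2)) + ((u \<boxtimes> t') \<cdot> (\<ii>\<dd> a \<boxtimes> \<epsilon> b \<rho>1 \<boxtimes> \<ii>\<dd> \<rho>2))"
    if u': "u' \<in> Hom C (a \<odot> \<rho>1) \<sigma>1" and t': "t' \<in> Hom C (b \<odot> \<rho>2) \<sigma>2" for u' t'
    using tar_add[OF Oar O(2) Obr O(4) u u' t t']
      cmp_add[OF OX X X ut tar_Hom[OF Oar O(2) Obr O(4) u' t]]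
      cmp_add[OF OX X X ut tar_Hom[OF Oar O(2) Obr O(4) u t']] by simp
  fix k l v w assume kl: "k \<in> S" "l \<in> S" and v: "v \<in> Hom C k a" and w: "w \<in> Hom C l b"
  note Ok = S_Ob[OF kl(1)] and Ol = S_Ob[OF kl(2)]
  note X' = exch[OF kl]
  note Okr = tob_Ob[OF Ok O(1)] and Olr = tob_Ob[OF Ol O(3)]
  note ir = idt_Hom[OF O(1)] idt_Hom[OF O(3)]
  have vr: "v \<boxtimes> \<ii>\<dd> \<rho>1 \<in> Hom C (k \<odot> \<rho>1) (a \<odot> \<rho>1)" by (rule tar_Hom[OF Ok Oa O(1,1) v ir(1)])
  have wr: "w \<boxtimes> \<ii>\<dd> \<rho>2 \<in> Hom C (l \<odot> \<rho>2) (b \<odot> \<rho>2)" by (rule tar_Hom[OF Ol Ob O(3,3) w ir(2)])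
  have wr1: "w \<boxtimes> \<ii>\<dd> \<rho>1 \<in> Hom C (l \<odot> \<rho>1) (b \<odot> \<rho>1)" by (rule tar_Hom[OF Ol Ob O(1,1) w ir(1)])
  have rw: "\<ii>\<dd> \<rho>1 \<boxtimes> w \<in> Hom C (\<rho>1 \<odot> l) (\<rho>1 \<odot> b)" by (rule tar_Hom[OF O(1,1) Ol Ob ir(1) w])
  have vwr: "(v \<boxtimes> \<ii>\<dd> \<rho>1) \<boxtimes> (w \<boxtimes> \<ii>\<dd> \<rho>2) \<in> Hom C ((k \<odot> \<rho>1) \<odot> (l \<odot> \<rho>2)) ((a \<odot> \<rho>1) \<odot> (b \<odot> \<rho>2))"
    by (rule tar_Hom[OF Okr Oar Olr Obr vr wr])
  have vwi: "(v \<boxtimes> w) \<boxtimes> \<ii>\<dd> (\<rho>1 \<odot> \<rho>2) \<in> Hom C ((k \<odot> l) \<odot> (\<rho>1 \<odot> \<rho>2)) ((a \<odot> b) \<odot> (\<rho>1 \<odot> \<rho>2))"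
    by (intro tar_Hom tob_Ob idt_Hom Ok Ol Oa Ob O v w)
  note OX' = tob_Ob[OF tob_Ob[OF Ok Ol] tob_Ob[OF O(1,3)]] tob_Ob[OF Okr Olr]
  note el = eps_Hom[OF Ol O(1)] and eb = eps_Hom[OF Ob O(1)]
  note Olr1 = tob_Ob[OF Ol O(1)] tob_Ob[OF O(1) Ol] and Obr1 = tob_Ob[OF Ob O(1)] tob_Ob[OF O(1) Ob]
  have slide: "((v \<boxtimes> \<ii>\<dd> \<rho>1) \<boxtimes> (w \<boxtimes> \<ii>\<dd> \<rho>2)) \<cdot> (\<ii>\<dd> k \<boxtimes> \<epsilon> l \<rho>1 \<boxtimes> \<ii>\<dd> \<rho>2) =
      (\<ii>\<dd> a \<boxtimes> \<epsilon> b \<rho>1 \<boxtimes> \<ii>\<dd> \<rho>2) \<cdot> ((v \<boxtimes> w) \<boxtimes> \<ii>\<dd> (\<rho>1 \<odot> \<rho>2))"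
  proof -
    let ?m = "(\<ii>\<dd> \<rho>1 \<boxtimes> w) \<cdot> \<epsilon> l \<rho>1"
    have m: "?m \<in> Hom C (l \<odot> \<rho>1) (\<rho>1 \<odot> b)" by (rule cmp_Hom[OF Olr1 Obr1(2) el rw])
    have el2: "\<epsilon> l \<rho>1 \<boxtimes> \<ii>\<dd> \<rho>2 \<in> Hom C ((l \<odot> \<rho>1) \<odot> \<rho>2) ((\<rho>1 \<odot> l) \<odot> \<rho>2)"
      and eb2: "\<epsilon> b \<rho>1 \<boxtimes> \<ii>\<dd> \<rho>2 \<in> Hom C ((b \<odot> \<rho>1) \<odot> \<rho>2) ((\<rho>1 \<odot> b) \<odot> \<rho>2)"
      and rw2: "(\<ii>\<dd> \<rho>1 \<boxtimes> w) \<boxtimes> \<ii>\<dd> \<rho>2 \<in> Hom C ((\<rho>1 \<odot> l) \<odot> \<rho>2) ((\<rho>1 \<odot> b) \<odot> \<rho>2)"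
      and wr2: "(w \<boxtimes> \<ii>\<dd> \<rho>1) \<boxtimes> \<ii>\<dd> \<rho>2 \<in> Hom C ((l \<odot> \<rho>1) \<odot> \<rho>2) ((b \<odot> \<rho>1) \<odot> \<rho>2)"
      by (intro tar_Hom tob_Ob Ol Ob O el eb rw wr1 ir)+
    have "(v \<boxtimes> \<ii>\<dd> \<rho>1) \<boxtimes> (w \<boxtimes> \<ii>\<dd> \<rho>2) = v \<boxtimes> (\<ii>\<dd> \<rho>1 \<boxtimes> (w \<boxtimes> \<ii>\<dd> \<rho>2))"
      by (rule tar_assoc[OF Ok Oa O(1,1) Olr Obr v ir(1) wr])
    also have "\<ii>\<dd> \<rho>1 \<boxtimes> (w \<boxtimes> \<ii>\<dd> \<rho>2) = (\<ii>\<dd> \<rho>1 \<boxtimes> w) \<boxtimes> \<ii>\<dd> \<rho>2"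
      by (rule tar_assoc[OF O(1,1) Ol Ob O(3,3) ir(1) w ir(2), symmetric])
    finally have "((v \<boxtimes> \<ii>\<dd> \<rho>1) \<boxtimes> (w \<boxtimes> \<ii>\<dd> \<rho>2)) \<cdot> (\<ii>\<dd> k \<boxtimes> (\<epsilon> l \<rho>1 \<boxtimes> \<ii>\<dd> \<rho>2)) =
        (v \<boxtimes> ((\<ii>\<dd> \<rho>1 \<boxtimes> w) \<boxtimes> \<ii>\<dd> \<rho>2)) \<cdot> (\<ii>\<dd> k \<boxtimes> (\<epsilon> l \<rho>1 \<boxtimes> \<ii>\<dd> \<rho>2))" by simp
    also have "\<dots> = (v \<cdot> \<ii>\<dd> k) \<boxtimes> (((\<ii>\<dd> \<rho>1 \<boxtimes> w) \<boxtimes> \<ii>\<dd> \<rho>2) \<cdot> (\<epsilon> l \<rho>1 \<boxtimes> \<ii>\<dd> \<rho>2))"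
      by (rule tar_cmp[OF Ok Ok Oa tob_Ob[OF Olr1(1) O(3)] tob_Ob[OF Olr1(2) O(3)] tob_Ob[OF Obr1(2) O(3)]
            idt_Hom[OF Ok] v el2 rw2, symmetric])
    also have "((\<ii>\<dd> \<rho>1 \<boxtimes> w) \<boxtimes> \<ii>\<dd> \<rho>2) \<cdot> (\<epsilon> l \<rho>1 \<boxtimes> \<ii>\<dd> \<rho>2) = ?m \<boxtimes> (\<ii>\<dd> \<rho>2 \<cdot> \<ii>\<dd> \<rho>2)"
      by (rule tar_cmp[OF Olr1 Obr1(2) O(3,3,3) el rw ir(2,2), symmetric])
    also have "?m = \<epsilon> b \<rho>1 \<cdot> (w \<boxtimes> \<ii>\<dd> \<rho>1)" by (rule eps_natural[OF Ol Ob O(1,1) w ir(1)])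
    also have "(\<epsilon> b \<rho>1 \<cdot> (w \<boxtimes> \<ii>\<dd> \<rho>1)) \<boxtimes> (\<ii>\<dd> \<rho>2 \<cdot> \<ii>\<dd> \<rho>2) = (\<epsilon> b \<rho>1 \<boxtimes> \<ii>\<dd> \<rho>2) \<cdot> ((w \<boxtimes> \<ii>\<dd> \<rho>1) \<boxtimes> \<ii>\<dd> \<rho>2)"
      by (rule tar_cmp[OF Olr1(1) Obr1 O(3,3,3) wr1 eb ir(2,2)])
    also have "v \<cdot> \<ii>\<dd> k = \<ii>\<dd> a \<cdot> v" using cmp_idt[OF Ok Oa v] by simp
    also have "(\<ii>\<dd> a \<cdot> v) \<boxtimes> ((\<epsilon> b \<rho>1 \<boxtimes> \<ii>\<dd> \<rho>2) \<cdot> ((w \<boxtimes> \<ii>\<dd> \<rho>1) \<boxtimes> \<ii>\<dd> \<rho>2)) =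
        (\<ii>\<dd> a \<boxtimes> (\<epsilon> b \<rho>1 \<boxtimes> \<ii>\<dd> \<rho>2)) \<cdot> (v \<boxtimes> ((w \<boxtimes> \<ii>\<dd> \<rho>1) \<boxtimes> \<ii>\<dd> \<rho>2))"
      by (rule tar_cmp[OF Ok Oa Oa tob_Ob[OF Olr1(1) O(3)] tob_Ob[OF Obr1(1) O(3)] tob_Ob[OF Obr1(2) O(3)]
            v idt_Hom[OF Oa] wr2 eb2])
    also have "(w \<boxtimes> \<ii>\<dd> \<rho>1) \<boxtimes> \<ii>\<dd> \<rho>2 = w \<boxtimes> \<ii>\<dd> (\<rho>1 \<odot> \<rho>2)"
      using tar_assoc[OF Ol Ob O(1,1,3,3) w ir] tar_idt[OF O(1,3)] by simp
    also have "v \<boxtimes> (w \<boxtimes> \<ii>\<dd> (\<rho>1 \<odot> \<rho>2)) = (v \<boxtimes> w) \<boxtimes> \<ii>\<dd> (\<rho>1 \<odot> \<rho>2)"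
      by (rule tar_assoc[OF Ok Oa Ol Ob tob_Ob[OF O(1,3)] tob_Ob[OF O(1,3)] v w idt_Hom[OF tob_Ob[OF O(1,3)]], symmetric])
    finally show ?thesis .
  qed
  have "((u \<cdot> (v \<boxtimes> \<ii>\<dd> \<rho>1)) \<boxtimes> (t \<cdot> (w \<boxtimes> \<ii>\<dd> \<rho>2))) \<cdot> (\<ii>\<dd> k \<boxtimes> \<epsilon> l \<rho>1 \<boxtimes> \<ii>\<dd> \<rho>2) =
      ((u \<boxtimes> t) \<cdot> ((v \<boxtimes> \<ii>\<dd> \<rho>1) \<boxtimes> (w \<boxtimes> \<ii>\<dd> \<rho>2))) \<cdot> (\<ii>\<dd> k \<boxtimes> \<epsilon> l \<rho>1 \<boxtimes> \<ii>\<dd> \<rho>2)"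
    using tar_cmp[OF Okr Oar O(2) Olr Obr O(4) vr u wr t] by simp
  also have "\<dots> = (u \<boxtimes> t) \<cdot> (((v \<boxtimes> \<ii>\<dd> \<rho>1) \<boxtimes> (w \<boxtimes> \<ii>\<dd> \<rho>2)) \<cdot> (\<ii>\<dd> k \<boxtimes> \<epsilon> l \<rho>1 \<boxtimes> \<ii>\<dd> \<rho>2))"
    by (rule cmp_assoc[OF OX' OX(2,3) X' vwr ut])
  also have "\<dots> = (u \<boxtimes> t) \<cdot> ((\<ii>\<dd> a \<boxtimes> \<epsilon> b \<rho>1 \<boxtimes> \<ii>\<dd> \<rho>2) \<cdot> ((v \<boxtimes> w) \<boxtimes> \<ii>\<dd> (\<rho>1 \<odot> \<rho>2)))"
    by (simp only: slide)
  also have "\<dots> = ((u \<boxtimes> t) \<cdot> (\<ii>\<dd> a \<boxtimes> \<epsilon> b \<rho>1 \<boxtimes> \<ii>\<dd> \<rho>2)) \<cdot> ((v \<boxtimes> w) \<boxtimes> \<ii>\<dd> (\<rho>1 \<odot> \<rho>2))"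
    by (rule cmp_assoc[OF OX'(1) OX vwi X ut, symmetric])
  finally show "((u \<cdot> (v \<boxtimes> \<ii>\<dd> \<rho>1)) \<boxtimes> (t \<cdot> (w \<boxtimes> \<ii>\<dd> \<rho>2))) \<cdot> (\<ii>\<dd> k \<boxtimes> \<epsilon> l \<rho>1 \<boxtimes> \<ii>\<dd> \<rho>2) =
      ((u \<boxtimes> t) \<cdot> (\<ii>\<dd> a \<boxtimes> \<epsilon> b \<rho>1 \<boxtimes> \<ii>\<dd> \<rho>2)) \<cdot> ((v \<boxtimes> w) \<boxtimes> \<ii>\<dd> (\<rho>1 \<odot> \<rho>2))" .
next
  show "tar_summand \<rho>1 \<sigma>1 k s \<psi> \<rho>2 \<sigma>2 l t \<psi>' = xfuse C F P (\<rho>1 \<odot> \<rho>2) (\<sigma>1 \<odot> \<sigma>2) k l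
      ((s \<boxtimes> t) \<cdot> (\<ii>\<dd> k \<boxtimes> \<epsilon> l \<rho>1 \<boxtimes> \<ii>\<dd> \<rho>2)) \<psi> \<psi>'" for k l s t \<psi> \<psi>'
    by (simp add: tar_summand_def)
qed (intro O tob_Ob)+

lemmas xtar_xHom = bisum_xHom[OF tar_fusion, folded xtar_bisum]
  and xtar_cten = bisum_cten[OF tar_fusion, folded xtar_bisum]
  and act_xtar = act_bisum[OF tar_fusion, folded xtar_bisum]

end


section \<open>Conjugate vectors and the *-operation\<close>

lemma vac_nonzero: "fvac F \<noteq> 0"
  using vac_unit fip_zero_right[OF S_tun fsp_zero[OF S_tun]] by auto

text \<open>
  The vacuum spans an invariant line, on which \<open>g\<close> acts by a scalar \<open>c\<close>; its tensor product with
  itself is again the vacuum, so \<open>c\<^sup>2 = c\<close>.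
\<close>

lemma frep_vac: assumes g: "g \<in> carrier G" shows "frep F \<iota> g (fvac F) = fvac F"
proof -
  note v = vac_space(1)
  have pv: "frep F \<iota> g (fvac F) \<in> fsp F \<iota>" by (rule frep_fsp[OF S_tun g v])
  then obtain c where c: "frep F \<iota> g (fvac F) = fsc F c (fvac F)"
    unfolding vac_space(2) by (auto simp: vecs.span_singleton)
  note u = tob_tun[OF tun_Ob]
  have "frep F \<iota> g (fvac F) = frep F (\<iota> \<odot> \<iota>) g (ften F \<iota> \<iota> (fvac F) (fvac F))"
    using ften_vac[OF S_tun v] u by simp
  also have "\<dots> = ften F \<iota> \<iota> (fsc F c (fvac F)) (fsc F c (fvac F))"
    using ften_rep[OF S_tun S_tun v v g] c by simp
  also have "\<dots> = fsc F c (fsc F c (fvac F))"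
    using ften_scl[OF S_tun S_tun v, of "fsc F c (fvac F)"] ften_vac[OF S_tun, of "fsc F c (fvac F)"]
      fsp_scale[OF S_tun v] by simp
  finally have "fsc F c (fvac F) = fsc F (c * c) (fvac F)" using c by simp
  then have "c = c * c" using vac_nonzero by simp
  moreover have "c \<noteq> 0"
  proof
    assume "c = 0"
    then have "frep F \<iota> g (fvac F) = 0" using c by simp
    then show False using frep_fip[OF S_tun g v v] vac_unit fip_zero_right[OF S_tun fsp_zero[OF S_tun]] by simp
  qed
  ultimately show ?thesis using c by simp
qed

context
  fixes k assumes k: "k \<in> irr P"
begin

lemma Rs_Hom: "Rs P k \<in> Hom C \<iota> (cbar P k \<odot> k)" "Rs' P k \<in> Hom C \<iota> (k \<odot> cbar P k)"
  and Rs_conj: "((Rs P k)\<^sup>\<star> \<boxtimes> \<ii>\<dd> (cbar P k)) \<cdot> (\<ii>\<dd> (cbar P k) \<boxtimes> Rs' P k) = \<ii>\<dd> (cbar P k)"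
    "((Rs' P k)\<^sup>\<star> \<boxtimes> \<ii>\<dd> k) \<cdot> (\<ii>\<dd> k \<boxtimes> Rs P k) = \<ii>\<dd> k"
  using Rs_solution[OF k] by (simp_all add: conj_equations_def)

lemma cbar_S: "cbar P k \<in> S" and k_S: "k \<in> S"
  using irr_in_S cbar_irr[OF k] k by auto

text \<open>The invariant vector that defines conjugate vectors.\<close>

definition cap :: 'h where "cap = farr F \<iota> (k \<odot> cbar P k) (Rs' P k) (fvac F)"

lemma cap_fsp: "cap \<in> fsp F (k \<odot> cbar P k)"
  unfolding cap_def by (rule farr_fsp[OF S_tun S_tob[OF k_S cbar_S] Rs_Hom(2) vac_space(1)])

lemma cap_inv: "g \<in> carrier G \<Longrightarrow> frep F (k \<odot> cbar P k) g cap = cap"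
  unfolding cap_def
  using farr_frep[OF S_tun S_tob[OF k_S cbar_S] Rs_Hom(2), of g "fvac F"] vac_space(1) frep_vac by simp

lemma conj_vector_props:
  assumes \<psi>: "\<psi> \<in> fsp F k"
  shows "conj_vector C F P k \<psi> \<in> fsp F (cbar P k)"
    and "x \<in> fsp F (cbar P k) \<Longrightarrow>
      fip F (cbar P k) x (conj_vector C F P k \<psi>) = fip F (k \<odot> cbar P k) (ften F k (cbar P k) \<psi> x) cap"
proof -
  let ?b = "cbar P k"
  interpret K: fd_hilbert "fsc F" "fsp F ?b" "fip F ?b" by (rule fsp_hilbert[OF cbar_S])
  let ?f = "\<lambda>x. fip F (k \<odot> ?b) (ften F k ?b \<psi> x) cap"
  note kb = S_tob[OF k_S cbar_S]
  note m = ften_fsp[OF k_S cbar_S \<psi>]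
  have "\<exists>y\<in>fsp F ?b. \<forall>x\<in>fsp F ?b. fip F ?b x y = ?f x"
  proof -
    have add: "?f (x + y) = ?f x + ?f y" if "x \<in> fsp F ?b" "y \<in> fsp F ?b" for x y
      using ften_add[OF k_S cbar_S \<psi> \<psi> that] fip_add_left[OF kb m[OF that(1)] m[OF that(2)] cap_fsp] by simp
    have scale: "?f (fsc F z x) = cnj z * ?f x" if "x \<in> fsp F ?b" for x z
      using ften_scl[OF k_S cbar_S \<psi> that] fip_scale_left[OF kb m[OF that] cap_fsp] by simp
    obtain y where "y \<in> fsp F ?b" "\<And>x. x \<in> fsp F ?b \<Longrightarrow> fip F ?b x y = ?f x"
      by (rule K.riesz[of ?f, OF add scale]) (assumption | rule that)+
    then show ?thesis by (intro bexI ballI)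
  qed
  then have "\<exists>!y. y \<in> fsp F ?b \<and> (\<forall>x\<in>fsp F ?b. fip F ?b x y = ?f x)"
    using K.ip_ext by (intro ex_ex1I) auto
  then have "conj_vector C F P k \<psi> \<in> fsp F ?b \<and> (\<forall>x\<in>fsp F ?b. fip F ?b x (conj_vector C F P k \<psi>) = ?f x)"
    unfolding conj_vector_def cap_def by (rule theI')
  then show "conj_vector C F P k \<psi> \<in> fsp F ?b"
    "x \<in> fsp F ?b \<Longrightarrow> fip F ?b x (conj_vector C F P k \<psi>) = ?f x" by simp_all
qed

lemma conj_vector_eq:
  assumes "\<psi> \<in> fsp F k" "y \<in> fsp F (cbar P k)"
    "\<And>x. x \<in> fsp F (cbar P k) \<Longrightarrow> fip F (cbar P k) x y = fip F (k \<odot> cbar P k) (ften F k (cbar P k) \<psi> x) cap"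
  shows "conj_vector C F P k \<psi> = y"
  by (rule fip_ext[OF cbar_S conj_vector_props(1)[OF assms(1)] assms(2)])
    (simp add: conj_vector_props(2)[OF assms(1)] assms(3))

lemma conj_vector_add:
  assumes "\<psi> \<in> fsp F k" "\<psi>' \<in> fsp F k"
  shows "conj_vector C F P k (\<psi> + \<psi>') = conj_vector C F P k \<psi> + conj_vector C F P k \<psi>'"
proof (rule conj_vector_eq)
  note kb = S_tob[OF k_S cbar_S] and c = conj_vector_props[OF assms(1)] conj_vector_props[OF assms(2)]
  show "\<psi> + \<psi>' \<in> fsp F k" by (rule fsp_add[OF k_S assms])
  show "conj_vector C F P k \<psi> + conj_vector C F P k \<psi>' \<in> fsp F (cbar P k)"
    by (rule fsp_add[OF cbar_S c(1,3)])
  fix x assume x: "x \<in> fsp F (cbar P k)"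
  show "fip F (cbar P k) x (conj_vector C F P k \<psi> + conj_vector C F P k \<psi>') =
      fip F (k \<odot> cbar P k) (ften F k (cbar P k) (\<psi> + \<psi>') x) cap"
    using fip_add_right[OF cbar_S x c(1,3)] c(2,4)[OF x] ften_add[OF k_S cbar_S assms x x]
      fip_add_left[OF kb ften_fsp[OF k_S cbar_S assms(1) x] ften_fsp[OF k_S cbar_S assms(2) x] cap_fsp] by simp
qed

lemma conj_vector_scale:
  assumes "\<psi> \<in> fsp F k"
  shows "conj_vector C F P k (fsc F z \<psi>) = fsc F (cnj z) (conj_vector C F P k \<psi>)"
proof (rule conj_vector_eq)
  note kb = S_tob[OF k_S cbar_S] and c = conj_vector_props[OF assms(1)]
  show "fsc F z \<psi> \<in> fsp F k" by (rule fsp_scale[OF k_S assms])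
  show "fsc F (cnj z) (conj_vector C F P k \<psi>) \<in> fsp F (cbar P k)"
    by (rule fsp_scale[OF cbar_S c(1)])
  fix x assume x: "x \<in> fsp F (cbar P k)"
  show "fip F (cbar P k) x (fsc F (cnj z) (conj_vector C F P k \<psi>)) =
      fip F (k \<odot> cbar P k) (ften F k (cbar P k) (fsc F z \<psi>) x) cap"
    using fip_scale_right[OF cbar_S x c(1)] c(2)[OF x] ften_scl[OF k_S cbar_S assms x]
      fip_scale_left[OF kb ften_fsp[OF k_S cbar_S assms(1) x] cap_fsp] by simp
qed

lemma conj_vector_frep:
  assumes g: "g \<in> carrier G" and \<psi>: "\<psi> \<in> fsp F k"
  shows "conj_vector C F P k (frep F k g \<psi>) = frep F (cbar P k) g (conj_vector C F P k \<psi>)"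
proof (rule conj_vector_eq)
  note kb = S_tob[OF k_S cbar_S] and c = conj_vector_props[OF \<psi>]
  note g' = G.inv_closed[OF g]
  show "frep F k g \<psi> \<in> fsp F k" by (rule frep_fsp[OF k_S g \<psi>])
  show "frep F (cbar P k) g (conj_vector C F P k \<psi>) \<in> fsp F (cbar P k)"
    by (rule frep_fsp[OF cbar_S g c(1)])
  fix x assume x: "x \<in> fsp F (cbar P k)"
  let ?x = "frep F (cbar P k) (inv\<^bsub>G\<^esub> g) x"
  have x': "?x \<in> fsp F (cbar P k)" by (rule frep_fsp[OF cbar_S g' x])
  have "fip F (cbar P k) x (frep F (cbar P k) g (conj_vector C F P k \<psi>)) =
      fip F (k \<odot> cbar P k) (ften F k (cbar P k) \<psi> ?x) cap"
    using frep_adjoint[OF cbar_S g x c(1)] c(2)[OF x'] by simp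
  also have "\<dots> = fip F (k \<odot> cbar P k) (frep F (k \<odot> cbar P k) g (ften F k (cbar P k) \<psi> ?x))
      (frep F (k \<odot> cbar P k) g cap)"
    by (rule frep_fip[OF kb g ften_fsp[OF k_S cbar_S \<psi> x'] cap_fsp, symmetric])
  also have "\<dots> = fip F (k \<odot> cbar P k) (ften F k (cbar P k) (frep F k g \<psi>) x) cap"
    using ften_rep[OF k_S cbar_S \<psi> x' g] cap_inv[OF g] frep_inv[OF cbar_S g x] by simp
  finally show "fip F (cbar P k) x (frep F (cbar P k) g (conj_vector C F P k \<psi>)) =
      fip F (k \<odot> cbar P k) (ften F k (cbar P k) (frep F k g \<psi>) x) cap" .
qed

end

context
  fixes \<rho> \<sigma> assumes O: "\<rho> \<in> Ob C" "\<sigma> \<in> Ob C"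
begin

lemma star_arrow:
  assumes k: "k \<in> irr P" and s: "s \<in> Hom C (k \<odot> \<rho>) \<sigma>"
  shows "\<ii>\<dd> (cbar P k) \<boxtimes> s\<^sup>\<star> \<in> Hom C (cbar P k \<odot> \<sigma>) ((cbar P k \<odot> k) \<odot> \<rho>)"
    and "(Rs P k)\<^sup>\<star> \<boxtimes> \<ii>\<dd> \<rho> \<in> Hom C ((cbar P k \<odot> k) \<odot> \<rho>) \<rho>"
    and "((Rs P k)\<^sup>\<star> \<boxtimes> \<ii>\<dd> \<rho>) \<cdot> (\<ii>\<dd> (cbar P k) \<boxtimes> s\<^sup>\<star>) \<in> Hom C (cbar P k \<odot> \<sigma>) \<rho>"
proof -
  note Ok = irr_Ob[OF k] and Ob = irr_Ob[OF cbar_irr[OF k]]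
  note Obk = tob_Ob[OF Ob Ok]
  have ss: "s\<^sup>\<star> \<in> Hom C \<sigma> (k \<odot> \<rho>)" by (rule str_Hom[OF tob_Ob[OF Ok O(1)] O(2) s])
  show 1: "\<ii>\<dd> (cbar P k) \<boxtimes> s\<^sup>\<star> \<in> Hom C (cbar P k \<odot> \<sigma>) ((cbar P k \<odot> k) \<odot> \<rho>)"
    using tar_Hom[OF Ob Ob O(2) tob_Ob[OF Ok O(1)] idt_Hom[OF Ob] ss] tob_assoc[OF Ob Ok O(1)] by simp
  show 2: "(Rs P k)\<^sup>\<star> \<boxtimes> \<ii>\<dd> \<rho> \<in> Hom C ((cbar P k \<odot> k) \<odot> \<rho>) \<rho>"
    using tar_Hom[OF Obk tun_Ob O(1,1) str_Hom[OF tun_Ob Obk Rs_Hom(1)[OF k]] idt_Hom[OF O(1)]] tob_tun[OF O(1)]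
    by simp
  show "((Rs P k)\<^sup>\<star> \<boxtimes> \<ii>\<dd> \<rho>) \<cdot> (\<ii>\<dd> (cbar P k) \<boxtimes> s\<^sup>\<star>) \<in> Hom C (cbar P k \<odot> \<sigma>) \<rho>"
    by (rule cmp_Hom[OF tob_Ob[OF Ob O(2)] tob_Ob[OF Obk O(1)] O(1) 1 2])
qed

lemma star_balanced:
  "balanced \<rho> \<sigma> (\<lambda>\<rho> \<sigma> k s \<psi>. stensor C F \<sigma> \<rho> (cbar P k)
     (((Rs P k)\<^sup>\<star> \<boxtimes> \<ii>\<dd> \<rho>) \<cdot> (\<ii>\<dd> (cbar P k) \<boxtimes> s\<^sup>\<star>)) (conj_vector C F P k \<psi>))"
proof (rule balancedI[OF O])
  fix k s \<psi> assume k: "k \<in> irr P" and s: "s \<in> Hom C (k \<odot> \<rho>) \<sigma>" and \<psi>: "\<psi> \<in> fsp F k"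
  note Ok = irr_Ob[OF k] and Ob = irr_Ob[OF cbar_irr[OF k]]
  note Okr = tob_Ob[OF Ok O(1)] and Obk = tob_Ob[OF Ob Ok]
  note ss = str_Hom[OF Okr O(2) s]
  note A = star_arrow[OF k s]
  note OO = tob_Ob[OF Ob O(2)] tob_Ob[OF Obk O(1)] O(1)
  show "stensor C F \<sigma> \<rho> (cbar P k) (((Rs P k)\<^sup>\<star> \<boxtimes> \<ii>\<dd> \<rho>) \<cdot> (\<ii>\<dd> (cbar P k) \<boxtimes> (s + s')\<^sup>\<star>)) (conj_vector C F P k \<psi>) =
      stensor C F \<sigma> \<rho> (cbar P k) (((Rs P k)\<^sup>\<star> \<boxtimes> \<ii>\<dd> \<rho>) \<cdot> (\<ii>\<dd> (cbar P k) \<boxtimes> s\<^sup>\<star>)) (conj_vector C F P k \<psi>) +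
      stensor C F \<sigma> \<rho> (cbar P k) (((Rs P k)\<^sup>\<star> \<boxtimes> \<ii>\<dd> \<rho>) \<cdot> (\<ii>\<dd> (cbar P k) \<boxtimes> s'\<^sup>\<star>)) (conj_vector C F P k \<psi>)"
    if s': "s' \<in> Hom C (k \<odot> \<rho>) \<sigma>" for s'
    using str_add[OF Okr O(2) s s'] tar_add[OF Ob Ob O(2) Okr idt_Hom[OF Ob] idt_Hom[OF Ob] ss str_Hom[OF Okr O(2) s']]
      cmp_add[OF OO A(1) star_arrow(1)[OF k s'] A(2,2)]
    by (simp add: stensor_add_arrow del: plus_fun_apply)
  show "stensor C F \<sigma> \<rho> (cbar P k) (((Rs P k)\<^sup>\<star> \<boxtimes> \<ii>\<dd> \<rho>) \<cdot> (\<ii>\<dd> (cbar P k) \<boxtimes> s\<^sup>\<star>)) (conj_vector C F P k (\<psi> + \<psi>')) =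
      stensor C F \<sigma> \<rho> (cbar P k) (((Rs P k)\<^sup>\<star> \<boxtimes> \<ii>\<dd> \<rho>) \<cdot> (\<ii>\<dd> (cbar P k) \<boxtimes> s\<^sup>\<star>)) (conj_vector C F P k \<psi>) +
      stensor C F \<sigma> \<rho> (cbar P k) (((Rs P k)\<^sup>\<star> \<boxtimes> \<ii>\<dd> \<rho>) \<cdot> (\<ii>\<dd> (cbar P k) \<boxtimes> s\<^sup>\<star>)) (conj_vector C F P k \<psi>')"
    if \<psi>': "\<psi>' \<in> fsp F k" for \<psi>'
    using conj_vector_add[OF k \<psi> \<psi>'] stensor_add_vec[OF cbar_S[OF k] conj_vector_props(1)[OF k \<psi>] conj_vector_props(1)[OF k \<psi>']]
    by (simp del: plus_fun_apply)
  show "stensor C F \<sigma> \<rho> (cbar P k) (((Rs P k)\<^sup>\<star> \<boxtimes> \<ii>\<dd> \<rho>) \<cdot> (\<ii>\<dd> (cbar P k) \<boxtimes> (scl C z s)\<^sup>\<star>)) (conj_vector C F P k \<psi>) =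
      stensor C F \<sigma> \<rho> (cbar P k) (((Rs P k)\<^sup>\<star> \<boxtimes> \<ii>\<dd> \<rho>) \<cdot> (\<ii>\<dd> (cbar P k) \<boxtimes> s\<^sup>\<star>)) (conj_vector C F P k (fsc F z \<psi>))"
    for z
    using str_scl[OF Okr O(2) s] tar_scl[OF Ob Ob O(2) Okr idt_Hom[OF Ob] ss] cmp_scl[OF OO A(1,2)]
      conj_vector_scale[OF k \<psi>] stensor_scl_vec[OF cbar_S[OF k] conj_vector_props(1)[OF k \<psi>]]
    by simp
qed

lemma xstr_stensor: "\<lbrakk>k \<in> irr P; s \<in> Hom C (k \<odot> \<rho>) \<sigma>; \<psi> \<in> fsp F k\<rbrakk>
    \<Longrightarrow> xstr C F P (stensor C F \<rho> \<sigma> k s \<psi>) = stensor C F \<sigma> \<rho> (cbar P k)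
      (((Rs P k)\<^sup>\<star> \<boxtimes> \<ii>\<dd> \<rho>) \<cdot> (\<ii>\<dd> (cbar P k) \<boxtimes> s\<^sup>\<star>)) (conj_vector C F P k \<psi>)"
  unfolding xstr_def by (rule xsum_stensor[OF O star_balanced])

lemma xstr_add: "\<lbrakk>x \<in> xHom C F P \<rho> \<sigma>; y \<in> xHom C F P \<rho> \<sigma>\<rbrakk>
    \<Longrightarrow> xstr C F P (x + y) = xstr C F P x + xstr C F P y"
  unfolding xstr_def by (rule xsum_add[OF O star_balanced])

lemma xstr_zero: "xstr C F P 0 = 0"
  by (simp add: xstr_def xsum_def)

lemma xstr_xHom:
  assumes "x \<in> xHom C F P \<rho> \<sigma>" shows "xstr C F P x \<in> xHom C F P \<sigma> \<rho>"
  using assms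
proof (induction rule: xHom_induct[OF O, consumes 1, case_names zero add])
  case (add k s \<psi> y)
  show ?case
    unfolding xstr_add[OF stensor_xHom[OF O add(1-3)] add(4)] xstr_stensor[OF add(1-3)]
    by (intro xHom_add[OF O(2,1)] stensor_xHom[OF O(2,1)] cbar_irr star_arrow conj_vector_props add)
next
  case zero
  show ?case unfolding xstr_zero by (rule xHom_zero[OF O(2,1)])
qed

lemma act_xstr:
  assumes g: "g \<in> carrier G" and "x \<in> xHom C F P \<rho> \<sigma>"
  shows "act_arr C F P g (xstr C F P x) = xstr C F P (act_arr C F P g x)"
  using assms(2)
proof (induction rule: xHom_induct[OF O, consumes 1, case_names zero add])
  case (add k s \<psi> y)
  note st = stensor_xHom[OF O add(1-3)]
  note sk = cbar_irr[OF add(1)] star_arrow(3)[OF add(1,2)] conj_vector_props(1)[OF add(1,3)]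
  note fk = frep_fsp[OF irr_in_S[OF add(1)] g add(3)]
  show ?case
    unfolding xstr_add[OF st add(4)] act_add[OF g O st add(4)]
      xstr_add[OF act_xHom[OF g O st] act_xHom[OF g O add(4)]]
      act_add[OF g O(2,1) xstr_xHom[OF st] xstr_xHom[OF add(4)]] add(5)
    unfolding xstr_stensor[OF add(1-3)] act_stensor[OF g O add(1-3)] xstr_stensor[OF add(1,2) fk]
      act_stensor[OF g O(2,1) sk] conj_vector_frep[OF add(1) g add(3)] ..
next
  case zero
  show ?case by (simp only: xstr_zero act_zero[OF g])
qed

lemma act_scl:
  assumes g: "g \<in> carrier G" and "x \<in> xHom C F P \<rho> \<sigma>"
  shows "act_arr C F P g (xscl C z x) = xscl C z (act_arr C F P g x)"
  using assms(2)
proof (induction rule: xHom_induct[OF O, consumes 1, case_names zero add])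
  case (add k s \<psi> y)
  note st = stensor_xHom[OF O add(1-3)]
  have zs: "scl C z s \<in> Hom C (k \<odot> \<rho>) \<sigma>" by (rule Hom_scl[OF tob_Ob[OF irr_Ob[OF add(1)] O(1)] O(2) add(2)])
  have zy: "xscl C z y \<in> xHom C F P \<rho> \<sigma>" using add(4) unfolding xHom_def by (rule xarrs.span_scale)
  show ?case
    unfolding xarrs.scale_right_distrib stensor_scl_arrow[symmetric] act_add[OF g O st add(4)]
      act_add[OF g O stensor_xHom[OF O add(1) zs add(3)] zy] add(5)
      act_stensor[OF g O add(1-3)] act_stensor[OF g O add(1) zs add(3)] ..
next
  case zero
  show ?case by (simp only: xarrs.scale_zero_right act_zero[OF g])
qed

lemma act_one:
  assumes "x \<in> xHom C F P \<rho> \<sigma>" shows "act_arr C F P \<one>\<^bsub>G\<^esub> x = x"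
  using assms
proof (induction rule: xHom_induct[OF O, consumes 1, case_names zero add])
  case (add k s \<psi> y)
  show ?case
    unfolding act_add[OF G.one_closed O stensor_xHom[OF O add(1-3)] add(4)] add(5)
      act_stensor[OF G.one_closed O add(1-3)] frep_one[OF irr_in_S[OF add(1)] add(3)] ..
next
  case zero
  show ?case by (rule act_zero[OF G.one_closed])
qed

lemma act_mult:
  assumes g: "g \<in> carrier G" "h \<in> carrier G" and "x \<in> xHom C F P \<rho> \<sigma>"
  shows "act_arr C F P (g \<otimes>\<^bsub>G\<^esub> h) x = act_arr C F P g (act_arr C F P h x)"
  using assms(3)
proof (induction rule: xHom_induct[OF O, consumes 1, case_names zero add])
  case (add k s \<psi> y)
  note st = stensor_xHom[OF O add(1-3)] and gh = G.m_closed[OF g] and kS = irr_in_S[OF add(1)]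
  show ?case
    unfolding act_add[OF gh O st add(4)] act_add[OF g(2) O st add(4)]
      act_add[OF g(1) O act_xHom[OF g(2) O st] act_xHom[OF g(2) O add(4)]] add(5)
    unfolding act_stensor[OF gh O add(1-3)] act_stensor[OF g(2) O add(1-3)]
      act_stensor[OF g(1) O add(1,2) frep_fsp[OF kS g(2) add(3)]] frep_mult[OF kS g add(3)] ..
next
  case zero
  show ?case by (simp only: act_zero[OF G.m_closed[OF g]] act_zero[OF g(1)] act_zero[OF g(2)])
qed

lemma act_inv:
  assumes g: "g \<in> carrier G" and x: "x \<in> xHom C F P \<rho> \<sigma>"
  shows "act_arr C F P g (act_arr C F P (inv\<^bsub>G\<^esub> g) x) = x" "act_arr C F P (inv\<^bsub>G\<^esub> g) (act_arr C F P g x) = x"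
  using act_mult[OF g G.inv_closed[OF g] x] act_mult[OF G.inv_closed[OF g] g x] act_one[OF x] g by simp_all

lemma xemb_cten: "s \<in> Hom C \<rho> \<sigma> \<Longrightarrow> xemb C F \<rho> \<sigma> s = cten \<rho> \<sigma> \<iota> s (fvac F)"
  unfolding xemb_def using cten_irr[OF irr_unit O _ vac_space(1), of s] tob_tun[OF O(1)] by simp

lemma xemb_xHom: "s \<in> Hom C \<rho> \<sigma> \<Longrightarrow> xemb C F \<rho> \<sigma> s \<in> xHom C F P \<rho> \<sigma>"
  unfolding xemb_def using stensor_xHom[OF O irr_unit _ vac_space(1), of s] tob_tun[OF O(1)] by simp

lemma act_xemb: "\<lbrakk>g \<in> carrier G; s \<in> Hom C \<rho> \<sigma>\<rbrakk> \<Longrightarrow> act_arr C F P g (xemb C F \<rho> \<sigma> s) = xemb C F \<rho> \<sigma> s"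
  unfolding xemb_def using act_stensor[OF _ O irr_unit _ vac_space(1), of g s] tob_tun[OF O(1)] frep_vac by simp

end


section \<open>The action of the group by automorphisms\<close>

abbreviation crossed where "crossed \<equiv> crossed_product C \<epsilon> F P"

lemma D_Ob: "(\<rho>, p) \<in> Ob crossed \<longleftrightarrow>
    \<rho> \<in> Ob C \<and> p \<in> xHom C F P \<rho> \<rho> \<and> xcmp C F P p p = p \<and> xstr C F P p = p"
  by (simp add: crossed_product_def subobject_completion_def crossed_product0_def proj_arrow_def)

lemma D_Hom: "Hom crossed (\<rho>, p) (\<sigma>, q) = {xcmp C F P (xcmp C F P q f) p | f. f \<in> xHom C F P \<rho> \<sigma>}"
  by (simp add: crossed_product_def subobject_completion_def crossed_product0_def)

lemma D_ops: "cmp crossed = xcmp C F P" "str crossed = xstr C F P" "scl crossed = xscl C" "tar crossed = xtar C \<epsilon> F P"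
    "idt crossed = snd" "tun crossed = (\<iota>, xemb C F \<iota> \<iota> (\<ii>\<dd> \<iota>))"
    "tob crossed (\<rho>, p) (\<sigma>, q) = (\<rho> \<odot> \<sigma>, xtar C \<epsilon> F P p q)"
  by (simp_all add: crossed_product_def subobject_completion_def crossed_product0_def)

lemma D_Hom_xHom:
  assumes "(\<rho>, p) \<in> Ob crossed" "(\<sigma>, q) \<in> Ob crossed" "f \<in> Hom crossed (\<rho>, p) (\<sigma>, q)"
  shows "f \<in> xHom C F P \<rho> \<sigma>"
  using assms xcmp_xHom[of \<rho> \<sigma> \<sigma>] xcmp_xHom[of \<rho> \<rho> \<sigma>] by (auto simp: D_Ob D_Hom)

context
  fixes g assumes g: "g \<in> carrier G"
begin

lemma act_ob_Ob: "X \<in> Ob crossed \<Longrightarrow> act_ob C F P g X \<in> Ob crossed"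
proof -
  assume X: "X \<in> Ob crossed"
  obtain \<rho> p where Xp: "X = (\<rho>, p)" by (cases X)
  then have p: "\<rho> \<in> Ob C" "p \<in> xHom C F P \<rho> \<rho>" "xcmp C F P p p = p" "xstr C F P p = p"
    using X by (simp_all add: D_Ob)
  show ?thesis
    using act_xHom[OF g p(1,1,2)] act_xcmp[OF p(1,1,1) g p(2,2)] act_xstr[OF p(1,1) g p(2)] p
    by (simp add: Xp act_ob_def D_Ob)
qed

lemma act_arr_Hom:
  assumes "X \<in> Ob crossed" "Y \<in> Ob crossed" "f \<in> Hom crossed X Y"
  shows "act_arr C F P g f \<in> Hom crossed (act_ob C F P g X) (act_ob C F P g Y)"
proof -
  obtain \<rho> p \<sigma> q where XY: "X = (\<rho>, p)" "Y = (\<sigma>, q)" by (cases X, cases Y)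
  then have p: "\<rho> \<in> Ob C" "p \<in> xHom C F P \<rho> \<rho>" and q: "\<sigma> \<in> Ob C" "q \<in> xHom C F P \<sigma> \<sigma>"
    using assms by (simp_all add: D_Ob)
  obtain f' where f': "f = xcmp C F P (xcmp C F P q f') p" "f' \<in> xHom C F P \<rho> \<sigma>"
    using assms(3) unfolding XY D_Hom by blast
  have "act_arr C F P g f = xcmp C F P (xcmp C F P (act_arr C F P g q) (act_arr C F P g f')) (act_arr C F P g p)"
    unfolding f'(1) act_xcmp[OF p(1,1) q(1) g xcmp_xHom[OF p(1) q(1,1) q(2) f'(2)] p(2)]
      act_xcmp[OF p(1) q(1,1) g q(2) f'(2)] ..
  then show ?thesis using act_xHom[OF g p(1) q(1) f'(2)] unfolding XY act_ob_def by (auto simp: D_Hom)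
qed

end

lemma act_ob_inv:
  assumes g: "g \<in> carrier G" and X: "X \<in> Ob crossed"
  shows "act_ob C F P g (act_ob C F P (inv\<^bsub>G\<^esub> g) X) = X" "act_ob C F P (inv\<^bsub>G\<^esub> g) (act_ob C F P g X) = X"
proof -
  obtain \<rho> p where Xp: "X = (\<rho>, p)" by (cases X)
  then have p: "\<rho> \<in> Ob C" "p \<in> xHom C F P \<rho> \<rho>" using X by (simp_all add: D_Ob)
  show "act_ob C F P g (act_ob C F P (inv\<^bsub>G\<^esub> g) X) = X" "act_ob C F P (inv\<^bsub>G\<^esub> g) (act_ob C F P g X) = X"
    using act_inv[OF p(1,1) g p(2)] by (simp_all add: Xp act_ob_def)
qed

lemma act_automorphism:
  assumes g: "g \<in> carrier G"
  shows "tensor_star_automorphism crossed (act_ob C F P g) (\<lambda>X Y. act_arr C F P g)"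
proof -
  note g' = G.inv_closed[OF g]
  let ?\<Phi> = "act_ob C F P g" and ?\<phi> = "act_arr C F P g"
  have bijO: "bij_betw ?\<Phi> (Ob crossed) (Ob crossed)"
    by (rule bij_betwI[of _ _ _ "act_ob C F P (inv\<^bsub>G\<^esub> g)"])
      (auto intro: act_ob_Ob g g' simp: act_ob_inv[OF g])
  have X: "f \<in> xHom C F P (fst X) (fst Y)" "fst X \<in> Ob C" "fst Y \<in> Ob C"
    if "X \<in> Ob crossed" "Y \<in> Ob crossed" "f \<in> Hom crossed X Y" for X Y f
  proof -
    have XY: "(fst X, snd X) \<in> Ob crossed" "(fst Y, snd Y) \<in> Ob crossed" "f \<in> Hom crossed (fst X, snd X) (fst Y, snd Y)"
      using that by simp_all
    show "f \<in> xHom C F P (fst X) (fst Y)" by (rule D_Hom_xHom[OF XY])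
    show "fst X \<in> Ob C" "fst Y \<in> Ob C" using XY(1,2) unfolding D_Ob by simp_all
  qed
  have bijH: "bij_betw ?\<phi> (Hom crossed X Y) (Hom crossed (?\<Phi> X) (?\<Phi> Y))" if XY: "X \<in> Ob crossed" "Y \<in> Ob crossed" for X Y
  proof (rule bij_betwI[of _ _ _ "act_arr C F P (inv\<^bsub>G\<^esub> g)"])
    show "?\<phi> \<in> Hom crossed X Y \<rightarrow> Hom crossed (?\<Phi> X) (?\<Phi> Y)"
      by (rule funcsetI) (rule act_arr_Hom[OF g XY])
    show "act_arr C F P (inv\<^bsub>G\<^esub> g) \<in> Hom crossed (?\<Phi> X) (?\<Phi> Y) \<rightarrow> Hom crossed X Y"
      by (rule funcsetI)
        (use act_arr_Hom[OF g' act_ob_Ob[OF g XY(1)] act_ob_Ob[OF g XY(2)]] act_ob_inv(2)[OF g XY(1)]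
          act_ob_inv(2)[OF g XY(2)] in simp)
    show "act_arr C F P (inv\<^bsub>G\<^esub> g) (?\<phi> f) = f" if "f \<in> Hom crossed X Y" for f
      using X[OF XY that] by (intro act_inv(2)[OF _ _ g])
    show "?\<phi> (act_arr C F P (inv\<^bsub>G\<^esub> g) f) = f" if "f \<in> Hom crossed (?\<Phi> X) (?\<Phi> Y)" for f
      using X[OF act_ob_Ob[OF g XY(1)] act_ob_Ob[OF g XY(2)] that] by (intro act_inv(1)[OF _ _ g])
  qed
  have add: "?\<phi> (f + f') = ?\<phi> f + ?\<phi> f'"
    if "X \<in> Ob crossed" "Y \<in> Ob crossed" "f \<in> Hom crossed X Y" "f' \<in> Hom crossed X Y" for X Y f f'
    using act_add[OF g X(2,3)[OF that(1-3)] X(1)[OF that(1-3)] X(1)[OF that(1,2,4)]] .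
  have scl: "?\<phi> (xscl C z f) = xscl C z (?\<phi> f)"
    if "X \<in> Ob crossed" "Y \<in> Ob crossed" "f \<in> Hom crossed X Y" for X Y f z
    using act_scl[OF X(2,3)[OF that] g X(1)[OF that]] .
  have cmp: "?\<phi> (xcmp C F P f' f) = xcmp C F P (?\<phi> f') (?\<phi> f)"
    if "X \<in> Ob crossed" "Y \<in> Ob crossed" "Z \<in> Ob crossed" "f \<in> Hom crossed X Y" "f' \<in> Hom crossed Y Z" for X Y Z f f'
    using act_xcmp[OF X(2,3)[OF that(1,2,4)] X(3)[OF that(2,3,5)] g X(1)[OF that(2,3,5)] X(1)[OF that(1,2,4)]] .
  have str: "?\<phi> (xstr C F P f) = xstr C F P (?\<phi> f)"
    if "X \<in> Ob crossed" "Y \<in> Ob crossed" "f \<in> Hom crossed X Y" for X Y f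
    using act_xstr[OF X(2,3)[OF that] g X(1)[OF that]] .
  have tar: "?\<phi> (xtar C \<epsilon> F P f f') = xtar C \<epsilon> F P (?\<phi> f) (?\<phi> f')"
    if "X \<in> Ob crossed" "Y \<in> Ob crossed" "Z \<in> Ob crossed" "W \<in> Ob crossed" "f \<in> Hom crossed X Y" "f' \<in> Hom crossed Z W" for X Y Z W f f'
    using act_xtar[OF X(2,3)[OF that(1,2,5)] X(2,3)[OF that(3,4,6)] g X(1)[OF that(1,2,5)] X(1)[OF that(3,4,6)]] .
  have idt: "?\<phi> (snd X) = snd (?\<Phi> X)" for X by (cases X) (simp add: act_ob_def)
  have tun: "?\<Phi> (\<iota>, xemb C F \<iota> \<iota> (\<ii>\<dd> \<iota>)) = (\<iota>, xemb C F \<iota> \<iota> (\<ii>\<dd> \<iota>))"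
    using act_xemb[OF tun_Ob tun_Ob g idt_Hom[OF tun_Ob]] by (simp add: act_ob_def)
  have tob: "?\<Phi> (tob crossed X Y) = tob crossed (?\<Phi> X) (?\<Phi> Y)" if "X \<in> Ob crossed" "Y \<in> Ob crossed" for X Y
  proof -
    obtain \<rho> p \<sigma> q where XY: "X = (\<rho>, p)" "Y = (\<sigma>, q)" by (cases X, cases Y)
    then have p: "\<rho> \<in> Ob C" "p \<in> xHom C F P \<rho> \<rho>" and q: "\<sigma> \<in> Ob C" "q \<in> xHom C F P \<sigma> \<sigma>"
      using that by (simp_all add: D_Ob)
    show ?thesis using act_xtar[OF p(1,1) q(1,1) g p(2) q(2)] by (simp add: XY D_ops act_ob_def)
  qed
  show ?thesis
    unfolding tensor_star_automorphism_def D_ops(1-6)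
    by (intro conjI ballI allI bijO bijH add scl idt cmp str tun tob tar)
qed

lemma act_braiding:
  assumes g: "g \<in> carrier G"
  shows "preserves_braiding crossed (crossed_braiding C \<epsilon> F P) (act_ob C F P g) (\<lambda>X Y. act_arr C F P g)"
  unfolding preserves_braiding_def
proof (intro ballI)
  fix X Y assume that: "X \<in> Ob crossed" "Y \<in> Ob crossed"
  obtain \<rho> p \<sigma> q where XY: "X = (\<rho>, p)" "Y = (\<sigma>, q)" by (cases X, cases Y)
  then have p: "\<rho> \<in> Ob C" "p \<in> xHom C F P \<rho> \<rho>" and q: "\<sigma> \<in> Ob C" "q \<in> xHom C F P \<sigma> \<sigma>"
    using that by (simp_all add: D_Ob)
  note O = tob_Ob[OF p(1) q(1)] tob_Ob[OF q(1) p(1)]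
  note pq = xtar_xHom[OF p(1,1) q(1,1) p(2) q(2)] and qp = xtar_xHom[OF q(1,1) p(1,1) q(2) p(2)]
  note e = xemb_xHom[OF O eps_Hom[OF p(1) q(1)]]
  show "act_arr C F P g (crossed_braiding C \<epsilon> F P X Y) =
      crossed_braiding C \<epsilon> F P (act_ob C F P g X) (act_ob C F P g Y)"
    unfolding XY crossed_braiding_def act_ob_def prod.case
      act_xcmp[OF O(1,1,2) g xcmp_xHom[OF O(1,2,2) qp e] pq] act_xcmp[OF O(1,2,2) g qp e]
      act_xtar[OF p(1,1) q(1,1) g p(2) q(2)] act_xtar[OF q(1,1) p(1,1) g q(2) p(2)]
      act_xemb[OF O g eps_Hom[OF p(1) q(1)]] ..
qed

text \<open>
  Each \<open>\<alpha>\<^sub>g\<close> is a braided automorphism of the crossed product, so only its effect on \<open>E\<close> matters.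
\<close>

lemma Gal_over_iff: "Gal_over C \<epsilon> S G F P E = {g \<in> carrier G.
    (\<forall>X\<in>Ob E. act_ob C F P g X = X) \<and> (\<forall>X\<in>Ob E. \<forall>Y\<in>Ob E. \<forall>f\<in>Hom E X Y. act_arr C F P g f = f)}"
  using act_automorphism act_braiding by (auto simp: Gal_over_def Aut_over_def)

lemma Gal_subgroup:
  assumes E: "subcategory E crossed"
  shows "subgroup (Gal_over C \<epsilon> S G F P E) G"
proof -
  have ED: "X \<in> Ob crossed" if "X \<in> Ob E" for X using E that by (auto simp: subcategory_def)
  have X: "\<exists>\<rho> \<sigma>. \<rho> \<in> Ob C \<and> \<sigma> \<in> Ob C \<and> f \<in> xHom C F P \<rho> \<sigma>"
    if "X \<in> Ob E" "Y \<in> Ob E" "f \<in> Hom E X Y" for X Y f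
  proof -
    obtain \<rho> p \<sigma> q where XY: "X = (\<rho>, p)" "Y = (\<sigma>, q)" by (cases X, cases Y)
    have "f \<in> Hom crossed X Y" using E that by (auto simp: subcategory_def)
    then have "f \<in> xHom C F P \<rho> \<sigma>" using D_Hom_xHom ED[OF that(1)] ED[OF that(2)] XY by blast
    then show ?thesis using ED[OF that(1)] ED[OF that(2)] unfolding XY D_Ob by blast
  qed
  have one: "act_ob C F P \<one>\<^bsub>G\<^esub> X = X" if "X \<in> Ob crossed" for X
    using that by (cases X) (auto simp: act_ob_def D_Ob act_one)
  have mult: "act_ob C F P (g \<otimes>\<^bsub>G\<^esub> h) X = act_ob C F P g (act_ob C F P h X)"
    if "X \<in> Ob crossed" "g \<in> carrier G" "h \<in> carrier G" for X g h
    using that by (cases X) (auto simp: act_ob_def D_Ob act_mult)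
  show ?thesis
  proof (rule G.subgroupI)
    show "Gal_over C \<epsilon> S G F P E \<subseteq> carrier G" by (auto simp: Gal_over_def)
    have "act_arr C F P \<one>\<^bsub>G\<^esub> f = f" if "X \<in> Ob E" "Y \<in> Ob E" "f \<in> Hom E X Y" for X Y f
      using X[OF that] act_one by blast
    then have "\<one>\<^bsub>G\<^esub> \<in> Gal_over C \<epsilon> S G F P E" using one ED by (simp add: Gal_over_iff)
    then show "Gal_over C \<epsilon> S G F P E \<noteq> {}" by blast
    fix g assume g: "g \<in> Gal_over C \<epsilon> S G F P E"
    then have gc: "g \<in> carrier G" by (simp add: Gal_over_iff)
    have gO: "act_ob C F P g X = X" if "X \<in> Ob E" for X using g that by (simp add: Gal_over_iff)
    have gA: "act_arr C F P g f = f" if "X \<in> Ob E" "Y \<in> Ob E" "f \<in> Hom E X Y" for X Y f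
      using g that by (simp add: Gal_over_iff)
    have "act_ob C F P (inv\<^bsub>G\<^esub> g) X = X" if "X \<in> Ob E" for X
      using act_ob_inv(2)[OF gc ED[OF that]] gO[OF that] by simp
    moreover have "act_arr C F P (inv\<^bsub>G\<^esub> g) f = f" if "X \<in> Ob E" "Y \<in> Ob E" "f \<in> Hom E X Y" for X Y f
      using X[OF that] act_inv(2)[OF _ _ gc] gA[OF that] by metis
    ultimately show "inv\<^bsub>G\<^esub> g \<in> Gal_over C \<epsilon> S G F P E" using gc by (simp add: Gal_over_iff)
    fix h assume h: "h \<in> Gal_over C \<epsilon> S G F P E"
    then have hc: "h \<in> carrier G" by (simp add: Gal_over_iff)
    have hO: "act_ob C F P h X = X" if "X \<in> Ob E" for X using h that by (simp add: Gal_over_iff)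
    have hA: "act_arr C F P h f = f" if "X \<in> Ob E" "Y \<in> Ob E" "f \<in> Hom E X Y" for X Y f
      using h that by (simp add: Gal_over_iff)
    have "act_ob C F P (g \<otimes>\<^bsub>G\<^esub> h) X = X" if "X \<in> Ob E" for X
      using mult[OF ED[OF that] gc hc] gO[OF that] hO[OF that] by simp
    moreover have "act_arr C F P (g \<otimes>\<^bsub>G\<^esub> h) f = f" if "X \<in> Ob E" "Y \<in> Ob E" "f \<in> Hom E X Y" for X Y f
      using X[OF that] act_mult[OF _ _ gc hc] gA[OF that] hA[OF that] by metis
    ultimately show "g \<otimes>\<^bsub>G\<^esub> h \<in> Gal_over C \<epsilon> S G F P E" using gc hc by (simp add: Gal_over_iff)
  qed
qed


section \<open>Tannaka duality for stable families of vectors\<close>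

lemma tensor_expansion:
  assumes ab: "a \<in> S" "b \<in> S" and B: "finite B" "vecs.span B = fsp F a" and x: "x \<in> fsp F (a \<odot> b)"
  shows "\<exists>z. (\<forall>e\<in>B. z e \<in> fsp F b) \<and> x = (\<Sum>e\<in>B. ften F a b e (z e))"
proof -
  have BK: "e \<in> fsp F a" if "e \<in> B" for e using B(2) vecs.span_base[OF that] by simp
  note Sa = fsp_subspace[OF ab(1)]
  have "x \<in> vecs.span {ften F a b u w | u w. u \<in> fsp F a \<and> w \<in> fsp F b}"
    using x ften_span[OF ab] by simp
  then show ?thesis
  proof (induction rule: vecs.span_induct_alt)
    case base
    have "(\<Sum>e\<in>B. ften F a b e 0) = 0"
      using ften_sum_right[OF ab BK, of _ "{}"] by (intro sum.neutral) simp
    then show ?case using fsp_zero[OF ab(2)] by (intro exI[of _ "\<lambda>_. 0"]) simp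
  next
    case (step c y x')
    then obtain u w where uw: "y = ften F a b u w" "u \<in> fsp F a" "w \<in> fsp F b" by blast
    obtain z where z: "\<And>e. e \<in> B \<Longrightarrow> z e \<in> fsp F b" "x' = (\<Sum>e\<in>B. ften F a b e (z e))"
      using step(2) by blast
    have "u \<in> vecs.span B" using uw(2) B(2) by simp
    then obtain d where d: "u = (\<Sum>e\<in>B. fsc F (d e) e)"
      unfolding vecs.span_finite[OF B(1)] by blast
    have cw: "fsc F (c * d e) w \<in> fsp F b" for e by (rule fsp_scale[OF ab(2) uw(3)])
    have "fsc F c y = (\<Sum>e\<in>B. ften F a b e (fsc F (c * d e) w))"
    proof -
      have "y = (\<Sum>e\<in>B. ften F a b (fsc F (d e) e) w)"
        unfolding uw(1) d by (rule ften_sum_left[OF ab uw(3)]) (rule fsp_scale[OF ab(1) BK])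
      also have "\<dots> = (\<Sum>e\<in>B. fsc F (d e) (ften F a b e w))"
        using ften_scl[OF ab BK uw(3)] by (intro sum.cong) auto
      finally show ?thesis using ften_scl[OF ab BK uw(3)] by (simp add: vecs.scale_sum_right)
    qed
    then have "fsc F c y + x' = (\<Sum>e\<in>B. ften F a b e (fsc F (c * d e) w + z e))"
      using ften_add[OF ab BK BK cw z(1)] by (simp add: z(2) sum.distrib)
    then show ?case using fsp_add[OF ab(2) cw z(1)]
      by (intro exI[of _ "\<lambda>e. fsc F (c * d e) w + z e"]) simp
  qed
qed

text \<open>
  The definition of the conjugate vector as an adjoint of contraction, with an additional factor \<open>b\<close>.
\<close>

lemma contract_inner:
  assumes k: "k \<in> irr P" and b: "b \<in> S" and \<psi>: "\<psi> \<in> fsp F k" and z: "z \<in> fsp F (cbar P k \<odot> b)"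
    and y: "y \<in> fsp F b"
  shows "fip F b (farr F ((k \<odot> cbar P k) \<odot> b) b ((Rs' P k)\<^sup>\<star> \<boxtimes> \<ii>\<dd> b) (ften F k (cbar P k \<odot> b) \<psi> z)) y =
    fip F (cbar P k \<odot> b) z (ften F (cbar P k) b (conj_vector C F P k \<psi>) y)"
proof -
  let ?k' = "cbar P k"
  note kS = irr_in_S[OF k] and k'S = irr_in_S[OF cbar_irr[OF k]]
  note kk' = S_tob[OF kS k'S]
  note Ob = S_Ob[OF b] and Okk' = S_Ob[OF kk']
  note R = Rs_Hom(2)[OF k] and c = conj_vector_props[OF k \<psi>]
  have Rs: "(Rs' P k)\<^sup>\<star> \<in> Hom C (k \<odot> ?k') \<iota>" by (rule str_Hom[OF tun_Ob Okk' R])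
  have RH: "(Rs' P k)\<^sup>\<star> \<boxtimes> \<ii>\<dd> b \<in> Hom C ((k \<odot> ?k') \<odot> b) b"
    using tar_Hom[OF Okk' tun_Ob Ob Ob Rs idt_Hom[OF Ob]] tob_tun[OF Ob] by simp
  note B = hbas_basis[OF cbar_irr[OF k]]
  obtain w where w: "\<And>e. e \<in> hbas P ?k' \<Longrightarrow> w e \<in> fsp F b" and zw: "z = (\<Sum>e\<in>hbas P ?k'. ften F ?k' b e (w e))"
    using tensor_expansion[OF k'S b _ _ z] B by blast
  have BK: "e \<in> fsp F ?k'" if "e \<in> hbas P ?k'" for e using B vecs.span_base[OF that] by simp
  let ?A = "farr F ((k \<odot> ?k') \<odot> b) b ((Rs' P k)\<^sup>\<star> \<boxtimes> \<ii>\<dd> b)"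
  have summand: "?A (ften F k (?k' \<odot> b) \<psi> (ften F ?k' b e (w e))) = fsc F (cnj (fip F ?k' e (conj_vector C F P k \<psi>))) (w e)"
    if e: "e \<in> hbas P ?k'" for e
  proof -
    let ?pe = "ften F k ?k' \<psi> e"
    have pe: "?pe \<in> fsp F (k \<odot> ?k')" by (rule ften_fsp[OF kS k'S \<psi> BK[OF e]])
    let ?r = "farr F (k \<odot> ?k') \<iota> ((Rs' P k)\<^sup>\<star>) ?pe"
    have r: "?r \<in> fsp F \<iota>" by (rule farr_fsp[OF kk' S_tun Rs pe])
    then obtain d where d: "?r = fsc F d (fvac F)"
      unfolding vac_space(2) by (auto simp: vecs.span_singleton)
    have "d = fip F \<iota> (fvac F) ?r"
      using d fip_scale_right[OF S_tun vac_space(1,1)] vac_unit by simp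
    also have "\<dots> = fip F (k \<odot> ?k') (cap k) ?pe"
      unfolding cap_def[OF k] by (rule farr_adjoint[OF S_tun kk' R vac_space(1) pe, symmetric])
    also have "\<dots> = cnj (fip F ?k' e (conj_vector C F P k \<psi>))"
      using fip_commute[OF kk' pe cap_fsp[OF k]] c(2)[OF BK[OF e]] by simp
    finally have dd: "d = cnj (fip F ?k' e (conj_vector C F P k \<psi>))" .
    have "?A (ften F k (?k' \<odot> b) \<psi> (ften F ?k' b e (w e))) = ?A (ften F (k \<odot> ?k') b ?pe (w e))"
      using ften_assoc[OF kS k'S b \<psi> BK[OF e] w[OF e]] by simp
    also have "\<dots> = ften F \<iota> b ?r (farr F b b (\<ii>\<dd> b) (w e))"
      using ften_farr[OF kk' b S_tun b Rs idt_Hom[OF Ob] pe w[OF e]] tob_tun[OF Ob] by simp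
    also have "\<dots> = fsc F d (w e)"
      using farr_idt[OF b w[OF e]] d ften_scl[OF S_tun b vac_space(1) w[OF e]] ften_vac[OF b w[OF e]] by simp
    finally show ?thesis using dd by simp
  qed
  have m: "ften F ?k' b e (w e) \<in> fsp F (?k' \<odot> b)" if "e \<in> hbas P ?k'" for e
    by (rule ften_fsp[OF k'S b BK[OF that] w[OF that]])
  note k'b = S_tob[OF k'S b]
  have kk'b: "(k \<odot> ?k') \<odot> b \<in> S" by (rule S_tob[OF kk' b])
  have asc: "(k \<odot> ?k') \<odot> b = k \<odot> (?k' \<odot> b)" by (rule tob_assoc[OF S_Ob[OF kS] S_Ob[OF k'S] Ob])
  have "?A (ften F k (?k' \<odot> b) \<psi> z) = (\<Sum>e\<in>hbas P ?k'. ?A (ften F k (?k' \<odot> b) \<psi> (ften F ?k' b e (w e))))"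
  proof -
    have "ften F k (?k' \<odot> b) \<psi> z = (\<Sum>e\<in>hbas P ?k'. ften F k (?k' \<odot> b) \<psi> (ften F ?k' b e (w e)))"
      unfolding zw by (rule ften_sum_right[OF kS k'b \<psi> m])
    then show ?thesis
      using farr_sum[OF kk'b b RH, of "hbas P ?k'" "\<lambda>e. ften F k (?k' \<odot> b) \<psi> (ften F ?k' b e (w e))"]
        ften_fsp[OF kS k'b \<psi> m] asc by simp
  qed
  also have "\<dots> = (\<Sum>e\<in>hbas P ?k'. fsc F (cnj (fip F ?k' e (conj_vector C F P k \<psi>))) (w e))"
    by (intro sum.cong refl summand)
  finally have "fip F b (?A (ften F k (?k' \<odot> b) \<psi> z)) y =
      (\<Sum>e\<in>hbas P ?k'. fip F b (fsc F (cnj (fip F ?k' e (conj_vector C F P k \<psi>))) (w e)) y)"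
    using fip_sum_left[OF b y, of "hbas P ?k'"] fsp_scale[OF b w] by simp
  also have "\<dots> = (\<Sum>e\<in>hbas P ?k'. fip F (?k' \<odot> b) (ften F ?k' b e (w e)) (ften F ?k' b (conj_vector C F P k \<psi>) y))"
    using ften_fip[OF k'S b BK c(1) w y] fip_scale_left[OF b w y] by (intro sum.cong) auto
  also have "\<dots> = fip F (?k' \<odot> b) z (ften F ?k' b (conj_vector C F P k \<psi>) y)"
    unfolding zw by (rule fip_sum_left[OF k'b ften_fsp[OF k'S b c(1) y] m, symmetric])
  finally show ?thesis .
qed

text \<open>
  By the conjugate equations \<open>x\<close> in \<open>F(k)\<close> is recovered from \<open>x \<otimes> r\<close> with \<open>r = F(R) \<Omega>\<close> by contraction
  of the first two factors, and contraction with \<open>x\<close> is adjoint to tensoring with the conjugate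
  vector of \<open>x\<close>.  The vector \<open>\<eta>\<close> represents the functional that is left after both steps.
\<close>

lemma conjugate_coefficient:
  assumes k: "k \<in> irr P" and \<phi>: "\<phi> \<in> fsp F k" and \<psi>: "\<psi> \<in> fsp F k"
  obtains \<eta> where "\<eta> \<in> fsp F (cbar P k)" "\<And>g. g \<in> carrier G \<Longrightarrow>
    cnj (fip F k \<phi> (frep F k g \<psi>)) = fip F (cbar P k) \<eta> (frep F (cbar P k) g (conj_vector C F P k \<psi>))"
proof -
  let ?k' = "cbar P k"
  note kS = irr_in_S[OF k] and k'S = irr_in_S[OF cbar_irr[OF k]]
  note k'k = S_tob[OF k'S kS] and kk' = S_tob[OF kS k'S]
  note Ok = S_Ob[OF kS] and Ok' = S_Ob[OF k'S]
  interpret K: fd_hilbert "fsc F" "fsp F ?k'" "fip F ?k'" by (rule fsp_hilbert[OF k'S])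
  define r where "r = farr F \<iota> (?k' \<odot> k) (Rs P k) (fvac F)"
  have r: "r \<in> fsp F (?k' \<odot> k)" unfolding r_def by (rule farr_fsp[OF S_tun k'k Rs_Hom(1)[OF k] vac_space(1)])
  let ?t = "(Rs' P k)\<^sup>\<star> \<boxtimes> \<ii>\<dd> k" and ?s = "\<ii>\<dd> k \<boxtimes> Rs P k"
  have asc: "(k \<odot> ?k') \<odot> k = k \<odot> (?k' \<odot> k)" by (rule tob_assoc[OF Ok Ok' Ok])
  have t: "?t \<in> Hom C ((k \<odot> ?k') \<odot> k) k"
    using tar_Hom[OF S_Ob[OF kk'] tun_Ob Ok Ok str_Hom[OF tun_Ob S_Ob[OF kk'] Rs_Hom(2)[OF k]] idt_Hom[OF Ok]]
      tob_tun[OF Ok] by simp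
  have s: "?s \<in> Hom C k ((k \<odot> ?k') \<odot> k)"
    using tar_Hom[OF Ok Ok tun_Ob S_Ob[OF k'k] idt_Hom[OF Ok] Rs_Hom(1)[OF k]] tob_tun[OF Ok] asc by simp
  have dual: "farr F ((k \<odot> ?k') \<odot> k) k ?t (ften F k (?k' \<odot> k) x r) = x" if x: "x \<in> fsp F k" for x
  proof -
    have "ften F k (?k' \<odot> k) x r = farr F k ((k \<odot> ?k') \<odot> k) ?s x"
      using ften_farr[OF kS S_tun kS k'k idt_Hom[OF Ok] Rs_Hom(1)[OF k] x vac_space(1)] tob_tun[OF Ok]
        ften_vac[OF kS x] farr_idt[OF kS x] asc by (simp add: r_def)
    then show ?thesis
      using farr_cmp[OF kS S_tob[OF kk' kS] kS s t x] Rs_conj(2)[OF k] farr_idt[OF kS x] by simp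
  qed
  let ?f = "\<lambda>u. fip F (?k' \<odot> k) (ften F ?k' k u \<phi>) r"
  note m = ften_fsp[OF k'S kS _ \<phi>]
  have add: "?f (x + y) = ?f x + ?f y" if "x \<in> fsp F ?k'" "y \<in> fsp F ?k'" for x y
    using ften_add[OF k'S kS that \<phi> \<phi>] fip_add_left[OF k'k m[OF that(1)] m[OF that(2)] r] by simp
  have scale: "?f (fsc F z x) = cnj z * ?f x" if "x \<in> fsp F ?k'" for x z
    using ften_scl[OF k'S kS that \<phi>] fip_scale_left[OF k'k m[OF that] r] by simp
  obtain \<eta> where \<eta>: "\<eta> \<in> fsp F ?k'" "\<And>u. u \<in> fsp F ?k' \<Longrightarrow> fip F ?k' u \<eta> = ?f u"
    by (rule K.riesz[of ?f, OF add scale]) (assumption | rule that)+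
  have key: "cnj (fip F k \<phi> (frep F k g \<psi>)) = fip F ?k' \<eta> (frep F ?k' g (conj_vector C F P k \<psi>))"
    if g: "g \<in> carrier G" for g
  proof -
    let ?x = "frep F k g \<psi>" and ?u = "frep F ?k' g (conj_vector C F P k \<psi>)"
    have x: "?x \<in> fsp F k" by (rule frep_fsp[OF kS g \<psi>])
    have u: "?u \<in> fsp F ?k'" by (rule frep_fsp[OF k'S g conj_vector_props(1)[OF k \<psi>]])
    have "cnj (fip F k \<phi> ?x) = fip F k ?x \<phi>" by (rule fip_commute[OF kS \<phi> x, symmetric])
    also have "\<dots> = fip F (?k' \<odot> k) r (ften F ?k' k (conj_vector C F P k ?x) \<phi>)"
      using contract_inner[OF k kS x r \<phi>] dual[OF x] by simp
    also have "\<dots> = fip F (?k' \<odot> k) r (ften F ?k' k ?u \<phi>)"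
      using conj_vector_frep[OF k g \<psi>] by simp
    also have "\<dots> = cnj (?f ?u)" by (rule fip_commute[OF k'k m[OF u] r])
    also have "\<dots> = fip F ?k' \<eta> ?u" using \<eta>(2)[OF u] fip_commute[OF k'S u \<eta>(1)] by simp
    finally show ?thesis .
  qed
  show ?thesis by (rule that[OF \<eta>(1) key])
qed

text \<open>
  The isometries of a direct sum have orthogonal ranges, so a sum of two matrix coefficients is one
  matrix coefficient of the direct sum.
\<close>

lemma coefficient_sum:
  assumes ab: "a \<in> S" "b \<in> S"
  obtains c v w where "c \<in> S" "v \<in> Hom C a c" "w \<in> Hom C b c"
    "\<And>g \<phi> \<psi> \<phi>' \<psi>'. \<lbrakk>g \<in> carrier G; \<phi> \<in> fsp F a; \<psi> \<in> fsp F a; \<phi>' \<in> fsp F b; \<psi>' \<in> fsp F b\<rbrakk> \<Longrightarrow>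
      fip F c (farr F a c v \<phi> + farr F b c w \<phi>') (frep F c g (farr F a c v \<psi> + farr F b c w \<psi>')) =
      fip F a \<phi> (frep F a g \<psi>) + fip F b \<phi>' (frep F b g \<psi>')"
proof -
  obtain c v w where c: "c \<in> S" and v: "v \<in> Hom C a c" "v\<^sup>\<star> \<cdot> v = \<ii>\<dd> a" and w: "w \<in> Hom C b c" "w\<^sup>\<star> \<cdot> w = \<ii>\<dd> b"
    and sum: "(v \<cdot> v\<^sup>\<star>) + (w \<cdot> w\<^sup>\<star>) = \<ii>\<dd> c"
    by (rule S_direct_sum[OF ab])
  note Oa = S_Ob[OF ab(1)] and Ob = S_Ob[OF ab(2)] and Oc = S_Ob[OF c]
  have vs: "v\<^sup>\<star> \<in> Hom C c a" and ws: "w\<^sup>\<star> \<in> Hom C c b"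
    using str_Hom[OF Oa Oc v(1)] str_Hom[OF Ob Oc w(1)] .
  have vw: "v\<^sup>\<star> \<cdot> w = 0"
  proof -
    let ?x = "v\<^sup>\<star> \<cdot> w"
    have x: "?x \<in> Hom C b a" by (rule cmp_Hom[OF Ob Oc Oa w(1) vs])
    have H: "v \<cdot> v\<^sup>\<star> \<in> Hom C c c" "w \<cdot> w\<^sup>\<star> \<in> Hom C c c"
      by (rule cmp_Hom[OF Oc Oa Oc vs v(1)], rule cmp_Hom[OF Oc Ob Oc ws w(1)])
    have "?x = v\<^sup>\<star> \<cdot> (((v \<cdot> v\<^sup>\<star>) + (w \<cdot> w\<^sup>\<star>)) \<cdot> w)" using sum cmp_idt[OF Ob Oc w(1)] by simp
    also have "\<dots> = v\<^sup>\<star> \<cdot> (((v \<cdot> v\<^sup>\<star>) \<cdot> w) + ((w \<cdot> w\<^sup>\<star>) \<cdot> w))"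
      using cmp_add[OF Ob Oc Oc w(1,1) H] by simp
    also have "\<dots> = (v\<^sup>\<star> \<cdot> ((v \<cdot> v\<^sup>\<star>) \<cdot> w)) + (v\<^sup>\<star> \<cdot> ((w \<cdot> w\<^sup>\<star>) \<cdot> w))"
      using cmp_add[OF Ob Oc Oa cmp_Hom[OF Ob Oc Oc w(1) H(1)] cmp_Hom[OF Ob Oc Oc w(1) H(2)] vs vs] by simp
    also have "(v \<cdot> v\<^sup>\<star>) \<cdot> w = v \<cdot> ?x" by (rule cmp_assoc[OF Ob Oc Oa Oc w(1) vs v(1)])
    also have "v\<^sup>\<star> \<cdot> (v \<cdot> ?x) = ?x"
      using cmp_assoc[OF Ob Oa Oc Oa x v(1) vs] v(2) cmp_idt[OF Ob Oa x] by simp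
    also have "(w \<cdot> w\<^sup>\<star>) \<cdot> w = w"
      using cmp_assoc[OF Ob Oc Ob Oc w(1) ws w(1)] w(2) cmp_idt[OF Ob Oc w(1)] by simp
    finally show ?thesis by simp
  qed
  have wv: "w\<^sup>\<star> \<cdot> v = 0"
    using str_cmp[OF Ob Oc Oa w(1) vs] str_str[OF Oa Oc v(1)] vw str_zero[OF Oa] by simp
  have vv: "farr F c a (v\<^sup>\<star>) (farr F a c v x) = x" "farr F c b (w\<^sup>\<star>) (farr F a c v x) = 0" if "x \<in> fsp F a" for x
    using farr_cmp[OF ab(1) c ab(1) v(1) vs that] farr_cmp[OF ab(1) c ab(2) v(1) ws that] v(2) wv
      farr_idt[OF ab(1) that] farr_zero_arrow[OF ab that] by simp_all
  have ww: "farr F c b (w\<^sup>\<star>) (farr F b c w x) = x" "farr F c a (v\<^sup>\<star>) (farr F b c w x) = 0" if "x \<in> fsp F b" for x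
    using farr_cmp[OF ab(2) c ab(2) w(1) ws that] farr_cmp[OF ab(2) c ab(1) w(1) vs that] w(2) vw
      farr_idt[OF ab(2) that] farr_zero_arrow[OF ab(2,1) that] by simp_all
  have key: "fip F c (farr F a c v \<phi> + farr F b c w \<phi>') (frep F c g (farr F a c v \<psi> + farr F b c w \<psi>')) =
      fip F a \<phi> (frep F a g \<psi>) + fip F b \<phi>' (frep F b g \<psi>')"
    if h: "g \<in> carrier G" "\<phi> \<in> fsp F a" "\<psi> \<in> fsp F a" "\<phi>' \<in> fsp F b" "\<psi>' \<in> fsp F b" for g \<phi> \<psi> \<phi>' \<psi>'
  proof -
    note m = farr_fsp[OF ab(1) c v(1)] farr_fsp[OF ab(2) c w(1)]
    let ?x = "frep F a g \<psi>" and ?y = "frep F b g \<psi>'"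
    have xy: "?x \<in> fsp F a" "?y \<in> fsp F b" by (rule frep_fsp[OF ab(1) h(1,3)], rule frep_fsp[OF ab(2) h(1,5)])
    have "frep F c g (farr F a c v \<psi> + farr F b c w \<psi>') = farr F a c v ?x + farr F b c w ?y"
      using frep_add[OF c h(1) m(1)[OF h(3)] m(2)[OF h(5)]] farr_frep[OF ab(1) c v(1) h(1,3)]
        farr_frep[OF ab(2) c w(1) h(1,5)] by simp
    moreover have "fip F c (farr F a c v \<phi>) (farr F a c v ?x) = fip F a \<phi> ?x"
      "fip F c (farr F a c v \<phi>) (farr F b c w ?y) = 0"
      "fip F c (farr F b c w \<phi>') (farr F a c v ?x) = 0"
      "fip F c (farr F b c w \<phi>') (farr F b c w ?y) = fip F b \<phi>' ?y"
      using farr_adjoint[OF ab(1) c v(1) h(2) m(1)[OF xy(1)]] farr_adjoint[OF ab(1) c v(1) h(2) m(2)[OF xy(2)]]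
        farr_adjoint[OF ab(2) c w(1) h(4) m(1)[OF xy(1)]] farr_adjoint[OF ab(2) c w(1) h(4) m(2)[OF xy(2)]]
        vv[OF xy(1)] ww[OF xy(2)] fip_zero_right[OF ab(1) h(2)] fip_zero_right[OF ab(2) h(4)] by simp_all
    ultimately show ?thesis
      using m(1)[OF h(2)] m(2)[OF h(4)] m(1)[OF xy(1)] m(2)[OF xy(2)]
      by (simp add: fip_add_left[OF c] fip_add_right[OF c] fsp_add[OF c])
  qed
  show ?thesis by (rule that[OF c v(1) w(1) key])
qed

text \<open>
  Functions with mean value zero over the group: averaging a representation projects onto its
  invariant vectors.
\<close>

definition null_coefficient :: "('g \<Rightarrow> complex) \<Rightarrow> bool" where
  "null_coefficient f \<longleftrightarrow> (\<exists>c \<Phi> \<Psi>. c \<in> S \<and> \<Phi> \<in> fsp F c \<and> \<Psi> \<in> fsp F c \<and>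
     (\<forall>z\<in>fsp F c. (\<forall>g\<in>carrier G. frep F c g z = z) \<longrightarrow> fip F c z \<Psi> = 0) \<and>
     (\<forall>g\<in>carrier G. f g = fip F c \<Phi> (frep F c g \<Psi>)))"

lemma null_coefficientE:
  assumes "null_coefficient f"
  obtains c \<Phi> \<Psi> where
    "\<And>z. \<lbrakk>z \<in> fsp F c; \<forall>g\<in>carrier G. frep F c g z = z\<rbrakk> \<Longrightarrow> fip F c z \<Psi> = 0"
    "\<And>g. g \<in> carrier G \<Longrightarrow> f g = fip F c \<Phi> (frep F c g \<Psi>)"
    "c \<in> S" "\<Phi> \<in> fsp F c" "\<Psi> \<in> fsp F c"
proof -
  from assms obtain c \<Phi> \<Psi> where h: "c \<in> S \<and> \<Phi> \<in> fsp F c \<and> \<Psi> \<in> fsp F c \<and>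
     (\<forall>z\<in>fsp F c. (\<forall>g\<in>carrier G. frep F c g z = z) \<longrightarrow> fip F c z \<Psi> = 0) \<and>
     (\<forall>g\<in>carrier G. f g = fip F c \<Phi> (frep F c g \<Psi>))"
    unfolding null_coefficient_def by (elim exE)
  show ?thesis by (rule that[of c \<Psi> \<Phi>]) (use h in simp_all)
qed

lemma null_not_bounded_below:
  assumes "null_coefficient f" "\<And>g. g \<in> carrier G \<Longrightarrow> d \<le> Re (f g)"
  shows "d \<le> 0"
proof -
  obtain c \<Phi> \<Psi> where orth: "\<And>z. \<lbrakk>z \<in> fsp F c; \<forall>g\<in>carrier G. frep F c g z = z\<rbrakk> \<Longrightarrow> fip F c z \<Psi> = 0"
    and f: "\<And>g. g \<in> carrier G \<Longrightarrow> f g = fip F c \<Phi> (frep F c g \<Psi>)"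
    and c: "c \<in> S" "\<Phi> \<in> fsp F c" "\<Psi> \<in> fsp F c"
    by (rule null_coefficientE[OF assms(1)]) (rule that)
  interpret K: fd_hilbert "fsc F" "fsp F c" "fip F c" by (rule fsp_hilbert[OF c(1)])
  have orth': "fip F c z \<Psi> = 0" if "z \<in> fsp F c" "\<And>g. g \<in> carrier G \<Longrightarrow> frep F c g z = z" for z
    using that by (intro orth ballI)
  show ?thesis
    by (rule K.coefficient_not_bounded_below[OF G.is_group rep[OF c(1)] c(3) orth' c(2)])
      (use assms(2) f in auto)
qed

lemma null_zero: "null_coefficient (\<lambda>_. 0)"
  unfolding null_coefficient_def
  using S_tun fsp_zero[OF S_tun] fip_zero_left[OF S_tun] fip_zero_right[OF S_tun] frep_fsp[OF S_tun]
  by (intro exI[of _ "\<iota>"] exI[of _ 0]) auto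

lemma null_add:
  assumes "null_coefficient f" "null_coefficient f'"
  shows "null_coefficient (\<lambda>g. f g + f' g)"
proof -
  obtain a \<Phi> \<Psi> where orth: "\<And>z. \<lbrakk>z \<in> fsp F a; \<forall>g\<in>carrier G. frep F a g z = z\<rbrakk> \<Longrightarrow> fip F a z \<Psi> = 0"
    and f: "\<And>g. g \<in> carrier G \<Longrightarrow> f g = fip F a \<Phi> (frep F a g \<Psi>)"
    and a: "a \<in> S" "\<Phi> \<in> fsp F a" "\<Psi> \<in> fsp F a"
    by (rule null_coefficientE[OF assms(1)]) (rule that)
  obtain b \<Phi>' \<Psi>' where orth': "\<And>z. \<lbrakk>z \<in> fsp F b; \<forall>g\<in>carrier G. frep F b g z = z\<rbrakk> \<Longrightarrow> fip F b z \<Psi>' = 0"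
    and f': "\<And>g. g \<in> carrier G \<Longrightarrow> f' g = fip F b \<Phi>' (frep F b g \<Psi>')"
    and b: "b \<in> S" "\<Phi>' \<in> fsp F b" "\<Psi>' \<in> fsp F b"
    by (rule null_coefficientE[OF assms(2)]) (rule that)
  obtain c v w where c: "c \<in> S" "v \<in> Hom C a c" "w \<in> Hom C b c"
    and sum: "\<And>g \<phi> \<psi> \<phi>' \<psi>'. \<lbrakk>g \<in> carrier G; \<phi> \<in> fsp F a; \<psi> \<in> fsp F a; \<phi>' \<in> fsp F b; \<psi>' \<in> fsp F b\<rbrakk> \<Longrightarrow>
      fip F c (farr F a c v \<phi> + farr F b c w \<phi>') (frep F c g (farr F a c v \<psi> + farr F b c w \<psi>')) =
      fip F a \<phi> (frep F a g \<psi>) + fip F b \<phi>' (frep F b g \<psi>')"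
    by (rule coefficient_sum[OF a(1) b(1)]) (rule that)
  note m = farr_fsp[OF a(1) c(1,2)] farr_fsp[OF b(1) c(1,3)]
  have vs: "v\<^sup>\<star> \<in> Hom C c a" and ws: "w\<^sup>\<star> \<in> Hom C c b"
    using str_Hom[OF S_Ob[OF a(1)] S_Ob[OF c(1)] c(2)] str_Hom[OF S_Ob[OF b(1)] S_Ob[OF c(1)] c(3)] .
  have "fip F c z (farr F a c v \<Psi> + farr F b c w \<Psi>') = 0"
    if z: "z \<in> fsp F c" "\<And>g. g \<in> carrier G \<Longrightarrow> frep F c g z = z" for z
  proof -
    have "fip F a (farr F c a (v\<^sup>\<star>) z) \<Psi> = 0"
      using farr_fsp[OF c(1) a(1) vs z(1)] farr_frep[OF c(1) a(1) vs _ z(1)] z(2) by (intro orth) simp_all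
    moreover have "fip F b (farr F c b (w\<^sup>\<star>) z) \<Psi>' = 0"
      using farr_fsp[OF c(1) b(1) ws z(1)] farr_frep[OF c(1) b(1) ws _ z(1)] z(2) by (intro orth') simp_all
    ultimately show ?thesis
      using farr_str[OF a(1) c(1,2) a(3) z(1)] farr_str[OF b(1) c(1,3) b(3) z(1)]
        fip_add_right[OF c(1) z(1) m(1)[OF a(3)] m(2)[OF b(3)]] by simp
  qed
  then show ?thesis
    unfolding null_coefficient_def
    using c(1) fsp_add[OF c(1) m(1)[OF a(2)] m(2)[OF b(2)]] fsp_add[OF c(1) m(1)[OF a(3)] m(2)[OF b(3)]]
      sum[OF _ a(2,3) b(2,3)] f f'
    by (intro exI[of _ c] exI[of _ "farr F a c v \<Phi> + farr F b c w \<Phi>'"]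
        exI[of _ "farr F a c v \<Psi> + farr F b c w \<Psi>'"]) simp
qed

lemma null_sum: "(\<And>i. i \<in> I \<Longrightarrow> null_coefficient (f i)) \<Longrightarrow> null_coefficient (\<lambda>g. \<Sum>i\<in>I. f i g)"
proof (induction I rule: infinite_finite_induct)
  case (insert i I)
  then show ?case using null_add[of "f i" "\<lambda>g. \<Sum>i\<in>I. f i g"] by simp
qed (simp_all add: null_zero)

text \<open>
  The linear map that sends the vacuum to \<open>z\<close> intertwines the trivial representation with \<open>F(a)\<close>.
\<close>

lemma invariant_vector:
  assumes a: "a \<in> S" and z: "z \<in> fsp F a" "\<And>g. g \<in> carrier G \<Longrightarrow> frep F a g z = z"
  obtains t where "t \<in> Hom C \<iota> a" "farr F \<iota> a t (fvac F) = z"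
proof -
  define A where "A x = fsc F (fip F \<iota> (fvac F) x) z" for x
  note v = vac_space(1)
  have inv: "frep F \<iota> g x = x" if gx: "g \<in> carrier G" "x \<in> fsp F \<iota>" for g x
  proof -
    obtain c where "x = fsc F c (fvac F)" using gx(2) unfolding vac_space(2) by (auto simp: vecs.span_singleton)
    then show ?thesis using frep_scale[OF S_tun gx(1) v] frep_vac[OF gx(1)] by simp
  qed
  have "intertwiner G (fsc F) (fsp F \<iota>) (frep F \<iota>) (fsp F a) (frep F a) A"
    unfolding intertwiner_def linear_between_def A_def
    using fsp_scale[OF a z(1)] inv frep_scale[OF a _ z(1)] z(2)
    by (auto simp: fip_add_right[OF S_tun v] fip_scale_right[OF S_tun v] vecs.scale_left_distrib)
  then obtain t where t: "t \<in> Hom C \<iota> a" "\<And>x. x \<in> fsp F \<iota> \<Longrightarrow> farr F \<iota> a t x = A x"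
    by (rule full[OF S_tun a]) (rule that)
  show ?thesis by (rule that[OF t(1)]) (simp add: t(2) v A_def vac_unit)
qed

definition stabilizer :: "('o \<Rightarrow> 'h set) \<Rightarrow> 'g set" where
  "stabilizer V = {g \<in> carrier G. \<forall>a\<in>S. \<forall>\<psi>\<in>V a. frep F a g \<psi> = \<psi>}"

context
  fixes V :: "'o \<Rightarrow> 'h set"
  assumes V_sub: "\<And>a. a \<in> S \<Longrightarrow> vecs.subspace (V a) \<and> V a \<subseteq> fsp F a"
    and V_arr: "\<And>a b s \<psi>. \<lbrakk>a \<in> S; b \<in> S; s \<in> Hom C a b; \<psi> \<in> V a\<rbrakk> \<Longrightarrow> farr F a b s \<psi> \<in> V b"
    and V_ten: "\<And>a b \<psi> \<psi>'. \<lbrakk>a \<in> S; b \<in> S; \<psi> \<in> V a; \<psi>' \<in> V b\<rbrakk> \<Longrightarrow> ften F a b \<psi> \<psi>' \<in> V (a \<odot> b)"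
    and V_vac: "fvac F \<in> V \<iota>"
    and V_conj: "\<And>k \<psi>. \<lbrakk>k \<in> irr P; \<psi> \<in> V k\<rbrakk> \<Longrightarrow> conj_vector C F P k \<psi> \<in> V (cbar P k)"
begin

text \<open>
  They form an algebra by stability of \<open>V\<close> under direct sums and tensor products, and this algebra
  is closed under complex conjugation by stability under conjugation of vectors.
\<close>

definition coefficients :: "('g \<Rightarrow> complex) set" where
  "coefficients = {f. \<exists>b \<phi> \<psi>. b \<in> S \<and> \<phi> \<in> fsp F b \<and> \<psi> \<in> V b \<and> (\<forall>g\<in>carrier G. f g = fip F b \<phi> (frep F b g \<psi>))}"

lemma coefficientsI: "\<lbrakk>b \<in> S; \<phi> \<in> fsp F b; \<psi> \<in> V b; \<And>g. g \<in> carrier G \<Longrightarrow> f g = fip F b \<phi> (frep F b g \<psi>)\<rbrakk>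
    \<Longrightarrow> f \<in> coefficients"
  unfolding coefficients_def by blast

lemma coefficientsE:
  assumes "f \<in> coefficients"
  obtains b \<phi> \<psi> where "b \<in> S" "\<phi> \<in> fsp F b" "\<psi> \<in> V b" "\<psi> \<in> fsp F b"
    "\<And>g. g \<in> carrier G \<Longrightarrow> f g = fip F b \<phi> (frep F b g \<psi>)"
proof -
  from assms obtain b \<phi> \<psi> where h: "b \<in> S \<and> \<phi> \<in> fsp F b \<and> \<psi> \<in> V b \<and>
      (\<forall>g\<in>carrier G. f g = fip F b \<phi> (frep F b g \<psi>))"
    unfolding coefficients_def by (elim CollectE exE)
  then have "\<psi> \<in> fsp F b" using V_sub[of b] by blast
  then show ?thesis by (intro that[of b \<phi> \<psi>]) (use h in simp_all)
qed

lemma topspace_T: "topspace T = carrier G"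
  using compact by (simp add: compact_group_def)

lemma coefficients_continuous: "f \<in> coefficients \<Longrightarrow> continuous_map T euclidean f"
proof (erule coefficientsE)
  fix b \<phi> \<psi> assume "b \<in> S" "\<phi> \<in> fsp F b" "\<psi> \<in> fsp F b"
    and f: "\<And>g. g \<in> carrier G \<Longrightarrow> f g = fip F b \<phi> (frep F b g \<psi>)"
  then have "continuous_map T euclidean (\<lambda>g. fip F b \<phi> (frep F b g \<psi>))" by (intro frep_continuous)
  then show "continuous_map T euclidean f"
    by (rule continuous_map_eq) (simp add: f topspace_T)
qed

lemma coefficients_const: "(\<lambda>_. c) \<in> coefficients"
proof (rule coefficientsI[OF S_tun vac_space(1)])
  show "fsc F c (fvac F) \<in> V \<iota>" using V_sub[OF S_tun] V_vac vecs.subspace_scale by blast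
  show "c = fip F \<iota> (fvac F) (frep F \<iota> g (fsc F c (fvac F)))" if "g \<in> carrier G" for g
    using frep_scale[OF S_tun that vac_space(1)] frep_vac[OF that] fip_scale_right[OF S_tun vac_space(1,1)]
      vac_unit by simp
qed

lemma coefficients_add:
  assumes "f \<in> coefficients" "f' \<in> coefficients"
  shows "(\<lambda>g. f g + f' g) \<in> coefficients"
proof -
  obtain a \<phi> \<psi> where a: "a \<in> S" "\<phi> \<in> fsp F a" "\<psi> \<in> V a" "\<psi> \<in> fsp F a"
    and f: "\<And>g. g \<in> carrier G \<Longrightarrow> f g = fip F a \<phi> (frep F a g \<psi>)"
    by (rule coefficientsE[OF assms(1)]) (rule that)
  obtain b \<phi>' \<psi>' where b: "b \<in> S" "\<phi>' \<in> fsp F b" "\<psi>' \<in> V b" "\<psi>' \<in> fsp F b"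
    and f': "\<And>g. g \<in> carrier G \<Longrightarrow> f' g = fip F b \<phi>' (frep F b g \<psi>')"
    by (rule coefficientsE[OF assms(2)]) (rule that)
  obtain c v w where c: "c \<in> S" "v \<in> Hom C a c" "w \<in> Hom C b c"
    and sum: "\<And>g \<phi> \<psi> \<phi>' \<psi>'. \<lbrakk>g \<in> carrier G; \<phi> \<in> fsp F a; \<psi> \<in> fsp F a; \<phi>' \<in> fsp F b; \<psi>' \<in> fsp F b\<rbrakk> \<Longrightarrow>
      fip F c (farr F a c v \<phi> + farr F b c w \<phi>') (frep F c g (farr F a c v \<psi> + farr F b c w \<psi>')) =
      fip F a \<phi> (frep F a g \<psi>) + fip F b \<phi>' (frep F b g \<psi>')"
    by (rule coefficient_sum[OF a(1) b(1)]) (rule that)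
  show ?thesis
  proof (rule coefficientsI[OF c(1)])
    show "farr F a c v \<phi> + farr F b c w \<phi>' \<in> fsp F c"
      by (rule fsp_add[OF c(1) farr_fsp[OF a(1) c(1,2) a(2)] farr_fsp[OF b(1) c(1,3) b(2)]])
    show "farr F a c v \<psi> + farr F b c w \<psi>' \<in> V c"
      using V_arr[OF a(1) c(1,2) a(3)] V_arr[OF b(1) c(1,3) b(3)] V_sub[OF c(1)] vecs.subspace_add by blast
    show "f g + f' g = fip F c (farr F a c v \<phi> + farr F b c w \<phi>') (frep F c g (farr F a c v \<psi> + farr F b c w \<psi>'))"
      if "g \<in> carrier G" for g
      using sum[OF that a(2,4) b(2,4)] f[OF that] f'[OF that] by simp
  qed
qed

lemma coefficients_mult:
  assumes "f \<in> coefficients" "f' \<in> coefficients"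
  shows "(\<lambda>g. f g * f' g) \<in> coefficients"
proof -
  obtain a \<phi> \<psi> where a: "a \<in> S" "\<phi> \<in> fsp F a" "\<psi> \<in> V a" "\<psi> \<in> fsp F a"
    and f: "\<And>g. g \<in> carrier G \<Longrightarrow> f g = fip F a \<phi> (frep F a g \<psi>)"
    by (rule coefficientsE[OF assms(1)]) (rule that)
  obtain b \<phi>' \<psi>' where b: "b \<in> S" "\<phi>' \<in> fsp F b" "\<psi>' \<in> V b" "\<psi>' \<in> fsp F b"
    and f': "\<And>g. g \<in> carrier G \<Longrightarrow> f' g = fip F b \<phi>' (frep F b g \<psi>')"
    by (rule coefficientsE[OF assms(2)]) (rule that)
  show ?thesis
  proof (rule coefficientsI[OF S_tob[OF a(1) b(1)] ften_fsp[OF a(1) b(1) a(2) b(2)] V_ten[OF a(1) b(1) a(3) b(3)]])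
    show "f g * f' g = fip F (a \<odot> b) (ften F a b \<phi> \<phi>') (frep F (a \<odot> b) g (ften F a b \<psi> \<psi>'))"
      if g: "g \<in> carrier G" for g
      using ften_rep[OF a(1) b(1) a(4) b(4) g] f[OF g] f'[OF g]
        ften_fip[OF a(1) b(1) a(2) frep_fsp[OF a(1) g a(4)] b(2) frep_fsp[OF b(1) g b(4)]] by simp
  qed
qed

lemma coefficients_sum: "(\<And>i. i \<in> I \<Longrightarrow> f i \<in> coefficients) \<Longrightarrow> (\<lambda>g. \<Sum>i\<in>I. f i g) \<in> coefficients"
proof (induction I rule: infinite_finite_induct)
  case (insert i I)
  then show ?case using coefficients_add[of "f i" "\<lambda>g. \<Sum>i\<in>I. f i g"] by simp
qed (simp_all add: coefficients_const)

text \<open>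
  Conjugate vectors are defined for irreducible representatives, so the coefficient is first
  decomposed by means of a resolution of \<open>b\<close>.
\<close>

lemma coefficients_cnj:
  assumes "f \<in> coefficients"
  shows "(\<lambda>g. cnj (f g)) \<in> coefficients"
proof -
  obtain b \<phi> \<psi> where b: "b \<in> S" "\<phi> \<in> fsp F b" "\<psi> \<in> V b" "\<psi> \<in> fsp F b"
    and f: "\<And>g. g \<in> carrier G \<Longrightarrow> f g = fip F b \<phi> (frep F b g \<psi>)"
    by (rule coefficientsE[OF assms]) (rule that)
  let ?I = "resolution b"
  note Ob = S_Ob[OF b(1)]
  note m = resolution_member[OF b(1) Ob Ob]
  let ?c = "\<lambda>i g. fip F (fst i) (farr F b (fst i) ((snd i)\<^sup>\<star>) \<phi>) (frep F (fst i) g (farr F b (fst i) ((snd i)\<^sup>\<star>) \<psi>))"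
  have cc: "(\<lambda>g. cnj (?c i g)) \<in> coefficients" if i: "i \<in> ?I" for i
  proof -
    note mi = m[OF i]
    let ?p = "farr F b (fst i) ((snd i)\<^sup>\<star>) \<phi>" and ?q = "farr F b (fst i) ((snd i)\<^sup>\<star>) \<psi>"
    have q: "?q \<in> V (fst i)" by (rule V_arr[OF b(1) mi(2,5) b(3)])
    obtain \<eta> where \<eta>: "\<eta> \<in> fsp F (cbar P (fst i))" "\<And>g. g \<in> carrier G \<Longrightarrow>
        cnj (?c i g) = fip F (cbar P (fst i)) \<eta> (frep F (cbar P (fst i)) g (conj_vector C F P (fst i) ?q))"
      by (rule conjugate_coefficient[OF mi(1) mi(6)[OF b(2)] mi(6)[OF b(4)]]) (rule that)
    show ?thesis
      by (rule coefficientsI[OF irr_in_S[OF cbar_irr[OF mi(1)]] \<eta>(1) V_conj[OF mi(1) q] \<eta>(2)])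
  qed
  have eq: "f g = (\<Sum>i\<in>?I. ?c i g)" if g: "g \<in> carrier G" for g
  proof -
    let ?x = "frep F b g \<psi>"
    have x: "?x \<in> fsp F b" by (rule frep_fsp[OF b(1) g b(4)])
    have "fip F b \<phi> ?x = fip F b \<phi> (\<Sum>i\<in>?I. farr F (fst i) b (snd i) (farr F b (fst i) ((snd i)\<^sup>\<star>) ?x))"
      using resolution_vector[OF resolves_resolution[OF b(1)] b(1) x] by simp
    also have "\<dots> = (\<Sum>i\<in>?I. fip F b \<phi> (farr F (fst i) b (snd i) (farr F b (fst i) ((snd i)\<^sup>\<star>) ?x)))"
      using m farr_fsp[OF m(2) b(1) m(4)] x by (intro fip_sum_right[OF b(1,2)]) blast
    also have "\<dots> = (\<Sum>i\<in>?I. ?c i g)"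
    proof (intro sum.cong refl)
      fix i assume i: "i \<in> ?I"
      note mi = m[OF i]
      show "fip F b \<phi> (farr F (fst i) b (snd i) (farr F b (fst i) ((snd i)\<^sup>\<star>) ?x)) = ?c i g"
        using farr_str[OF mi(2) b(1) mi(4) mi(6)[OF x] b(2)] farr_frep[OF b(1) mi(2,5) g b(4)] by simp
    qed
    finally show ?thesis using f[OF g] by simp
  qed
  have "(\<lambda>g. \<Sum>i\<in>?I. cnj (?c i g)) \<in> coefficients" by (rule coefficients_sum[OF cc])
  then obtain b' \<phi>' \<psi>' where b': "b' \<in> S" "\<phi>' \<in> fsp F b'" "\<psi>' \<in> V b'" "\<psi>' \<in> fsp F b'"
    "\<And>g. g \<in> carrier G \<Longrightarrow> (\<Sum>i\<in>?I. cnj (?c i g)) = fip F b' \<phi>' (frep F b' g \<psi>')"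
    by (rule coefficientsE) (rule that)
  show ?thesis by (rule coefficientsI[OF b'(1-3)]) (simp add: eq b'(5)[symmetric])
qed

text \<open>
  The product is a coefficient of \<open>J\<psi> \<otimes> \<psi>'\<close>, where \<open>J\<psi>\<close> is the conjugate vector and \<open>\<psi>'\<close> lies in
  \<open>V b\<close>.  An invariant vector is of the form \<open>F(t) \<Omega>\<close>, and its inner product with \<open>J\<psi> \<otimes> \<psi>'\<close> is the
  inner product of \<open>\<psi>\<close> with the image of \<open>\<psi>'\<close> under an arrow from \<open>b\<close> to \<open>k\<close> obtained from \<open>t\<close>.  This
  image lies in \<open>V k\<close>.
\<close>

lemma null_product:
  assumes k: "k \<in> irr P" and \<psi>: "\<psi> \<in> fsp F k" "\<And>x. x \<in> V k \<Longrightarrow> fip F k \<psi> x = 0"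
    and \<phi>: "\<phi> \<in> fsp F k" and f: "f \<in> coefficients"
  shows "null_coefficient (\<lambda>g. cnj (fip F k \<phi> (frep F k g \<psi>)) * f g)"
proof -
  let ?k' = "cbar P k" and ?J = "conj_vector C F P k \<psi>"
  note kS = irr_in_S[OF k] and k'S = irr_in_S[OF cbar_irr[OF k]]
  note kk' = S_tob[OF kS k'S]
  note J = conj_vector_props(1)[OF k \<psi>(1)]
  obtain b \<phi>' \<psi>' where b: "b \<in> S" "\<phi>' \<in> fsp F b" "\<psi>' \<in> V b" "\<psi>' \<in> fsp F b"
    and f: "\<And>g. g \<in> carrier G \<Longrightarrow> f g = fip F b \<phi>' (frep F b g \<psi>')"
    by (rule coefficientsE[OF f]) (rule that)
  obtain \<eta> where \<eta>: "\<eta> \<in> fsp F ?k'" "\<And>g. g \<in> carrier G \<Longrightarrow>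
      cnj (fip F k \<phi> (frep F k g \<psi>)) = fip F ?k' \<eta> (frep F ?k' g ?J)"
    by (rule conjugate_coefficient[OF k \<phi> \<psi>(1)]) (rule that)
  note k'b = S_tob[OF k'S b(1)]
  note Ok = S_Ob[OF kS] and Ok' = S_Ob[OF k'S] and Ob = S_Ob[OF b(1)]
  have asc: "(k \<odot> ?k') \<odot> b = k \<odot> (?k' \<odot> b)" by (rule tob_assoc[OF Ok Ok' Ob])
  have "fip F (?k' \<odot> b) z (ften F ?k' b ?J \<psi>') = 0"
    if z: "z \<in> fsp F (?k' \<odot> b)" "\<And>g. g \<in> carrier G \<Longrightarrow> frep F (?k' \<odot> b) g z = z" for z
  proof -
    obtain t where t: "t \<in> Hom C \<iota> (?k' \<odot> b)" "farr F \<iota> (?k' \<odot> b) t (fvac F) = z"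
      by (rule invariant_vector[OF k'b z])
    let ?r = "(Rs' P k)\<^sup>\<star> \<boxtimes> \<ii>\<dd> b" and ?s = "\<ii>\<dd> k \<boxtimes> t"
    have r: "?r \<in> Hom C ((k \<odot> ?k') \<odot> b) b"
      using tar_Hom[OF S_Ob[OF kk'] tun_Ob Ob Ob str_Hom[OF tun_Ob S_Ob[OF kk'] Rs_Hom(2)[OF k]] idt_Hom[OF Ob]]
        tob_tun[OF Ob] by simp
    have s: "?s \<in> Hom C k ((k \<odot> ?k') \<odot> b)"
      using tar_Hom[OF Ok Ok tun_Ob S_Ob[OF k'b] idt_Hom[OF Ok] t(1)] tob_tun[OF Ok] asc by simp
    have rs: "?r \<cdot> ?s \<in> Hom C k b" by (rule cmp_Hom[OF Ok S_Ob[OF S_tob[OF kk' b(1)]] Ob s r])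
    have rss: "(?r \<cdot> ?s)\<^sup>\<star> \<in> Hom C b k" by (rule str_Hom[OF Ok Ob rs])
    have "ften F k (?k' \<odot> b) \<psi> z = farr F k ((k \<odot> ?k') \<odot> b) ?s \<psi>"
      using ften_farr[OF kS S_tun kS k'b idt_Hom[OF Ok] t(1) \<psi>(1) vac_space(1)] tob_tun[OF Ok]
        ften_vac[OF kS \<psi>(1)] farr_idt[OF kS \<psi>(1)] asc t(2) by simp
    then have "fip F (?k' \<odot> b) z (ften F ?k' b ?J \<psi>') = fip F b (farr F k b (?r \<cdot> ?s) \<psi>) \<psi>'"
      using contract_inner[OF k b(1) \<psi>(1) z(1) b(4)] farr_cmp[OF kS S_tob[OF kk' b(1)] b(1) s r \<psi>(1)] by simp
    also have "\<dots> = fip F k \<psi> (farr F b k ((?r \<cdot> ?s)\<^sup>\<star>) \<psi>')" by (rule farr_adjoint[OF kS b(1) rs \<psi>(1) b(4)])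
    also have "\<dots> = 0" by (rule \<psi>(2)[OF V_arr[OF b(1) kS rss b(3)]])
    finally show ?thesis .
  qed
  moreover have "cnj (fip F k \<phi> (frep F k g \<psi>)) * f g =
      fip F (?k' \<odot> b) (ften F ?k' b \<eta> \<phi>') (frep F (?k' \<odot> b) g (ften F ?k' b ?J \<psi>'))" if g: "g \<in> carrier G" for g
    using ften_rep[OF k'S b(1) J b(4) g] f[OF g] \<eta>(2)[OF g]
      ften_fip[OF k'S b(1) \<eta>(1) frep_fsp[OF k'S g J] b(2) frep_fsp[OF b(1) g b(4)]] by simp
  ultimately show ?thesis
    unfolding null_coefficient_def
    using k'b ften_fsp[OF k'S b(1) \<eta>(1) b(2)] ften_fsp[OF k'S b(1) J b(4)]
    by (intro exI[of _ "?k' \<odot> b"] exI[of _ "ften F ?k' b \<eta> \<phi>'"] exI[of _ "ften F ?k' b ?J \<psi>'"]) simp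
qed

lemma coefficients_separate:
  assumes g: "g \<in> carrier G" "h \<in> carrier G" and eq: "\<And>a. a \<in> coefficients \<Longrightarrow> a g = a h"
  shows "inv\<^bsub>G\<^esub> h \<otimes>\<^bsub>G\<^esub> g \<in> stabilizer V"
  unfolding stabilizer_def
proof (intro CollectI conjI ballI)
  show "inv\<^bsub>G\<^esub> h \<otimes>\<^bsub>G\<^esub> g \<in> carrier G" using g by simp
  fix a \<psi> assume a: "a \<in> S" and \<psi>: "\<psi> \<in> V a"
  have \<psi>K: "\<psi> \<in> fsp F a" using \<psi> V_sub[OF a] by blast
  have "frep F a g \<psi> = frep F a h \<psi>"
  proof (rule fip_ext[OF a frep_fsp[OF a g(1) \<psi>K] frep_fsp[OF a g(2) \<psi>K]])
    fix \<phi> assume \<phi>: "\<phi> \<in> fsp F a"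
    show "fip F a \<phi> (frep F a g \<psi>) = fip F a \<phi> (frep F a h \<psi>)"
      by (rule eq[OF coefficientsI[OF a \<phi> \<psi>]]) simp
  qed
  then show "frep F a (inv\<^bsub>G\<^esub> h \<otimes>\<^bsub>G\<^esub> g) \<psi> = \<psi>"
    using frep_mult[OF a G.inv_closed[OF g(2)] g(1) \<psi>K] frep_inv[OF a g(2) \<psi>K] by simp
qed

text \<open>
  Let \<open>\<psi>0\<close> be the part of \<open>\<psi>\<close> orthogonal to \<open>V k\<close>.  Its coefficients \<open>f e\<close> with respect to an
  orthonormal basis are constant on the cosets of the stabilizer, so they have uniform
  approximations \<open>a e\<close> by coefficients of \<open>V\<close>.  The sum of \<open>\<bar>f e\<bar>\<^sup>2\<close> is the squared norm \<open>n\<close> of \<open>\<psi>0\<close>,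
  while the sum of \<open>cnj (f e) * a e\<close> has mean value zero.
\<close>

lemma stabilizer_fixed:
  assumes k: "k \<in> irr P" and \<psi>: "\<psi> \<in> fsp F k" "\<And>g. g \<in> stabilizer V \<Longrightarrow> frep F k g \<psi> = \<psi>"
  shows "\<psi> \<in> V k"
proof -
  note kS = irr_in_S[OF k]
  interpret K: fd_hilbert "fsc F" "fsp F k" "fip F k" by (rule fsp_hilbert[OF kS])
  note Vk = conjunct1[OF V_sub[OF kS]] conjunct2[OF V_sub[OF kS]]
  obtain p where p: "p \<in> V k" "\<And>x. x \<in> V k \<Longrightarrow> fip F k x (\<psi> - p) = 0"
    by (rule K.ex_orthogonal_projection[OF Vk \<psi>(1)]) (rule that)
  define \<psi>0 where "\<psi>0 = \<psi> - p"
  have pK: "p \<in> fsp F k" using p(1) Vk(2) by blast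
  have \<psi>0: "\<psi>0 \<in> fsp F k" unfolding \<psi>0_def by (rule K.diff_K[OF \<psi>(1) pK])
  have orth: "fip F k \<psi>0 x = 0" if "x \<in> V k" for x
  proof -
    have "x \<in> fsp F k" using that Vk(2) by blast
    then show ?thesis using K.ip_commute[of x \<psi>0] \<psi>0 p(2)[OF that] by (simp add: \<psi>0_def)
  qed
  have fixed: "frep F k g \<psi>0 = \<psi>0" if g: "g \<in> stabilizer V" for g
  proof -
    have gc: "g \<in> carrier G" "frep F k g p = p" using g p(1) kS by (auto simp: stabilizer_def)
    have "frep F k g \<psi> = frep F k g \<psi>0 + frep F k g p"
      using frep_add[OF kS gc(1) \<psi>0 pK] by (simp add: \<psi>0_def)
    then show ?thesis using \<psi>(2)[OF g] gc(2) by (simp add: \<psi>0_def algebra_simps)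
  qed
  have "\<psi>0 = 0"
  proof (rule ccontr)
    assume nz: "\<psi>0 \<noteq> 0"
    define n where "n = Re (fip F k \<psi>0 \<psi>0)"
    have n: "n > 0" "fip F k \<psi>0 \<psi>0 = of_real n"
      using K.ip_pos[OF \<psi>0 nz] K.ip_self_real[OF \<psi>0] by (simp_all add: n_def)
    let ?B = "hbas P k"
    note B = hbas_basis[OF k]
    have on: "K.orthonormal ?B" using hbas_orthonormal[OF k] by (simp add: K.orthonormal_def)
    have BK: "e \<in> fsp F k" if "e \<in> ?B" for e using B vecs.span_base[OF that] by simp
    let ?f = "\<lambda>e g. fip F k e (frep F k g \<psi>0)"
    define m where "m = real (card ?B)"
    \<comment> \<open>So small that \<open>m\<close> errors of size \<open>sqrt n * \<delta>\<close> add up to at most \<open>n / 2\<close>; the summands \<open>1\<close> keep the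
      denominator positive.\<close>
    define \<delta> where "\<delta> = n / (2 * (m + 1) * (sqrt n + 1))"
    have "0 < 2 * (m + 1) * (sqrt n + 1)"
      using n(1) by (intro mult_pos_pos add_nonneg_pos) (auto simp: m_def)
    then have \<delta>: "\<delta> > 0" using n(1) unfolding \<delta>_def by (rule divide_pos_pos[rotated])
    have "\<exists>a\<in>coefficients. \<forall>g\<in>topspace T. cmod (?f e g - a g) < \<delta>" if e: "e \<in> ?B" for e
    proof (rule complex_Stone_Weierstrass)
      show "compact_space T" using compact by (simp add: compact_group_def)
      show "continuous_map T euclidean (?f e)" by (rule frep_continuous[OF kS BK[OF e] \<psi>0])
      show "?f e g = ?f e h" if gh: "g \<in> topspace T" "h \<in> topspace T" and
        eq: "\<And>a. a \<in> coefficients \<Longrightarrow> a g = a h" for g h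
      proof -
        have g: "g \<in> carrier G" "h \<in> carrier G" using gh topspace_T by simp_all
        have "frep F k (inv\<^bsub>G\<^esub> h \<otimes>\<^bsub>G\<^esub> g) \<psi>0 = \<psi>0" by (rule fixed[OF coefficients_separate[OF g eq]])
        then have "frep F k h (frep F k (inv\<^bsub>G\<^esub> h) (frep F k g \<psi>0)) = frep F k h \<psi>0"
          using frep_mult[OF kS G.inv_closed[OF g(2)] g(1) \<psi>0] by simp
        then show ?thesis using frep_inv[OF kS g(2) frep_fsp[OF kS g(1) \<psi>0]] by simp
      qed
    qed (fact coefficients_continuous coefficients_const coefficients_add coefficients_mult coefficients_cnj \<delta>)+
    then obtain a where a: "\<And>e. e \<in> ?B \<Longrightarrow> a e \<in> coefficients"
      "\<And>e g. e \<in> ?B \<Longrightarrow> g \<in> carrier G \<Longrightarrow> cmod (?f e g - a e g) < \<delta>"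
      unfolding topspace_T by metis
    have null: "null_coefficient (\<lambda>g. \<Sum>e\<in>?B. cnj (?f e g) * a e g)"
      by (intro null_sum null_product[OF k \<psi>0 orth BK] a(1))
    have "n / 2 \<le> Re (\<Sum>e\<in>?B. cnj (?f e g) * a e g)" if g: "g \<in> carrier G" for g
    proof -
      let ?x = "frep F k g \<psi>0"
      have x: "?x \<in> fsp F k" by (rule frep_fsp[OF kS g \<psi>0])
      have xx: "fip F k ?x ?x = of_real n" using frep_fip[OF kS g \<psi>0 \<psi>0] n(2) by simp
      have bound: "cmod (?f e g) \<le> sqrt n" if e: "e \<in> ?B" for e
        using K.cmod_ip_le[OF BK[OF e] x] xx hbas_orthonormal[OF k e e] by (simp add: K.nsq_def)
      have sub: "?B \<subseteq> fsp F k" using BK by blast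
      have "(\<Sum>e\<in>?B. cnj (?f e g) * ?f e g) = of_real n"
        using K.parseval[OF on _ sub _ x, of ?x] B x xx by simp
      then have split: "(\<Sum>e\<in>?B. cnj (?f e g) * a e g) = of_real n - (\<Sum>e\<in>?B. cnj (?f e g) * (?f e g - a e g))"
        by (simp add: algebra_simps sum_subtractf)
      have "cmod (\<Sum>e\<in>?B. cnj (?f e g) * (?f e g - a e g)) \<le> (\<Sum>e\<in>?B. sqrt n * \<delta>)"
      proof (rule sum_norm_le)
        fix e assume e: "e \<in> ?B"
        show "norm (cnj (?f e g) * (?f e g - a e g)) \<le> sqrt n * \<delta>"
          unfolding norm_mult complex_mod_cnj
          using bound[OF e] less_imp_le[OF a(2)[OF e g]] n(1) by (intro mult_mono) simp_all
      qed
      also have "\<dots> = m * sqrt n * \<delta>" by (simp add: m_def)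
      also have "\<dots> \<le> n / 2"
      proof -
        have "m * sqrt n \<le> (m + 1) * (sqrt n + 1)"
          using n(1) by (intro mult_mono) (auto simp: m_def)
        then have "m * sqrt n * \<delta> \<le> (m + 1) * (sqrt n + 1) * \<delta>"
          using \<delta> by (intro mult_right_mono) auto
        also have "\<dots> = n / 2"
        proof -
          have "m + 1 > 0" "sqrt n + 1 > 0" using n(1) by (simp_all add: m_def add_pos_pos)
          moreover have "c * d * (n / (2 * c * d)) = n / 2" if "c > 0" "d > 0" for c d :: real
            using that by (simp add: field_simps)
          ultimately show ?thesis unfolding \<delta>_def by blast
        qed
        finally show ?thesis .
      qed
      finally have small: "cmod (\<Sum>e\<in>?B. cnj (?f e g) * (?f e g - a e g)) \<le> n / 2" .
      have "Re (\<Sum>e\<in>?B. cnj (?f e g) * (?f e g - a e g)) \<le> n / 2"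
        using complex_Re_le_cmod small by (rule order_trans)
      then show ?thesis unfolding split minus_complex.sel Re_complex_of_real by linarith
    qed
    then have "n / 2 \<le> 0" by (rule null_not_bounded_below[OF null])
    then show False using n(1) by simp
  qed
  then show ?thesis using p(1) by (simp add: \<psi>0_def)
qed

end


section \<open>Arrows determined by their components\<close>

context
  fixes \<rho> \<sigma> assumes O: "\<rho> \<in> Ob C" "\<sigma> \<in> Ob C"
begin

lemma component_antilinear:
  assumes x: "x \<in> xHom C F P \<rho> \<sigma>" and k: "k \<in> irr P"
  shows "\<lbrakk>\<phi> \<in> fsp F k; \<phi>' \<in> fsp F k\<rbrakk> \<Longrightarrow> x (\<rho>, \<sigma>, k) (\<phi> + \<phi>') = x (\<rho>, \<sigma>, k) \<phi> + x (\<rho>, \<sigma>, k) \<phi>'"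
    and "\<phi> \<in> fsp F k \<Longrightarrow> x (\<rho>, \<sigma>, k) (fsc F z \<phi>) = scl C (cnj z) (x (\<rho>, \<sigma>, k) \<phi>)"
    and "\<phi> \<notin> fsp F k \<Longrightarrow> x (\<rho>, \<sigma>, k) \<phi> = 0"
proof -
  note kS = irr_in_S[OF k]
  have "(\<forall>\<phi>\<in>fsp F k. \<forall>\<phi>'\<in>fsp F k. x (\<rho>, \<sigma>, k) (\<phi> + \<phi>') = x (\<rho>, \<sigma>, k) \<phi> + x (\<rho>, \<sigma>, k) \<phi>') \<and>
      (\<forall>\<phi>\<in>fsp F k. \<forall>z. x (\<rho>, \<sigma>, k) (fsc F z \<phi>) = scl C (cnj z) (x (\<rho>, \<sigma>, k) \<phi>)) \<and>
      (\<forall>\<phi>. \<phi> \<notin> fsp F k \<longrightarrow> x (\<rho>, \<sigma>, k) \<phi> = 0)"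
    using x
  proof (induction rule: xHom_induct[OF O, consumes 1, case_names zero add])
    case (add l s \<psi> y)
    show ?case
    proof (cases "l = k")
      case True
      have \<psi>: "\<psi> \<in> fsp F k" using add(3) True by simp
      show ?thesis
        using add(5) True
        by (auto simp: stensor_def fsp_add[OF kS] fsp_scale[OF kS] fip_add_left[OF kS _ _ \<psi>]
            fip_scale_left[OF kS _ \<psi>] arrows.scale_left_distrib arrows.scale_right_distrib algebra_simps)
    next
      case False
      then have "stensor C F \<rho> \<sigma> l s \<psi> (\<rho>, \<sigma>, k) \<phi> = 0" for \<phi> by (simp add: stensor_def)
      then show ?thesis using add(5) by simp
    qed
  qed simp
  then show "\<lbrakk>\<phi> \<in> fsp F k; \<phi>' \<in> fsp F k\<rbrakk> \<Longrightarrow> x (\<rho>, \<sigma>, k) (\<phi> + \<phi>') = x (\<rho>, \<sigma>, k) \<phi> + x (\<rho>, \<sigma>, k) \<phi>'"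
    "\<phi> \<in> fsp F k \<Longrightarrow> x (\<rho>, \<sigma>, k) (fsc F z \<phi>) = scl C (cnj z) (x (\<rho>, \<sigma>, k) \<phi>)"
    "\<phi> \<notin> fsp F k \<Longrightarrow> x (\<rho>, \<sigma>, k) \<phi> = 0"
    by simp_all
qed

lemma component_diff:
  assumes x: "x \<in> xHom C F P \<rho> \<sigma>" and k: "k \<in> irr P" and \<phi>: "\<phi> \<in> fsp F k" "\<phi>' \<in> fsp F k"
  shows "x (\<rho>, \<sigma>, k) (\<phi> - \<phi>') = x (\<rho>, \<sigma>, k) \<phi> - x (\<rho>, \<sigma>, k) \<phi>'"
  using component_antilinear(1)[OF x k fsp_diff[OF irr_in_S[OF k] \<phi>] \<phi>(2)] by simp

lemma component_sum:
  assumes x: "x \<in> xHom C F P \<rho> \<sigma>" and k: "k \<in> irr P" and h: "\<And>i. i \<in> I \<Longrightarrow> h i \<in> fsp F k"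
  shows "x (\<rho>, \<sigma>, k) (sum h I) = (\<Sum>i\<in>I. x (\<rho>, \<sigma>, k) (h i))"
proof -
  note kS = irr_in_S[OF k]
  have z: "x (\<rho>, \<sigma>, k) 0 = 0" using component_antilinear(1)[OF x k fsp_zero[OF kS] fsp_zero[OF kS]] by simp
  show ?thesis using h
  proof (induction I rule: infinite_finite_induct)
    case (insert i I)
    then show ?case using fsp_sum[OF kS, of I h] component_antilinear(1)[OF x k, of "h i" "sum h I"] by simp
  qed (simp_all add: z)
qed

lemma xHom_ext:
  assumes x: "x \<in> xHom C F P \<rho> \<sigma>" and y: "y \<in> xHom C F P \<rho> \<sigma>"
    and eq: "\<And>k \<phi>. \<lbrakk>k \<in> irr P; \<phi> \<in> fsp F k\<rbrakk> \<Longrightarrow> x (\<rho>, \<sigma>, k) \<phi> = y (\<rho>, \<sigma>, k) \<phi>"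
  shows "x = y"
proof (intro ext)
  fix t \<phi>
  show "x t \<phi> = y t \<phi>"
  proof (cases "\<exists>k\<in>irr P. t = (\<rho>, \<sigma>, k)")
    case True
    then obtain k where k: "k \<in> irr P" "t = (\<rho>, \<sigma>, k)" by blast
    show ?thesis
      using eq[OF k(1)] component_antilinear(3)[OF x k(1)] component_antilinear(3)[OF y k(1)] k(2)
      by (cases "\<phi> \<in> fsp F k") simp_all
  next
    case False
    then have "x t = 0" "y t = 0" using xHom_component(1)[OF O x, of t] xHom_component(1)[OF O y, of t] by blast+
    then show ?thesis by simp
  qed
qed

end

text \<open>Equivalently, \<open>x\<close> is a sum of simple tensors with vectors in the spaces \<open>V k\<close>.\<close>

definition supported_on :: "('o \<Rightarrow> 'h set) \<Rightarrow> 'o \<Rightarrow> 'o \<Rightarrow> ('o, 'v, 'h) xarr \<Rightarrow> bool" where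
  "supported_on V \<rho> \<sigma> x \<longleftrightarrow> x \<in> xHom C F P \<rho> \<sigma> \<and>
     (\<forall>k\<in>irr P. \<forall>\<phi>\<in>fsp F k. (\<forall>y\<in>V k. fip F k \<phi> y = 0) \<longrightarrow> x (\<rho>, \<sigma>, k) \<phi> = 0)"

lemma supported_on_expansion:
  assumes O: "\<rho> \<in> Ob C" "\<sigma> \<in> Ob C" and x: "supported_on V \<rho> \<sigma> x"
    and V: "\<And>k. k \<in> irr P \<Longrightarrow> vecs.subspace (V k) \<and> V k \<subseteq> fsp F k"
  obtains J B where "finite J" "J \<subseteq> irr P" "\<forall>k\<in>J. finite (B k) \<and> B k \<subseteq> V k"
    "x = (\<Sum>k\<in>J. \<Sum>e\<in>B k. stensor C F \<rho> \<sigma> k (x (\<rho>, \<sigma>, k) e) e)"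
proof -
  have xH: "x \<in> xHom C F P \<rho> \<sigma>" using x by (simp add: supported_on_def)
  have "\<exists>B. finite B \<and> B \<subseteq> V k \<and> (\<forall>e\<in>B. \<forall>f\<in>B. fip F k e f = (if e = f then 1 else 0)) \<and> vecs.span B = V k"
    if k: "k \<in> irr P" for k
  proof -
    interpret K: fd_hilbert "fsc F" "fsp F k" "fip F k" by (rule fsp_hilbert[OF irr_in_S[OF k]])
    obtain B where "finite B" "B \<subseteq> V k" "K.orthonormal B" "vecs.span B = V k"
      by (rule K.ex_orthonormal_basis[OF conjunct1[OF V[OF k]] conjunct2[OF V[OF k]]])
    then show ?thesis unfolding K.orthonormal_def by (intro exI[of _ B]) simp
  qed
  then obtain B where B: "\<And>k. k \<in> irr P \<Longrightarrow> finite (B k)" "\<And>k. k \<in> irr P \<Longrightarrow> B k \<subseteq> V k"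
    "\<And>k. k \<in> irr P \<Longrightarrow> \<forall>e\<in>B k. \<forall>f\<in>B k. fip F k e f = (if e = f then 1 else 0)"
    "\<And>k. k \<in> irr P \<Longrightarrow> vecs.span (B k) = V k"
    by metis
  have BK: "e \<in> fsp F k" if "k \<in> irr P" "e \<in> B k" for k e using B(2)[OF that(1)] V[OF that(1)] that(2) by blast
  let ?J = "{k. x (\<rho>, \<sigma>, k) \<noteq> 0}"
  note J = xHom_support[OF O xH]
  define y where "y = (\<Sum>k\<in>?J. \<Sum>e\<in>B k. stensor C F \<rho> \<sigma> k (x (\<rho>, \<sigma>, k) e) e)"
  have st: "stensor C F \<rho> \<sigma> k (x (\<rho>, \<sigma>, k) e) e \<in> xHom C F P \<rho> \<sigma>" if "k \<in> ?J" "e \<in> B k" for k e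
    using that J(2) BK xHom_component(3)[OF O xH] by (intro stensor_xHom[OF O]) auto
  have yH: "y \<in> xHom C F P \<rho> \<sigma>" unfolding y_def by (intro xHom_sum[OF O] st)
  have apply_sum: "(\<Sum>i\<in>I. f i) t \<phi> = (\<Sum>i\<in>I. f i t \<phi>)" for I :: "'i set" and f :: "'i \<Rightarrow> ('o, 'v, 'h) xarr" and t \<phi>
    by (induction I rule: infinite_finite_induct) simp_all
  have "x = y"
  proof (rule xHom_ext[OF O xH yH])
    fix l \<phi> assume l: "l \<in> irr P" and \<phi>: "\<phi> \<in> fsp F l"
    interpret K: fd_hilbert "fsc F" "fsp F l" "fip F l" by (rule fsp_hilbert[OF irr_in_S[OF l]])
    have on: "K.orthonormal (B l)" using B(3)[OF l] by (simp add: K.orthonormal_def)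
    have sub: "B l \<subseteq> fsp F l" using BK[OF l] by blast
    let ?p = "\<Sum>e\<in>B l. fsc F (fip F l e \<phi>) e"
    have p: "?p \<in> fsp F l" by (intro K.sum_K K.scale_K BK[OF l])
    have "fip F l (\<phi> - ?p) y = 0" if "y \<in> V l" for y
    proof -
      have y: "y \<in> fsp F l" using that V[OF l] by blast
      have "fip F l y (\<phi> - ?p) = 0"
        by (rule K.orthonormal_residual[OF on B(1)[OF l] sub \<phi>]) (simp add: B(4)[OF l] that)
      then show ?thesis using K.ip_commute[OF y K.diff_K[OF \<phi> p]] by simp
    qed
    then have "x (\<rho>, \<sigma>, l) (\<phi> - ?p) = 0"
      using x l K.diff_K[OF \<phi> p] unfolding supported_on_def by blast
    then have "x (\<rho>, \<sigma>, l) \<phi> = x (\<rho>, \<sigma>, l) ?p" using component_diff[OF O xH l \<phi> p] by simp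
    also have "\<dots> = (\<Sum>e\<in>B l. x (\<rho>, \<sigma>, l) (fsc F (fip F l e \<phi>) e))"
      by (rule component_sum[OF O xH l]) (rule K.scale_K[OF BK[OF l]])
    also have "\<dots> = (\<Sum>e\<in>B l. scl C (fip F l \<phi> e) (x (\<rho>, \<sigma>, l) e))"
      using component_antilinear(2)[OF O xH l BK[OF l]] K.ip_commute[OF BK[OF l] \<phi>] by (intro sum.cong) simp_all
    finally have xl: "x (\<rho>, \<sigma>, l) \<phi> = (\<Sum>e\<in>B l. scl C (fip F l \<phi> e) (x (\<rho>, \<sigma>, l) e))" .
    have "y (\<rho>, \<sigma>, l) \<phi> = (\<Sum>k\<in>?J. \<Sum>e\<in>B k. stensor C F \<rho> \<sigma> k (x (\<rho>, \<sigma>, k) e) e (\<rho>, \<sigma>, l) \<phi>)"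
      unfolding y_def by (simp only: apply_sum)
    also have "\<dots> = (\<Sum>k\<in>?J. if k = l then x (\<rho>, \<sigma>, l) \<phi> else 0)"
      using xl \<phi> by (intro sum.cong refl) (auto simp: stensor_def)
    also have "\<dots> = x (\<rho>, \<sigma>, l) \<phi>" using J(1) by (auto simp: sum.delta')
    finally show "x (\<rho>, \<sigma>, l) \<phi> = y (\<rho>, \<sigma>, l) \<phi>" by simp
  qed
  then show ?thesis using that[OF J, of B] B(1,2) J(2) y_def by blast
qed

lemma supported_on_act:
  assumes O: "\<rho> \<in> Ob C" "\<sigma> \<in> Ob C" and x: "supported_on V \<rho> \<sigma> x"
    and V: "\<And>k. k \<in> irr P \<Longrightarrow> V k \<subseteq> fsp F k"
    and g: "g \<in> carrier G" "\<And>k \<psi>. \<lbrakk>k \<in> irr P; \<psi> \<in> V k\<rbrakk> \<Longrightarrow> frep F k g \<psi> = \<psi>"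
  shows "act_arr C F P g x = x"
proof -
  have xH: "x \<in> xHom C F P \<rho> \<sigma>" using x by (simp add: supported_on_def)
  show ?thesis
  proof (rule xHom_ext[OF O act_xHom[OF g(1) O xH] xH])
    fix k \<phi> assume k: "k \<in> irr P" and \<phi>: "\<phi> \<in> fsp F k"
    note kS = irr_in_S[OF k]
    let ?\<phi> = "frep F k (inv\<^bsub>G\<^esub> g) \<phi>"
    have \<phi>': "?\<phi> \<in> fsp F k" by (rule frep_fsp[OF kS G.inv_closed[OF g(1)] \<phi>])
    interpret K: fd_hilbert "fsc F" "fsp F k" "fip F k" by (rule fsp_hilbert[OF kS])
    have "fip F k (?\<phi> - \<phi>) y = 0" if y: "y \<in> V k" for y
    proof -
      have yK: "y \<in> fsp F k" using y V[OF k] by blast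
      have "fip F k ?\<phi> y = fip F k \<phi> y" using frep_adjoint[OF kS g(1) \<phi> yK] g(2)[OF k y] by simp
      then show ?thesis using K.ip_diff_left[OF \<phi>' \<phi> yK] by simp
    qed
    then have "x (\<rho>, \<sigma>, k) (?\<phi> - \<phi>) = 0" using x k K.diff_K[OF \<phi>' \<phi>] unfolding supported_on_def by blast
    then show "act_arr C F P g x (\<rho>, \<sigma>, k) \<phi> = x (\<rho>, \<sigma>, k) \<phi>"
      using act_component[OF g(1) O xH k \<phi>] component_diff[OF O xH k \<phi>' \<phi>] by simp
  qed
qed

text \<open>
  By Schur's lemma only the component at \<open>l\<close> is nonzero, and its arrow is a scalar.
\<close>

lemma xHom_unit_irr:
  assumes l: "l \<in> irr P" and y: "y \<in> xHom C F P \<iota> l"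
  obtains \<psi> where "\<psi> \<in> fsp F l" "y = cten \<iota> l l (\<ii>\<dd> l) \<psi>"
proof -
  note Ol = irr_Ob[OF l] and lS = irr_in_S[OF l]
  have il: "\<ii>\<dd> l \<in> Hom C (l \<odot> \<iota>) l" using idt_Hom[OF Ol] tob_tun[OF Ol] by simp
  have "\<exists>\<psi>\<in>fsp F l. y = stensor C F \<iota> l l (\<ii>\<dd> l) \<psi>"
    using y
  proof (induction rule: xHom_induct[OF tun_Ob Ol, consumes 1, case_names zero add])
    case zero
    show ?case by (rule bexI[OF _ fsp_zero[OF lS]]) (rule stensor_zero_vec[OF lS, symmetric])
  next
    case (add k s \<psi> y)
    then obtain \<psi>' where \<psi>': "\<psi>' \<in> fsp F l" "y = stensor C F \<iota> l l (\<ii>\<dd> l) \<psi>'" by blast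
    have s: "s \<in> Hom C k l" using add(2) tob_tun[OF irr_Ob[OF add(1)]] by simp
    have "\<exists>\<psi>''\<in>fsp F l. stensor C F \<iota> l k s \<psi> = stensor C F \<iota> l l (\<ii>\<dd> l) \<psi>''"
    proof (cases "k = l")
      case True
      obtain c where "s = scl C c (\<ii>\<dd> l)" by (rule irr_endomorphism[OF l]) (use s True in simp)
      then have "stensor C F \<iota> l k s \<psi> = stensor C F \<iota> l l (\<ii>\<dd> l) (fsc F c \<psi>)"
        using stensor_scl_vec[OF lS, of \<psi>] add(3) True by simp
      then show ?thesis using fsp_scale[OF lS, of \<psi> c] add(3) True by blast
    next
      case False
      then have "s = 0" using irr_distinct_Hom[OF add(1) l _ s] by simp
      then show ?thesis using stensor_zero_vec[OF lS] fsp_zero[OF lS] by (intro bexI[of _ 0]) (simp_all add: stensor_zero_arrow)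
    qed
    then obtain \<psi>'' where \<psi>'': "\<psi>'' \<in> fsp F l" "stensor C F \<iota> l k s \<psi> = stensor C F \<iota> l l (\<ii>\<dd> l) \<psi>''" by blast
    have "stensor C F \<iota> l k s \<psi> + y = stensor C F \<iota> l l (\<ii>\<dd> l) (\<psi>'' + \<psi>')"
      unfolding \<psi>''(2) \<psi>'(2) by (rule stensor_add_vec[OF lS \<psi>''(1) \<psi>'(1), symmetric])
    then show ?case by (rule bexI[OF _ fsp_add[OF lS \<psi>''(1) \<psi>'(1)]])
  qed
  then obtain \<psi> where "\<psi> \<in> fsp F l" "y = stensor C F \<iota> l l (\<ii>\<dd> l) \<psi>" by blast
  then show ?thesis using that cten_irr[OF l tun_Ob Ol il] by simp
qed

text \<open>
  Frobenius reciprocity: bending the source of \<open>x\<close> around by an arrow \<open>r'\<close> and composing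
  with \<open>t\<^sup>\<star>\<close> for \<open>t\<close> from an irreducible object of \<open>S\<close>.
\<close>

definition probe :: "'o \<Rightarrow> 'o \<Rightarrow> 'o \<Rightarrow> 'o \<Rightarrow> 'v \<Rightarrow> 'v \<Rightarrow> ('o, 'v, 'h) xarr \<Rightarrow> ('o, 'v, 'h) xarr" where
  "probe \<rho> \<sigma> \<rho>' l r' t x =
     xcmp C F P (xemb C F (\<sigma> \<odot> \<rho>') l (t\<^sup>\<star>))
       (xcmp C F P (xtar C \<epsilon> F P x (xemb C F \<rho>' \<rho>' (\<ii>\<dd> \<rho>'))) (xemb C F \<iota> (\<rho> \<odot> \<rho>') r'))"

context
  fixes \<rho> \<sigma> \<rho>' l r' t
  assumes O: "\<rho> \<in> Ob C" "\<sigma> \<in> Ob C" "\<rho>' \<in> Ob C" and l: "l \<in> irr P"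
    and r': "r' \<in> Hom C \<iota> (\<rho> \<odot> \<rho>')" and t: "t \<in> Hom C l (\<sigma> \<odot> \<rho>')"
begin

lemma probe_Ob: "l \<in> Ob C" "\<rho> \<odot> \<rho>' \<in> Ob C" "\<sigma> \<odot> \<rho>' \<in> Ob C"
  using irr_Ob[OF l] O tob_Ob by auto

lemma probe_star: "t\<^sup>\<star> \<in> Hom C (\<sigma> \<odot> \<rho>') l"
  by (rule str_Hom[OF probe_Ob(1,3) t])

lemma probe_parts:
  "xemb C F (\<sigma> \<odot> \<rho>') l (t\<^sup>\<star>) \<in> xHom C F P (\<sigma> \<odot> \<rho>') l"
  "xemb C F \<rho>' \<rho>' (\<ii>\<dd> \<rho>') \<in> xHom C F P \<rho>' \<rho>'"
  "xemb C F \<iota> (\<rho> \<odot> \<rho>') r' \<in> xHom C F P \<iota> (\<rho> \<odot> \<rho>')"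
  by (rule xemb_xHom[OF probe_Ob(3,1) probe_star], rule xemb_xHom[OF O(3,3) idt_Hom[OF O(3)]], rule xemb_xHom[OF tun_Ob probe_Ob(2) r'])

lemma probe_mid: "x \<in> xHom C F P \<rho> \<sigma> \<Longrightarrow>
    xtar C \<epsilon> F P x (xemb C F \<rho>' \<rho>' (\<ii>\<dd> \<rho>')) \<in> xHom C F P (\<rho> \<odot> \<rho>') (\<sigma> \<odot> \<rho>')"
  by (rule xtar_xHom[OF O(1,2,3,3) _ probe_parts(2)])

lemma probe_xHom: "x \<in> xHom C F P \<rho> \<sigma> \<Longrightarrow> probe \<rho> \<sigma> \<rho>' l r' t x \<in> xHom C F P \<iota> l"
  unfolding probe_def
  by (intro xcmp_xHom[OF tun_Ob probe_Ob(3,1) probe_parts(1)] xcmp_xHom[OF tun_Ob probe_Ob(2,3) probe_mid probe_parts(3)])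

lemma probe_add:
  assumes "x \<in> xHom C F P \<rho> \<sigma>" "y \<in> xHom C F P \<rho> \<sigma>"
  shows "probe \<rho> \<sigma> \<rho>' l r' t (x + y) = probe \<rho> \<sigma> \<rho>' l r' t x + probe \<rho> \<sigma> \<rho>' l r' t y"
  unfolding probe_def
    bisum_add_left[OF tar_fusion[OF O(1,2,3,3)], folded xtar_bisum, OF assms probe_parts(2)]
    xcmp_add_left[OF tun_Ob probe_Ob(2,3) probe_mid[OF assms(1)] probe_mid[OF assms(2)] probe_parts(3)]
  by (rule xcmp_add_right[OF tun_Ob probe_Ob(3,1) probe_parts(1)
        xcmp_xHom[OF tun_Ob probe_Ob(2,3) probe_mid[OF assms(1)] probe_parts(3)]
        xcmp_xHom[OF tun_Ob probe_Ob(2,3) probe_mid[OF assms(2)] probe_parts(3)]])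

lemma probe_zero: "probe \<rho> \<sigma> \<rho>' l r' t 0 = 0"
  unfolding probe_def
  by (simp only: bisum_zero(1)[OF tar_fusion[OF O(1,2,3,3)], folded xtar_bisum] xcmp_zero[OF tun_Ob probe_Ob(2,3)]
      xcmp_zero[OF tun_Ob probe_Ob(3,1)])

lemma bend_Hom:
  assumes k: "k \<in> Ob C" and s: "s \<in> Hom C (k \<odot> \<rho>) \<sigma>"
  shows "s \<boxtimes> \<ii>\<dd> \<rho>' \<in> Hom C (k \<odot> (\<rho> \<odot> \<rho>')) (\<sigma> \<odot> \<rho>')" "\<ii>\<dd> k \<boxtimes> r' \<in> Hom C k (k \<odot> (\<rho> \<odot> \<rho>'))"
    "(s \<boxtimes> \<ii>\<dd> \<rho>') \<cdot> (\<ii>\<dd> k \<boxtimes> r') \<in> Hom C k (\<sigma> \<odot> \<rho>')"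
    "t\<^sup>\<star> \<cdot> ((s \<boxtimes> \<ii>\<dd> \<rho>') \<cdot> (\<ii>\<dd> k \<boxtimes> r')) \<in> Hom C k l"
proof -
  note kr = tob_Ob[OF k probe_Ob(2)]
  show 1: "s \<boxtimes> \<ii>\<dd> \<rho>' \<in> Hom C (k \<odot> (\<rho> \<odot> \<rho>')) (\<sigma> \<odot> \<rho>')"
    using tar_Hom[OF tob_Ob[OF k O(1)] O(2,3,3) s idt_Hom[OF O(3)]] tob_assoc[OF k O(1,3)] by simp
  show 2: "\<ii>\<dd> k \<boxtimes> r' \<in> Hom C k (k \<odot> (\<rho> \<odot> \<rho>'))"
    using tar_Hom[OF k k tun_Ob probe_Ob(2) idt_Hom[OF k] r'] tob_tun[OF k] by simp
  show 3: "(s \<boxtimes> \<ii>\<dd> \<rho>') \<cdot> (\<ii>\<dd> k \<boxtimes> r') \<in> Hom C k (\<sigma> \<odot> \<rho>')" by (rule cmp_Hom[OF k kr probe_Ob(3) 2 1])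
  show "t\<^sup>\<star> \<cdot> ((s \<boxtimes> \<ii>\<dd> \<rho>') \<cdot> (\<ii>\<dd> k \<boxtimes> r')) \<in> Hom C k l" by (rule cmp_Hom[OF k probe_Ob(3,1) 3 probe_star])
qed

lemma probe_stensor:
  assumes k: "k \<in> irr P" "s \<in> Hom C (k \<odot> \<rho>) \<sigma>" "\<psi> \<in> fsp F k"
  shows "probe \<rho> \<sigma> \<rho>' l r' t (stensor C F \<rho> \<sigma> k s \<psi>) =
    stensor C F \<iota> l k (t\<^sup>\<star> \<cdot> ((s \<boxtimes> \<ii>\<dd> \<rho>') \<cdot> (\<ii>\<dd> k \<boxtimes> r'))) \<psi>"
proof -
  note kS = irr_in_S[OF k(1)] and Ok = irr_Ob[OF k(1)]
  note H = bend_Hom[OF Ok k(2)]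
  note v = vac_space(1)
  note kr = tob_Ob[OF Ok O(1)] and krr = tob_Ob[OF Ok probe_Ob(2)]
  have i: "\<ii>\<dd> \<rho>' \<in> Hom C (\<iota> \<odot> \<rho>') \<rho>'" "r' \<in> Hom C (\<iota> \<odot> \<iota>) (\<rho> \<odot> \<rho>')" "t\<^sup>\<star> \<in> Hom C (\<iota> \<odot> (\<sigma> \<odot> \<rho>')) l"
    using idt_Hom[OF O(3)] r' probe_star tob_tun[OF O(3)] tob_tun[OF tun_Ob] tob_tun[OF probe_Ob(3)] by simp_all
  have "xtar C \<epsilon> F P (cten \<rho> \<sigma> k s \<psi>) (cten \<rho>' \<rho>' \<iota> (\<ii>\<dd> \<rho>') (fvac F)) =
      cten (\<rho> \<odot> \<rho>') (\<sigma> \<odot> \<rho>') (k \<odot> \<iota>) ((s \<boxtimes> \<ii>\<dd> \<rho>') \<cdot> (\<ii>\<dd> k \<boxtimes> \<epsilon> \<iota> \<rho> \<boxtimes> \<ii>\<dd> \<rho>')) (ften F k \<iota> \<psi> (fvac F))"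
    by (rule xtar_cten[OF O(1,2,3,3) kS S_tun k(2) i(1) k(3) v])
  also have "\<ii>\<dd> k \<boxtimes> \<epsilon> \<iota> \<rho> \<boxtimes> \<ii>\<dd> \<rho>' = \<ii>\<dd> (k \<odot> (\<rho> \<odot> \<rho>'))"
    using eps_unit(2)[OF O(1)] tar_idt[OF O(1,3)] tar_idt[OF Ok probe_Ob(2)] by simp
  also have "(s \<boxtimes> \<ii>\<dd> \<rho>') \<cdot> \<ii>\<dd> (k \<odot> (\<rho> \<odot> \<rho>')) = s \<boxtimes> \<ii>\<dd> \<rho>'" using cmp_idt[OF krr probe_Ob(3) H(1)] by simp
  finally have mid: "xtar C \<epsilon> F P (cten \<rho> \<sigma> k s \<psi>) (cten \<rho>' \<rho>' \<iota> (\<ii>\<dd> \<rho>') (fvac F)) =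
      cten (\<rho> \<odot> \<rho>') (\<sigma> \<odot> \<rho>') k (s \<boxtimes> \<ii>\<dd> \<rho>') \<psi>"
    using tob_tun[OF Ok] ften_vac[OF kS k(3)] by simp
  have "xcmp C F P (cten (\<rho> \<odot> \<rho>') (\<sigma> \<odot> \<rho>') k (s \<boxtimes> \<ii>\<dd> \<rho>') \<psi>) (cten \<iota> (\<rho> \<odot> \<rho>') \<iota> r' (fvac F)) =
      cten \<iota> (\<sigma> \<odot> \<rho>') (k \<odot> \<iota>) ((s \<boxtimes> \<ii>\<dd> \<rho>') \<cdot> (\<ii>\<dd> k \<boxtimes> r')) (ften F k \<iota> \<psi> (fvac F))"
    by (rule xcmp_cten[OF tun_Ob probe_Ob(2,3) kS S_tun H(1) i(2) k(3) v])
  then have low: "xcmp C F P (cten (\<rho> \<odot> \<rho>') (\<sigma> \<odot> \<rho>') k (s \<boxtimes> \<ii>\<dd> \<rho>') \<psi>) (cten \<iota> (\<rho> \<odot> \<rho>') \<iota> r' (fvac F)) =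
      cten \<iota> (\<sigma> \<odot> \<rho>') k ((s \<boxtimes> \<ii>\<dd> \<rho>') \<cdot> (\<ii>\<dd> k \<boxtimes> r')) \<psi>"
    using tob_tun[OF Ok] ften_vac[OF kS k(3)] by simp
  have H3: "(s \<boxtimes> \<ii>\<dd> \<rho>') \<cdot> (\<ii>\<dd> k \<boxtimes> r') \<in> Hom C (k \<odot> \<iota>) (\<sigma> \<odot> \<rho>')"
    and H4: "t\<^sup>\<star> \<cdot> ((s \<boxtimes> \<ii>\<dd> \<rho>') \<cdot> (\<ii>\<dd> k \<boxtimes> r')) \<in> Hom C (k \<odot> \<iota>) l"
    using H(3,4) tob_tun[OF Ok] by simp_all
  have "xcmp C F P (cten (\<sigma> \<odot> \<rho>') l \<iota> (t\<^sup>\<star>) (fvac F)) (cten \<iota> (\<sigma> \<odot> \<rho>') k ((s \<boxtimes> \<ii>\<dd> \<rho>') \<cdot> (\<ii>\<dd> k \<boxtimes> r')) \<psi>) =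
      cten \<iota> l (\<iota> \<odot> k) (t\<^sup>\<star> \<cdot> (\<ii>\<dd> \<iota> \<boxtimes> ((s \<boxtimes> \<ii>\<dd> \<rho>') \<cdot> (\<ii>\<dd> k \<boxtimes> r')))) (ften F \<iota> k (fvac F) \<psi>)"
    by (rule xcmp_cten[OF tun_Ob probe_Ob(3,1) S_tun kS i(3) H3 v k(3)])
  also have "\<dots> = cten \<iota> l k (t\<^sup>\<star> \<cdot> ((s \<boxtimes> \<ii>\<dd> \<rho>') \<cdot> (\<ii>\<dd> k \<boxtimes> r'))) \<psi>"
    using tob_tun[OF Ok] ften_vac[OF kS k(3)] tar_tun[OF Ok probe_Ob(3) H(3)] by simp
  finally have top: "xcmp C F P (cten (\<sigma> \<odot> \<rho>') l \<iota> (t\<^sup>\<star>) (fvac F))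
      (cten \<iota> (\<sigma> \<odot> \<rho>') k ((s \<boxtimes> \<ii>\<dd> \<rho>') \<cdot> (\<ii>\<dd> k \<boxtimes> r')) \<psi>) =
      cten \<iota> l k (t\<^sup>\<star> \<cdot> ((s \<boxtimes> \<ii>\<dd> \<rho>') \<cdot> (\<ii>\<dd> k \<boxtimes> r'))) \<psi>" .
  show ?thesis
    unfolding probe_def xemb_cten[OF O(3,3) idt_Hom[OF O(3)]] xemb_cten[OF tun_Ob probe_Ob(2) r'] xemb_cten[OF probe_Ob(3,1) probe_star]
      cten_irr[OF k(1) O(1,2) k(2,3), symmetric] mid low top
    by (rule cten_irr[OF k(1) tun_Ob probe_Ob(1) H4 k(3)])
qed

lemma probe_component:
  assumes x: "x \<in> xHom C F P \<rho> \<sigma>" and \<phi>: "\<phi> \<in> fsp F l"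
  shows "probe \<rho> \<sigma> \<rho>' l r' t x (\<iota>, l, l) \<phi> = t\<^sup>\<star> \<cdot> ((x (\<rho>, \<sigma>, l) \<phi> \<boxtimes> \<ii>\<dd> \<rho>') \<cdot> (\<ii>\<dd> l \<boxtimes> r'))"
proof -
  note lr = tob_Ob[OF probe_Ob(1) O(1)] and lrr = tob_Ob[OF probe_Ob(1,2)]
  note zero = Hom_zero[OF lr O(2)]
  note i' = idt_Hom[OF O(3)]
  have bend_add: "t\<^sup>\<star> \<cdot> (((s + s') \<boxtimes> \<ii>\<dd> \<rho>') \<cdot> (\<ii>\<dd> l \<boxtimes> r')) =
      (t\<^sup>\<star> \<cdot> ((s \<boxtimes> \<ii>\<dd> \<rho>') \<cdot> (\<ii>\<dd> l \<boxtimes> r'))) + (t\<^sup>\<star> \<cdot> ((s' \<boxtimes> \<ii>\<dd> \<rho>') \<cdot> (\<ii>\<dd> l \<boxtimes> r')))"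
    if s: "s \<in> Hom C (l \<odot> \<rho>) \<sigma>" "s' \<in> Hom C (l \<odot> \<rho>) \<sigma>" for s s'
  proof -
    note H = bend_Hom[OF probe_Ob(1) s(1)] and H' = bend_Hom[OF probe_Ob(1) s(2)]
    show ?thesis
      using tar_add[OF lr O(2,3,3) s i' i'] cmp_add[OF probe_Ob(1) lrr probe_Ob(3) H(2,2) H(1) H'(1)]
        cmp_add[OF probe_Ob(1,3,1) H(3) H'(3) probe_star probe_star] by simp
  qed
  have bend_scl: "t\<^sup>\<star> \<cdot> ((scl C z s \<boxtimes> \<ii>\<dd> \<rho>') \<cdot> (\<ii>\<dd> l \<boxtimes> r')) = scl C z (t\<^sup>\<star> \<cdot> ((s \<boxtimes> \<ii>\<dd> \<rho>') \<cdot> (\<ii>\<dd> l \<boxtimes> r')))"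
    if s: "s \<in> Hom C (l \<odot> \<rho>) \<sigma>" for s z
  proof -
    note H = bend_Hom[OF probe_Ob(1) s]
    show ?thesis
      using tar_scl[OF lr O(2,3,3) s i'] cmp_scl[OF probe_Ob(1) lrr probe_Ob(3) H(2,1)] cmp_scl[OF probe_Ob(1,3,1) H(3) probe_star] by simp
  qed
  have bend_zero: "t\<^sup>\<star> \<cdot> ((0 \<boxtimes> \<ii>\<dd> \<rho>') \<cdot> (\<ii>\<dd> l \<boxtimes> r')) = 0"
    using bend_scl[OF zero, of 0] by simp
  show ?thesis
    using x
  proof (induction rule: xHom_induct[OF O(1,2), consumes 1, case_names zero add])
    case zero
    show ?case unfolding probe_zero using bend_zero by simp
  next
    case (add k s \<psi> y)
    note st = stensor_xHom[OF O(1,2) add(1-3)]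
    have "stensor C F \<iota> l k (t\<^sup>\<star> \<cdot> ((s \<boxtimes> \<ii>\<dd> \<rho>') \<cdot> (\<ii>\<dd> k \<boxtimes> r'))) \<psi> (\<iota>, l, l) \<phi> =
        t\<^sup>\<star> \<cdot> ((stensor C F \<rho> \<sigma> k s \<psi> (\<rho>, \<sigma>, l) \<phi> \<boxtimes> \<ii>\<dd> \<rho>') \<cdot> (\<ii>\<dd> l \<boxtimes> r'))"
    proof (cases "k = l")
      case True
      then show ?thesis using bend_scl[of s] add(2) \<phi> by (simp add: stensor_def)
    next
      case False
      then show ?thesis using bend_zero by (simp add: stensor_def)
    qed
    then show ?case
      unfolding probe_add[OF st add(4)] probe_stensor[OF add(1-3)]
      unfolding plus_fun_apply
        bend_add[OF xHom_component(3)[OF O(1,2) st l] xHom_component(3)[OF O(1,2) add(4) l]] add(5)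
      by simp
  qed
qed

lemma act_probe:
  assumes g: "g \<in> carrier G" and x: "x \<in> xHom C F P \<rho> \<sigma>"
  shows "act_arr C F P g (probe \<rho> \<sigma> \<rho>' l r' t x) = probe \<rho> \<sigma> \<rho>' l r' t (act_arr C F P g x)"
  unfolding probe_def
    act_xcmp[OF tun_Ob probe_Ob(3,1) g probe_parts(1) xcmp_xHom[OF tun_Ob probe_Ob(2,3) probe_mid[OF x] probe_parts(3)]]
    act_xcmp[OF tun_Ob probe_Ob(2,3) g probe_mid[OF x] probe_parts(3)]
    act_xtar[OF O(1,2,3,3) g x probe_parts(2)]
    act_xemb[OF probe_Ob(3,1) g probe_star] act_xemb[OF O(3,3) g idt_Hom[OF O(3)]] act_xemb[OF tun_Ob probe_Ob(2) g r'] ..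

end

text \<open>The adjoint of the conjugate equation straightens the bent arrow again.\<close>

lemma bend_injective:
  assumes O: "\<rho> \<in> Ob C" "\<sigma> \<in> Ob C" "\<rho>' \<in> Ob C" "l \<in> Ob C" and r: "conj_equations C \<rho> \<rho>' r r'"
    and s: "s \<in> Hom C (l \<odot> \<rho>) \<sigma>" and zero: "(s \<boxtimes> \<ii>\<dd> \<rho>') \<cdot> (\<ii>\<dd> l \<boxtimes> r') = 0"
  shows "s = 0"
proof -
  have rH: "r \<in> Hom C \<iota> (\<rho>' \<odot> \<rho>)" "r' \<in> Hom C \<iota> (\<rho> \<odot> \<rho>')"
    and conj: "(r'\<^sup>\<star> \<boxtimes> \<ii>\<dd> \<rho>) \<cdot> (\<ii>\<dd> \<rho> \<boxtimes> r) = \<ii>\<dd> \<rho>"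
    using r by (simp_all add: conj_equations_def)
  note Orr = tob_Ob[OF O(1,3)] tob_Ob[OF O(3,1)] and i = idt_Hom[OF O(1)] idt_Hom[OF O(2)] idt_Hom[OF O(3)] idt_Hom[OF O(4)]
  note rs = str_Hom[OF tun_Ob Orr(2) rH(1)] and r's = str_Hom[OF tun_Ob Orr(1) rH(2)]
  note Olr = tob_Ob[OF O(4,1)] and Orrr = tob_Ob[OF Orr(1) O(1)]
  have A: "\<ii>\<dd> \<rho> \<boxtimes> r \<in> Hom C \<rho> ((\<rho> \<odot> \<rho>') \<odot> \<rho>)"
    using tar_Hom[OF O(1,1) tun_Ob Orr(2) i(1) rH(1)] tob_tun[OF O(1)] tob_assoc[OF O(1,3,1)] by simp
  have B: "r'\<^sup>\<star> \<boxtimes> \<ii>\<dd> \<rho> \<in> Hom C ((\<rho> \<odot> \<rho>') \<odot> \<rho>) \<rho>"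
    using tar_Hom[OF Orr(1) tun_Ob O(1,1) r's i(1)] tob_tun[OF O(1)] by simp
  have As: "\<ii>\<dd> \<rho> \<boxtimes> r\<^sup>\<star> \<in> Hom C ((\<rho> \<odot> \<rho>') \<odot> \<rho>) \<rho>"
    using tar_Hom[OF O(1,1) Orr(2) tun_Ob i(1) rs] tob_tun[OF O(1)] tob_assoc[OF O(1,3,1)] by simp
  have Bs: "r' \<boxtimes> \<ii>\<dd> \<rho> \<in> Hom C \<rho> ((\<rho> \<odot> \<rho>') \<odot> \<rho>)"
    using tar_Hom[OF tun_Ob Orr(1) O(1,1) rH(2) i(1)] tob_tun[OF O(1)] by simp
  have dual: "(\<ii>\<dd> \<rho> \<boxtimes> r\<^sup>\<star>) \<cdot> (r' \<boxtimes> \<ii>\<dd> \<rho>) = \<ii>\<dd> \<rho>"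
    using str_cmp[OF O(1) Orrr O(1) A B] conj str_idt[OF O(1)]
      str_tar[OF O(1,1) tun_Ob Orr(2) i(1) rH(1)] str_tar[OF Orr(1) tun_Ob O(1,1) r's i(1)]
      str_str[OF tun_Ob Orr(1) rH(2)] by simp
  have s1: "s \<boxtimes> \<ii>\<dd> \<rho>' \<in> Hom C (l \<odot> (\<rho> \<odot> \<rho>')) (\<sigma> \<odot> \<rho>')"
    using tar_Hom[OF Olr O(2,3,3) s i(3)] tob_assoc[OF O(4,1,3)] by simp
  have s2: "\<ii>\<dd> l \<boxtimes> r' \<in> Hom C l (l \<odot> (\<rho> \<odot> \<rho>'))"
    using tar_Hom[OF O(4,4) tun_Ob Orr(1) i(4) rH(2)] tob_tun[OF O(4)] by simp
  have S1: "(s \<boxtimes> \<ii>\<dd> \<rho>') \<boxtimes> \<ii>\<dd> \<rho> = s \<boxtimes> \<ii>\<dd> (\<rho>' \<odot> \<rho>)"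
    using tar_assoc[OF Olr O(2,3,3,1,1) s i(3,1)] tar_idt[OF O(3,1)] by simp
  have S2: "(\<ii>\<dd> l \<boxtimes> r') \<boxtimes> \<ii>\<dd> \<rho> = \<ii>\<dd> l \<boxtimes> (r' \<boxtimes> \<ii>\<dd> \<rho>)"
    by (rule tar_assoc[OF O(4,4) tun_Ob Orr(1) O(1,1) i(4) rH(2) i(1)])
  have R: "\<ii>\<dd> \<sigma> \<boxtimes> r\<^sup>\<star> \<in> Hom C (\<sigma> \<odot> (\<rho>' \<odot> \<rho>)) \<sigma>"
    using tar_Hom[OF O(2,2) Orr(2) tun_Ob i(2) rs] tob_tun[OF O(2)] by simp
  have S1H: "s \<boxtimes> \<ii>\<dd> (\<rho>' \<odot> \<rho>) \<in> Hom C ((l \<odot> \<rho>) \<odot> (\<rho>' \<odot> \<rho>)) (\<sigma> \<odot> (\<rho>' \<odot> \<rho>))"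
    by (rule tar_Hom[OF Olr O(2) Orr(2,2) s idt_Hom[OF Orr(2)]])
  have ass: "(l \<odot> \<rho>) \<odot> (\<rho>' \<odot> \<rho>) = l \<odot> ((\<rho> \<odot> \<rho>') \<odot> \<rho>)"
    using tob_assoc[OF O(4,1) Orr(2)] tob_assoc[OF O(1,3,1)] by simp
  have S2H: "\<ii>\<dd> l \<boxtimes> (r' \<boxtimes> \<ii>\<dd> \<rho>) \<in> Hom C (l \<odot> \<rho>) ((l \<odot> \<rho>) \<odot> (\<rho>' \<odot> \<rho>))"
    using tar_Hom[OF O(4,4,1) Orrr i(4) Bs] ass by simp
  have L: "\<ii>\<dd> (l \<odot> \<rho>) \<boxtimes> r\<^sup>\<star> = \<ii>\<dd> l \<boxtimes> (\<ii>\<dd> \<rho> \<boxtimes> r\<^sup>\<star>)"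
    using tar_assoc[OF O(4,4,1,1) Orr(2) tun_Ob i(4,1) rs] tar_idt[OF O(4,1)] by simp
  have LH: "\<ii>\<dd> (l \<odot> \<rho>) \<boxtimes> r\<^sup>\<star> \<in> Hom C ((l \<odot> \<rho>) \<odot> (\<rho>' \<odot> \<rho>)) (l \<odot> \<rho>)"
    using tar_Hom[OF Olr Olr Orr(2) tun_Ob idt_Hom[OF Olr] rs] tob_tun[OF Olr] by simp
  note OX = tob_Ob[OF Olr Orr(2)] tob_Ob[OF O(2) Orr(2)]
  have "(\<ii>\<dd> \<sigma> \<boxtimes> r\<^sup>\<star>) \<cdot> (s \<boxtimes> \<ii>\<dd> (\<rho>' \<odot> \<rho>)) = s \<boxtimes> r\<^sup>\<star>"
    using tar_cmp[OF Olr O(2,2) Orr(2,2) tun_Ob s i(2) idt_Hom[OF Orr(2)] rs] cmp_idt[OF Olr O(2) s]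
      cmp_idt[OF Orr(2) tun_Ob rs] by simp
  also have "\<dots> = s \<cdot> (\<ii>\<dd> (l \<odot> \<rho>) \<boxtimes> r\<^sup>\<star>)"
    using tar_cmp[OF Olr Olr O(2) Orr(2) tun_Ob tun_Ob idt_Hom[OF Olr] s rs idt_Hom[OF tun_Ob]]
      cmp_idt[OF Olr O(2) s] cmp_idt[OF Orr(2) tun_Ob rs] tar_tun[OF Olr O(2) s] by simp
  finally have slide: "(\<ii>\<dd> \<sigma> \<boxtimes> r\<^sup>\<star>) \<cdot> (s \<boxtimes> \<ii>\<dd> (\<rho>' \<odot> \<rho>)) = s \<cdot> (\<ii>\<dd> (l \<odot> \<rho>) \<boxtimes> r\<^sup>\<star>)" .
  have "s = s \<cdot> (\<ii>\<dd> l \<boxtimes> ((\<ii>\<dd> \<rho> \<boxtimes> r\<^sup>\<star>) \<cdot> (r' \<boxtimes> \<ii>\<dd> \<rho>)))"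
    using dual tar_idt[OF O(4,1)] cmp_idt[OF Olr O(2) s] by simp
  also have "\<ii>\<dd> l \<boxtimes> ((\<ii>\<dd> \<rho> \<boxtimes> r\<^sup>\<star>) \<cdot> (r' \<boxtimes> \<ii>\<dd> \<rho>)) = (\<ii>\<dd> l \<boxtimes> (\<ii>\<dd> \<rho> \<boxtimes> r\<^sup>\<star>)) \<cdot> (\<ii>\<dd> l \<boxtimes> (r' \<boxtimes> \<ii>\<dd> \<rho>))"
    using tar_cmp[OF O(4,4,4,1) Orrr O(1) i(4,4) Bs As] cmp_idt[OF O(4,4) i(4)] by simp
  also have "\<dots> = (\<ii>\<dd> (l \<odot> \<rho>) \<boxtimes> r\<^sup>\<star>) \<cdot> (\<ii>\<dd> l \<boxtimes> (r' \<boxtimes> \<ii>\<dd> \<rho>))" by (simp only: L)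
  also have "s \<cdot> \<dots> = (s \<cdot> (\<ii>\<dd> (l \<odot> \<rho>) \<boxtimes> r\<^sup>\<star>)) \<cdot> (\<ii>\<dd> l \<boxtimes> (r' \<boxtimes> \<ii>\<dd> \<rho>))"
    by (rule cmp_assoc[OF Olr OX(1) Olr O(2) S2H LH s, symmetric])
  also have "\<dots> = (\<ii>\<dd> \<sigma> \<boxtimes> r\<^sup>\<star>) \<cdot> ((s \<boxtimes> \<ii>\<dd> (\<rho>' \<odot> \<rho>)) \<cdot> (\<ii>\<dd> l \<boxtimes> (r' \<boxtimes> \<ii>\<dd> \<rho>)))"
    unfolding slide[symmetric] by (rule cmp_assoc[OF Olr OX O(2) S2H S1H R])
  also have "(s \<boxtimes> \<ii>\<dd> (\<rho>' \<odot> \<rho>)) \<cdot> (\<ii>\<dd> l \<boxtimes> (r' \<boxtimes> \<ii>\<dd> \<rho>)) = ((s \<boxtimes> \<ii>\<dd> \<rho>') \<cdot> (\<ii>\<dd> l \<boxtimes> r')) \<boxtimes> \<ii>\<dd> \<rho>"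
    using tar_cmp[OF O(4) tob_Ob[OF O(4) Orr(1)] tob_Ob[OF O(2,3)] O(1,1,1) s2 s1 i(1,1)] cmp_idt[OF O(1,1) i(1)] S1 S2
    by simp
  also have "\<dots> = 0" using zero tar_zero_left[OF O(1,1,4) i(1)] by simp
  finally show ?thesis using cmp_zero_right[OF OX(2) O(2) R] by simp
qed

text \<open>
  For \<open>\<phi>\<close> orthogonal to \<open>V k\<close> let \<open>s\<close> be the value at \<open>\<phi>\<close> of the component of \<open>x\<close> at \<open>k\<close>, and let
  \<open>t\<close> be the arrow that arises from \<open>s\<close> by bending.  The component of the probe with \<open>t\<close> itself takes
  the value \<open>t\<^sup>\<star> \<cdot> t\<close> at \<open>\<phi>\<close>.  It vanishes because the probe has its vector in \<open>V k\<close>, so \<open>t = 0\<close> and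
  \<open>s = 0\<close>.
\<close>

lemma supported_onI:
  assumes O: "\<rho> \<in> Ob C" "\<sigma> \<in> Ob C" and x: "x \<in> xHom C F P \<rho> \<sigma>"
    and r: "\<rho>' \<in> Ob C" "conj_equations C \<rho> \<rho>' r r'"
    and probe: "\<And>l t \<psi>. \<lbrakk>l \<in> irr P; t \<in> Hom C l (\<sigma> \<odot> \<rho>'); \<psi> \<in> fsp F l;
      probe \<rho> \<sigma> \<rho>' l r' t x = cten \<iota> l l (\<ii>\<dd> l) \<psi>\<rbrakk> \<Longrightarrow> \<psi> \<in> V l"
  shows "supported_on V \<rho> \<sigma> x"
  unfolding supported_on_def
proof (intro conjI ballI impI x)
  fix k \<phi> assume k: "k \<in> irr P" and \<phi>: "\<phi> \<in> fsp F k" and orth: "\<forall>y\<in>V k. fip F k \<phi> y = 0"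
  note Ok = irr_Ob[OF k]
  have r': "r' \<in> Hom C \<iota> (\<rho> \<odot> \<rho>')" using r(2) by (simp add: conj_equations_def)
  let ?s = "x (\<rho>, \<sigma>, k) \<phi>"
  have s: "?s \<in> Hom C (k \<odot> \<rho>) \<sigma>" by (rule xHom_component(3)[OF O x k])
  define t where "t = (?s \<boxtimes> \<ii>\<dd> \<rho>') \<cdot> (\<ii>\<dd> k \<boxtimes> r')"
  have kr: "k \<odot> (\<rho> \<odot> \<rho>') \<in> Ob C" by (intro tob_Ob Ok O r)
  have "?s \<boxtimes> \<ii>\<dd> \<rho>' \<in> Hom C (k \<odot> (\<rho> \<odot> \<rho>')) (\<sigma> \<odot> \<rho>')"
    using tar_Hom[OF tob_Ob[OF Ok O(1)] O(2) r(1,1) s idt_Hom[OF r(1)]] tob_assoc[OF Ok O(1) r(1)] by simp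
  moreover have "\<ii>\<dd> k \<boxtimes> r' \<in> Hom C k (k \<odot> (\<rho> \<odot> \<rho>'))"
    using tar_Hom[OF Ok Ok tun_Ob tob_Ob[OF O(1) r(1)] idt_Hom[OF Ok] r'] tob_tun[OF Ok] by simp
  ultimately have t: "t \<in> Hom C k (\<sigma> \<odot> \<rho>')"
    unfolding t_def using cmp_Hom[OF Ok kr tob_Ob[OF O(2) r(1)]] by blast
  note pr = O r(1) k r' t
  obtain \<psi> where \<psi>: "\<psi> \<in> fsp F k" "probe \<rho> \<sigma> \<rho>' k r' t x = cten \<iota> k k (\<ii>\<dd> k) \<psi>"
    by (rule xHom_unit_irr[OF k probe_xHom[OF pr x]])
  have "\<psi> \<in> V k" by (rule probe[OF k t \<psi>])
  then have zero: "fip F k \<phi> \<psi> = 0" using orth by simp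
  have ik: "\<ii>\<dd> k \<in> Hom C (k \<odot> \<iota>) k" using idt_Hom[OF Ok] tob_tun[OF Ok] by simp
  have "t\<^sup>\<star> \<cdot> t = probe \<rho> \<sigma> \<rho>' k r' t x (\<iota>, k, k) \<phi>"
    using probe_component[OF pr x \<phi>] by (simp add: t_def)
  also have "\<dots> = 0"
    unfolding \<psi>(2) cten_irr[OF k tun_Ob Ok ik \<psi>(1)] using zero by (simp add: stensor_def)
  finally have "t = 0" by (rule str_positive[OF Ok tob_Ob[OF O(2) r(1)] t])
  then show "?s = 0" using bend_injective[OF O r(1) Ok r(2) s] by (simp add: t_def)
qed


section \<open>Intermediate categories\<close>

lemma cten_irr_injective:
  assumes l: "l \<in> irr P" and \<psi>: "\<psi> \<in> fsp F l" "\<psi>' \<in> fsp F l"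
    and eq: "cten \<iota> l l (\<ii>\<dd> l) \<psi> = cten \<iota> l l (\<ii>\<dd> l) \<psi>'"
  shows "\<psi> = \<psi>'"
proof (rule fip_ext[OF irr_in_S[OF l] \<psi>])
  fix \<phi> assume \<phi>: "\<phi> \<in> fsp F l"
  note Ol = irr_Ob[OF l]
  have il: "\<ii>\<dd> l \<in> Hom C (l \<odot> \<iota>) l" using idt_Hom[OF Ol] tob_tun[OF Ol] by simp
  have "stensor C F \<iota> l l (\<ii>\<dd> l) \<psi> (\<iota>, l, l) \<phi> = stensor C F \<iota> l l (\<ii>\<dd> l) \<psi>' (\<iota>, l, l) \<phi>"
    using eq unfolding cten_irr[OF l tun_Ob Ol il \<psi>(1)] cten_irr[OF l tun_Ob Ol il \<psi>(2)] by simp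
  then have "scl C (fip F l \<phi> \<psi>) (\<ii>\<dd> l) = scl C (fip F l \<phi> \<psi>') (\<ii>\<dd> l)"
    using \<phi> by (simp add: stensor_def)
  moreover have "\<ii>\<dd> l \<noteq> 0" using irr_S[OF l] by (simp add: irreducible_object_def)
  ultimately show "fip F l \<phi> \<psi> = fip F l \<phi> \<psi>'" by (rule arrows.scale_right_imp_eq[rotated])
qed

lemma D_Hom_absorb:
  assumes X: "(\<rho>, p) \<in> Ob crossed" "(\<sigma>, q) \<in> Ob crossed" and f: "f \<in> Hom crossed (\<rho>, p) (\<sigma>, q)"
  shows "xcmp C F P f p = f" "xcmp C F P q f = f"
proof -
  have p: "\<rho> \<in> Ob C" "p \<in> xHom C F P \<rho> \<rho>" "xcmp C F P p p = p"
    and q: "\<sigma> \<in> Ob C" "q \<in> xHom C F P \<sigma> \<sigma>" "xcmp C F P q q = q"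
    using X by (simp_all add: D_Ob)
  obtain f' where f': "f' \<in> xHom C F P \<rho> \<sigma>" and ff: "f = xcmp C F P (xcmp C F P q f') p"
    using f by (auto simp: D_Hom)
  note qf = xcmp_xHom[OF p(1) q(1,1) q(2) f']
  show "xcmp C F P f p = f"
    unfolding ff xcmp_assoc[OF p(1,1,1) q(1) p(2,2) qf] p(3) ..
  show "xcmp C F P q f = f"
    unfolding ff xcmp_assoc[OF p(1,1) q(1,1) p(2) qf q(2), symmetric]
      xcmp_assoc[OF p(1) q(1,1,1) f' q(2,2), symmetric] q(3) ..
qed

context
  fixes E :: "(('o, 'v, 'h) xob, ('o, 'v, 'h) xarr) tcat"
  assumes E_TC: "TC_star E" and E_mid: "intermediate_category C \<epsilon> F P E" and E_sub: "inherits_subobjects C F E"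
begin

lemma E_cat: "tensor_star_category E"
  using E_TC by (simp add: TC_star_def)

lemma E_subcategory: "subcategory E crossed"
  using E_mid by (simp add: intermediate_category_def)

lemma E_Ob: "X \<in> Ob E \<Longrightarrow> X \<in> Ob crossed"
  and E_Hom: "\<lbrakk>X \<in> Ob E; Y \<in> Ob E; f \<in> Hom E X Y\<rbrakk> \<Longrightarrow> f \<in> Hom crossed X Y"
  using E_subcategory by (auto simp: subcategory_def)

lemma E_ops: "cmp E = xcmp C F P" "str E = xstr C F P" "scl E = xscl C" "tar E = xtar C \<epsilon> F P"
    "idt E = snd" "tob E = tob crossed"
proof -
  have eq: "E = crossed\<lparr>Ob := Ob E, Hom := Hom E\<rparr>" using E_subcategory by (simp add: subcategory_def)
  show "cmp E = xcmp C F P" using arg_cong[OF eq, of cmp] by (simp add: D_ops)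
  show "str E = xstr C F P" using arg_cong[OF eq, of str] by (simp add: D_ops)
  show "scl E = xscl C" using arg_cong[OF eq, of scl] by (simp add: D_ops)
  show "tar E = xtar C \<epsilon> F P" using arg_cong[OF eq, of tar] by (simp add: D_ops)
  show "idt E = snd" using arg_cong[OF eq, of idt] by (simp add: D_ops)
  show "tob E = tob crossed" using arg_cong[OF eq, of tob] by simp
qed

lemmas E_cmp = tensor_star_category.cmp_Hom[OF E_cat, unfolded E_ops]
  and E_str = tensor_star_category.str_Hom[OF E_cat, unfolded E_ops]
  and E_idt = tensor_star_category.cmp_idt[OF E_cat, unfolded E_ops]

abbreviation EHom where "EHom \<rho> \<sigma> \<equiv> Hom E (xobj C F \<rho>) (xobj C F \<sigma>)"

lemma xobj_E: "\<rho> \<in> Ob C \<Longrightarrow> xobj C F \<rho> \<in> Ob E"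
  using E_mid by (simp add: intermediate_category_def)

lemma xemb_E: "\<lbrakk>\<rho> \<in> Ob C; \<sigma> \<in> Ob C; s \<in> Hom C \<rho> \<sigma>\<rbrakk> \<Longrightarrow> xemb C F \<rho> \<sigma> s \<in> EHom \<rho> \<sigma>"
  using E_mid by (simp add: intermediate_category_def)

lemma EHom_xHom:
  assumes O: "\<rho> \<in> Ob C" "\<sigma> \<in> Ob C" and x: "x \<in> EHom \<rho> \<sigma>"
  shows "x \<in> xHom C F P \<rho> \<sigma>"
  using D_Hom_xHom E_Ob[OF xobj_E[OF O(1)]] E_Ob[OF xobj_E[OF O(2)]] E_Hom[OF xobj_E[OF O(1)] xobj_E[OF O(2)] x]
  unfolding xobj_def .

lemma EHom_cmp: "\<lbrakk>\<rho> \<in> Ob C; \<sigma> \<in> Ob C; \<delta> \<in> Ob C; x \<in> EHom \<rho> \<sigma>; y \<in> EHom \<sigma> \<delta>\<rbrakk> \<Longrightarrow> xcmp C F P y x \<in> EHom \<rho> \<delta>"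
  by (rule E_cmp[OF xobj_E xobj_E xobj_E])

lemma tob_xobj:
  assumes O: "\<rho> \<in> Ob C" "\<sigma> \<in> Ob C"
  shows "tob E (xobj C F \<rho>) (xobj C F \<sigma>) = xobj C F (\<rho> \<odot> \<sigma>)"
proof -
  have i: "\<ii>\<dd> \<rho> \<in> Hom C (\<iota> \<odot> \<rho>) \<rho>" "\<ii>\<dd> \<sigma> \<in> Hom C (\<iota> \<odot> \<sigma>) \<sigma>"
    using idt_Hom[OF O(1)] idt_Hom[OF O(2)] tob_tun[OF O(1)] tob_tun[OF O(2)] by simp_all
  note v = vac_space(1)
  have "xtar C \<epsilon> F P (cten \<rho> \<rho> \<iota> (\<ii>\<dd> \<rho>) (fvac F)) (cten \<sigma> \<sigma> \<iota> (\<ii>\<dd> \<sigma>) (fvac F)) =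
      cten (\<rho> \<odot> \<sigma>) (\<rho> \<odot> \<sigma>) (\<iota> \<odot> \<iota>) ((\<ii>\<dd> \<rho> \<boxtimes> \<ii>\<dd> \<sigma>) \<cdot> (\<ii>\<dd> \<iota> \<boxtimes> \<epsilon> \<iota> \<rho> \<boxtimes> \<ii>\<dd> \<sigma>)) (ften F \<iota> \<iota> (fvac F) (fvac F))"
    by (rule xtar_cten[OF O(1,1,2,2) S_tun S_tun i v v])
  also have "\<dots> = cten (\<rho> \<odot> \<sigma>) (\<rho> \<odot> \<sigma>) \<iota> (\<ii>\<dd> (\<rho> \<odot> \<sigma>)) (fvac F)"
    using eps_unit(2)[OF O(1)] tar_idt[OF O] tar_idt[OF tun_Ob tob_Ob[OF O]] tob_tun[OF tun_Ob] tob_tun[OF tob_Ob[OF O]]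
      ften_vac[OF S_tun v] cmp_idt[OF tob_Ob[OF O] tob_Ob[OF O] idt_Hom[OF tob_Ob[OF O]]] by simp
  finally show ?thesis
    unfolding E_ops xobj_def D_ops
      xemb_cten[OF O(1,1) idt_Hom[OF O(1)]] xemb_cten[OF O(2,2) idt_Hom[OF O(2)]]
      xemb_cten[OF tob_Ob[OF O] tob_Ob[OF O] idt_Hom[OF tob_Ob[OF O]]] by simp
qed

lemma EHom_tar:
  assumes O: "\<rho>1 \<in> Ob C" "\<sigma>1 \<in> Ob C" "\<rho>2 \<in> Ob C" "\<sigma>2 \<in> Ob C" and x: "x \<in> EHom \<rho>1 \<sigma>1" "y \<in> EHom \<rho>2 \<sigma>2"
  shows "xtar C \<epsilon> F P x y \<in> EHom (\<rho>1 \<odot> \<rho>2) (\<sigma>1 \<odot> \<sigma>2)"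
  using tensor_star_category.tar_Hom[OF E_cat xobj_E[OF O(1)] xobj_E[OF O(2)] xobj_E[OF O(3)] xobj_E[OF O(4)] x]
  unfolding tob_xobj[OF O(1,3)] tob_xobj[OF O(2,4)] E_ops(4) .

lemma EHom_sum:
  assumes O: "\<rho> \<in> Ob C" "\<sigma> \<in> Ob C" and h: "\<And>i. i \<in> I \<Longrightarrow> h i \<in> EHom \<rho> \<sigma>"
  shows "sum h I \<in> EHom \<rho> \<sigma>"
  by (rule tensor_star_category.Hom_sum[OF E_cat xobj_E[OF O(1)] xobj_E[OF O(2)] h])

text \<open>
  The vectors \<open>\<psi>\<close> for which the arrow \<open>id \<otimes> \<psi>\<close> from the unit to \<open>a\<close> lies in \<open>E\<close>.  These
  spaces determine \<open>E\<close>, because every arrow of the crossed product is obtained from such arrows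
  and from arrows of \<open>C\<close>.
\<close>

definition vectors_in :: "'o \<Rightarrow> 'h set" where
  "vectors_in a = {\<psi> \<in> fsp F a. cten \<iota> a a (\<ii>\<dd> a) \<psi> \<in> EHom \<iota> a}"

text \<open>
  Tensoring \<open>id \<otimes> \<psi>\<close> with the identity of \<open>\<rho>\<close> gives an arrow from \<open>\<rho>\<close> to \<open>a \<odot> \<rho>\<close>, which is then
  composed with \<open>s\<close>.
\<close>

lemma cten_EHom:
  assumes O: "\<rho> \<in> Ob C" "\<sigma> \<in> Ob C" and a: "a \<in> S" and s: "s \<in> Hom C (a \<odot> \<rho>) \<sigma>" and \<psi>: "\<psi> \<in> vectors_in a"
  shows "cten \<rho> \<sigma> a s \<psi> \<in> EHom \<rho> \<sigma>"
proof -
  note Oa = S_Ob[OF a] and v = vac_space(1)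
  note Oar = tob_Ob[OF Oa O(1)] and iar = idt_Hom[OF tob_Ob[OF Oa O(1)]]
  have \<psi>F: "\<psi> \<in> fsp F a" and \<psi>E: "cten \<iota> a a (\<ii>\<dd> a) \<psi> \<in> EHom \<iota> a" using \<psi> by (simp_all add: vectors_in_def)
  have i: "\<ii>\<dd> a \<in> Hom C (a \<odot> \<iota>) a" "\<ii>\<dd> \<rho> \<in> Hom C (\<iota> \<odot> \<rho>) \<rho>" "s \<in> Hom C (\<iota> \<odot> (a \<odot> \<rho>)) \<sigma>"
    using idt_Hom[OF Oa] tob_tun[OF Oa] idt_Hom[OF O(1)] tob_tun[OF O(1)] s tob_tun[OF Oar] by simp_all
  have "xtar C \<epsilon> F P (cten \<iota> a a (\<ii>\<dd> a) \<psi>) (cten \<rho> \<rho> \<iota> (\<ii>\<dd> \<rho>) (fvac F)) =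
      cten (\<iota> \<odot> \<rho>) (a \<odot> \<rho>) (a \<odot> \<iota>) ((\<ii>\<dd> a \<boxtimes> \<ii>\<dd> \<rho>) \<cdot> (\<ii>\<dd> a \<boxtimes> \<epsilon> \<iota> \<iota> \<boxtimes> \<ii>\<dd> \<rho>)) (ften F a \<iota> \<psi> (fvac F))"
    by (rule xtar_cten[OF tun_Ob Oa O(1,1) a S_tun i(1,2) \<psi>F v])
  also have "\<dots> = cten \<rho> (a \<odot> \<rho>) a (\<ii>\<dd> (a \<odot> \<rho>)) \<psi>"
    using eps_unit(2)[OF tun_Ob] tar_idt[OF Oa O(1)] tar_idt[OF tun_Ob O(1)] tob_tun[OF O(1)] tob_tun[OF Oa]
      ften_vac[OF a \<psi>F] cmp_idt[OF Oar Oar iar] by simp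
  finally have low: "cten \<rho> (a \<odot> \<rho>) a (\<ii>\<dd> (a \<odot> \<rho>)) \<psi> \<in> EHom \<rho> (a \<odot> \<rho>)"
    using EHom_tar[OF tun_Ob Oa O(1,1) \<psi>E xemb_E[OF O(1,1) idt_Hom[OF O(1)]]] tob_tun[OF O(1)]
    unfolding xemb_cten[OF O(1,1) idt_Hom[OF O(1)]] by simp
  have "xcmp C F P (cten (a \<odot> \<rho>) \<sigma> \<iota> s (fvac F)) (cten \<rho> (a \<odot> \<rho>) a (\<ii>\<dd> (a \<odot> \<rho>)) \<psi>) =
      cten \<rho> \<sigma> (\<iota> \<odot> a) (s \<cdot> (\<ii>\<dd> \<iota> \<boxtimes> \<ii>\<dd> (a \<odot> \<rho>))) (ften F \<iota> a (fvac F) \<psi>)"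
    by (rule xcmp_cten[OF O(1) Oar O(2) S_tun a i(3) iar v \<psi>F])
  also have "\<dots> = cten \<rho> \<sigma> a s \<psi>"
    using tar_idt[OF tun_Ob Oar] tob_tun[OF Oar] tob_tun[OF Oa] ften_vac[OF a \<psi>F] cmp_idt[OF Oar O(2) s] by simp
  finally show ?thesis
    using EHom_cmp[OF O(1) Oar O(2) low xemb_E[OF Oar O(2) s]] unfolding xemb_cten[OF Oar O(2) s] by simp
qed

lemma vectors_in_subspace:
  assumes a: "a \<in> S"
  shows "vecs.subspace (vectors_in a) \<and> vectors_in a \<subseteq> fsp F a"
proof -
  note Oa = S_Ob[OF a]
  note O = xobj_E[OF tun_Ob] xobj_E[OF Oa]
  have i: "\<ii>\<dd> a \<in> Hom C (a \<odot> \<iota>) a" using idt_Hom[OF Oa] tob_tun[OF Oa] by simp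
  show ?thesis
    unfolding vecs.subspace_def
  proof (intro conjI ballI allI)
    show "0 \<in> vectors_in a"
      using tensor_star_category.Hom_zero[OF E_cat O] cten_zero_vec[OF a tun_Ob Oa] fsp_zero[OF a]
      by (simp add: vectors_in_def)
    fix x assume x: "x \<in> vectors_in a"
    then have xF: "x \<in> fsp F a" and xE: "cten \<iota> a a (\<ii>\<dd> a) x \<in> EHom \<iota> a" by (simp_all add: vectors_in_def)
    show "fsc F c x \<in> vectors_in a" for c
      using tensor_star_category.Hom_scl[OF E_cat O xE, of c] cten_scl_vec[OF a tun_Ob Oa i xF, of c]
        fsp_scale[OF a xF] by (simp add: vectors_in_def E_ops)
    fix y assume y: "y \<in> vectors_in a"
    then have yF: "y \<in> fsp F a" and yE: "cten \<iota> a a (\<ii>\<dd> a) y \<in> EHom \<iota> a" by (simp_all add: vectors_in_def)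
    show "x + y \<in> vectors_in a"
      using tensor_star_category.Hom_add[OF E_cat O xE yE] cten_add_vec[OF a tun_Ob Oa xF yF]
        fsp_add[OF a xF yF] by (simp add: vectors_in_def del: plus_fun_apply)
  qed (auto simp: vectors_in_def)
qed

lemma vectors_in_farr:
  assumes ab: "a \<in> S" "b \<in> S" and s: "s \<in> Hom C a b" and \<psi>: "\<psi> \<in> vectors_in a"
  shows "farr F a b s \<psi> \<in> vectors_in b"
proof -
  note O = S_Ob[OF ab(1)] S_Ob[OF ab(2)]
  have \<psi>F: "\<psi> \<in> fsp F a" using \<psi> by (simp add: vectors_in_def)
  have i: "\<ii>\<dd> b \<in> Hom C (b \<odot> \<iota>) b" "s \<in> Hom C (a \<odot> \<iota>) b" using idt_Hom[OF O(2)] tob_tun[OF O(2)] tob_tun[OF O(1)] s by simp_all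
  have "cten \<iota> b a s \<psi> = cten \<iota> b b (\<ii>\<dd> b) (farr F a b s \<psi>)"
    using cten_slide[OF ab s tun_Ob O(2) i(1) \<psi>F] tar_tun[OF O s] cmp_idt[OF O s] by simp
  then show ?thesis
    using cten_EHom[OF tun_Ob O(2) ab(1) i(2) \<psi>] farr_fsp[OF ab s \<psi>F] by (simp add: vectors_in_def)
qed

lemma vectors_in_ften:
  assumes ab: "a \<in> S" "b \<in> S" and \<psi>: "\<psi> \<in> vectors_in a" "\<psi>' \<in> vectors_in b"
  shows "ften F a b \<psi> \<psi>' \<in> vectors_in (a \<odot> b)"
proof -
  note O = S_Ob[OF ab(1)] S_Ob[OF ab(2)]
  note Oab = tob_Ob[OF O]
  have F: "\<psi> \<in> fsp F a" "\<psi>' \<in> fsp F b"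
    and E: "cten \<iota> a a (\<ii>\<dd> a) \<psi> \<in> EHom \<iota> a" "cten \<iota> b b (\<ii>\<dd> b) \<psi>' \<in> EHom \<iota> b"
    using \<psi> by (simp_all add: vectors_in_def)
  have i: "\<ii>\<dd> a \<in> Hom C (a \<odot> \<iota>) a" "\<ii>\<dd> b \<in> Hom C (b \<odot> \<iota>) b"
    using idt_Hom[OF O(1)] idt_Hom[OF O(2)] tob_tun[OF O(1)] tob_tun[OF O(2)] by simp_all
  have "xtar C \<epsilon> F P (cten \<iota> a a (\<ii>\<dd> a) \<psi>) (cten \<iota> b b (\<ii>\<dd> b) \<psi>') =
      cten (\<iota> \<odot> \<iota>) (a \<odot> b) (a \<odot> b) ((\<ii>\<dd> a \<boxtimes> \<ii>\<dd> b) \<cdot> (\<ii>\<dd> a \<boxtimes> \<epsilon> b \<iota> \<boxtimes> \<ii>\<dd> \<iota>)) (ften F a b \<psi> \<psi>')"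
    by (rule xtar_cten[OF tun_Ob O(1) tun_Ob O(2) ab i F])
  also have "\<dots> = cten \<iota> (a \<odot> b) (a \<odot> b) (\<ii>\<dd> (a \<odot> b)) (ften F a b \<psi> \<psi>')"
    using eps_unit(1)[OF O(2)] tar_idt[OF O] tar_idt[OF O(2) tun_Ob] tob_tun[OF tun_Ob] tob_tun[OF O(2)]
      cmp_idt[OF Oab Oab idt_Hom[OF Oab]] by simp
  finally show ?thesis
    using EHom_tar[OF tun_Ob O(1) tun_Ob O(2) E] ften_fsp[OF ab F] tob_tun[OF tun_Ob] by (simp add: vectors_in_def)
qed

lemma vectors_in_vac: "fvac F \<in> vectors_in \<iota>"
  using xemb_E[OF tun_Ob tun_Ob idt_Hom[OF tun_Ob]] xemb_cten[OF tun_Ob tun_Ob idt_Hom[OF tun_Ob]] vac_space(1)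
  by (simp add: vectors_in_def)

text \<open>
  The adjoint of \<open>id \<otimes> \<psi>\<close> is an arrow from \<open>k\<close> to the unit with the conjugate vector; a solution of
  the conjugate equations bends it into an arrow from the unit to the conjugate of \<open>k\<close>.
\<close>

lemma vectors_in_conj:
  assumes k: "k \<in> irr P" and \<psi>: "\<psi> \<in> vectors_in k"
  shows "conj_vector C F P k \<psi> \<in> vectors_in (cbar P k)"
proof -
  let ?b = "cbar P k" and ?J = "conj_vector C F P k \<psi>"
  note kb = cbar_irr[OF k] and Ok = irr_Ob[OF k] and Ob = irr_Ob[OF cbar_irr[OF k]] and bS = irr_in_S[OF cbar_irr[OF k]]
  note Okb = tob_Ob[OF Ok Ob] and Obk = tob_Ob[OF Ob Ok] and v = vac_space(1)
  note R = Rs_Hom[OF k]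
  have \<psi>F: "\<psi> \<in> fsp F k" and \<psi>E: "cten \<iota> k k (\<ii>\<dd> k) \<psi> \<in> EHom \<iota> k" using \<psi> by (simp_all add: vectors_in_def)
  have J: "?J \<in> fsp F ?b" by (rule conj_vector_props(1)[OF k \<psi>F])
  have i: "\<ii>\<dd> k \<in> Hom C (k \<odot> \<iota>) k" using idt_Hom[OF Ok] tob_tun[OF Ok] by simp
  have Rs: "(Rs P k)\<^sup>\<star> \<in> Hom C (?b \<odot> k) \<iota>" by (rule str_Hom[OF tun_Ob Obk R(1)])
  have "xstr C F P (stensor C F \<iota> k k (\<ii>\<dd> k) \<psi>) =
      stensor C F k \<iota> ?b (((Rs P k)\<^sup>\<star> \<boxtimes> \<ii>\<dd> \<iota>) \<cdot> (\<ii>\<dd> ?b \<boxtimes> (\<ii>\<dd> k)\<^sup>\<star>)) ?J"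
    by (rule xstr_stensor[OF tun_Ob Ok k i \<psi>F])
  also have "\<dots> = stensor C F k \<iota> ?b ((Rs P k)\<^sup>\<star>) ?J"
    using str_idt[OF Ok] tar_idt[OF Ob Ok] tar_tun[OF Obk tun_Ob Rs] cmp_idt[OF Obk tun_Ob Rs] by simp
  also have "\<dots> = cten k \<iota> ?b ((Rs P k)\<^sup>\<star>) ?J" by (rule cten_irr[OF kb Ok tun_Ob Rs J, symmetric])
  finally have y: "cten k \<iota> ?b ((Rs P k)\<^sup>\<star>) ?J \<in> EHom k \<iota>"
    using E_str[OF xobj_E[OF tun_Ob] xobj_E[OF Ok] \<psi>E] unfolding cten_irr[OF k tun_Ob Ok i \<psi>F] by simp
  have i': "\<ii>\<dd> ?b \<in> Hom C (\<iota> \<odot> ?b) ?b" "Rs' P k \<in> Hom C (\<iota> \<odot> \<iota>) (k \<odot> ?b)"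
    using idt_Hom[OF Ob] tob_tun[OF Ob] R(2) tob_tun[OF tun_Ob] by simp_all
  have Rb: "(Rs P k)\<^sup>\<star> \<boxtimes> \<ii>\<dd> ?b \<in> Hom C (?b \<odot> (k \<odot> ?b)) ?b"
    using tar_Hom[OF Obk tun_Ob Ob Ob Rs idt_Hom[OF Ob]] tob_assoc[OF Ob Ok Ob] tob_tun[OF Ob] by simp
  have "xtar C \<epsilon> F P (cten k \<iota> ?b ((Rs P k)\<^sup>\<star>) ?J) (cten ?b ?b \<iota> (\<ii>\<dd> ?b) (fvac F)) =
      cten (k \<odot> ?b) (\<iota> \<odot> ?b) (?b \<odot> \<iota>) (((Rs P k)\<^sup>\<star> \<boxtimes> \<ii>\<dd> ?b) \<cdot> (\<ii>\<dd> ?b \<boxtimes> \<epsilon> \<iota> k \<boxtimes> \<ii>\<dd> ?b)) (ften F ?b \<iota> ?J (fvac F))"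
    by (rule xtar_cten[OF Ok tun_Ob Ob Ob bS S_tun Rs i'(1) J v])
  also have "\<dots> = cten (k \<odot> ?b) ?b ?b ((Rs P k)\<^sup>\<star> \<boxtimes> \<ii>\<dd> ?b) ?J"
    using eps_unit(2)[OF Ok] tar_idt[OF Ok Ob] tar_idt[OF Ob Okb] tob_tun[OF Ob]
      ften_vac[OF bS J] cmp_idt[OF tob_Ob[OF Ob Okb] Ob Rb] by simp
  finally have bent: "cten (k \<odot> ?b) ?b ?b ((Rs P k)\<^sup>\<star> \<boxtimes> \<ii>\<dd> ?b) ?J \<in> EHom (k \<odot> ?b) ?b"
    using EHom_tar[OF Ok tun_Ob Ob Ob y xemb_E[OF Ob Ob idt_Hom[OF Ob]]] tob_tun[OF Ob]
    unfolding xemb_cten[OF Ob Ob idt_Hom[OF Ob]] by simp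
  have "xcmp C F P (cten (k \<odot> ?b) ?b ?b ((Rs P k)\<^sup>\<star> \<boxtimes> \<ii>\<dd> ?b) ?J) (cten \<iota> (k \<odot> ?b) \<iota> (Rs' P k) (fvac F)) =
      cten \<iota> ?b (?b \<odot> \<iota>) (((Rs P k)\<^sup>\<star> \<boxtimes> \<ii>\<dd> ?b) \<cdot> (\<ii>\<dd> ?b \<boxtimes> Rs' P k)) (ften F ?b \<iota> ?J (fvac F))"
    by (rule xcmp_cten[OF tun_Ob Okb Ob bS S_tun Rb i'(2) J v])
  also have "\<dots> = cten \<iota> ?b ?b (\<ii>\<dd> ?b) ?J"
    using Rs_conj(1)[OF k] tob_tun[OF Ob] ften_vac[OF bS J] by simp
  finally show ?thesis
    using EHom_cmp[OF tun_Ob Okb Ob xemb_E[OF tun_Ob Okb R(2)] bent] J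
    unfolding xemb_cten[OF tun_Ob Okb R(2)] by (simp add: vectors_in_def)
qed

lemma supported_on_EHom:
  assumes O: "\<rho> \<in> Ob C" "\<sigma> \<in> Ob C" and x: "supported_on vectors_in \<rho> \<sigma> x"
  shows "x \<in> EHom \<rho> \<sigma>"
proof -
  have xH: "x \<in> xHom C F P \<rho> \<sigma>" using x by (simp add: supported_on_def)
  obtain J B where J: "finite J" "J \<subseteq> irr P" "\<forall>k\<in>J. finite (B k) \<and> B k \<subseteq> vectors_in k"
    "x = (\<Sum>k\<in>J. \<Sum>e\<in>B k. stensor C F \<rho> \<sigma> k (x (\<rho>, \<sigma>, k) e) e)"
    by (rule supported_on_expansion[OF O x vectors_in_subspace[OF irr_in_S]]) (assumption | rule that)+
  have "stensor C F \<rho> \<sigma> k (x (\<rho>, \<sigma>, k) e) e \<in> EHom \<rho> \<sigma>" if ke: "k \<in> J" "e \<in> B k" for k e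
  proof -
    have k: "k \<in> irr P" and e: "e \<in> vectors_in k" using J(2,3) ke by blast+
    have eF: "e \<in> fsp F k" using e by (simp add: vectors_in_def)
    note c = xHom_component(3)[OF O xH k, of e]
    show ?thesis using cten_EHom[OF O irr_in_S[OF k] c e] unfolding cten_irr[OF k O c eF] .
  qed
  then have "(\<Sum>k\<in>J. \<Sum>e\<in>B k. stensor C F \<rho> \<sigma> k (x (\<rho>, \<sigma>, k) e) e) \<in> EHom \<rho> \<sigma>"
    by (intro EHom_sum[OF O])
  then show ?thesis using J(4) by simp
qed

lemma EHom_supported_on:
  assumes O: "\<rho> \<in> Ob C" "\<sigma> \<in> Ob C" and x: "x \<in> EHom \<rho> \<sigma>"
  shows "supported_on vectors_in \<rho> \<sigma> x"
proof -
  obtain \<rho>' r r' where r: "\<rho>' \<in> Ob C" "conj_equations C \<rho> \<rho>' r r'"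
    using conjugates O(1) unfolding has_conjugates_def by metis
  have r': "r' \<in> Hom C \<iota> (\<rho> \<odot> \<rho>')" using r(2) by (simp add: conj_equations_def)
  note Or = tob_Ob[OF O(1) r(1)] tob_Ob[OF O(2) r(1)]
  show ?thesis
  proof (rule supported_onI[OF O EHom_xHom[OF O x] r])
    fix l t \<psi> assume l: "l \<in> irr P" and t: "t \<in> Hom C l (\<sigma> \<odot> \<rho>')" and \<psi>: "\<psi> \<in> fsp F l"
      and pr: "probe \<rho> \<sigma> \<rho>' l r' t x = cten \<iota> l l (\<ii>\<dd> l) \<psi>"
    note Ol = irr_Ob[OF l]
    have "probe \<rho> \<sigma> \<rho>' l r' t x \<in> EHom \<iota> l"
      unfolding probe_def
      by (rule EHom_cmp[OF tun_Ob Or(2) Ol EHom_cmp[OF tun_Ob Or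
            xemb_E[OF tun_Ob Or(1) r'] EHom_tar[OF O r(1,1) x xemb_E[OF r(1,1) idt_Hom[OF r(1)]]]]
          xemb_E[OF Or(2) Ol str_Hom[OF Ol Or(2) t]]])
    then show "\<psi> \<in> vectors_in l" using \<psi> unfolding pr vectors_in_def by simp
  qed
qed

text \<open>The probes of an invariant arrow are invariant, hence have invariant vectors.\<close>

lemma fixed_supported_on:
  assumes O: "\<rho> \<in> Ob C" "\<sigma> \<in> Ob C" and x: "x \<in> xHom C F P \<rho> \<sigma>"
    and fixed: "\<And>g. g \<in> stabilizer vectors_in \<Longrightarrow> act_arr C F P g x = x"
  shows "supported_on vectors_in \<rho> \<sigma> x"
proof -
  obtain \<rho>' r r' where r: "\<rho>' \<in> Ob C" "conj_equations C \<rho> \<rho>' r r'"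
    using conjugates O(1) unfolding has_conjugates_def by metis
  have r': "r' \<in> Hom C \<iota> (\<rho> \<odot> \<rho>')" using r(2) by (simp add: conj_equations_def)
  show ?thesis
  proof (rule supported_onI[OF O x r])
    fix l t \<psi> assume l: "l \<in> irr P" and t: "t \<in> Hom C l (\<sigma> \<odot> \<rho>')" and \<psi>: "\<psi> \<in> fsp F l"
      and pr: "probe \<rho> \<sigma> \<rho>' l r' t x = cten \<iota> l l (\<ii>\<dd> l) \<psi>"
    note Ol = irr_Ob[OF l] and lS = irr_in_S[OF l]
    have il: "\<ii>\<dd> l \<in> Hom C (l \<odot> \<iota>) l" using idt_Hom[OF Ol] tob_tun[OF Ol] by simp
    have fixed_\<psi>: "frep F l g \<psi> = \<psi>" if g: "g \<in> stabilizer vectors_in" for g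
    proof -
      have gc: "g \<in> carrier G" using g by (simp add: stabilizer_def)
      have "cten \<iota> l l (\<ii>\<dd> l) (frep F l g \<psi>) = act_arr C F P g (probe \<rho> \<sigma> \<rho>' l r' t x)"
        unfolding pr by (rule act_cten[OF gc tun_Ob Ol lS il \<psi>, symmetric])
      also have "\<dots> = cten \<iota> l l (\<ii>\<dd> l) \<psi>"
        unfolding act_probe[OF O r(1) l r' t gc x] fixed[OF g] by (rule pr)
      finally show ?thesis by (rule cten_irr_injective[OF l frep_fsp[OF lS gc \<psi>] \<psi>])
    qed
    show "\<psi> \<in> vectors_in l"
      by (rule stabilizer_fixed[OF vectors_in_subspace vectors_in_farr vectors_in_ften vectors_in_vac vectors_in_conj l \<psi> fixed_\<psi>])
  qed
qed

lemma EHom_fixed: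
  assumes O: "\<rho> \<in> Ob C" "\<sigma> \<in> Ob C" and x: "x \<in> EHom \<rho> \<sigma>" and g: "g \<in> stabilizer vectors_in"
  shows "act_arr C F P g x = x"
proof (rule supported_on_act[OF O EHom_supported_on[OF O x]])
  show "vectors_in k \<subseteq> fsp F k" for k by (auto simp: vectors_in_def)
  show "g \<in> carrier G" using g by (simp add: stabilizer_def)
  show "frep F k g \<psi> = \<psi>" if "k \<in> irr P" "\<psi> \<in> vectors_in k" for k \<psi>
    using g irr_in_S[OF that(1)] that(2) by (simp add: stabilizer_def)
qed

text \<open>An arrow of \<open>E\<close> between subobjects of \<open>\<rho>\<close> and \<open>\<sigma>\<close> is also an arrow of \<open>E\<close> from \<open>\<rho>\<close> to \<open>\<sigma>\<close>,
  by composition with the isometries \<open>q\<close> and \<open>p\<^sup>\<star>\<close>.\<close>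

lemma E_inclusion:
  assumes "(\<rho>, p) \<in> Ob E"
  shows "\<rho> \<in> Ob C" "p \<in> Hom E (\<rho>, p) (xobj C F \<rho>)" "p \<in> Hom E (xobj C F \<rho>) (\<rho>, p)" "p \<in> EHom \<rho> \<rho>"
proof -
  have p: "\<rho> \<in> Ob C" "xcmp C F P p p = p" "xstr C F P p = p" using E_Ob[OF assms] by (simp_all add: D_Ob)
  show "\<rho> \<in> Ob C" by (rule p(1))
  show 1: "p \<in> Hom E (\<rho>, p) (xobj C F \<rho>)" using E_sub assms by (simp add: inherits_subobjects_def)
  show 2: "p \<in> Hom E (xobj C F \<rho>) (\<rho>, p)" using E_str[OF assms xobj_E[OF p(1)] 1] p(3) by simp
  show "p \<in> EHom \<rho> \<rho>" using E_cmp[OF xobj_E[OF p(1)] assms xobj_E[OF p(1)] 2 1] p(2) by simp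
qed

lemma E_Hom_EHom:
  assumes X: "(\<rho>, p) \<in> Ob E" "(\<sigma>, q) \<in> Ob E" and f: "f \<in> Hom E (\<rho>, p) (\<sigma>, q)"
  shows "f \<in> EHom \<rho> \<sigma>"
proof -
  note p = E_inclusion[OF X(1)] and q = E_inclusion[OF X(2)]
  note id = D_Hom_absorb[OF E_Ob[OF X(1)] E_Ob[OF X(2)] E_Hom[OF X f]]
  have "f \<in> Hom E (xobj C F \<rho>) (\<sigma>, q)" using E_cmp[OF xobj_E[OF p(1)] X p(3) f] id(1) by simp
  then show ?thesis using E_cmp[OF xobj_E[OF p(1)] X(2) xobj_E[OF q(1)] _ q(2), of f] id(2) by simp
qed

text \<open>
  An automorphism that fixes \<open>E\<close> fixes the arrows \<open>id \<otimes> \<psi>\<close> in \<open>E\<close>, and for irreducible objects the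
  vector \<open>\<psi>\<close> is determined by the arrow.  For other objects a vector of \<open>V a\<close> is decomposed by means
  of a resolution of \<open>a\<close>, whose arrows preserve \<open>V\<close>.
\<close>

lemma Gal_over_stabilizer: "Gal_over C \<epsilon> S G F P E = stabilizer vectors_in"
proof (intro equalityI subsetI)
  fix g assume "g \<in> Gal_over C \<epsilon> S G F P E"
  then have gc: "g \<in> carrier G" and gA: "\<And>X Y f. \<lbrakk>X \<in> Ob E; Y \<in> Ob E; f \<in> Hom E X Y\<rbrakk> \<Longrightarrow> act_arr C F P g f = f"
    by (simp_all add: Gal_over_iff)
  have irr: "frep F k g \<psi> = \<psi>" if k: "k \<in> irr P" and \<psi>: "\<psi> \<in> vectors_in k" for k \<psi>
  proof -
    note Ok = irr_Ob[OF k] and kS = irr_in_S[OF k]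
    have \<psi>F: "\<psi> \<in> fsp F k" and \<psi>E: "cten \<iota> k k (\<ii>\<dd> k) \<psi> \<in> EHom \<iota> k" using \<psi> by (simp_all add: vectors_in_def)
    have i: "\<ii>\<dd> k \<in> Hom C (k \<odot> \<iota>) k" using idt_Hom[OF Ok] tob_tun[OF Ok] by simp
    have "cten \<iota> k k (\<ii>\<dd> k) (frep F k g \<psi>) = cten \<iota> k k (\<ii>\<dd> k) \<psi>"
      using act_cten[OF gc tun_Ob Ok kS i \<psi>F] gA[OF xobj_E[OF tun_Ob] xobj_E[OF Ok] \<psi>E] by simp
    then show ?thesis by (rule cten_irr_injective[OF k frep_fsp[OF kS gc \<psi>F] \<psi>F])
  qed
  have "frep F a g \<psi> = \<psi>" if a: "a \<in> S" and \<psi>: "\<psi> \<in> vectors_in a" for a \<psi>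
  proof -
    have \<psi>F: "\<psi> \<in> fsp F a" using \<psi> by (simp add: vectors_in_def)
    note R = resolves_resolution[OF a] and m = resolution_member[OF a S_Ob[OF a] S_Ob[OF a]]
    have "frep F a g \<psi> = (\<Sum>i\<in>resolution a. farr F (fst i) a (snd i) (farr F a (fst i) ((snd i)\<^sup>\<star>) (frep F a g \<psi>)))"
      by (rule resolution_vector[OF R a frep_fsp[OF a gc \<psi>F], symmetric])
    also have "\<dots> = (\<Sum>i\<in>resolution a. farr F (fst i) a (snd i) (farr F a (fst i) ((snd i)\<^sup>\<star>) \<psi>))"
    proof (rule sum.cong[OF refl])
      fix i assume i: "i \<in> resolution a"
      have "farr F a (fst i) ((snd i)\<^sup>\<star>) (frep F a g \<psi>) = frep F (fst i) g (farr F a (fst i) ((snd i)\<^sup>\<star>) \<psi>)"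
        by (rule farr_frep[OF a m(2,5)[OF i] gc \<psi>F])
      also have "\<dots> = farr F a (fst i) ((snd i)\<^sup>\<star>) \<psi>"
        by (rule irr[OF m(1)[OF i] vectors_in_farr[OF a m(2,5)[OF i] \<psi>]])
      finally show "farr F (fst i) a (snd i) (farr F a (fst i) ((snd i)\<^sup>\<star>) (frep F a g \<psi>)) =
          farr F (fst i) a (snd i) (farr F a (fst i) ((snd i)\<^sup>\<star>) \<psi>)" by simp
    qed
    also have "\<dots> = \<psi>" by (rule resolution_vector[OF R a \<psi>F])
    finally show ?thesis .
  qed
  then show "g \<in> stabilizer vectors_in" using gc by (simp add: stabilizer_def)
next
  fix g assume g: "g \<in> stabilizer vectors_in"
  have "act_ob C F P g X = X" if X: "X \<in> Ob E" for X
  proof -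
    obtain \<rho> p where Xp: "X = (\<rho>, p)" by (cases X)
    note p = E_inclusion[OF X[unfolded Xp]]
    show ?thesis using EHom_fixed[OF p(1,1,4) g] by (simp add: Xp act_ob_def)
  qed
  moreover have "act_arr C F P g f = f" if f: "X \<in> Ob E" "Y \<in> Ob E" "f \<in> Hom E X Y" for X Y f
  proof -
    obtain \<rho> p \<sigma> q where XY: "X = (\<rho>, p)" "Y = (\<sigma>, q)" by (cases X, cases Y)
    show ?thesis
      by (rule EHom_fixed[OF E_inclusion(1)[OF f(1)[unfolded XY]] E_inclusion(1)[OF f(2)[unfolded XY]]
            E_Hom_EHom[OF f[unfolded XY]] g])
  qed
  moreover have "g \<in> carrier G" using g by (simp add: stabilizer_def)
  ultimately show "g \<in> Gal_over C \<epsilon> S G F P E" by (simp add: Gal_over_iff)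
qed

lemma Gal_over_closed: "closedin T (Gal_over C \<epsilon> S G F P E)"
proof -
  have T: "topspace T = carrier G" using compact by (simp add: compact_group_def)
  have sub: "\<psi> \<in> fsp F a" if "\<psi> \<in> vectors_in a" for a \<psi> using that by (simp add: vectors_in_def)
  let ?K = "\<lambda>(a, \<psi>, \<phi>). {g \<in> topspace T. fip F a \<phi> (frep F a g \<psi>) \<in> {fip F a \<phi> \<psi>}}"
  let ?I = "{(a, \<psi>, \<phi>). a \<in> S \<and> \<psi> \<in> vectors_in a \<and> \<phi> \<in> fsp F a}"
  have "frep F a g \<psi> = \<psi> \<longleftrightarrow> (\<forall>\<phi>\<in>fsp F a. fip F a \<phi> (frep F a g \<psi>) = fip F a \<phi> \<psi>)"
    if a: "a \<in> S" and \<psi>: "\<psi> \<in> vectors_in a" and g: "g \<in> carrier G" for a g \<psi>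
    using fip_ext[OF a frep_fsp[OF a g sub[OF \<psi>]] sub[OF \<psi>]] by metis
  then have "g \<in> stabilizer vectors_in \<longleftrightarrow> g \<in> \<Inter> (insert (topspace T) (?K ` ?I))" for g
    unfolding stabilizer_def T by (cases "g \<in> carrier G") auto
  then have "stabilizer vectors_in = \<Inter> (insert (topspace T) (?K ` ?I))" by blast
  moreover have "closedin T (\<Inter> (insert (topspace T) (?K ` ?I)))"
  proof (rule closedin_Inter)
    fix K assume "K \<in> insert (topspace T) (?K ` ?I)"
    then consider "K = topspace T" | a \<psi> \<phi> where "a \<in> S" "\<psi> \<in> vectors_in a" "\<phi> \<in> fsp F a"
      "K = {g \<in> topspace T. fip F a \<phi> (frep F a g \<psi>) \<in> {fip F a \<phi> \<psi>}}" by auto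
    then show "closedin T K"
    proof cases
      case 2
      then show ?thesis
        using closedin_continuous_map_preimage[OF frep_continuous[OF 2(1,3) sub[OF 2(2)]], of "{fip F a \<phi> \<psi>}"] by simp
    qed simp
  qed simp
  ultimately show ?thesis by (simp add: Gal_over_stabilizer)
qed

abbreviation fixed_cat where "fixed_cat \<equiv> fixed_category C \<epsilon> F P (Gal_over C \<epsilon> S G F P E)"

lemma fixed_ops: "cmp fixed_cat = xcmp C F P" "str fixed_cat = xstr C F P" "idt fixed_cat = snd"
  by (simp_all add: fixed_category_def D_ops)

lemma fixed_arrow_E:
  assumes O: "\<rho> \<in> Ob C" "\<sigma> \<in> Ob C" and x: "x \<in> xHom C F P \<rho> \<sigma>"
    and fixed: "\<And>g. g \<in> Gal_over C \<epsilon> S G F P E \<Longrightarrow> act_arr C F P g x = x"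
  shows "x \<in> EHom \<rho> \<sigma>"
  by (rule supported_on_EHom[OF O fixed_supported_on[OF O x fixed[unfolded Gal_over_stabilizer]]])

lemma Hom_E_eq_fixed:
  assumes XY: "X \<in> Ob E" "Y \<in> Ob E"
  shows "Hom E X Y = Hom fixed_cat X Y"
proof (intro equalityI subsetI)
  fix f assume "f \<in> Hom E X Y"
  then show "f \<in> Hom fixed_cat X Y"
    using E_Hom[OF XY] XY by (simp add: fixed_category_def Gal_over_iff)
next
  fix f assume f: "f \<in> Hom fixed_cat X Y"
  obtain \<rho> p \<sigma> q where X: "X = (\<rho>, p)" "Y = (\<sigma>, q)" by (cases X, cases Y)
  note p = E_inclusion[OF XY(1)[unfolded X]] and q = E_inclusion[OF XY(2)[unfolded X]]
  have fD: "f \<in> Hom crossed (\<rho>, p) (\<sigma>, q)" using f by (simp add: fixed_category_def X)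
  note OD = E_Ob[OF XY(1)[unfolded X]] E_Ob[OF XY(2)[unfolded X]]
  have inv: "act_arr C F P g f = f" if "g \<in> Gal_over C \<epsilon> S G F P E" for g
    using f that by (simp add: fixed_category_def)
  have fE: "f \<in> EHom \<rho> \<sigma>" by (rule fixed_arrow_E[OF p(1) q(1) D_Hom_xHom[OF OD fD] inv])
  note id = D_Hom_absorb[OF OD fD]
  have "f \<in> Hom E (\<rho>, p) (xobj C F \<sigma>)"
    using E_cmp[OF XY(1)[unfolded X] xobj_E[OF p(1)] xobj_E[OF q(1)] p(2) fE] id(1) by simp
  from E_cmp[OF XY(1)[unfolded X] xobj_E[OF q(1)] XY(2)[unfolded X] this q(3)]
  show "f \<in> Hom E X Y" using id(2) by (simp add: X)
qed

lemma fixed_Ob_projection: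
  assumes "(\<rho>, p) \<in> Ob fixed_cat"
  shows "\<rho> \<in> Ob C" "(\<rho>, p) \<in> Ob crossed" "proj_arrow E (xobj C F \<rho>) p"
proof -
  have X: "(\<rho>, p) \<in> Ob crossed" and inv: "\<And>g. g \<in> Gal_over C \<epsilon> S G F P E \<Longrightarrow> act_arr C F P g p = p"
    using assms by (auto simp: fixed_category_def act_ob_def)
  then have p: "\<rho> \<in> Ob C" "p \<in> xHom C F P \<rho> \<rho>" "xcmp C F P p p = p" "xstr C F P p = p" by (simp_all add: D_Ob)
  show "\<rho> \<in> Ob C" "(\<rho>, p) \<in> Ob crossed" by (rule p(1), rule X)
  show "proj_arrow E (xobj C F \<rho>) p"
    using fixed_arrow_E[OF p(1,1,2) inv] p(3,4) by (simp add: proj_arrow_def E_ops)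
qed

text \<open>
  The projection \<open>p\<close> of a fixed object \<open>(\<rho>, p)\<close> lies in \<open>E\<close>.  If the isometry \<open>v\<close> defines the
  corresponding subobject of \<open>\<rho>\<close> in \<open>E\<close>, then \<open>v\<^sup>\<star>\<close> is the unitary equivalence.
\<close>

lemma fixed_object_E:
  assumes X: "X \<in> Ob fixed_cat"
  shows "\<exists>Y\<in>Ob E. \<exists>u. unitary_arrow fixed_cat X Y u"
proof -
  obtain \<rho> p where Xp: "X = (\<rho>, p)" by (cases X)
  note p = fixed_Ob_projection[OF X[unfolded Xp]]
  note O = xobj_E[OF p(1)]
  obtain Y v where Y: "Y \<in> Ob E" and v: "v \<in> Hom E Y (xobj C F \<rho>)"
      "xcmp C F P (xstr C F P v) v = snd Y" "xcmp C F P v (xstr C F P v) = p"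
    using E_TC p(3) O unfolding TC_star_def has_subobjects_def isometry_def E_ops by metis
  obtain \<tau> q where Yq: "Y = (\<tau>, q)" by (cases Y)
  let ?u = "xstr C F P v"
  have u: "?u \<in> Hom E (xobj C F \<rho>) Y" by (rule E_str[OF Y O v(1)])
  have uv: "xstr C F P ?u = v" using tensor_star_category.str_str[OF E_cat Y O v(1)] by (simp add: E_ops)
  have qu: "xcmp C F P q ?u = ?u" using E_idt[OF O Y u] by (simp add: Yq)
  have up: "xcmp C F P ?u p = ?u"
    using tensor_star_category.cmp_assoc[OF E_cat O Y O Y u v(1) u] v(2,3) E_idt[OF O Y u]
    by (simp add: E_ops)
  have OD: "(\<rho>, snd (xobj C F \<rho>)) \<in> Ob crossed" using E_Ob[OF O] by (simp add: xobj_def)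
  have "?u \<in> xHom C F P \<rho> \<tau>"
    by (rule D_Hom_xHom[OF OD E_Ob[OF Y[unfolded Yq]]])
      (use E_Hom[OF O Y u] in \<open>simp add: Yq xobj_def\<close>)
  then have "?u \<in> Hom crossed X Y" unfolding Xp Yq D_Hom using qu up by force
  moreover have "act_arr C F P g ?u = ?u" if "g \<in> Gal_over C \<epsilon> S G F P E" for g
    using that O Y u unfolding Gal_over_iff by blast
  ultimately have "?u \<in> Hom fixed_cat X Y" by (simp add: fixed_category_def)
  then have "unitary_arrow fixed_cat X Y ?u"
    unfolding unitary_arrow_def isometry_def fixed_ops uv using v(2,3) by (simp add: Xp)
  then show ?thesis using Y by blast
qed

lemma E_Ob_fixed: "Ob E \<subseteq> Ob fixed_cat"
  using E_Ob by (auto simp: fixed_category_def Gal_over_iff)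

theorem intermediate_is_fixed: "equal_up_to_iso E fixed_cat"
  unfolding equal_up_to_iso_def using E_Ob_fixed Hom_E_eq_fixed fixed_object_E by simp

theorem intermediate_equals_fixed:
  assumes cl: "closed_under_subobjects E"
  shows "equal_categories E fixed_cat"
proof -
  have "X \<in> Ob E" if X: "X \<in> Ob fixed_cat" for X
  proof -
    obtain \<rho> p where Xp: "X = (\<rho>, p)" by (cases X)
    note p = fixed_Ob_projection[OF X[unfolded Xp]]
    show ?thesis
      using cl xobj_E[OF p(1)] p(3) unfolding closed_under_subobjects_def xobj_def Xp by blast
  qed
  then show ?thesis using E_Ob_fixed Hom_E_eq_fixed unfolding equal_categories_def by blast
qed

end

end

theorem proposition4p8:
  fixes C :: "('o, 'v::ab_group_add) tcat"
    and \<epsilon> :: "'o \<Rightarrow> 'o \<Rightarrow> 'v"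
    and S :: "'o set"
    and G :: "'g monoid"
    and T :: "'g topology"
    and F :: "('o, 'v, 'g, 'h::ab_group_add) rep_functor"
    and P :: "('o, 'v, 'h) crossed_data"
    and E :: "(('o, 'v, 'h) xob, ('o, 'v, 'h) xarr) tcat"
    and H :: "'g set"
  assumes "BTC_star C \<epsilon>"
    and "even_symmetric_subcategory C \<epsilon> S"
    and "compact_group G T"
    and "DR_isomorphism C \<epsilon> S G T F"
    and "crossed_product_data C S F P"
    and "TC_star E"
    and "intermediate_category C \<epsilon> F P E"
    and "inherits_subobjects C F E"
    and "H = Gal_over C \<epsilon> S G F P E"
  shows "subgroup H G \<and> closedin T H \<and>
    equal_up_to_iso E (fixed_category C \<epsilon> F P H) \<and>
    (closed_under_subobjects E \<longrightarrow> equal_categories E (fixed_category C \<epsilon> F P H))"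
proof -
  interpret crossed_setting C \<epsilon> S G T F P
  proof (intro crossed_setting.intro crossed_setting_axioms.intro)
    show "tensor_star_category C" "has_conjugates C" "unitary_braiding C \<epsilon>"
      using assms(1) by (simp_all add: BTC_star_def TC_star_def)
  qed (fact assms)+
  note E = assms(6-8)
  have "subgroup H G"
    unfolding assms(9) by (rule Gal_subgroup[OF E_subcategory[OF E]])
  moreover have "closedin T H"
    unfolding assms(9) by (rule Gal_over_closed[OF E])
  moreover have "equal_up_to_iso E (fixed_category C \<epsilon> F P H)"
    unfolding assms(9) by (rule intermediate_is_fixed[OF E])
  moreover have "closed_under_subobjects E \<longrightarrow> equal_categories E (fixed_category C \<epsilon> F P H)"
    unfolding assms(9) using intermediate_equals_fixed[OF E] by (rule impI)
  ultimately show ?thesis by (intro conjI)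
qed

end
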